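(* Let $d\in\mathbb{N}$, $1<p<\infty$, $0<q,r\le\infty$, and $b>-1/q$. Then $$\mathfrak{L}\cap F^{0,b+1/q+1/2-1/\max\{r,2\}}_{p,r}(\mathbb{R}^d)\hookrightarrow\mathbf{B}^{0,b}_{p,q}(\mathbb{R}^d)\quad\text{if and only if}\quad q\ge r,$$ and $$\mathfrak{L}\cap\mathbf{B}^{0,b}_{p,q}(\mathbb{R}^d)\hookrightarrow F^{0,b+1/q+1/2-1/\min\{r,2\}}_{p,r}(\mathbb{R}^d)\quad\text{if and only if}\quad q\le r.$$ In particular, $$\mathfrak{L}\cap F^{0,b+1/\min\{2,q\}}_{p,q}(\mathbb{R}^d)\hookrightarrow\mathfrak{L}\cap\mathbf{B}^{0,b}_{p,q}(\mathbb{R}^d)\hookrightarrow\mathfrak{L}\cap F^{0,b+1/\max\{q,2\}}_{p,q}(\mathbb{R}^d).$$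
   Context: Convention: $1/\infty=0$. Lacunary class: fix $\psi\in\mathcal{S}(\mathbb{R}^d)\setminus\{0\}$ with $\operatorname{supp}\widehat\psi\subset\{\xi:|\xi|\le2\}$. $\mathfrak{L}$ is the set of all $f=\psi W$, where $W(x)\sim\sum_{j=3}^\infty b_je^{i\lambda_jx_1}$, $x=(x_1,\dots,x_d)\in\mathbb{R}^d$, with $b_j\in\mathbb{C}$ and $\lambda_j=2^j-2$. Let $\varphi_0\in\mathcal{S}(\mathbb{R}^d)$ with $\operatorname{supp}\varphi_0\subset\{|x|\le2\}$, $\varphi_0(x)=1$ if $|x|\le1$, and $\varphi_j(x)=\varphi_0(2^{-j}x)-\varphi_0(2^{-j+1}x)$ for $j\in\mathbb{N}$. $F^{s,b}_{p,r}(\mathbb{R}^d)$ is the set of tempered distributions $f$ with $\|f\|_{F^{s,b}_{p,r}}=\Big\|\Big(\sum_{j=0}^\infty(2^{js}(1+j)^b|(\varphi_j\widehat f)^\vee(\cdot)|)^r\Big)^{1/r}\Big\|_{L_p(\mathbb{R}^d)}<\infty$ (supremum over $j$ if $r=\infty$); it does not depend on $\varphi_0$, up to equivalent quasi-norms. $\mathbf{B}^{0,b}_{p,q}(\mathbb{R}^d)$ is the set of $f\in L_p(\mathbb{R}^d)$ with finite quasi-norm $\|f\|_{L_p(\mathbb{R}^d)}+\left(\int_0^1((1-\log t)^b\omega_k(f,t)_p)^q\frac{dt}{t}\right)^{1/q}$ (supremum over $0<t<1$ if $q=\infty$), where $k\in\mathbb{N}$ is fixed (different $k$ give equivalent quasi-norms),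 $\omega_k(f,t)_p=\sup_{|h|\le t}\|\Delta_h^kf\|_{L_p(\mathbb{R}^d)}$, $\Delta^1_hf(x)=f(x+h)-f(x)$, $\Delta_h^{k+1}=\Delta_h^1\Delta_h^k$. $\mathfrak{L}\cap A\hookrightarrow B$ (or $\hookrightarrow\mathfrak{L}\cap B$) means $\mathfrak{L}\cap A\subset B$ and $\|f\|_B\le c\|f\|_A$ for all $f\in\mathfrak{L}\cap A$ with $c$ independent of $f$ (it may depend on the parameters and on $\psi$). *)

theory Defs
  imports "HOL-Analysis.Analysis"
begin

section \<open>Extended quasi-norms\<close>

text \<open>Quasi-norms take values in \<open>[0,\<infinity>]\<close>; a space is the set of elements of finite quasi-norm.
  The power below is only used with exponent \<open>a > 0\<close>, hence \<open>\<infinity> ^ a = \<infinity>\<close>.\<close>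

definition epowr :: "ennreal \<Rightarrow> real \<Rightarrow> ennreal" where
  "epowr x a = (if x = top then top else ennreal (enn2real x powr a))"

text \<open>For an exponent \<open>0 < q \<le> \<infinity>\<close> this is \<open>1/q\<close>, with \<open>1/\<infinity> = 0\<close>.\<close>

definition recip :: "ennreal \<Rightarrow> real" where
  "recip q = enn2real (1 / q)"

definition Lp_norm :: "real \<Rightarrow> ('a::euclidean_space \<Rightarrow> ennreal) \<Rightarrow> ennreal" where
  "Lp_norm p f = epowr (\<integral>\<^sup>+x. epowr (f x) p \<partial>lborel) (1 / p)"

definition lr_norm :: "ennreal \<Rightarrow> (nat \<Rightarrow> ennreal) \<Rightarrow> ennreal" where
  "lr_norm r a = (if r = top then (SUP j. a j)
     else epowr (\<Sum>j. epowr (a j) (enn2real r)) (1 / enn2real r))"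

section \<open>Schwartz functions and tempered distributions\<close>

definition partial_deriv :: "'d::finite \<Rightarrow> (real^'d \<Rightarrow> complex) \<Rightarrow> real^'d \<Rightarrow> complex" where
  "partial_deriv i f x = frechet_derivative f (at x) (axis i 1)"

text \<open>The list \<open>is\<close> of coordinate directions plays the role of a multi-index, of order \<open>length is\<close>.\<close>

definition iter_partial :: "'d::finite list \<Rightarrow> (real^'d \<Rightarrow> complex) \<Rightarrow> real^'d \<Rightarrow> complex" where
  "iter_partial is f = foldr partial_deriv is f"

definition schwartz :: "(real^'d::finite \<Rightarrow> complex) set" where
  "schwartz = {f. \<forall>is. (\<forall>x. iter_partial is f differentiable (at x)) \<and>
     (\<forall>N. bounded (range (\<lambda>x. (1 + norm x) ^ N *\<^sub>R iter_partial is f x)))}"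

definition schwartz_norm :: "nat \<Rightarrow> (real^'d::finite \<Rightarrow> complex) \<Rightarrow> real" where
  "schwartz_norm N f =
     (SUP (is, x) \<in> {is. length is \<le> N} \<times> UNIV. (1 + norm x) ^ N * cmod (iter_partial is f x))"

definition supp :: "(real^'d::finite \<Rightarrow> complex) \<Rightarrow> (real^'d) set" where
  "supp f = closure {x. f x \<noteq> 0}"

text \<open>Distributions are functionals on functions; only their values on Schwartz functions
  matter, and nothing below evaluates a tempered distribution anywhere else.\<close>

type_synonym 'd distr = "(real^'d \<Rightarrow> complex) \<Rightarrow> complex"

definition tempered :: "('d::finite) distr set" where
  "tempered = {u.
     (\<forall>f\<in>schwartz. \<forall>g\<in>schwartz. u (\<lambda>x. f x + g x) = u f + u g) \<and>
     (\<forall>f\<in>schwartz. \<forall>c. u (\<lambda>x. c * f x) = c * u f) \<and>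
     (\<exists>C N. \<forall>f\<in>schwartz. cmod (u f) \<le> C * schwartz_norm N f)}"

text \<open>The Fourier transform in angular frequency, so that multiplication by
  \<open>exp (i \<lambda> x\<^sub>1)\<close> translates the spectrum by \<open>\<lambda>\<close> in the first coordinate.\<close>

definition fourier :: "(real^'d::finite \<Rightarrow> complex) \<Rightarrow> real^'d \<Rightarrow> complex" where
  "fourier f \<xi> = complex_of_real ((2 * pi) powr (- real CARD('d) / 2)) *
     (LINT x|lborel. cis (- (x \<bullet> \<xi>)) * f x)"

definition inv_fourier :: "(real^'d::finite \<Rightarrow> complex) \<Rightarrow> real^'d \<Rightarrow> complex" where
  "inv_fourier f x = complex_of_real ((2 * pi) powr (- real CARD('d) / 2)) *
     (LINT \<xi>|lborel. cis (x \<bullet> \<xi>) * f \<xi>)"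

definition distr_fourier :: "('d::finite) distr \<Rightarrow> 'd distr" where
  "distr_fourier u f = u (fourier f)"

definition distr_inv_fourier :: "('d::finite) distr \<Rightarrow> 'd distr" where
  "distr_inv_fourier u f = u (inv_fourier f)"

definition distr_mult :: "(real^'d::finite \<Rightarrow> complex) \<Rightarrow> 'd distr \<Rightarrow> 'd distr" where
  "distr_mult m u f = u (\<lambda>x. m x * f x)"

definition represents :: "(real^'d::finite \<Rightarrow> complex) \<Rightarrow> 'd distr \<Rightarrow> bool" where
  "represents g u \<longleftrightarrow> g \<in> borel_measurable lborel \<and>
     (\<forall>f\<in>schwartz. integrable lborel (\<lambda>x. g x * f x) \<and> u f = (LINT x|lborel. g x * f x))"

text \<open>The representing function is unique almost everywhere, and it is only used
  inside expressions that do not depend on null sets.\<close>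

definition fun_of :: "('d::finite) distr \<Rightarrow> real^'d \<Rightarrow> complex" where
  "fun_of u = (SOME g. represents g u)"

section \<open>Triebel-Lizorkin spaces of logarithmic smoothness\<close>

definition resolution :: "(real^'d::finite \<Rightarrow> complex) \<Rightarrow> nat \<Rightarrow> real^'d \<Rightarrow> complex" where
  "resolution \<phi>0 j x = (if j = 0 then \<phi>0 x
     else \<phi>0 ((1/2) ^ j *\<^sub>R x) - \<phi>0 ((1/2) ^ (j - 1) *\<^sub>R x))"

text \<open>The distribution below has compact spectrum, hence is always given by a (smooth) function.\<close>

definition lp_block :: "(real^'d::finite \<Rightarrow> complex) \<Rightarrow> nat \<Rightarrow> 'd distr \<Rightarrow> real^'d \<Rightarrow> complex" where
  "lp_block \<phi>0 j u = fun_of (distr_inv_fourier (distr_mult (resolution \<phi>0 j) (distr_fourier u)))"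

definition F_norm :: "(real^'d::finite \<Rightarrow> complex) \<Rightarrow> real \<Rightarrow> real \<Rightarrow> real \<Rightarrow> ennreal \<Rightarrow>
    'd distr \<Rightarrow> ennreal" where
  "F_norm \<phi>0 s b p r u = Lp_norm p (\<lambda>x. lr_norm r (\<lambda>j.
     ennreal (2 powr (real j * s) * (1 + real j) powr b * cmod (lp_block \<phi>0 j u x))))"

definition F_space :: "(real^'d::finite \<Rightarrow> complex) \<Rightarrow> real \<Rightarrow> real \<Rightarrow> real \<Rightarrow> ennreal \<Rightarrow>
    'd distr set" where
  "F_space \<phi>0 s b p r = {u \<in> tempered. F_norm \<phi>0 s b p r u < top}"

section \<open>Besov spaces of smoothness near zero\<close>

definition diff_op :: "real^'d::finite \<Rightarrow> (real^'d \<Rightarrow> complex) \<Rightarrow> real^'d \<Rightarrow> complex" where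
  "diff_op h f x = f (x + h) - f x"

definition modulus :: "nat \<Rightarrow> real \<Rightarrow> (real^'d::finite \<Rightarrow> complex) \<Rightarrow> real \<Rightarrow> ennreal" where
  "modulus k p f t =
     (SUP h \<in> {h. norm h \<le> t}. Lp_norm p (\<lambda>x. ennreal (cmod ((diff_op h ^^ k) f x))))"

definition B_seminorm :: "nat \<Rightarrow> real \<Rightarrow> real \<Rightarrow> ennreal \<Rightarrow> (real^'d::finite \<Rightarrow> complex) \<Rightarrow>
    ennreal" where
  "B_seminorm k b p q f =
     (if q = top then (SUP t \<in> {0<..<1}. ennreal ((1 - ln t) powr b) * modulus k p f t)
      else epowr (\<integral>\<^sup>+t\<in>{0<..<1}. epowr (ennreal ((1 - ln t) powr b) * modulus k p f t) (enn2real q)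
        * ennreal (1 / t) \<partial>lborel) (1 / enn2real q))"

text \<open>As usual, a function in \<open>L\<^sub>p\<close> is identified with the tempered distribution it represents;
  distributions that are not functions get quasi-norm \<open>\<infinity>\<close>.\<close>

definition B_norm :: "nat \<Rightarrow> real \<Rightarrow> real \<Rightarrow> ennreal \<Rightarrow> ('d::finite) distr \<Rightarrow> ennreal" where
  "B_norm k b p q u = (if \<exists>g. represents g u
     then Lp_norm p (\<lambda>x. ennreal (cmod (fun_of u x))) + B_seminorm k b p q (fun_of u)
     else top)"

definition B_space :: "nat \<Rightarrow> real \<Rightarrow> real \<Rightarrow> ennreal \<Rightarrow> ('d::finite) distr set" where
  "B_space k b p q = {u \<in> tempered. B_norm k b p q u < top}"

section \<open>The lacunary class\<close>

definition lac_freq :: "nat \<Rightarrow> real" where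
  "lac_freq j = 2 ^ j - 2"

text \<open>The expansion \<open>W \<sim> (\<Sum>j\<ge>3. b\<^sub>j exp (i \<lambda>\<^sub>j x\<^sub>1))\<close> is that of a periodic distribution into its
  Fourier series, i.e. the series converges to \<open>W\<close> in the tempered distributions.
  The index \<open>i1\<close> is the coordinate called \<open>x\<^sub>1\<close>; the summation index is shifted by 3.\<close>

definition lacunary_expansion :: "'d::finite \<Rightarrow> (nat \<Rightarrow> complex) \<Rightarrow> 'd distr \<Rightarrow> bool" where
  "lacunary_expansion i1 b W \<longleftrightarrow> W \<in> tempered \<and>
     (\<forall>f\<in>schwartz.
        (\<lambda>n. b (n + 3) * (LINT x|lborel. cis (lac_freq (n + 3) * (x $ i1)) * f x)) sums W f)"

definition lacunary :: "(real^'d::finite \<Rightarrow> complex) \<Rightarrow> 'd \<Rightarrow> 'd distr set" where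
  "lacunary \<psi> i1 = {u \<in> tempered. \<exists>b W. lacunary_expansion i1 b W \<and>
     (\<forall>f\<in>schwartz. u f = distr_mult \<psi> W f)}"

section \<open>Embeddings\<close>

definition embeds :: "'a set \<Rightarrow> ('a \<Rightarrow> ennreal) \<Rightarrow> 'a set \<Rightarrow> ('a \<Rightarrow> ennreal) \<Rightarrow> bool" where
  "embeds A nA B nB \<longleftrightarrow> A \<subseteq> B \<and> (\<exists>c::real. 0 < c \<and> (\<forall>f\<in>A. nB f \<le> ennreal c * nA f))"

end

theory Submission
  imports Defs
begin

text \<open>Write \<open>f = \<psi> W\<close> with coefficients \<open>b\<^sub>j\<close>. Since \<open>\<psi>\<close> is band-limited and the frequencies are
  lacunary, every Littlewood-Paley block of \<open>f\<close> contains at most two terms, so the Triebel-Lizorkin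
  quasi-norm with weight exponent \<open>\<gamma>\<close> is equivalent to the \<open>\<ell>\<^sub>r\<close>-norm of \<open>(1 + j)\<^sup>\<gamma> b\<^sub>j\<close>. For the Besov
  quasi-norm, Riesz products give Zygmund's inequality, i.e. \<open>L\<^sub>p\<close>-norms of lacunary sums are
  \<open>\<ell>\<^sub>2\<close>-norms of coefficients, whence \<open>\<omega>\<^sub>k(f, t)\<close> for \<open>- log t \<sim> 2\<^sup>m\<close> is essentially the \<open>\<ell>\<^sub>2\<close>-norm of
  the tail \<open>(b\<^sub>j)\<close>, \<open>j \<ge> 2\<^sup>m\<close>. Integrating over \<open>t\<close>, the quasi-norm becomes the \<open>\<ell>\<^sub>q\<close>-norm of
  \<open>2\<close> to the power \<open>m (b + 1/q)\<close> times these tails, and Hardy's inequality, where \<open>b + 1/q > 0\<close> enters,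
  replaces tails by blocks \<open>2\<^sup>m \<le> j < 2\<^sup>m\<^sup>+\<^sup>1\<close>. Both embeddings are thus inequalities between weighted
  mixed sequence norms: within a block \<open>\<ell>\<^sub>r\<close> is compared with \<open>\<ell>\<^sub>2\<close> by Hoelder's inequality, and across
  blocks \<open>\<ell>\<^sub>r\<close> with \<open>\<ell>\<^sub>q\<close>. Sequences extremal within each of \<open>N\<close> consecutive blocks leave exactly the
  comparison of \<open>N\<^sup>1\<^sup>/\<^sup>r\<close> with \<open>N\<^sup>1\<^sup>/\<^sup>q\<close>, which forces the condition on \<open>q\<close> and \<open>r\<close>.\<close>

section \<open>Schwartz functions\<close>

text \<open>The wave of frequency \<lambda>_n is shared by two neighbouring blocks, as
  \<open>piece (n - 1) n\<close> and \<open>piece n n\<close>, so recovering coefficients from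
  blocks means inverting a bidiagonal relation. On the spectrum of that wave the argument of the
  bump in block n - 1 tends to a point of norm 2, where \<phi>0 vanishes; the coupling therefore
  dies out, and the relation can be solved by iterating towards higher indices. Lower bounds for L_p
  norms come by duality from upper bounds: a function is paired with partial sums of its own
  expansion, whose norm in the dual exponent is already controlled. The modulus of smoothness is
  bounded below by the same pairing, averaged over the step of the difference. Upper bounds are
  proved for the smooth partial sums and carried to the limit function by Fatou's lemma.\<close>

lemma partial_deriv_eq:
  assumes "(f has_derivative D) (at x)"
  shows "partial_deriv i f x = D (axis i 1)"
  using frechet_derivative_at[OF assms] by (simp add: partial_deriv_def)

text \<open>Closure properties are proved by exhibiting a set that is stable under a single partial
  derivative, so that no Leibniz formula for \<open>iter_partial\<close> has to be written
  down.\<close>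

lemma schwartz_coinduct:
  fixes X :: "(real^'d::finite \<Rightarrow> complex) set"
  assumes f: "f \<in> X"
    and diff: "\<And>f x. f \<in> X \<Longrightarrow> f differentiable (at x)"
    and bound: "\<And>f N. f \<in> X \<Longrightarrow> \<exists>C. \<forall>x. (1 + norm x) ^ N * cmod (f x) \<le> C"
    and step: "\<And>f i. f \<in> X \<Longrightarrow> partial_deriv i f \<in> X"
  shows "f \<in> schwartz"
proof -
  have X: "iter_partial is f \<in> X" for "is"
    by (induction "is") (auto simp: iter_partial_def f step)
  have "bounded (range (\<lambda>x. (1 + norm x) ^ N *\<^sub>R g x))" if "g \<in> X" for g N
    using bound[OF that, of N] unfolding bounded_iff by (auto simp: abs_of_nonneg)
  then show ?thesis
    using X diff by (auto simp: schwartz_def)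
qed

lemma schwartz_differentiable: "f \<in> schwartz \<Longrightarrow> f differentiable (at x)"
  by (auto simp: schwartz_def iter_partial_def dest: spec[of _ "[]"])

lemma schwartz_decay:
  assumes "f \<in> schwartz"
  obtains C where "C > 0" "\<And>x. (1 + norm x) ^ N * cmod (f x) \<le> C"
proof -
  have "bounded (range (\<lambda>x. (1 + norm x) ^ N *\<^sub>R f x))"
    using assms by (auto simp: schwartz_def iter_partial_def dest: spec[of _ "[]"])
  then obtain C where "C > 0" "\<And>x. norm ((1 + norm x) ^ N *\<^sub>R f x) \<le> C"
    unfolding bounded_pos by auto
  then show ?thesis by (intro that[of C]) (auto simp: abs_of_nonneg)
qed

lemma schwartz_partial:
  assumes "f \<in> schwartz"
  shows "partial_deriv i f \<in> schwartz"
proof -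
  \<comment> \<open>\<open>foldr\<close> applies the last list entry first, so an inner derivative
    is appended at the end of the list.\<close>
  have "iter_partial is (partial_deriv i f) = iter_partial (is @ [i]) f" for "is"
    by (simp add: iter_partial_def)
  then show ?thesis
    using assms by (auto simp: schwartz_def)
qed

lemma schwartz_has_derivative:
  assumes "f \<in> schwartz"
  shows "(f has_derivative (\<lambda>h. \<Sum>i\<in>UNIV. (h $ i) *\<^sub>R partial_deriv i f x)) (at x)"
proof -
  let ?D = "frechet_derivative f (at x)"
  have D: "(f has_derivative ?D) (at x)"
    using schwartz_differentiable[OF assms] frechet_derivative_works by blast
  interpret linear ?D using has_derivative_linear[OF D] .
  have "?D h = (\<Sum>i\<in>UNIV. (h $ i) *\<^sub>R partial_deriv i f x)" for h
  proof -
    have "?D h = ?D (\<Sum>i\<in>UNIV. (h $ i) *\<^sub>R axis i 1)"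
      using basis_expansion[of h] by (simp add: scalar_mult_eq_scaleR)
    then show ?thesis by (simp add: sum scale partial_deriv_def)
  qed
  then have "?D = (\<lambda>h. \<Sum>i\<in>UNIV. (h $ i) *\<^sub>R partial_deriv i f x)" by blast
  with D show ?thesis by simp
qed

lemma schwartz_continuous: "f \<in> schwartz \<Longrightarrow> continuous_on S f"
  by (meson continuous_at_imp_continuous_on schwartz_has_derivative has_derivative_continuous)

lemma schwartz_measurable [measurable_dest]: "f \<in> schwartz \<Longrightarrow> f \<in> borel_measurable borel"
  by (simp add: borel_measurable_continuous_onI schwartz_continuous)

lemma decay_combine:
  fixes g :: "real^'d::finite \<Rightarrow> complex"
  assumes "f1 \<in> schwartz" "f2 \<in> schwartz"
    and "\<And>x. cmod (g x) \<le> K1 * cmod (f1 x) + K2 * cmod (f2 x)" "K1 \<ge> 0" "K2 \<ge> 0"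
  shows "\<exists>C. \<forall>x. (1 + norm x) ^ N * cmod (g x) \<le> C"
proof -
  obtain C1 where C1: "\<And>x. (1 + norm x) ^ N * cmod (f1 x) \<le> C1"
    using schwartz_decay[OF assms(1)] by metis
  obtain C2 where C2: "\<And>x. (1 + norm x) ^ N * cmod (f2 x) \<le> C2"
    using schwartz_decay[OF assms(2)] by metis
  have "(1 + norm x) ^ N * cmod (g x) \<le> K1 * C1 + K2 * C2" for x
  proof -
    have "(1 + norm x) ^ N * cmod (g x) \<le> (1 + norm x) ^ N * (K1 * cmod (f1 x) + K2 * cmod (f2 x))"
      by (intro mult_left_mono assms) auto
    also have "\<dots> = K1 * ((1 + norm x) ^ N * cmod (f1 x)) + K2 * ((1 + norm x) ^ N * cmod (f2 x))"
      by (simp add: algebra_simps)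
    also have "\<dots> \<le> K1 * C1 + K2 * C2"
      by (intro add_mono mult_left_mono C1 C2 assms)
    finally show ?thesis .
  qed
  then show ?thesis by blast
qed

lemma schwartz_zero: "(\<lambda>x. 0) \<in> schwartz"
proof -
  have "partial_deriv i (\<lambda>x. 0) = (\<lambda>x. 0)" for i :: 'a
    by (simp add: fun_eq_iff partial_deriv_eq[OF has_derivative_const])
  then show ?thesis
    by (intro schwartz_coinduct[of _ "{\<lambda>x. 0}"]) (simp_all, blast)
qed

lemma schwartz_lincomb:
  assumes "f \<in> schwartz" "g \<in> schwartz"
  shows "(\<lambda>x. a * f x + b * g x) \<in> schwartz"
proof (rule schwartz_coinduct[of _ "{\<lambda>x. a * f x + b * g x | f g. f \<in> schwartz \<and> g \<in> schwartz}"])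
  show "(\<lambda>x. a * f x + b * g x) \<in> {\<lambda>x. a * f x + b * g x | f g. f \<in> schwartz \<and> g \<in> schwartz}"
    using assms by blast
next
  fix h :: "real^'a \<Rightarrow> complex" and x
  assume "h \<in> {\<lambda>x. a * f x + b * g x | f g. f \<in> schwartz \<and> g \<in> schwartz}"
  then show "h differentiable (at x)"
    by (auto dest!: schwartz_differentiable[of _ x] intro!: derivative_intros)
next
  fix h :: "real^'a \<Rightarrow> complex" and N
  assume "h \<in> {\<lambda>x. a * f x + b * g x | f g. f \<in> schwartz \<and> g \<in> schwartz}"
  then obtain f g where h: "h = (\<lambda>x. a * f x + b * g x)" "f \<in> schwartz" "g \<in> schwartz" by blast
  show "\<exists>C. \<forall>x. (1 + norm x) ^ N * cmod (h x) \<le> C"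
    by (rule decay_combine[OF h(2,3), of _ "cmod a" "cmod b"])
      (auto intro!: norm_triangle_le simp: norm_mult h(1))
next
  fix h :: "real^'a \<Rightarrow> complex" and i
  assume "h \<in> {\<lambda>x. a * f x + b * g x | f g. f \<in> schwartz \<and> g \<in> schwartz}"
  then obtain f g where h: "h = (\<lambda>x. a * f x + b * g x)" "f \<in> schwartz" "g \<in> schwartz" by blast
  have "partial_deriv i h = (\<lambda>x. a * partial_deriv i f x + b * partial_deriv i g x)"
    unfolding h(1)
    by (rule ext, subst partial_deriv_eq, (rule derivative_intros schwartz_has_derivative h)+)
      (simp add: axis_def if_distrib[of "\<lambda>x. x *\<^sub>R _"] cong: if_cong)
  then show "partial_deriv i h \<in> {\<lambda>x. a * f x + b * g x | f g. f \<in> schwartz \<and> g \<in> schwartz}"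
    using h schwartz_partial by blast
qed

lemma schwartz_add: "f \<in> schwartz \<Longrightarrow> g \<in> schwartz \<Longrightarrow> (\<lambda>x. f x + g x) \<in> schwartz"
  using schwartz_lincomb[of f g 1 1] by simp

lemma schwartz_diff: "f \<in> schwartz \<Longrightarrow> g \<in> schwartz \<Longrightarrow> (\<lambda>x. f x - g x) \<in> schwartz"
  using schwartz_lincomb[of f g 1 "-1"] by simp

lemma schwartz_cmult: "f \<in> schwartz \<Longrightarrow> (\<lambda>x. c * f x) \<in> schwartz"
  using schwartz_lincomb[of f f c 0] by simp

lemma schwartz_sum:
  assumes "\<And>j. j \<in> J \<Longrightarrow> f j \<in> schwartz"
  shows "(\<lambda>x. \<Sum>j\<in>J. f j x) \<in> schwartz"
  using assms
  by (induction J rule: infinite_finite_induct) (auto simp: schwartz_zero intro!: schwartz_add)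

text \<open>The derivative of a product is a sum of two products, so an invariant set for
  \<open>schwartz_coinduct\<close> has to be closed under sums.\<close>

inductive_set schwartz_products :: "(real^'d::finite \<Rightarrow> complex) set" where
  prod: "f \<in> schwartz \<Longrightarrow> g \<in> schwartz \<Longrightarrow> (\<lambda>x. f x * g x) \<in> schwartz_products"
| sum: "f \<in> schwartz_products \<Longrightarrow> g \<in> schwartz_products \<Longrightarrow> (\<lambda>x. f x + g x) \<in> schwartz_products"

lemma schwartz_bounded:
  assumes "f \<in> schwartz"
  obtains C where "C > 0" "\<And>x. cmod (f x) \<le> C"
  using schwartz_decay[OF assms, of 0] by auto

lemma schwartz_mult:
  assumes "f \<in> schwartz" "g \<in> schwartz"
  shows "(\<lambda>x. f x * g x) \<in> schwartz"
proof (rule schwartz_coinduct[of _ schwartz_products])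
  show "(\<lambda>x. f x * g x) \<in> schwartz_products" using assms by (rule schwartz_products.prod)
next
  fix h :: "real^'a \<Rightarrow> complex" and x
  assume "h \<in> schwartz_products"
  then show "h differentiable (at x)"
    by induction (auto dest!: schwartz_differentiable[of _ x] intro!: derivative_intros)
next
  fix h :: "real^'a \<Rightarrow> complex" and N
  assume "h \<in> schwartz_products"
  then show "\<exists>C. \<forall>x. (1 + norm x) ^ N * cmod (h x) \<le> C"
  proof induction
    case (prod f g)
    obtain K where "K > 0" "\<And>x. cmod (f x) \<le> K" using schwartz_bounded[OF prod(1)] by metis
    then show ?case
      using prod by (intro decay_combine[of g g _ K 0]) (auto simp: norm_mult mult_right_mono)
  next
    case (sum f g)
    then obtain C1 C2 where "\<forall>x. (1 + norm x) ^ N * cmod (f x) \<le> C1"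
      "\<forall>x. (1 + norm x) ^ N * cmod (g x) \<le> C2" by blast
    then have "(1 + norm x) ^ N * cmod (f x + g x) \<le> C1 + C2" for x
    proof -
      have "(1 + norm x) ^ N * cmod (f x + g x) \<le> (1 + norm x) ^ N * (cmod (f x) + cmod (g x))"
        by (intro mult_left_mono norm_triangle_ineq) auto
      also have "\<dots> \<le> C1 + C2"
        using \<open>\<forall>x. (1 + norm x) ^ N * cmod (f x) \<le> C1\<close> \<open>\<forall>x. (1 + norm x) ^ N * cmod (g x) \<le> C2\<close>
        by (simp add: distrib_left add_mono)
      finally show ?thesis .
    qed
    then show ?case by blast
  qed
next
  fix h :: "real^'a \<Rightarrow> complex" and i :: 'a
  \<comment> \<open>Differentiability is carried through the induction because the derivative of a
    sum of two members can be split only once both are known to be differentiable.\<close>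
  have aux: "h \<in> schwartz_products \<Longrightarrow> (\<forall>x. h differentiable (at x)) \<and> partial_deriv i h \<in> schwartz_products"
    for h :: "real^'a \<Rightarrow> complex"
  proof (induction rule: schwartz_products.induct)
    case (prod f g)
    have "partial_deriv i (\<lambda>x. f x * g x) = (\<lambda>x. partial_deriv i f x * g x + f x * partial_deriv i g x)"
      by (rule ext, subst partial_deriv_eq, (rule derivative_intros schwartz_has_derivative prod)+)
        (simp add: axis_def if_distrib[of "\<lambda>x. x *\<^sub>R _"] cong: if_cong)
    moreover have "(\<lambda>x. partial_deriv i f x * g x + f x * partial_deriv i g x) \<in> schwartz_products"
      by (intro schwartz_products.intros schwartz_partial prod)
    moreover have "(\<lambda>x. f x * g x) differentiable (at x)" for x
      by (intro differentiable_mult schwartz_differentiable prod)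
    ultimately show ?case by simp
  next
    case (sum f g)
    have "partial_deriv i (\<lambda>x. f x + g x) = (\<lambda>x. partial_deriv i f x + partial_deriv i g x)"
    proof
      fix x
      have "(f has_derivative frechet_derivative f (at x)) (at x)"
        "(g has_derivative frechet_derivative g (at x)) (at x)"
        using sum frechet_derivative_works by blast+
      from partial_deriv_eq[OF has_derivative_add[OF this]]
      show "partial_deriv i (\<lambda>x. f x + g x) x = partial_deriv i f x + partial_deriv i g x"
        by (simp add: partial_deriv_def)
    qed
    with sum show ?case
      by (auto intro!: schwartz_products.intros derivative_intros)
  qed
  assume "h \<in> schwartz_products"
  with aux show "partial_deriv i h \<in> schwartz_products" by blast
qed

lemma schwartz_cnj:
  assumes "f \<in> schwartz"
  shows "(\<lambda>x. cnj (f x)) \<in> schwartz"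
proof (rule schwartz_coinduct[of _ "{\<lambda>x. cnj (f x) | f. f \<in> schwartz}"])
  show "(\<lambda>x. cnj (f x)) \<in> {\<lambda>x. cnj (f x) | f. f \<in> schwartz}"
    using assms by blast
next
  fix h :: "real^'a \<Rightarrow> complex" and x
  assume "h \<in> {\<lambda>x. cnj (f x) | f. f \<in> schwartz}"
  then show "h differentiable (at x)"
    using differentiableI[OF bounded_linear.has_derivative[OF bounded_linear_cnj schwartz_has_derivative]]
    by auto
next
  fix h :: "real^'a \<Rightarrow> complex" and N
  assume "h \<in> {\<lambda>x. cnj (f x) | f. f \<in> schwartz}"
  then show "\<exists>C. \<forall>x. (1 + norm x) ^ N * cmod (h x) \<le> C"
    using schwartz_decay by (auto, metis)
next
  fix h :: "real^'a \<Rightarrow> complex" and i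
  assume "h \<in> {\<lambda>x. cnj (f x) | f. f \<in> schwartz}"
  then obtain f where h: "h = (\<lambda>x. cnj (f x))" "f \<in> schwartz" by blast
  have "partial_deriv i h = (\<lambda>x. cnj (partial_deriv i f x))"
    unfolding h(1)
    by (rule ext, subst partial_deriv_eq,
        (rule bounded_linear.has_derivative[OF bounded_linear_cnj] schwartz_has_derivative h)+)
      (simp add: axis_def if_distrib[of "\<lambda>x. x *\<^sub>R _"] cong: if_cong)
  then show "partial_deriv i h \<in> {\<lambda>x. cnj (f x) | f. f \<in> schwartz}"
    using h schwartz_partial by blast
qed

text \<open>Peetre's inequality with exponent one: polynomial weights move between translates at the
  cost of a factor depending on the shift alone.\<close>

lemma one_plus_norm_affine:
  fixes x y :: "'a::real_normed_vector"
  shows "1 + norm x \<le> (1 + norm (x + y)) * (1 + norm y)"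
proof -
  have "norm x \<le> norm (x + y) + norm y"
    using norm_triangle_ineq4[of "x + y" y] by simp
  moreover have "0 \<le> norm y * norm (x + y)" by simp
  ultimately have "1 + norm x \<le> 1 + norm (x + y) + norm y + norm y * norm (x + y)" by linarith
  then show ?thesis by (simp add: algebra_simps)
qed

lemma schwartz_affine:
  fixes f :: "real^'d::finite \<Rightarrow> complex"
  assumes "f \<in> schwartz" "a \<noteq> 0"
  shows "(\<lambda>x. f (y + a *\<^sub>R x)) \<in> schwartz"
proof -
  let ?X = "{\<lambda>x. f (y + a *\<^sub>R x) | f. f \<in> schwartz}"
  show ?thesis
  proof (rule schwartz_coinduct[of _ ?X])
    show "(\<lambda>x. f (y + a *\<^sub>R x)) \<in> ?X"
      using assms by blast
  next
    fix h :: "real^'d \<Rightarrow> complex" and x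
    assume "h \<in> ?X"
    then obtain f where h: "h = (\<lambda>x. f (y + a *\<^sub>R x))" "f \<in> schwartz" by blast
    have "((\<lambda>x. y + a *\<^sub>R x) has_derivative (\<lambda>h. a *\<^sub>R h)) (at x)"
      by (auto intro!: derivative_eq_intros)
    from differentiableI[OF has_derivative_compose[OF this schwartz_has_derivative[OF h(2)]]]
    show "h differentiable (at x)" by (simp add: h)
  next
    fix h :: "real^'d \<Rightarrow> complex" and N
    assume "h \<in> ?X"
    then obtain f where h: "h = (\<lambda>x. f (y + a *\<^sub>R x))" "f \<in> schwartz" by blast
    obtain C where C: "\<And>x. (1 + norm x) ^ N * cmod (f x) \<le> C" using schwartz_decay[OF h(2)] by metis
    let ?K = "(1 + norm y) * (1 + 1 / \<bar>a\<bar>)"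
    have K: "1 + norm x \<le> ?K * (1 + norm (y + a *\<^sub>R x))" for x
    proof -
      have "1 + norm x \<le> (1 + 1 / \<bar>a\<bar>) * (1 + norm (a *\<^sub>R x))"
        using assms(2) by (simp add: field_simps)
      also have "\<dots> \<le> (1 + 1 / \<bar>a\<bar>) * ((1 + norm (a *\<^sub>R x + y)) * (1 + norm y))"
        by (intro mult_left_mono one_plus_norm_affine) auto
      finally show ?thesis by (simp add: ac_simps)
    qed
    have "(1 + norm x) ^ N * cmod (h x) \<le> ?K ^ N * C" for x
    proof -
      have "(1 + norm x) ^ N * cmod (h x) \<le> (?K * (1 + norm (y + a *\<^sub>R x))) ^ N * cmod (h x)"
        by (intro mult_right_mono power_mono K) auto
      also have "\<dots> = ?K ^ N * ((1 + norm (y + a *\<^sub>R x)) ^ N * cmod (f (y + a *\<^sub>R x)))"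
        by (simp add: h power_mult_distrib ac_simps)
      also have "\<dots> \<le> ?K ^ N * C" by (intro mult_left_mono C) auto
      finally show ?thesis .
    qed
    then show "\<exists>C. \<forall>x. (1 + norm x) ^ N * cmod (h x) \<le> C" by blast
  next
    fix h :: "real^'d \<Rightarrow> complex" and i
    assume "h \<in> ?X"
    then obtain f where h: "h = (\<lambda>x. f (y + a *\<^sub>R x))" "f \<in> schwartz" by blast
    have "partial_deriv i h x = of_real a * partial_deriv i f (y + a *\<^sub>R x)" for x
    proof -
      have "((\<lambda>x. y + a *\<^sub>R x) has_derivative (\<lambda>h. a *\<^sub>R h)) (at x)"
        by (auto intro!: derivative_eq_intros)
      from partial_deriv_eq[OF has_derivative_compose[OF this schwartz_has_derivative[OF h(2)]]]
      show ?thesis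
        by (simp add: h axis_def if_distrib[of "\<lambda>x. a * x"] if_distrib[of "\<lambda>x. x *\<^sub>R _"] cong: if_cong)
          (simp add: scaleR_conv_of_real)
    qed
    then show "partial_deriv i h \<in> ?X"
      using schwartz_cmult[OF schwartz_partial[OF h(2)], of "of_real a" i]
      by (intro CollectI exI[of _ "\<lambda>z. of_real a * partial_deriv i f z"]) auto
  qed
qed

lemma has_derivative_cis_inner:
  "((\<lambda>x. cis (x \<bullet> \<eta>)) has_derivative (\<lambda>h. \<i> * of_real (h \<bullet> \<eta>) * cis (x \<bullet> \<eta>))) (at x)"
proof -
  have 1: "((\<lambda>x. x \<bullet> \<eta>) has_derivative (\<lambda>h. h \<bullet> \<eta>)) (at x)"
    by (auto intro!: derivative_eq_intros)
  have "((\<lambda>t. cis t) has_derivative (\<lambda>h. h *\<^sub>R (\<i> * cis (x \<bullet> \<eta>)))) (at (x \<bullet> \<eta>))"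
    by (rule derivative_eq_intros | simp add: complex_eq_iff cis.ctr | (auto simp: cis_conv_exp scaleR_conv_of_real fun_eq_iff intro!: derivative_eq_intros; fail))+
  from has_derivative_compose[OF 1 this] show ?thesis
    by (simp add: scaleR_conv_of_real ac_simps)
qed

lemma schwartz_cis_mult:
  fixes f :: "real^'d::finite \<Rightarrow> complex"
  assumes "f \<in> schwartz"
  shows "(\<lambda>x. cis (x \<bullet> \<eta>) * f x) \<in> schwartz"
proof -
  let ?X = "{\<lambda>x. cis (x \<bullet> \<eta>) * f x | f. f \<in> schwartz}"
  show ?thesis
  proof (rule schwartz_coinduct[of _ ?X])
    show "(\<lambda>x. cis (x \<bullet> \<eta>) * f x) \<in> ?X"
      using assms by blast
  next
    fix h :: "real^'d \<Rightarrow> complex" and x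
    assume "h \<in> ?X"
    then show "h differentiable (at x)"
      using differentiableI[OF has_derivative_mult[OF has_derivative_cis_inner schwartz_has_derivative]]
      by auto
  next
    fix h :: "real^'d \<Rightarrow> complex" and N
    assume "h \<in> ?X"
    then show "\<exists>C. \<forall>x. (1 + norm x) ^ N * cmod (h x) \<le> C"
      using schwartz_decay by (auto simp: norm_mult, metis)
  next
    fix h :: "real^'d \<Rightarrow> complex" and i
    assume "h \<in> ?X"
    then obtain f where h: "h = (\<lambda>x. cis (x \<bullet> \<eta>) * f x)" "f \<in> schwartz" by blast
    have "partial_deriv i h = (\<lambda>x. cis (x \<bullet> \<eta>) * (\<i> * of_real (\<eta> $ i) * f x + 1 * partial_deriv i f x))"
      unfolding h(1)
      by (rule ext, subst partial_deriv_eq,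
          (rule has_derivative_mult has_derivative_cis_inner schwartz_has_derivative h)+)
        (simp add: axis_def if_distrib[of "\<lambda>x. x *\<^sub>R _"] algebra_simps
           inner_axis_axis inner_commute[of _ \<eta>] inner_axis[unfolded axis_def] cong: if_cong)
    moreover have "(\<lambda>x. \<i> * of_real (\<eta> $ i) * f x + 1 * partial_deriv i f x) \<in> schwartz"
      using h by (intro schwartz_lincomb schwartz_partial)
    ultimately show "partial_deriv i h \<in> ?X" by (intro CollectI) (rule exI, rule conjI)
  qed
qed

lemma schwartz_coord_mult:
  fixes f :: "real^'d::finite \<Rightarrow> complex"
  assumes "f \<in> schwartz"
  shows "(\<lambda>x. of_real (x $ j) * f x) \<in> schwartz"
proof -
  \<comment> \<open>Differentiating the product with a coordinate leaves f itself as an extra term;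
    the free summand g absorbs it.\<close>
  let ?X = "{\<lambda>x. of_real (x $ j) * f x + g x | f g. f \<in> schwartz \<and> g \<in> schwartz}"
  have d: "((\<lambda>x. complex_of_real (x $ j)) has_derivative (\<lambda>h. of_real (h $ j))) (at x)" for x
    by (intro bounded_linear.has_derivative[OF bounded_linear_of_real] 
        bounded_linear.has_derivative[OF bounded_linear_vec_nth] has_derivative_ident)
  show ?thesis
  proof (rule schwartz_coinduct[of _ ?X])
    have "(\<lambda>x. of_real (x $ j) * f x + (\<lambda>_. 0) x) \<in> ?X"
      using assms schwartz_zero by (intro CollectI exI[of _ f] exI[of _ "\<lambda>_. 0"]) auto
    then show "(\<lambda>x. of_real (x $ j) * f x) \<in> ?X" by simp
  next
    fix h :: "real^'d \<Rightarrow> complex" and x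
    assume "h \<in> ?X"
    then show "h differentiable (at x)"
      using differentiableI[OF has_derivative_add[OF has_derivative_mult[OF d schwartz_has_derivative]
            schwartz_has_derivative]]
      by auto
  next
    fix h :: "real^'d \<Rightarrow> complex" and N
    assume "h \<in> ?X"
    then obtain f g where h: "h = (\<lambda>x. of_real (x $ j) * f x + g x)" "f \<in> schwartz" "g \<in> schwartz" by blast
    obtain C1 where C1: "\<And>x. (1 + norm x) ^ Suc N * cmod (f x) \<le> C1"
      using schwartz_decay[OF h(2), of "Suc N"] by blast
    obtain C2 where C2: "\<And>x. (1 + norm x) ^ N * cmod (g x) \<le> C2"
      using schwartz_decay[OF h(3), of N] by blast
    have "(1 + norm x) ^ N * cmod (h x) \<le> C1 + C2" for x
    proof -
      have "cmod (h x) \<le> (1 + norm x) * cmod (f x) + cmod (g x)"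
        unfolding h using component_le_norm_cart[of x j]
        by (auto intro!: norm_triangle_mono mult_right_mono simp: norm_mult)
      then have "(1 + norm x) ^ N * cmod (h x) \<le> (1 + norm x) ^ N * ((1 + norm x) * cmod (f x) + cmod (g x))"
        by (intro mult_left_mono) auto
      also have "\<dots> = (1 + norm x) ^ Suc N * cmod (f x) + (1 + norm x) ^ N * cmod (g x)"
        by (simp add: algebra_simps)
      also have "\<dots> \<le> C1 + C2" by (intro add_mono C1 C2)
      finally show ?thesis .
    qed
    then show "\<exists>C. \<forall>x. (1 + norm x) ^ N * cmod (h x) \<le> C" by blast
  next
    fix h :: "real^'d \<Rightarrow> complex" and i
    assume "h \<in> ?X"
    then obtain f g where h: "h = (\<lambda>x. of_real (x $ j) * f x + g x)" "f \<in> schwartz" "g \<in> schwartz" by blast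
    have "partial_deriv i h = (\<lambda>x. of_real (x $ j) * partial_deriv i f x
        + (of_bool (i = j) * f x + 1 * partial_deriv i g x))"
      unfolding h(1)
      by (rule ext, subst partial_deriv_eq,
          (rule has_derivative_add has_derivative_mult d schwartz_has_derivative h)+)
        (simp add: axis_def if_distrib[of "\<lambda>x. x *\<^sub>R _"] cong: if_cong)
    moreover have "(\<lambda>x. of_bool (i = j) * f x + 1 * partial_deriv i g x) \<in> schwartz"
      using h by (intro schwartz_lincomb schwartz_partial)
    ultimately show "partial_deriv i h \<in> ?X"
      using schwartz_partial[OF h(2)] by (intro CollectI) (rule exI, rule exI, intro conjI)
  qed
qed

section \<open>Integrals over Euclidean space\<close>

text \<open>Space is covered by the balls of radius n + 1, with n the integer part of the norm.
  Their volumes grow like (1 + n) to the power of the dimension, so the exponent DIM + 2 leaves the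
  summable series of 1 / (1 + n)^2.\<close>

lemma integrable_decay:
  "integrable lborel (\<lambda>x::'a::euclidean_space. 1 / (1 + norm x) ^ (DIM('a) + 2))"
proof (rule integrableI_bounded)
  let ?D = "DIM('a) + 2"
  have bound: "ennreal (1 / (1 + norm x) ^ ?D)
      \<le> (\<Sum>n. ennreal (1 / (1 + real n) ^ ?D) * indicator (ball (0::'a) (1 + real n)) x)" for x
  proof -
    let ?n = "nat \<lfloor>norm x\<rfloor>"
    have n: "real ?n \<le> norm x" "norm x < 1 + real ?n"
      by (simp_all add: of_nat_nat) linarith
    have "1 / (1 + norm x) ^ ?D \<le> 1 / (1 + real ?n) ^ ?D"
      using n by (intro divide_left_mono power_mono mult_pos_pos zero_less_power) (auto intro: add_pos_nonneg)
    also have "ennreal (1 / (1 + real ?n) ^ ?D)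
        = ennreal (1 / (1 + real ?n) ^ ?D) * indicator (ball (0::'a) (1 + real ?n)) x"
      using n by simp
    also have "\<dots> \<le> (\<Sum>n. ennreal (1 / (1 + real n) ^ ?D) * indicator (ball (0::'a) (1 + real n)) x)"
      using sum_le_suminf[of "\<lambda>n. ennreal (1 / (1 + real n) ^ ?D) * indicator (ball (0::'a) (1 + real n)) x" "{?n}"]
      by simp
    finally show ?thesis by (simp add: ennreal_leI)
  qed
  have "(\<integral>\<^sup>+x. ennreal (norm (1 / (1 + norm (x::'a)) ^ ?D)) \<partial>lborel)
      \<le> (\<integral>\<^sup>+x. (\<Sum>n. ennreal (1 / (1 + real n) ^ ?D) * indicator (ball (0::'a) (1 + real n)) x) \<partial>lborel)"
    using bound by (intro nn_integral_mono) simp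
  also have "\<dots> = (\<Sum>n. ennreal (1 / (1 + real n) ^ ?D) * emeasure lborel (ball (0::'a) (1 + real n)))"
    by (subst nn_integral_suminf)
      (auto intro!: borel_measurable_times_ennreal borel_measurable_indicator simp: nn_integral_cmult_indicator)
  also have "\<dots> = (\<Sum>n. ennreal (unit_ball_vol (DIM('a)) * (1 / (1 + real n) ^ 2)))"
  proof (rule suminf_cong)
    fix n
    have "1 + real n > 0" by simp
    then have "1 / (1 + real n) ^ ?D * (unit_ball_vol (DIM('a)) * (1 + real n) ^ DIM('a))
        = unit_ball_vol (DIM('a)) * (1 / (1 + real n) ^ 2)"
      by (simp add: power2_eq_square)
    then show "ennreal (1 / (1 + real n) ^ ?D) * emeasure lborel (ball (0::'a) (1 + real n))
        = ennreal (unit_ball_vol (DIM('a)) * (1 / (1 + real n) ^ 2))"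
      by (subst emeasure_ball) (simp_all flip: ennreal_mult)
  qed
  also have "\<dots> < top"
  proof -
    have "summable (\<lambda>n. 1 / (1 + real n) ^ 2)"
      using inverse_power_summable[of 2] summable_Suc_iff[of "\<lambda>n. inverse (real n ^ 2)"]
      by (simp add: inverse_eq_divide add.commute)
    then have "summable (\<lambda>n. unit_ball_vol (DIM('a)) * (1 / (1 + real n) ^ 2))"
      by (rule summable_mult)
    then have "(\<Sum>n. ennreal (unit_ball_vol (DIM('a)) * (1 / (1 + real n) ^ 2))) \<noteq> top"
      by (rule ennreal_suminf_neq_top) simp
    then show ?thesis by (simp only: less_top)
  qed
  finally show "(\<integral>\<^sup>+x. ennreal (norm (1 / (1 + norm (x::'a)) ^ ?D)) \<partial>lborel) < \<infinity>"
    by simp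
qed simp

lemma nn_integral_affine:
  fixes t :: "'a::euclidean_space"
  assumes [measurable]: "f \<in> borel_measurable borel" and c: "c \<noteq> 0"
  shows "(\<integral>\<^sup>+x. f x \<partial>lborel) = \<bar>c\<bar> ^ DIM('a) * (\<integral>\<^sup>+x. f (t + c *\<^sub>R x) \<partial>lborel)"
  by (subst lborel_affine[OF c, of t])
     (simp add: nn_integral_density nn_integral_distr nn_integral_cmult ennreal_power)

lemma integrable_affine:
  fixes f :: "'a::euclidean_space \<Rightarrow> 'b :: {banach, second_countable_topology}"
  assumes f: "integrable lborel f" and c: "c \<noteq> 0"
  shows "integrable lborel (\<lambda>x. f (t + c *\<^sub>R x))"
  using f f[THEN borel_measurable_integrable] c unfolding integrable_iff_bounded
  by (subst (asm) nn_integral_affine[where c=c and t=t]) (auto simp: ennreal_mult_less_top)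

lemma integral_affine:
  fixes f :: "'a::euclidean_space \<Rightarrow> 'b :: {banach, second_countable_topology}"
  assumes [measurable]: "f \<in> borel_measurable borel" and c: "c \<noteq> 0"
  shows "(LINT x|lborel. f x) = \<bar>c\<bar> ^ DIM('a) *\<^sub>R (LINT x|lborel. f (t + c *\<^sub>R x))"
  by (subst lborel_affine[OF c, of t]) (simp add: integral_density integral_distr)

lemma integral_shift:
  fixes f :: "'a::euclidean_space \<Rightarrow> 'b :: {banach, second_countable_topology}"
  assumes "f \<in> borel_measurable borel"
  shows "(LINT x|lborel. f (x + t)) = (LINT x|lborel. f x)"
  using integral_affine[OF assms, of 1 t] by (simp add: add.commute)

lemma integrable_shift:
  fixes f :: "'a::euclidean_space \<Rightarrow> 'b :: {banach, second_countable_topology}"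
  assumes "integrable lborel f"
  shows "integrable lborel (\<lambda>x. f (x + t))"
  using integrable_affine[OF assms, of 1 t] by (simp add: add.commute)

lemma nn_integral_shift:
  fixes t :: "'a::euclidean_space"
  assumes "f \<in> borel_measurable borel"
  shows "(\<integral>\<^sup>+x. f (x + t) \<partial>lborel) = (\<integral>\<^sup>+x. f x \<partial>lborel)"
  using nn_integral_affine[OF assms, of 1 t] by (simp add: add.commute)

lemma AE_shift:
  fixes t :: "'a::euclidean_space"
  assumes P: "AE x in lborel. P x"
  shows "AE x in lborel. P (x + t)"
proof -
  obtain N where N: "{x. \<not> P x} \<subseteq> N" "emeasure lborel N = 0" "N \<in> sets borel"
    using AE_E[OF P] by auto
  have [measurable]: "N \<in> sets borel" by fact
  have "(\<integral>\<^sup>+x. indicator N (x + t) \<partial>lborel) = (\<integral>\<^sup>+x. indicator N x \<partial>lborel)"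
    by (rule nn_integral_shift) simp
  then have "(\<integral>\<^sup>+x. indicator N (x + t) \<partial>lborel) = 0" using N by simp
  then have "AE x in lborel. indicator N (x + t) = (0::ennreal)"
    by (subst (asm) nn_integral_0_iff_AE) auto
  then show ?thesis
    by eventually_elim (use N in \<open>auto simp: indicator_def split: if_splits\<close>)
qed

section \<open>The Fourier transform of Schwartz functions\<close>

lemma borel_measurable_cis [measurable]:
  "f \<in> borel_measurable M \<Longrightarrow> (\<lambda>x. cis (f x)) \<in> borel_measurable M"
  by (rule measurable_compose[of f M borel cis])
    (auto intro!: borel_measurable_continuous_onI continuous_intros)

lemma integrable_bounded_decay:
  fixes f :: "real^'d::finite \<Rightarrow> complex"
  assumes [measurable]: "f \<in> borel_measurable borel"
    and bound: "\<And>x. cmod (f x) \<le> C / (1 + norm x) ^ (CARD('d) + 2)"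
  shows "integrable lborel f"
proof (rule Bochner_Integration.integrable_bound)
  show "integrable lborel (\<lambda>x::real^'d. C * (1 / (1 + norm x) ^ (CARD('d) + 2)))"
    using integrable_decay[where 'a="real^'d"] by (intro integrable_mult_right) simp
  show "AE x in lborel. norm (f x) \<le> norm (C * (1 / (1 + norm x) ^ (CARD('d) + 2)))"
    using bound order_trans[OF bound abs_ge_self] by simp
qed simp

lemma schwartz_decay':
  assumes "f \<in> schwartz"
  obtains C where "C > 0" "\<And>x. cmod (f x) \<le> C / (1 + norm x) ^ N"
proof -
  obtain C where "C > 0" "\<And>x. (1 + norm x) ^ N * cmod (f x) \<le> C"
    using schwartz_decay[OF assms] by metis
  then show ?thesis
    by (intro that[of C]) (auto simp: pos_le_divide_eq add_pos_nonneg mult.commute)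
qed

lemma schwartz_integrable:
  assumes "f \<in> schwartz"
  shows "integrable lborel f"
  by (rule schwartz_decay'[OF assms, of "CARD('a) + 2"])
    (use integrable_bounded_decay schwartz_measurable[OF assms] in blast)

lemma schwartz_mult_integrable:
  "f \<in> schwartz \<Longrightarrow> g \<in> schwartz \<Longrightarrow> integrable lborel (\<lambda>x. f x * g x)"
  by (intro schwartz_integrable schwartz_mult)

abbreviation fourier_const :: "'d::finite itself \<Rightarrow> complex" where
  "fourier_const _ \<equiv> complex_of_real ((2 * pi) powr (- real CARD('d) / 2))"

lemma inv_fourier_eq: "inv_fourier f x = fourier f (- x)"
  by (simp add: inv_fourier_def fourier_def inner_commute)

lemma cis_inner_integrable:
  assumes "integrable lborel f"
  shows "integrable lborel (\<lambda>x. cis (x \<bullet> \<eta>) * f x)"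
proof (rule Bochner_Integration.integrable_bound[OF assms])
  have [measurable]: "f \<in> borel_measurable borel" using assms by (auto dest: borel_measurable_integrable)
  show "(\<lambda>x. cis (x \<bullet> \<eta>) * f x) \<in> borel_measurable lborel" by simp
qed (auto simp: norm_mult)

lemma cis_minus_inner_integrable:
  assumes "integrable lborel f"
  shows "integrable lborel (\<lambda>x. cis (- (x \<bullet> \<eta>)) * f x)"
  using cis_inner_integrable[OF assms, of "- \<eta>"] by simp

lemma fourier_bound:
  assumes "integrable lborel (f :: real^'d::finite \<Rightarrow> complex)"
  shows "cmod (fourier f \<xi>) \<le> cmod (fourier_const TYPE('d)) * (LINT x|lborel. cmod (f x))"
  unfolding fourier_def norm_mult
  by (intro mult_left_mono order_trans[OF integral_norm_bound]) (auto simp: norm_mult)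

lemma fourier_lincomb:
  assumes "integrable lborel f" "integrable lborel g"
  shows "fourier (\<lambda>x. a * f x + b * g x) \<xi> = a * fourier f \<xi> + b * fourier g \<xi>"
proof -
  have "(LINT x|lborel. cis (- (x \<bullet> \<xi>)) * (a * f x + b * g x))
      = (LINT x|lborel. a * (cis (- (x \<bullet> \<xi>)) * f x) + b * (cis (- (x \<bullet> \<xi>)) * g x))"
    by (simp add: algebra_simps)
  also have "\<dots> = a * (LINT x|lborel. cis (- (x \<bullet> \<xi>)) * f x) + b * (LINT x|lborel. cis (- (x \<bullet> \<xi>)) * g x)"
    using assms by (subst Bochner_Integration.integral_add) (auto intro!: cis_minus_inner_integrable integrable_mult_right)
  finally show ?thesis by (simp add: fourier_def algebra_simps)
qed

lemma fourier_modulate: "fourier (\<lambda>x. cis (x \<bullet> \<eta>) * f x) \<xi> = fourier f (\<xi> - \<eta>)"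
proof -
  have "cis (- (x \<bullet> \<xi>)) * (cis (x \<bullet> \<eta>) * f x) = cis (- (x \<bullet> (\<xi> - \<eta>))) * f x" for x
    by (simp add: inner_diff_right cis_mult mult.assoc[symmetric])
  then show ?thesis by (simp only: fourier_def)
qed

lemma fourier_shift:
  assumes [measurable]: "f \<in> borel_measurable borel"
  shows "fourier (\<lambda>x. f (x + h)) \<xi> = cis (h \<bullet> \<xi>) * fourier f \<xi>"
proof -
  have "(LINT x|lborel. cis (- (x \<bullet> \<xi>)) * f (x + h))
      = (LINT x|lborel. (\<lambda>z. cis (h \<bullet> \<xi>) * (cis (- (z \<bullet> \<xi>)) * f z)) (x + h))"
    by (simp add: inner_add_left cis_mult mult.assoc[symmetric])
  also have "\<dots> = (LINT x|lborel. cis (h \<bullet> \<xi>) * (cis (- (x \<bullet> \<xi>)) * f x))"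
    by (rule integral_shift) simp
  finally show ?thesis by (simp add: fourier_def)
qed

lemma fourier_dilate:
  fixes f :: "real^'d::finite \<Rightarrow> complex"
  assumes [measurable]: "f \<in> borel_measurable borel" and "s > 0"
  shows "fourier (\<lambda>x. f (s *\<^sub>R x)) (s *\<^sub>R z) = of_real (1 / s ^ CARD('d)) * fourier f z"
proof -
  have "(LINT x|lborel. cis (- (x \<bullet> z)) * f x)
      = \<bar>s\<bar> ^ CARD('d) *\<^sub>R (LINT x|lborel. cis (- (x \<bullet> (s *\<^sub>R z))) * f (s *\<^sub>R x))"
    using integral_affine[of "\<lambda>x. cis (- (x \<bullet> z)) * f x" s 0] assms by simp
  then show ?thesis
    using assms(2) by (simp add: fourier_def scaleR_conv_of_real field_simps)
qed

lemma fourier_cnj: "fourier (\<lambda>x. cnj (f x)) \<xi> = cnj (inv_fourier f \<xi>)"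
proof -
  have "cnj (LINT x|lborel. cis (x \<bullet> \<xi>) * f x) = (LINT x|lborel. cnj (cis (x \<bullet> \<xi>) * f x))"
    by (rule Bochner_Integration.integral_cnj[symmetric])
  then show ?thesis by (simp add: fourier_def inv_fourier_def cis_cnj inner_commute[of \<xi>])
qed

lemma inv_fourier_cnj: "inv_fourier (\<lambda>x. cnj (f x)) \<xi> = cnj (fourier f \<xi>)"
  by (simp add: inv_fourier_eq fourier_cnj)

lemma fourier_swap:
  fixes f g :: "real^'d::finite \<Rightarrow> complex"
  assumes f: "integrable lborel f" and g: "integrable lborel g"
  shows "(LINT \<xi>|lborel. fourier f \<xi> * g \<xi>) = (LINT x|lborel. f x * fourier g x)"
proof -
  have [measurable]: "f \<in> borel_measurable borel" "g \<in> borel_measurable borel"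
    using f g by (auto dest: borel_measurable_integrable)
  let ?F = "\<lambda>x \<xi>. cis (- (x \<bullet> \<xi>)) * (f x * g \<xi>)"
  have "integrable (lborel \<Otimes>\<^sub>M lborel) (case_prod ?F)"
  proof (rule lborel_pair.Fubini_integrable)
    have "integrable lborel (\<lambda>x. cmod (f x) * (LINT \<xi>|lborel. cmod (g \<xi>)))"
      using f by (intro integrable_mult_left integrable_norm)
    then show "integrable lborel (\<lambda>x. LINT \<xi>|lborel. cmod (case (x, \<xi>) of (x, \<xi>) \<Rightarrow> ?F x \<xi>))"
      by (simp add: norm_mult)
    show "AE x in lborel. integrable lborel (\<lambda>\<xi>. case (x, \<xi>) of (x, \<xi>) \<Rightarrow> ?F x \<xi>)"
    proof (intro AE_I2)
      fix x
      have "integrable lborel (\<lambda>\<xi>. f x * (cis (\<xi> \<bullet> (- x)) * g \<xi>))"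
        using g by (intro integrable_mult_right cis_inner_integrable)
      then show "integrable lborel (\<lambda>\<xi>. case (x, \<xi>) of (x, \<xi>) \<Rightarrow> ?F x \<xi>)"
        by (simp add: inner_commute ac_simps)
    qed
  qed measurable
  from lborel_pair.Fubini_integral[OF this]
  have eq: "(LINT \<xi>|lborel. LINT x|lborel. ?F x \<xi>) = (LINT x|lborel. LINT \<xi>|lborel. ?F x \<xi>)" .
  have 1: "(LINT x|lborel. ?F x \<xi>) = (LINT x|lborel. cis (- (x \<bullet> \<xi>)) * f x) * g \<xi>" for \<xi>
    by (subst integral_mult_left_zero[symmetric]) (simp add: ac_simps)
  have 2: "(LINT \<xi>|lborel. ?F x \<xi>) = f x * (LINT \<xi>|lborel. cis (- (\<xi> \<bullet> x)) * g \<xi>)" for x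
    by (subst integral_mult_right_zero[symmetric]) (simp add: ac_simps inner_commute)
  from eq show ?thesis
    unfolding 1 2 fourier_def
    by (simp add: mult.assoc mult.left_commute[of "f _"])
qed

lemma inv_fourier_swap:
  assumes "integrable lborel f" "integrable lborel g"
  shows "(LINT \<xi>|lborel. inv_fourier f \<xi> * g \<xi>) = (LINT x|lborel. f x * inv_fourier g x)"
proof -
  have "cnj (LINT \<xi>|lborel. inv_fourier f \<xi> * g \<xi>) = (LINT \<xi>|lborel. cnj (inv_fourier f \<xi> * g \<xi>))"
    by (rule Bochner_Integration.integral_cnj[symmetric])
  also have "\<dots> = (LINT \<xi>|lborel. fourier (\<lambda>x. cnj (f x)) \<xi> * cnj (g \<xi>))"
    by (simp add: fourier_cnj)
  also have "\<dots> = (LINT x|lborel. cnj (f x) * fourier (\<lambda>x. cnj (g x)) x)"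
    using assms by (intro fourier_swap) auto
  also have "\<dots> = cnj (LINT x|lborel. f x * inv_fourier g x)"
    by (subst Bochner_Integration.integral_cnj[symmetric]) (simp add: fourier_cnj)
  finally show ?thesis by simp
qed

text \<open>Mean value inequality along the segment from x to x + h, where for
  \<open>norm h \<le> 1\<close> the weights at all points are comparable. It dominates difference
  quotients, and later it makes the increment of \<psi> small in proportion to the step.\<close>

lemma schwartz_increment:
  fixes f :: "real^'d::finite \<Rightarrow> complex"
  assumes f: "f \<in> schwartz"
  obtains D where "D > 0"
    "\<And>x h. norm h \<le> 1 \<Longrightarrow> cmod (f (x + h) - f x) \<le> norm h * (D / (1 + norm x) ^ N)"
proof -
  have "\<exists>C>0. \<forall>x. cmod (partial_deriv i f x) \<le> C / (1 + norm x) ^ N" for i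
    using schwartz_decay'[OF schwartz_partial[OF f]] by metis
  then obtain C where C: "\<And>i. C i > 0" "\<And>i x. cmod (partial_deriv i f x) \<le> C i / (1 + norm x) ^ N"
    by metis
  let ?D = "(\<Sum>i\<in>UNIV. C i) * 2 ^ N"
  have "cmod (f (x + h) - f x) \<le> norm h * (?D / (1 + norm x) ^ N)" if h: "norm h \<le> 1" for x h
  proof (rule differentiable_bound_segment)
    show "\<And>y. y \<in> UNIV \<Longrightarrow> (f has_derivative (\<lambda>h. \<Sum>i\<in>UNIV. (h $ i) *\<^sub>R partial_deriv i f y)) (at y within UNIV)"
      using schwartz_has_derivative[OF f] by simp
    fix t :: real assume "t \<in> {0..1}"
    show "onorm (\<lambda>k. \<Sum>i\<in>UNIV. (k $ i) *\<^sub>R partial_deriv i f (x + t *\<^sub>R h)) \<le> ?D / (1 + norm x) ^ N"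
    proof (rule onorm_le)
      fix k
      let ?y = "x + t *\<^sub>R h"
      have "1 + norm x \<le> (1 + norm ?y) * (1 + norm (t *\<^sub>R h))" by (rule one_plus_norm_affine)
      also have "\<dots> \<le> (1 + norm ?y) * 2"
        using \<open>t \<in> {0..1}\<close> h by (intro mult_left_mono) (auto intro!: mult_le_one)
      finally have "(1 + norm x) ^ N \<le> ((1 + norm ?y) * 2) ^ N"
        by (intro power_mono) auto
      then have "(1 + norm x) ^ N \<le> 2 ^ N * (1 + norm ?y) ^ N"
        by (simp only: power_mult_distrib mult.commute)
      moreover have "(1 + norm x) ^ N > 0" "(1 + norm ?y) ^ N > 0"
        by (simp_all add: add_pos_nonneg)
      ultimately have y: "1 / (1 + norm ?y) ^ N \<le> 2 ^ N / (1 + norm x) ^ N"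
        by (simp add: divide_le_eq le_divide_eq mult.commute)
      have "cmod (\<Sum>i\<in>UNIV. (k $ i) *\<^sub>R partial_deriv i f ?y) \<le> (\<Sum>i\<in>UNIV. norm k * (C i * (2 ^ N / (1 + norm x) ^ N)))"
      proof (intro sum_norm_le)
        fix i
        have "cmod (partial_deriv i f ?y) \<le> C i * (1 / (1 + norm ?y) ^ N)" using C(2)[of i ?y] by simp
        also have "\<dots> \<le> C i * (2 ^ N / (1 + norm x) ^ N)"
          using C(1)[of i] by (intro mult_left_mono y) auto
        finally show "cmod ((k $ i) *\<^sub>R partial_deriv i f ?y) \<le> norm k * (C i * (2 ^ N / (1 + norm x) ^ N))"
          using component_le_norm_cart[of k i] by (simp only: norm_scaleR real_norm_def) (intro mult_mono, auto)
      qed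
      also have "\<dots> = ?D / (1 + norm x) ^ N * norm k"
        by (simp add: sum_distrib_left sum_distrib_right sum_divide_distrib ac_simps)
      finally show "cmod (\<Sum>i\<in>UNIV. (k $ i) *\<^sub>R partial_deriv i f ?y) \<le> ?D / (1 + norm x) ^ N * norm k" .
    qed
  qed auto
  moreover have "?D > 0" using C(1) by (intro mult_pos_pos sum_pos) auto
  ultimately show ?thesis by (rule that[rotated])
qed

text \<open>Difference quotients have integral zero by translation invariance, and dominated
  convergence passes this to the derivative. Applied to a modulated function it plays the part of
  integration by parts.\<close>

lemma integral_partial_deriv:
  fixes f :: "real^'d::finite \<Rightarrow> complex"
  assumes f: "f \<in> schwartz"
  shows "(LINT x|lborel. partial_deriv i f x) = 0"
proof -
  define s where "s n = inverse (real (Suc n))" for n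
  have s: "0 < s n" "s n \<le> 1" for n by (auto simp: s_def field_simps)
  have s0: "s \<longlonglongrightarrow> 0" unfolding s_def by (rule LIMSEQ_inverse_real_of_nat)
  note [measurable] = schwartz_measurable[OF f] schwartz_measurable[OF schwartz_partial[OF f]]
  obtain D where D: "D > 0"
    "\<And>x h. norm h \<le> 1 \<Longrightarrow> cmod (f (x + h) - f x) \<le> norm h * (D / (1 + norm x) ^ (CARD('d) + 2))"
    using schwartz_increment[OF f] by metis
  have "(\<lambda>n. LINT x|lborel. (1 / s n) *\<^sub>R (f (x + s n *\<^sub>R axis i 1) - f x))
     \<longlonglongrightarrow> (LINT x|lborel. partial_deriv i f x)"
  proof (rule integral_dominated_convergence)
    show "integrable lborel (\<lambda>x::real^'d. D * (1 / (1 + norm x) ^ (CARD('d) + 2)))"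
      using integrable_decay[where 'a="real^'d"] by (intro integrable_mult_right) simp
    show "AE x in lborel. (\<lambda>n. (1 / s n) *\<^sub>R (f (x + s n *\<^sub>R axis i 1) - f x)) \<longlonglongrightarrow> partial_deriv i f x"
    proof (intro AE_I2)
      fix x :: "real^'d"
      let ?D = "\<lambda>h. \<Sum>j\<in>UNIV. (h $ j) *\<^sub>R partial_deriv j f x"
      have D: "?D (s n *\<^sub>R axis i 1) = s n *\<^sub>R partial_deriv i f x" for n
        by (simp add: axis_def if_distrib[of "\<lambda>x. _ * x"] if_distrib[of "\<lambda>x. x *\<^sub>R _"] cong: if_cong)
      have "(\<lambda>h. norm (f (x + h) - f x - ?D h) / norm h) \<midarrow>0\<rightarrow> 0"
        using schwartz_has_derivative[OF f, of x] by (simp add: has_derivative_at)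
      moreover have "filterlim (\<lambda>n. s n *\<^sub>R axis i 1) (at (0::real^'d)) sequentially"
        using s tendsto_scaleR[OF s0 tendsto_const[of "axis i 1 :: real^'d"]]
        by (auto simp: filterlim_at axis_eq_0_iff less_imp_neq[THEN not_sym] intro!: always_eventually)
      ultimately have "(\<lambda>n. norm (f (x + s n *\<^sub>R axis i 1) - f x - ?D (s n *\<^sub>R axis i 1)) / norm (s n *\<^sub>R axis i (1::real) :: real^'d)) \<longlonglongrightarrow> 0"
        by (rule filterlim_compose)
      moreover have "norm (f (x + s n *\<^sub>R axis i 1) - f x - ?D (s n *\<^sub>R axis i 1)) / norm (s n *\<^sub>R axis i (1::real) :: real^'d)
          = norm ((1 / s n) *\<^sub>R (f (x + s n *\<^sub>R axis i 1) - f x) - partial_deriv i f x)" for n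
      proof -
        have "(1 / s n) *\<^sub>R (f (x + s n *\<^sub>R axis i 1) - f x) - partial_deriv i f x
            = (1 / s n) *\<^sub>R (f (x + s n *\<^sub>R axis i 1) - f x - ?D (s n *\<^sub>R axis i 1))"
          using s(1)[of n] unfolding D by (simp add: scaleR_diff_right)
        then show ?thesis using s(1)[of n] by (simp add: norm_axis_1)
      qed
      ultimately show "(\<lambda>n. (1 / s n) *\<^sub>R (f (x + s n *\<^sub>R axis i 1) - f x)) \<longlonglongrightarrow> partial_deriv i f x"
        by (simp only: tendsto_norm_zero_iff LIM_zero_iff)
    qed
    fix n
    show "AE x in lborel. norm ((1 / s n) *\<^sub>R (f (x + s n *\<^sub>R axis i 1) - f x)) \<le> D * (1 / (1 + norm x) ^ (CARD('d) + 2))"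
    proof (intro AE_I2)
      fix x
      have "norm (f (x + s n *\<^sub>R axis i 1) - f x) \<le> s n * (D / (1 + norm x) ^ (CARD('d) + 2))"
        using D(2)[of "s n *\<^sub>R axis i 1" x] s[of n] by (simp add: norm_axis_1)
      then show "norm ((1 / s n) *\<^sub>R (f (x + s n *\<^sub>R axis i 1) - f x)) \<le> D * (1 / (1 + norm x) ^ (CARD('d) + 2))"
        using s(1)[of n] by (simp only: norm_scaleR) (simp add: divide_le_eq mult.commute)
    qed
  qed measurable
  moreover have "(LINT x|lborel. (1 / s n) *\<^sub>R (f (x + s n *\<^sub>R axis i 1) - f x)) = 0" for n
  proof -
    have "integrable lborel (\<lambda>x. f (x + s n *\<^sub>R axis i 1))"
      by (rule integrable_shift[OF schwartz_integrable[OF f]])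
    then show ?thesis
      using schwartz_integrable[OF f] by (simp add: integral_shift)
  qed
  ultimately show ?thesis by (simp only: LIMSEQ_const_iff)
qed

lemma fourier_partial_deriv:
  assumes f: "f \<in> schwartz"
  shows "fourier (partial_deriv i f) \<xi> = \<i> * of_real (\<xi> $ i) * fourier f \<xi>"
proof -
  have "partial_deriv i (\<lambda>x. cis (x \<bullet> (- \<xi>)) * f x) = (\<lambda>x. cis (x \<bullet> (- \<xi>)) * partial_deriv i f x
      - \<i> * of_real (\<xi> $ i) * (cis (x \<bullet> (- \<xi>)) * f x))"
    by (rule ext, subst partial_deriv_eq,
        (rule has_derivative_mult has_derivative_cis_inner schwartz_has_derivative f)+)
      (simp add: axis_def if_distrib[of "\<lambda>x. x *\<^sub>R _"] algebra_simps
           inner_axis_axis inner_commute[of _ \<xi>] inner_axis[unfolded axis_def] cong: if_cong)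
  then have "(LINT x|lborel. cis (x \<bullet> (- \<xi>)) * partial_deriv i f x - \<i> * of_real (\<xi> $ i) * (cis (x \<bullet> (- \<xi>)) * f x)) = 0"
    using integral_partial_deriv[OF schwartz_cis_mult[OF f, of "- \<xi>"], of i] by simp
  then show ?thesis
    using cis_inner_integrable[OF schwartz_integrable[OF schwartz_partial[OF f]], of "- \<xi>"]
      cis_inner_integrable[OF schwartz_integrable[OF f], of "- \<xi>"]
    by (simp add: fourier_def)
qed

lemma fourier_has_derivative:
  fixes f :: "real^'d::finite \<Rightarrow> complex"
  assumes f: "f \<in> schwartz"
  shows "(fourier f has_derivative
    (\<lambda>h. \<Sum>i\<in>UNIV. (h $ i) *\<^sub>R fourier (\<lambda>x. - \<i> * (of_real (x $ i) * f x)) \<xi>)) (at \<xi>)"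
  (is "(_ has_derivative ?L) _")
proof -
  let ?c = "fourier_const TYPE('d)"
  note [measurable] = schwartz_measurable[OF f]
  have int: "integrable lborel (\<lambda>x. cis (- (x \<bullet> \<xi>)) * (- \<i> * (of_real (x $ i) * f x)))" for i
    by (intro cis_minus_inner_integrable schwartz_integrable schwartz_cmult schwartz_coord_mult f)
  have L: "?L h = ?c * (LINT x|lborel. cis (- (x \<bullet> \<xi>)) * (- \<i> * of_real (x \<bullet> h)) * f x)" for h
  proof -
    have "(LINT x|lborel. cis (- (x \<bullet> \<xi>)) * (- \<i> * of_real (x \<bullet> h)) * f x)
        = (LINT x|lborel. (\<Sum>i\<in>UNIV. of_real (h $ i) * (cis (- (x \<bullet> \<xi>)) * (- \<i> * (of_real (x $ i) * f x)))))"
      by (intro Bochner_Integration.integral_cong refl)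
        (simp add: inner_vec_def sum_distrib_left sum_distrib_right sum_negf ac_simps)
    also have "\<dots> = (\<Sum>i\<in>UNIV. of_real (h $ i) * (LINT x|lborel. cis (- (x \<bullet> \<xi>)) * (- \<i> * (of_real (x $ i) * f x))))"
      using int by (subst Bochner_Integration.integral_sum) auto
    finally show ?thesis
      by (simp add: fourier_def scaleR_conv_of_real sum_distrib_left ac_simps)
  qed
  \<comment> \<open>Two powers more than integrability asks for; they pay for
    \<open>norm x ^ 2\<close> in the second-order Taylor remainder of the exponential.\<close>
  obtain C where C: "C > 0" "\<And>x. cmod (f x) \<le> C / (1 + norm x) ^ (CARD('d) + 4)"
    using schwartz_decay'[OF f] by metis
  have C': "norm x ^ 2 * cmod (f x) \<le> C * (1 / (1 + norm x) ^ (CARD('d) + 2))" for x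
  proof -
    have "norm x ^ 2 * cmod (f x) \<le> (1 + norm x) ^ 2 * (C / (1 + norm x) ^ (CARD('d) + 4))"
      by (intro mult_mono C power_mono) auto
    also have "(1 + norm x) ^ (CARD('d) + 4) = (1 + norm x) ^ 2 * (1 + norm x) ^ (CARD('d) + 2)"
      using power_add[of "1 + norm x" 2 "CARD('d) + 2"] by (simp add: numeral_eq_Suc)
    also have "(1 + norm x) ^ 2 * (C / ((1 + norm x) ^ 2 * (1 + norm x) ^ (CARD('d) + 2))) = C * (1 / (1 + norm x) ^ (CARD('d) + 2))"
      using norm_ge_zero[of x] by (simp del: norm_ge_zero)
    finally show ?thesis .
  qed
  have intw: "integrable lborel (\<lambda>x::real^'d. C * (1 / (1 + norm x) ^ (CARD('d) + 2)))"
    using integrable_decay[where 'a="real^'d"] by (intro integrable_mult_right) simp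
  let ?K = "cmod ?c * (LINT x|lborel. C * (1 / (1 + norm (x::real^'d)) ^ (CARD('d) + 2)))"
  have main: "cmod (fourier f (\<xi> + h) - fourier f \<xi> - ?L h) \<le> ?K * norm h ^ 2" for h
  proof -
    have i1: "integrable lborel (\<lambda>x. cis (- (x \<bullet> (\<xi> + h))) * f x)" "integrable lborel (\<lambda>x. cis (- (x \<bullet> \<xi>)) * f x)"
      by (intro cis_minus_inner_integrable schwartz_integrable f)+
    have "integrable lborel (\<lambda>x. (\<Sum>i\<in>UNIV. of_real (h $ i) * (cis (- (x \<bullet> \<xi>)) * (- \<i> * (of_real (x $ i) * f x)))))"
      using int by (intro Bochner_Integration.integrable_sum integrable_mult_right)
    also have "(\<lambda>x. (\<Sum>i\<in>UNIV. of_real (h $ i) * (cis (- (x \<bullet> \<xi>)) * (- \<i> * (of_real (x $ i) * f x)))))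
       = (\<lambda>x. cis (- (x \<bullet> \<xi>)) * (- \<i> * of_real (x \<bullet> h)) * f x)"
      by (simp add: inner_vec_def sum_distrib_left sum_distrib_right sum_negf ac_simps)
    finally have i2: "integrable lborel (\<lambda>x. cis (- (x \<bullet> \<xi>)) * (- \<i> * of_real (x \<bullet> h)) * f x)" .
    have "fourier f (\<xi> + h) - fourier f \<xi> - ?L h = ?c * ((LINT x|lborel. cis (- (x \<bullet> (\<xi> + h))) * f x)
        - (LINT x|lborel. cis (- (x \<bullet> \<xi>)) * f x) - (LINT x|lborel. cis (- (x \<bullet> \<xi>)) * (- \<i> * of_real (x \<bullet> h)) * f x))"
      unfolding L unfolding fourier_def by (simp add: algebra_simps)
    also have "\<dots> = ?c * (LINT x|lborel. cis (- (x \<bullet> (\<xi> + h))) * f x - cis (- (x \<bullet> \<xi>)) * f x - cis (- (x \<bullet> \<xi>)) * (- \<i> * of_real (x \<bullet> h)) * f x)"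
      using i1 i2 by simp
    also have "cmod \<dots> \<le> cmod ?c * (LINT x|lborel. norm h ^ 2 * (C * (1 / (1 + norm (x::real^'d)) ^ (CARD('d) + 2))))"
      unfolding norm_mult
    proof (intro mult_left_mono)
     show "cmod (LINT x|lborel. cis (- (x \<bullet> (\<xi> + h))) * f x - cis (- (x \<bullet> \<xi>)) * f x - cis (- (x \<bullet> \<xi>)) * (- \<i> * of_real (x \<bullet> h)) * f x)
       \<le> (LINT x|lborel. norm h ^ 2 * (C * (1 / (1 + norm (x::real^'d)) ^ (CARD('d) + 2))))"
     proof (rule order_trans[OF integral_norm_bound Bochner_Integration.integral_mono])
      show "integrable lborel (\<lambda>x. cmod (cis (- (x \<bullet> (\<xi> + h))) * f x - cis (- (x \<bullet> \<xi>)) * f x - cis (- (x \<bullet> \<xi>)) * (- \<i> * of_real (x \<bullet> h)) * f x))"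
        using i1 i2 by (intro integrable_norm Bochner_Integration.integrable_diff)
      show "integrable lborel (\<lambda>x::real^'d. norm h ^ 2 * (C * (1 / (1 + norm x) ^ (CARD('d) + 2))))"
        by (intro integrable_mult_right intw)
      fix x
      have "cis (- (x \<bullet> (\<xi> + h))) * f x - cis (- (x \<bullet> \<xi>)) * f x - cis (- (x \<bullet> \<xi>)) * (- \<i> * of_real (x \<bullet> h)) * f x
         = cis (- (x \<bullet> \<xi>)) * (exp (- \<i> * of_real (x \<bullet> h)) - (1 - \<i> * of_real (x \<bullet> h))) * f x"
      proof -
        have "cis (- (x \<bullet> (\<xi> + h))) = cis (- (x \<bullet> \<xi>)) * cis (- (x \<bullet> h))"
          by (simp add: inner_add_right cis_mult)
        moreover have "cis (- (x \<bullet> h)) = exp (- \<i> * of_real (x \<bullet> h))"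
          by (simp add: cis_conv_exp)
        ultimately show ?thesis by (simp add: algebra_simps)
      qed
      also have "cmod \<dots> \<le> norm (x \<bullet> h) ^ 2 * cmod (f x)"
        using Taylor_exp[of "- \<i> * of_real (x \<bullet> h)" 1]
        by (auto simp: norm_mult power2_eq_square intro!: mult_right_mono)
      also have "\<dots> \<le> (norm x * norm h) ^ 2 * cmod (f x)"
        using Cauchy_Schwarz_ineq2[of x h] by (intro mult_right_mono power_mono) auto
      also have "\<dots> = norm h ^ 2 * (norm x ^ 2 * cmod (f x))" by (simp add: power_mult_distrib)
      also have "\<dots> \<le> norm h ^ 2 * (C * (1 / (1 + norm x) ^ (CARD('d) + 2)))"
        by (intro mult_left_mono C') auto
      finally show "cmod (cis (- (x \<bullet> (\<xi> + h))) * f x - cis (- (x \<bullet> \<xi>)) * f x - cis (- (x \<bullet> \<xi>)) * (- \<i> * of_real (x \<bullet> h)) * f x)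
         \<le> norm h ^ 2 * (C * (1 / (1 + norm x) ^ (CARD('d) + 2)))" .
     qed
    qed simp
    finally show ?thesis by (simp only: integral_mult_right_zero integral_mult_left_zero mult.assoc mult.commute[of "norm h ^ 2"])
  qed
  have K: "?K \<ge> 0"
    using C(1) by (intro mult_nonneg_nonneg Bochner_Integration.integral_nonneg) auto
  have "bounded_linear ?L"
    by (intro bounded_linear_sum bounded_linear_compose[OF bounded_linear_scaleR_left] bounded_linear_vec_nth)
  moreover have "\<exists>d>0. \<forall>y. norm (y - \<xi>) < d \<longrightarrow> cmod (fourier f y - fourier f \<xi> - ?L (y - \<xi>)) \<le> e * norm (y - \<xi>)"
    if "e > 0" for e
  proof (intro exI conjI allI impI)
    show "e / (?K + 1) > 0" using that K by simp
    fix y assume y: "norm (y - \<xi>) < e / (?K + 1)"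
    have "cmod (fourier f y - fourier f \<xi> - ?L (y - \<xi>)) \<le> ?K * norm (y - \<xi>) * norm (y - \<xi>)"
      using main[of "y - \<xi>"] by (simp add: power2_eq_square mult.assoc)
    also have "\<dots> \<le> e * norm (y - \<xi>)"
    proof (intro mult_right_mono)
      have "?K * norm (y - \<xi>) \<le> (?K + 1) * norm (y - \<xi>)" by (simp add: mult_right_mono)
      also have "\<dots> \<le> e" using y K by (simp add: field_simps)
      finally show "?K * norm (y - \<xi>) \<le> e" .
    qed simp
    finally show "cmod (fourier f y - fourier f \<xi> - ?L (y - \<xi>)) \<le> e * norm (y - \<xi>)" .
  qed
  ultimately show ?thesis by (simp add: has_derivative_at_alt)
qed

text \<open>The image of \<open>schwartz\<close> under the transform is itself an invariant set,
  since a derivative of a transform is the transform of a coordinate multiple. Decay follows by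
  induction on the order, each further power of the weight being traded for one derivative of the
  original function.\<close>

lemma schwartz_fourier:
  fixes f :: "real^'d::finite \<Rightarrow> complex"
  assumes "f \<in> schwartz"
  shows "fourier f \<in> schwartz"
proof (rule schwartz_coinduct[of _ "fourier ` schwartz"])
  show "fourier f \<in> fourier ` schwartz" using assms by simp
next
  fix h :: "real^'d \<Rightarrow> complex" and x
  assume "h \<in> fourier ` schwartz"
  then show "h differentiable (at x)" using differentiableI[OF fourier_has_derivative] by auto
next
  fix h :: "real^'d \<Rightarrow> complex" and i
  assume "h \<in> fourier ` schwartz"
  then obtain g where g: "h = fourier g" "g \<in> schwartz" by auto
  have "partial_deriv i h = fourier (\<lambda>x. - \<i> * (of_real (x $ i) * g x))"
    unfolding g(1)
    by (rule ext, subst partial_deriv_eq[OF fourier_has_derivative[OF g(2)]])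
      (simp add: axis_def if_distrib[of "\<lambda>x. x *\<^sub>R _"] cong: if_cong)
  then show "partial_deriv i h \<in> fourier ` schwartz"
    using schwartz_cmult[OF schwartz_coord_mult[OF g(2)]] by blast
next
  fix h :: "real^'d \<Rightarrow> complex" and N
  have "g \<in> schwartz \<Longrightarrow> \<exists>C. \<forall>x. (1 + norm x) ^ N * cmod (fourier g x) \<le> C" for g :: "real^'d \<Rightarrow> complex"
  proof (induction N arbitrary: g)
    case 0
    then show ?case using fourier_bound[OF schwartz_integrable[OF 0]] by auto
  next
    case (Suc N)
    obtain C where C: "\<And>x. (1 + norm x) ^ N * cmod (fourier g x) \<le> C" using Suc by metis
    have "\<exists>C. \<forall>x. (1 + norm x) ^ N * cmod (fourier (partial_deriv i g) x) \<le> C" for i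
      using Suc.IH[OF schwartz_partial[OF Suc.prems]] .
    then obtain B where B: "\<And>i x. (1 + norm x) ^ N * cmod (fourier (partial_deriv i g) x) \<le> B i" by metis
    have "(1 + norm x) ^ Suc N * cmod (fourier g x) \<le> C + (\<Sum>i\<in>UNIV. B i)" for x
    proof -
      have "(1 + norm x) * cmod (fourier g x) \<le> (1 + (\<Sum>i\<in>UNIV. \<bar>x $ i\<bar>)) * cmod (fourier g x)"
        by (intro mult_right_mono add_left_mono norm_le_l1_cart) auto
      also have "\<dots> = cmod (fourier g x) + (\<Sum>i\<in>UNIV. cmod (fourier (partial_deriv i g) x))"
        by (simp add: fourier_partial_deriv[OF Suc.prems] norm_mult distrib_right sum_distrib_right)
      finally have "(1 + norm x) ^ N * ((1 + norm x) * cmod (fourier g x))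
          \<le> (1 + norm x) ^ N * (cmod (fourier g x) + (\<Sum>i\<in>UNIV. cmod (fourier (partial_deriv i g) x)))"
        by (intro mult_left_mono) auto
      also have "\<dots> = (1 + norm x) ^ N * cmod (fourier g x) + (\<Sum>i\<in>UNIV. (1 + norm x) ^ N * cmod (fourier (partial_deriv i g) x))"
        by (simp add: distrib_left sum_distrib_left)
      also have "\<dots> \<le> C + (\<Sum>i\<in>UNIV. B i)" by (intro add_mono sum_mono C B)
      finally show ?thesis by (simp add: ac_simps)
    qed
    then show ?case by blast
  qed
  moreover assume "h \<in> fourier ` schwartz"
  ultimately show "\<exists>C. \<forall>x. (1 + norm x) ^ N * cmod (h x) \<le> C" by auto
qed

lemma schwartz_inv_fourier: "f \<in> schwartz \<Longrightarrow> inv_fourier f \<in> schwartz"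
  using schwartz_affine[OF schwartz_fourier, of f "-1" 0] by (simp add: inv_fourier_eq[abs_def])


lemma schwartz_dilate: "f \<in> schwartz \<Longrightarrow> s \<noteq> 0 \<Longrightarrow> (\<lambda>x. f (s *\<^sub>R x)) \<in> schwartz"
  using schwartz_affine[of f s 0] by simp

lemma schwartz_shift: "f \<in> schwartz \<Longrightarrow> (\<lambda>x. f (x + y)) \<in> schwartz"
  using schwartz_affine[of f 1 y] by (simp add: add.commute)

text \<open>A multiplier dilated by s acts on f as an average of the values at x + s z against the
  fixed kernel \<open>fourier \<rho>\<close>. Letting s tend to 0 gives Fourier inversion; keeping s
  at most 1 gives decay bounds uniform in the scale.\<close>

lemma inv_fourier_dilate_mult:
  fixes f \<rho> :: "real^'d::finite \<Rightarrow> complex"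
  assumes f: "f \<in> schwartz" and \<rho>: "\<rho> \<in> schwartz" and s: "s > 0"
  shows "inv_fourier (\<lambda>\<xi>. \<rho> (s *\<^sub>R \<xi>) * fourier f \<xi>) x
    = fourier_const TYPE('d) * (LINT z|lborel. fourier \<rho> z * f (x + s *\<^sub>R z))"
proof -
  note [measurable] = schwartz_measurable[OF f] schwartz_measurable[OF \<rho>]
    schwartz_measurable[OF schwartz_fourier[OF \<rho>]] schwartz_measurable[OF schwartz_fourier[OF f]]
  let ?g = "\<lambda>\<xi>. cis (\<xi> \<bullet> x) * \<rho> (s *\<^sub>R \<xi>)"
  have g: "?g \<in> schwartz" using s by (intro schwartz_cis_mult schwartz_dilate \<rho>) simp
  have "(LINT \<xi>|lborel. cis (x \<bullet> \<xi>) * (\<rho> (s *\<^sub>R \<xi>) * fourier f \<xi>)) = (LINT \<xi>|lborel. fourier f \<xi> * ?g \<xi>)"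
    by (simp add: inner_commute ac_simps)
  also have "\<dots> = (LINT y|lborel. f y * fourier ?g y)"
    by (intro fourier_swap schwartz_integrable f g)
  also have "\<dots> = (LINT y|lborel. f y * fourier (\<lambda>\<xi>. \<rho> (s *\<^sub>R \<xi>)) (y - x))"
    by (simp add: fourier_modulate)
  also have "\<dots> = s ^ CARD('d) *\<^sub>R (LINT z|lborel. f (x + s *\<^sub>R z) * fourier (\<lambda>\<xi>. \<rho> (s *\<^sub>R \<xi>)) (x + s *\<^sub>R z - x))"
    using s schwartz_measurable[OF schwartz_fourier[OF schwartz_dilate[OF \<rho>, of s]]]
    by (subst integral_affine[of _ s x]) simp_all
  also have "\<dots> = (LINT z|lborel. fourier \<rho> z * f (x + s *\<^sub>R z))"
  proof -
    have eq: "fourier (\<lambda>\<xi>. \<rho> (s *\<^sub>R \<xi>)) (x + s *\<^sub>R z - x) = of_real (1 / s ^ CARD('d)) * fourier \<rho> z" for z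
      using fourier_dilate[of \<rho> s z] s by simp
    have "(LINT z|lborel. f (x + s *\<^sub>R z) * fourier (\<lambda>\<xi>. \<rho> (s *\<^sub>R \<xi>)) (x + s *\<^sub>R z - x))
        = of_real (1 / s ^ CARD('d)) * (LINT z|lborel. fourier \<rho> z * f (x + s *\<^sub>R z))"
      unfolding eq by (subst integral_mult_right_zero[symmetric]) (simp add: ac_simps)
    then show ?thesis using s by (simp only: scaleR_conv_of_real) simp
  qed
  finally show ?thesis by (simp add: inv_fourier_def)
qed

lemma schwartz_zero_of_L2:
  assumes f: "f \<in> schwartz" and 0: "(LINT x|lborel. f x * cnj (f x)) = 0"
  shows "f x = 0"
proof -
  have [measurable]: "f \<in> borel_measurable borel" by (rule schwartz_measurable[OF f])
  from 0 have "(LINT x|lborel. of_real ((cmod (f x))\<^sup>2)) = (0::complex)"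
    by (simp only: complex_norm_square)
  then have "(LINT x|lborel. (cmod (f x))\<^sup>2) = 0"
    by (simp only: integral_complex_of_real of_real_eq_0_iff)
  moreover have "integrable lborel (\<lambda>x. (cmod (f x))\<^sup>2)"
    using integrable_norm[OF schwartz_mult_integrable[OF f f]]
    by (simp add: norm_mult power2_eq_square)
  ultimately have "AE x in lborel. (cmod (f x))\<^sup>2 = 0"
    by (subst (asm) integral_nonneg_eq_0_iff_AE) auto
  then have ae: "AE x in lborel. f x = 0" by simp
  have "open {x. f x \<noteq> 0}"
    using schwartz_continuous[OF f, of UNIV]
    by (intro open_Collect_neq continuous_on_const)
  moreover have "{x. f x \<noteq> 0} \<in> null_sets lborel"
    using ae \<open>open _\<close> by (subst AE_iff_null_sets) (auto simp: borel_open)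
  ultimately have "{x. f x \<noteq> 0} = {}"
    using open_not_negligible null_sets_completionI by (auto simp: negligible_iff_null_sets)
  then show ?thesis by blast
qed

text \<open>Testing against dilates of an arbitrary Schwartz function instead of Gaussians avoids
  computing any explicit transform; the price is an unspecified constant \<open>\<kappa>\<close>.\<close>

lemma fourier_inversion:
  fixes \<rho> :: "real^'d::finite \<Rightarrow> complex"
  assumes \<rho>: "\<rho> \<in> schwartz" and \<rho>0: "\<rho> 0 = 1"
  obtains \<kappa> where "\<kappa> \<noteq> 0" "\<And>f x. f \<in> schwartz \<Longrightarrow> inv_fourier (fourier f) (x :: real^'d) = \<kappa> * f x"
proof -
  let ?c = "fourier_const TYPE('d)"
  note [measurable] = schwartz_measurable[OF \<rho>] schwartz_measurable[OF schwartz_fourier[OF \<rho>]]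
  define s where "s n = inverse (real (Suc n))" for n
  have s: "0 < s n" for n by (auto simp: s_def field_simps)
  have s0: "s \<longlonglongrightarrow> 0" unfolding s_def by (rule LIMSEQ_inverse_real_of_nat)
  have s0': "(\<lambda>n. s n *\<^sub>R z) \<longlonglongrightarrow> 0" for z :: "real^'d"
    using tendsto_scaleR[OF s0 tendsto_const[of z]] by simp
  define \<kappa> where "\<kappa> = ?c * (LINT z|lborel. fourier \<rho> z)"
  have inv: "inv_fourier (fourier f) x = \<kappa> * f x" if f: "f \<in> schwartz" for f and x :: "real^'d"
  proof (rule LIMSEQ_unique)
    note [measurable] = schwartz_measurable[OF f] schwartz_measurable[OF schwartz_fourier[OF f]]
    have cont: "isCont g y" if "g \<in> schwartz" for g and y :: "real^'d"
      using schwartz_continuous[OF that, of UNIV] by (simp add: continuous_on_eq_continuous_at)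
    obtain K where K: "K > 0" "\<And>x. cmod (\<rho> x) \<le> K" using schwartz_bounded[OF \<rho>] by metis
    obtain L where L: "L > 0" "\<And>x. cmod (f x) \<le> L" using schwartz_bounded[OF f] by metis
    show "(\<lambda>n. inv_fourier (\<lambda>\<xi>. \<rho> (s n *\<^sub>R \<xi>) * fourier f \<xi>) x) \<longlonglongrightarrow> inv_fourier (fourier f) x"
      unfolding inv_fourier_def
    proof (intro tendsto_mult tendsto_const integral_dominated_convergence)
      show "integrable lborel (\<lambda>\<xi>. K * cmod (fourier f \<xi>))"
        by (intro integrable_mult_right integrable_norm schwartz_integrable schwartz_fourier f)
      have "(\<lambda>n. \<rho> (s n *\<^sub>R \<xi>)) \<longlonglongrightarrow> 1" for \<xi>
        using isCont_tendsto_compose[OF cont[OF \<rho>] s0'] \<rho>0 by simp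
      then have "(\<lambda>n. cis (x \<bullet> \<xi>) * (\<rho> (s n *\<^sub>R \<xi>) * fourier f \<xi>)) \<longlonglongrightarrow> cis (x \<bullet> \<xi>) * (1 * fourier f \<xi>)" for \<xi>
        by (intro tendsto_mult tendsto_const)
      then show "AE \<xi> in lborel. (\<lambda>n. cis (x \<bullet> \<xi>) * (\<rho> (s n *\<^sub>R \<xi>) * fourier f \<xi>)) \<longlonglongrightarrow> cis (x \<bullet> \<xi>) * fourier f \<xi>"
        by simp
      show "AE \<xi> in lborel. norm (cis (x \<bullet> \<xi>) * (\<rho> (s n *\<^sub>R \<xi>) * fourier f \<xi>)) \<le> K * cmod (fourier f \<xi>)" for n
        using K(2) by (auto simp: norm_mult intro!: mult_right_mono)
    qed measurable
    have "(\<lambda>n. ?c * (LINT z|lborel. fourier \<rho> z * f (x + s n *\<^sub>R z))) \<longlonglongrightarrow> ?c * (LINT z|lborel. fourier \<rho> z * f x)"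
    proof (intro tendsto_mult tendsto_const integral_dominated_convergence)
      show "integrable lborel (\<lambda>z. cmod (fourier \<rho> z) * L)"
        by (intro integrable_mult_left integrable_norm schwartz_integrable schwartz_fourier \<rho>)
      have "(\<lambda>n. x + s n *\<^sub>R z) \<longlonglongrightarrow> x" for z
        using tendsto_add[OF tendsto_const s0', of x z] by simp
      then have "(\<lambda>n. fourier \<rho> z * f (x + s n *\<^sub>R z)) \<longlonglongrightarrow> fourier \<rho> z * f x" for z
        by (intro tendsto_mult tendsto_const isCont_tendsto_compose[OF cont[OF f]])
      then show "AE z in lborel. (\<lambda>n. fourier \<rho> z * f (x + s n *\<^sub>R z)) \<longlonglongrightarrow> fourier \<rho> z * f x"
        by simp
      show "AE z in lborel. norm (fourier \<rho> z * f (x + s n *\<^sub>R z)) \<le> cmod (fourier \<rho> z) * L" for n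
        using L(2) by (auto simp: norm_mult intro!: mult_left_mono)
    qed measurable
    then show "(\<lambda>n. inv_fourier (\<lambda>\<xi>. \<rho> (s n *\<^sub>R \<xi>) * fourier f \<xi>) x) \<longlonglongrightarrow> \<kappa> * f x"
      using s by (simp only: inv_fourier_dilate_mult[OF f \<rho>] \<kappa>_def integral_mult_left_zero mult.assoc)
  qed
  \<comment> \<open>If the constant vanished, pairing the transform of |\<rho>|^2 with itself would
    give 0, so that transform would be zero. Its value at the origin is a multiple of the integral
    of |\<rho>|^2, which would contradict \<open>\<rho> 0 = 1\<close>.\<close>
  have "\<kappa> \<noteq> 0"
  proof
    assume "\<kappa> = 0"
    then have 0: "inv_fourier (fourier f) x = 0" if "f \<in> schwartz" for f and x :: "real^'d"
      using inv[OF that] by simp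
    let ?q = "\<lambda>x. \<rho> x * cnj (\<rho> x)"
    have q: "?q \<in> schwartz" by (intro schwartz_mult schwartz_cnj \<rho>)
    have "(LINT \<xi>|lborel. fourier ?q \<xi> * cnj (fourier ?q \<xi>)) = (LINT \<xi>|lborel. fourier ?q \<xi> * inv_fourier (\<lambda>x. cnj (?q x)) \<xi>)"
      by (simp only: inv_fourier_cnj)
    also have "\<dots> = (LINT \<xi>|lborel. inv_fourier (fourier ?q) \<xi> * cnj (?q \<xi>))"
      by (intro inv_fourier_swap[symmetric] schwartz_integrable schwartz_fourier schwartz_cnj q)
    also have "\<dots> = 0" using 0[OF q] by simp
    finally have "fourier ?q 0 = 0" by (rule schwartz_zero_of_L2[OF schwartz_fourier[OF q]])
    then have "(LINT x|lborel. ?q x) = 0" by (simp add: fourier_def)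
    from schwartz_zero_of_L2[OF \<rho> this, of 0] \<rho>0 show False by simp
  qed
  with inv show ?thesis by (rule that[rotated])
qed

lemma parseval:
  assumes "f \<in> schwartz" "g \<in> schwartz" and inv: "\<And>x. inv_fourier (fourier f) x = \<kappa> * f x"
  shows "(LINT \<xi>|lborel. fourier f \<xi> * cnj (fourier g \<xi>)) = \<kappa> * (LINT x|lborel. f x * cnj (g x))"
proof -
  have "(LINT \<xi>|lborel. fourier f \<xi> * cnj (fourier g \<xi>)) = (LINT \<xi>|lborel. fourier f \<xi> * inv_fourier (\<lambda>x. cnj (g x)) \<xi>)"
    by (simp only: inv_fourier_cnj)
  also have "\<dots> = (LINT \<xi>|lborel. inv_fourier (fourier f) \<xi> * cnj (g \<xi>))"
    by (intro inv_fourier_swap[symmetric] schwartz_integrable schwartz_fourier schwartz_cnj assms)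
  also have "\<dots> = \<kappa> * (LINT x|lborel. f x * cnj (g x))"
    by (simp add: inv mult.assoc)
  finally show ?thesis .
qed

section \<open>Extended quasi-norms\<close>

lemma epowr_ennreal [simp]: "0 \<le> x \<Longrightarrow> epowr (ennreal x) a = ennreal (x powr a)"
  by (simp add: epowr_def)

lemma epowr_top [simp]: "epowr top a = top"
  by (simp add: epowr_def)

lemma epowr_0 [simp]: "epowr 0 a = 0"
  by (simp add: epowr_def)

lemma epowr_1 [simp]: "epowr 1 a = 1"
  by (simp add: epowr_def)

lemma epowr_one [simp]: "epowr x 1 = x"
  by (cases x) (auto simp: epowr_def)

lemma epowr_mono: "x \<le> y \<Longrightarrow> 0 \<le> a \<Longrightarrow> epowr x a \<le> epowr y a"
  by (cases x; cases y) (auto simp: powr_mono2 top_unique)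

lemma epowr_mult: "0 < a \<Longrightarrow> epowr (x * y) a = epowr x a * epowr y a"
proof (cases x; cases y)
  fix r s assume "x = ennreal r" "0 \<le> r" "y = ennreal s" "0 \<le> s"
  then show ?thesis by (simp add: powr_mult flip: ennreal_mult)
next
  fix r assume "x = ennreal r" "0 \<le> r" "y = top" "0 < a"
  then show ?thesis by (cases "r = 0") (auto simp: ennreal_mult_top)
next
  fix s assume "y = ennreal s" "0 \<le> s" "x = top" "0 < a"
  then show ?thesis by (cases "s = 0") (auto simp: ennreal_top_mult)
qed (auto simp: ennreal_top_mult)

lemma epowr_epowr: "epowr (epowr x a) b = epowr x (a * b)"
  by (cases x) (auto simp: powr_powr)

lemma epowr_eq_0_iff [simp]: "epowr x a = 0 \<longleftrightarrow> x = 0"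
  by (cases x) auto

lemma epowr_eq_top_iff [simp]: "epowr x a = top \<longleftrightarrow> x = top"
  by (cases x) auto

lemma epowr_less_top_iff [simp]: "epowr x a < top \<longleftrightarrow> x < top"
  by (metis epowr_eq_top_iff less_top)

lemma epowr_add: "epowr x (a + b) = epowr x a * epowr x b"
  by (cases x) (auto simp: powr_add ennreal_mult)

lemma measurable_epowr [measurable]:
  "f \<in> borel_measurable M \<Longrightarrow> (\<lambda>x. epowr (f x) a) \<in> borel_measurable M"
  using measurable_sets[of f M borel "{top}"]
  unfolding epowr_def by (intro measurable_If) (auto simp: vimage_def Int_def conj_commute)

lemma epowr_max_le: "epowr (max x y) a \<le> epowr x a + epowr y a"
  by (simp add: max_def)

lemma epowr_add_le:
  assumes "0 < a"
  shows "epowr (x + y) a \<le> ennreal (2 powr a) * (epowr x a + epowr y a)"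
proof -
  have "x + y \<le> max x y + max x y" by (intro add_mono) auto
  also have "\<dots> = 2 * max x y" by (simp add: mult_2)
  finally have "epowr (x + y) a \<le> epowr (2 * max x y) a"
    using assms by (intro epowr_mono) auto
  also have "\<dots> = ennreal (2 powr a) * epowr (max x y) a"
    using assms epowr_ennreal[of 2 a] by (simp add: epowr_mult)
  also have "\<dots> \<le> ennreal (2 powr a) * (epowr x a + epowr y a)"
    by (intro mult_left_mono epowr_max_le) auto
  finally show ?thesis .
qed

lemma epowr_root_le: "0 < a \<Longrightarrow> epowr x a \<le> y \<Longrightarrow> x \<le> epowr y (1 / a)"
  using epowr_mono[of "epowr x a" y "1 / a"] by (simp add: epowr_epowr)

lemma epowr_root_ge: "0 < a \<Longrightarrow> x \<le> epowr y a \<Longrightarrow> epowr x (1 / a) \<le> y"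
  using epowr_mono[of x "epowr y a" "1 / a"] by (simp add: epowr_epowr)

lemma nn_integral_Hoelder:
  fixes f g :: "'a \<Rightarrow> ennreal"
  assumes [measurable]: "f \<in> borel_measurable M" "g \<in> borel_measurable M"
    and p: "1 < p" "1 < p'" "1 / p + 1 / p' = 1"
  shows "(\<integral>\<^sup>+x. f x * g x \<partial>M)
    \<le> epowr (\<integral>\<^sup>+x. epowr (f x) p \<partial>M) (1 / p) * epowr (\<integral>\<^sup>+x. epowr (g x) p' \<partial>M) (1 / p')"
proof -
  let ?A = "\<integral>\<^sup>+x. epowr (f x) p \<partial>M" and ?B = "\<integral>\<^sup>+x. epowr (g x) p' \<partial>M"
  consider "?A = 0 \<or> ?B = 0" | "?A \<noteq> 0" "?B \<noteq> 0" "?A = top \<or> ?B = top"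
    | "?A \<noteq> 0" "?B \<noteq> 0" "?A \<noteq> top" "?B \<noteq> top" by blast
  then show ?thesis
  proof cases
    case 1
    then have "AE x in M. f x = 0 \<or> g x = 0"
      by (auto simp: nn_integral_0_iff_AE)
    then have "(\<integral>\<^sup>+x. f x * g x \<partial>M) = 0"
      by (subst nn_integral_0_iff_AE) auto
    then show ?thesis by simp
  next
    case 2
    then show ?thesis by (auto simp: ennreal_mult_top ennreal_top_mult)
  next
    case 3
    obtain A where A: "?A = ennreal A" "A > 0" using 3 by (cases ?A) (auto simp: less_le)
    obtain B where B: "?B = ennreal B" "B > 0" using 3 by (cases ?B) (auto simp: less_le)
    \<comment> \<open>Young's inequality is applied to the two factors divided by their norms, which
      are positive and finite in this case; \<open>?K\<close> is the product of the norms and undoes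
      the normalisation.\<close>
    let ?K = "A powr (1 / p) * B powr (1 / p')"
    have young: "a * b \<le> ennreal (?K / (p * A)) * epowr a p + ennreal (?K / (p' * B)) * epowr b p'" for a b
    proof (cases "a = top \<or> b = top")
      case True
      have "?K / (p * A) > 0" "?K / (p' * B) > 0" using A B p by auto
      with True show ?thesis by (auto simp: ennreal_mult_top)
    next
      case False
      then obtain r s where rs: "a = ennreal r" "b = ennreal s" "r \<ge> 0" "s \<ge> 0"
        by (cases a; cases b) auto
      let ?u = "r / A powr (1 / p)" and ?v = "s / B powr (1 / p')"
      have "?u * ?v \<le> ?u powr p / p + ?v powr p' / p'"
        using p rs by (intro Youngs_inequality) auto
      also have "?u powr p = r powr p / A" using A p rs by (simp add: powr_divide powr_powr)
      also have "?v powr p' = s powr p' / B" using B p rs by (simp add: powr_divide powr_powr)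
      finally have "?K * (?u * ?v) \<le> ?K * (r powr p / A / p + s powr p' / B / p')"
        using A B by (intro mult_left_mono) auto
      moreover have "?K * (?u * ?v) = r * s" using A B by simp
      moreover have "?K * (r powr p / A / p + s powr p' / B / p')
          = ?K / (p * A) * r powr p + ?K / (p' * B) * s powr p'"
        by (simp add: distrib_left ac_simps)
      ultimately have "r * s \<le> ?K / (p * A) * r powr p + ?K / (p' * B) * s powr p'" by simp
      then show ?thesis
        using rs A B p by (simp flip: ennreal_mult ennreal_plus) 
    qed
    have "(\<integral>\<^sup>+x. f x * g x \<partial>M) \<le> (\<integral>\<^sup>+x. ennreal (?K / (p * A)) * epowr (f x) p + ennreal (?K / (p' * B)) * epowr (g x) p' \<partial>M)"
      by (intro nn_integral_mono young)
    also have "\<dots> = ennreal (?K / (p * A)) * ennreal A + ennreal (?K / (p' * B)) * ennreal B"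
      by (simp add: nn_integral_add nn_integral_cmult A B)
    also have "\<dots> = ennreal (?K * (1 / p + 1 / p'))"
      using A(2) B(2) p(1,2) by (simp flip: ennreal_mult ennreal_plus add: distrib_left)
    also have "?K * (1 / p + 1 / p') = ?K" using p by simp
    also have "ennreal ?K = epowr ?A (1 / p) * epowr ?B (1 / p')"
      using A B by (simp add: ennreal_mult)
    finally show ?thesis .
  qed
qed

lemma epowr_Lp_norm: "0 < p \<Longrightarrow> epowr (Lp_norm p f) p = (\<integral>\<^sup>+x. epowr (f x) p \<partial>lborel)"
  by (simp add: Lp_norm_def epowr_epowr)

lemma Lp_norm_mono_AE:
  assumes "AE x in lborel. f x \<le> g x" "0 < p"
  shows "Lp_norm p f \<le> Lp_norm p g"
  unfolding Lp_norm_def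
  using assms by (intro epowr_mono nn_integral_mono_AE) (auto elim!: eventually_mono intro: epowr_mono)

lemma Lp_norm_mono: "(\<And>x. f x \<le> g x) \<Longrightarrow> 0 < p \<Longrightarrow> Lp_norm p f \<le> Lp_norm p g"
  by (rule Lp_norm_mono_AE) auto

lemma Lp_norm_cong_AE: "AE x in lborel. f x = g x \<Longrightarrow> Lp_norm p f = Lp_norm p g"
  unfolding Lp_norm_def by (subst nn_integral_cong_AE[of "\<lambda>x. epowr (f x) p" "\<lambda>x. epowr (g x) p"]) auto

lemma Lp_norm_cmult:
  assumes [measurable]: "f \<in> borel_measurable borel" and "0 < p"
  shows "Lp_norm p (\<lambda>x. c * f x) = c * Lp_norm p f"
  using assms(2) by (simp add: Lp_norm_def epowr_mult nn_integral_cmult epowr_epowr)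

lemma Lp_norm_shift:
  assumes [measurable]: "f \<in> borel_measurable borel"
  shows "Lp_norm p (\<lambda>x. f (x + h)) = Lp_norm p f"
  unfolding Lp_norm_def by (subst nn_integral_shift[of "\<lambda>x. epowr (f x) p"]) auto

lemma Lp_norm_add:
  assumes [measurable]: "f \<in> borel_measurable borel" "g \<in> borel_measurable borel" and p: "0 < p"
  shows "Lp_norm p (\<lambda>x. f x + g x) \<le> ennreal (4 powr (1 + 1 / p)) * (Lp_norm p f + Lp_norm p g)"
proof -
  let ?F = "\<integral>\<^sup>+x. epowr (f x) p \<partial>lborel" and ?G = "\<integral>\<^sup>+x. epowr (g x) p \<partial>lborel"
  have "(\<integral>\<^sup>+x. epowr (f x + g x) p \<partial>lborel) \<le> (\<integral>\<^sup>+x. ennreal (2 powr p) * (epowr (f x) p + epowr (g x) p) \<partial>lborel)"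
    by (intro nn_integral_mono epowr_add_le p)
  also have "\<dots> = ennreal (2 powr p) * (?F + ?G)"
    by (simp add: nn_integral_cmult nn_integral_add)
  finally have "Lp_norm p (\<lambda>x. f x + g x) \<le> epowr (ennreal (2 powr p) * (?F + ?G)) (1 / p)"
    unfolding Lp_norm_def using p by (intro epowr_mono) auto
  also have "\<dots> = 2 * epowr (?F + ?G) (1 / p)"
    using p by (simp add: epowr_mult powr_powr)
  also have "\<dots> \<le> 2 * (ennreal (2 powr (1 / p)) * (epowr ?F (1 / p) + epowr ?G (1 / p)))"
    using p by (intro mult_left_mono epowr_add_le) auto
  also have "\<dots> = ennreal (2 * 2 powr (1 / p)) * (Lp_norm p f + Lp_norm p g)"
    by (simp add: Lp_norm_def ennreal_mult mult.assoc)
  also have "\<dots> \<le> ennreal (4 powr (1 + 1 / p)) * (Lp_norm p f + Lp_norm p g)"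
  proof (intro mult_right_mono ennreal_leI)
    have "2 * 2 powr (1 / p) = 2 powr (1 + 1 / p)" by (simp add: powr_add)
    also have "\<dots> \<le> 4 powr (1 + 1 / p)" using p by (intro powr_mono2) auto
    finally show "2 * 2 powr (1 / p) \<le> 4 powr (1 + 1 / p)" .
  qed simp
  finally show ?thesis .
qed

text \<open>Carries bounds on smooth partial sums over to a rough limit. The threshold
  \<open>n0\<close> serves differences from a fixed member of the sequence, which are bounded for
  later indices only.\<close>

lemma Lp_norm_Fatou:
  fixes f :: "nat \<Rightarrow> 'a::euclidean_space \<Rightarrow> complex"
  assumes [measurable]: "\<And>n. f n \<in> borel_measurable borel" and p: "0 < p"
    and lim: "AE x in lborel. (\<lambda>n. f n x) \<longlonglongrightarrow> g x"
    and bound: "\<And>n. n \<ge> n0 \<Longrightarrow> Lp_norm p (\<lambda>x. ennreal (cmod (f n x))) \<le> B"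
  shows "Lp_norm p (\<lambda>x. ennreal (cmod (g x))) \<le> B"
proof -
  have "AE x in lborel. epowr (ennreal (cmod (g x))) p = liminf (\<lambda>n. epowr (ennreal (cmod (f n x))) p)"
    using lim
  proof eventually_elim
    case (elim x)
    have "(\<lambda>n. ennreal (cmod (f n x) powr p)) \<longlonglongrightarrow> ennreal (cmod (g x) powr p)"
      using elim p by (intro tendsto_ennrealI tendsto_powr2 tendsto_norm tendsto_const) auto
    from lim_imp_Liminf[OF _ this] show ?case by simp
  qed
  then have "(\<integral>\<^sup>+x. epowr (ennreal (cmod (g x))) p \<partial>lborel) = (\<integral>\<^sup>+x. liminf (\<lambda>n. epowr (ennreal (cmod (f n x))) p) \<partial>lborel)"
    by (rule nn_integral_cong_AE)
  also have "\<dots> \<le> liminf (\<lambda>n. \<integral>\<^sup>+x. epowr (ennreal (cmod (f n x))) p \<partial>lborel)"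
    by (rule nn_integral_liminf) simp
  also have "\<dots> \<le> liminf (\<lambda>n. epowr B p)"
  proof (rule Liminf_mono)
    show "\<forall>\<^sub>F n in sequentially. (\<integral>\<^sup>+x. epowr (ennreal (cmod (f n x))) p \<partial>lborel) \<le> epowr B p"
      using eventually_ge_at_top[of n0]
    proof eventually_elim
      case (elim n)
      show ?case
        using epowr_mono[OF bound[OF elim], of p] p by (simp add: epowr_Lp_norm)
    qed
  qed
  also have "\<dots> = epowr B p" by (simp add: Liminf_const)
  finally show ?thesis
    using p epowr_mono[of _ "epowr B p" "1 / p"] by (simp add: Lp_norm_def epowr_epowr)
qed

lemma Lp_norm_Hoelder_pairing:
  fixes f g :: "'a::euclidean_space \<Rightarrow> complex"
  assumes [measurable]: "f \<in> borel_measurable borel" "g \<in> borel_measurable borel"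
    and p: "1 < p" "1 < p'" "1 / p + 1 / p' = 1"
  shows "ennreal (cmod (LINT x|lborel. f x * g x))
    \<le> Lp_norm p (\<lambda>x. ennreal (cmod (f x))) * Lp_norm p' (\<lambda>x. ennreal (cmod (g x)))"
proof -
  \<comment> \<open>A product that is not integrable has Bochner integral 0 by default, so the
    estimate survives in that case as well.\<close>
  have "ennreal (cmod (LINT x|lborel. f x * g x)) \<le> (\<integral>\<^sup>+x. ennreal (cmod (f x * g x)) \<partial>lborel)"
    by (cases "integrable lborel (\<lambda>x. f x * g x)")
      (auto simp: integral_norm_bound_ennreal not_integrable_integral_eq)
  also have "\<dots> = (\<integral>\<^sup>+x. ennreal (cmod (f x)) * ennreal (cmod (g x)) \<partial>lborel)"
    by (simp add: norm_mult ennreal_mult)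
  also have "\<dots> \<le> Lp_norm p (\<lambda>x. ennreal (cmod (f x))) * Lp_norm p' (\<lambda>x. ennreal (cmod (g x)))"
    unfolding Lp_norm_def by (intro nn_integral_Hoelder p) auto
  finally show ?thesis .
qed

section \<open>Weighted sequence spaces\<close>

lemma exponent_cases:
  fixes q :: ennreal
  assumes "0 < q"
  obtains "q = top" | t where "t > 0" "q = ennreal t" "q \<noteq> top" "enn2real q = t"
proof (cases q)
  case (real t)
  then show ?thesis using assms that(2)[of t] by auto
qed (use that in auto)

lemma lr_norm_ennreal:
  "0 < t \<Longrightarrow> lr_norm (ennreal t) a = epowr (\<Sum>j. epowr (a j) t) (1 / t)"
  by (simp add: lr_norm_def)

lemma lr_norm_top: "lr_norm top a = (SUP j. a j)"
  by (simp add: lr_norm_def)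

lemma lr_norm_mono:
  assumes "\<And>j. a j \<le> c j" "0 < q"
  shows "lr_norm q a \<le> lr_norm q c"
proof (cases rule: exponent_cases[OF assms(2)])
  case 1
  then show ?thesis using assms by (auto simp: lr_norm_def intro: SUP_mono')
next
  case (2 t)
  then show ?thesis using assms
    by (auto simp: lr_norm_def intro!: epowr_mono suminf_le)
qed

lemma lr_norm_cmult:
  assumes "0 < q"
  shows "lr_norm q (\<lambda>j. c * a j) = c * lr_norm q a"
proof (cases rule: exponent_cases[OF assms])
  case 1
  then show ?thesis by (simp add: lr_norm_def SUP_mult_left_ennreal)
next
  case (2 t)
  then show ?thesis by (simp add: lr_norm_def epowr_mult epowr_epowr)
qed

lemma lr_norm_ge:
  assumes "0 < q"
  shows "a j \<le> lr_norm q a"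
proof (cases rule: exponent_cases[OF assms])
  case 1
  then show ?thesis by (auto simp: lr_norm_def intro: SUP_upper)
next
  case (2 t)
  have "epowr (a j) t \<le> (\<Sum>j. epowr (a j) t)"
    using sum_le_suminf[of "\<lambda>j. epowr (a j) t" "{j}"] by simp
  with 2 show ?thesis by (auto simp: lr_norm_def intro: epowr_root_le)
qed

lemma lr_norm_add:
  assumes "0 < q"
  obtains K :: real where "K > 0" "\<And>a c. lr_norm q (\<lambda>j. a j + c j) \<le> ennreal K * (lr_norm q a + lr_norm q c)"
proof (cases rule: exponent_cases[OF assms])
  case 1
  have "lr_norm q (\<lambda>j. a j + c j) \<le> ennreal 1 * (lr_norm q a + lr_norm q c)" for a c
    unfolding 1 lr_norm_top by (auto intro!: SUP_least add_mono SUP_upper)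
  then show ?thesis using that[of 1] by simp
next
  case (2 t)
  have "lr_norm q (\<lambda>j. a j + c j) \<le> ennreal (2 * 2 powr (1 / t)) * (lr_norm q a + lr_norm q c)" for a c
  proof -
    let ?A = "\<Sum>j. epowr (a j) t" and ?C = "\<Sum>j. epowr (c j) t"
    have "(\<Sum>j. epowr (a j + c j) t) \<le> (\<Sum>j. ennreal (2 powr t) * (epowr (a j) t + epowr (c j) t))"
      using 2 by (intro suminf_le epowr_add_le) auto
    also have "\<dots> = ennreal (2 powr t) * (?A + ?C)"
      by (simp add: suminf_add[symmetric])
    finally have "lr_norm q (\<lambda>j. a j + c j) \<le> epowr (ennreal (2 powr t) * (?A + ?C)) (1 / t)"
      unfolding lr_norm_def using 2 by (auto intro!: epowr_mono)
    also have "\<dots> = 2 * epowr (?A + ?C) (1 / t)"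
      using 2 by (simp add: epowr_mult powr_powr)
    also have "\<dots> \<le> 2 * (ennreal (2 powr (1 / t)) * (epowr ?A (1 / t) + epowr ?C (1 / t)))"
      using 2 by (intro mult_left_mono epowr_add_le) auto
    also have "\<dots> = ennreal (2 * 2 powr (1 / t)) * (lr_norm q a + lr_norm q c)"
      using 2 by (simp add: lr_norm_def ennreal_mult mult.assoc)
    finally show ?thesis .
  qed
  then show ?thesis using that[of "2 * 2 powr (1 / t)"] by simp
qed

text \<open>No entry exceeds the norm with exponent r, so the surplus of the larger exponent over
  the smaller can be taken out of every term at the value of that norm.\<close>

lemma lr_norm_embed:
  assumes "0 < r" "r \<le> q"
  shows "lr_norm q a \<le> lr_norm r a"
proof -
  have q: "0 < q" using assms by simp
  show ?thesis
  proof (cases rule: exponent_cases[OF q])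
    case 1
    then show ?thesis using lr_norm_ge[OF assms(1)] by (auto simp: lr_norm_top intro: SUP_least)
  next
    case q: (2 t)
    have "r \<noteq> top" using le_less_trans[OF assms(2), of top] q(2) by auto
    define s where "s = enn2real r"
    have s: "r = ennreal s" "s > 0" "enn2real r = s"
      using assms(1) \<open>r \<noteq> top\<close> unfolding s_def by (cases r; simp)+
    have "s \<le> t" using q s assms by simp
    show ?thesis
    proof (cases "s = t \<or> lr_norm r a = top")
      case True
      then show ?thesis using q s by auto
    next
      case False
      let ?N = "lr_norm r a"
      have "epowr (a j) t \<le> epowr (a j) s * epowr ?N (t - s)" for j
      proof -
        have "epowr (a j) t = epowr (a j) s * epowr (a j) (t - s)"
          using epowr_add[of "a j" s "t - s"] by simp
        also have "\<dots> \<le> epowr (a j) s * epowr ?N (t - s)"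
          using False \<open>s \<le> t\<close> lr_norm_ge[OF assms(1)] by (intro mult_left_mono epowr_mono) auto
        finally show ?thesis .
      qed
      then have "(\<Sum>j. epowr (a j) t) \<le> (\<Sum>j. epowr (a j) s * epowr ?N (t - s))"
        by (intro suminf_le) auto
      also have "\<dots> = epowr ?N s * epowr ?N (t - s)"
        using s \<open>r \<noteq> top\<close> by (simp add: lr_norm_def epowr_epowr)
      also have "\<dots> = epowr ?N t" using epowr_add[of ?N s "t - s"] by simp
      finally have "epowr (\<Sum>j. epowr (a j) t) (1 / t) \<le> ?N"
        using q by (intro epowr_root_ge) auto
      then show ?thesis using q by (simp add: lr_norm_def)
    qed
  qed
qed

lemma suminf_ennreal_swap:
  fixes f :: "nat \<Rightarrow> nat \<Rightarrow> ennreal"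
  shows "(\<Sum>m. \<Sum>l. f m l) = (\<Sum>l. \<Sum>m. f m l)"
proof -
  have "(\<Sum>m. \<Sum>l. f m l) = (\<integral>\<^sup>+m. (\<Sum>l. f m l) \<partial>count_space UNIV)"
    by (simp add: nn_integral_count_space_nat)
  also have "\<dots> = (\<Sum>l. \<integral>\<^sup>+m. f m l \<partial>count_space UNIV)"
    by (rule nn_integral_suminf) simp
  finally show ?thesis by (simp add: nn_integral_count_space_nat)
qed

text \<open>With truncated subtraction \<open>(m - l) + (l - m)\<close> is the distance of m and l.
  The indices on either side of m contribute one geometric series each, whence the factor 2.\<close>

lemma suminf_geometric_distance:
  fixes \<sigma> :: real
  assumes "0 \<le> \<sigma>" "\<sigma> < 1"
  shows "(\<Sum>l. ennreal (\<sigma> ^ ((m - l) + (l - m)))) \<le> ennreal (2 / (1 - \<sigma>))"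
  unfolding suminf_eq_SUP
proof (rule SUP_least)
  fix n
  have geom: "(\<Sum>i\<in>J. \<sigma> ^ i) \<le> 1 / (1 - \<sigma>)" if "finite J" for J
    using sum_le_suminf[OF summable_geometric that, of \<sigma>] suminf_geometric[of \<sigma>] assms by simp
  have "(\<Sum>l<n. \<sigma> ^ ((m - l) + (l - m)))
      \<le> (\<Sum>l\<in>{..<n} \<inter> {..m}. \<sigma> ^ ((m - l) + (l - m))) + (\<Sum>l\<in>{..<n} \<inter> {m..}. \<sigma> ^ ((m - l) + (l - m)))"
  proof -
    have "(\<Sum>l<n. \<sigma> ^ ((m - l) + (l - m))) = (\<Sum>l\<in>({..<n} \<inter> {..m}) \<union> ({..<n} \<inter> {m<..}). \<sigma> ^ ((m - l) + (l - m)))"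
      by (rule sum.cong) auto
    also have "\<dots> = (\<Sum>l\<in>{..<n} \<inter> {..m}. \<sigma> ^ ((m - l) + (l - m))) + (\<Sum>l\<in>{..<n} \<inter> {m<..}. \<sigma> ^ ((m - l) + (l - m)))"
      by (rule sum.union_disjoint) auto
    also have "(\<Sum>l\<in>{..<n} \<inter> {m<..}. \<sigma> ^ ((m - l) + (l - m))) \<le> (\<Sum>l\<in>{..<n} \<inter> {m..}. \<sigma> ^ ((m - l) + (l - m)))"
      using assms by (intro sum_mono2) auto
    finally show ?thesis by simp
  qed
  also have "(\<Sum>l\<in>{..<n} \<inter> {..m}. \<sigma> ^ ((m - l) + (l - m))) = (\<Sum>i\<in>(\<lambda>l. m - l) ` ({..<n} \<inter> {..m}). \<sigma> ^ i)"
    by (subst sum.reindex) (auto simp: inj_on_def)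
  also have "\<dots> \<le> 1 / (1 - \<sigma>)" by (rule geom) simp
  also have "(\<Sum>l\<in>{..<n} \<inter> {m..}. \<sigma> ^ ((m - l) + (l - m))) = (\<Sum>i\<in>(\<lambda>l. l - m) ` ({..<n} \<inter> {m..}). \<sigma> ^ i)"
    by (subst sum.reindex) (auto simp: inj_on_def)
  also have "\<dots> \<le> 1 / (1 - \<sigma>)" by (rule geom) simp
  finally have "(\<Sum>l<n. \<sigma> ^ ((m - l) + (l - m))) \<le> 2 / (1 - \<sigma>)" by simp
  then show "(\<Sum>l<n. ennreal (\<sigma> ^ ((m - l) + (l - m)))) \<le> ennreal (2 / (1 - \<sigma>))"
    using assms by (simp add: sum_ennreal ennreal_leI)
qed

text \<open>For q < 1 there is no triangle inequality to rely on. The kernel is therefore split into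
  two factors with ratio \<open>\<sigma>\<close>, the root of \<open>\<rho>\<close>: one is summed,
  the other stays inside a supremum, and the power t of a supremum is at most the sum of the
  powers.\<close>

lemma lr_norm_geometric:
  fixes \<rho> :: real
  assumes q: "0 < q" and \<rho>: "0 < \<rho>" "\<rho> < 1"
  obtains K :: real where "K > 0"
    "\<And>Z. lr_norm q (\<lambda>m. \<Sum>l. ennreal (\<rho> ^ ((m - l) + (l - m))) * Z l) \<le> ennreal K * lr_norm q Z"
proof -
  define \<sigma> where "\<sigma> = sqrt \<rho>"
  have \<sigma>: "0 < \<sigma>" "\<sigma> < 1" "\<rho> = \<sigma> * \<sigma>" using \<rho> by (auto simp: \<sigma>_def)
  let ?d = "\<lambda>m l::nat. (m - l) + (l - m)"
  let ?c = "2 / (1 - \<sigma>)"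
  have step: "(\<Sum>l. ennreal (\<rho> ^ ?d m l) * Z l) \<le> ennreal ?c * (SUP l. ennreal (\<sigma> ^ ?d m l) * Z l)" for m Z
  proof -
    have "(\<Sum>l. ennreal (\<rho> ^ ?d m l) * Z l) = (\<Sum>l. ennreal (\<sigma> ^ ?d m l) * (ennreal (\<sigma> ^ ?d m l) * Z l))"
      using \<sigma> by (simp add: power_mult_distrib ennreal_mult mult.assoc)
    also have "\<dots> \<le> (\<Sum>l. ennreal (\<sigma> ^ ?d m l) * (SUP l. ennreal (\<sigma> ^ ?d m l) * Z l))"
      by (intro suminf_le mult_left_mono SUP_upper) auto
    also have "\<dots> \<le> ennreal ?c * (SUP l. ennreal (\<sigma> ^ ?d m l) * Z l)"
      unfolding ennreal_suminf_multc using \<sigma> by (intro mult_right_mono suminf_geometric_distance) auto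
    finally show ?thesis .
  qed
  have c: "?c > 0" using \<sigma> by simp
  show ?thesis
  proof (cases rule: exponent_cases[OF q])
    case 1
    have "lr_norm q (\<lambda>m. \<Sum>l. ennreal (\<rho> ^ ?d m l) * Z l) \<le> ennreal ?c * lr_norm q Z" for Z
      unfolding 1 lr_norm_top
    proof (intro SUP_least order_trans[OF step] mult_left_mono)
      fix m l
      have "ennreal (\<sigma> ^ ?d m l) * Z l \<le> 1 * Z l"
        using \<sigma> by (intro mult_right_mono) (auto simp: power_le_one)
      also have "\<dots> \<le> (SUP l. Z l)" by (auto intro: SUP_upper)
      finally show "ennreal (\<sigma> ^ ?d m l) * Z l \<le> (SUP l. Z l)" .
    qed auto
    then show ?thesis using that c by blast
  next
    case (2 t)
    define \<tau> where "\<tau> = \<sigma> powr t"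
    have \<tau>: "0 < \<tau>" "\<tau> < 1" using \<sigma> 2 by (auto simp: \<tau>_def powr01_less_one)
    have \<tau>p: "(\<sigma> ^ n) powr t = \<tau> ^ n" for n
      using \<sigma> by (simp add: \<tau>_def powr_powr mult.commute flip: powr_realpow)
    have "lr_norm q (\<lambda>m. \<Sum>l. ennreal (\<rho> ^ ?d m l) * Z l) \<le> ennreal (?c * (2 / (1 - \<tau>)) powr (1 / t)) * lr_norm q Z" for Z
    proof -
      have sup: "epowr (SUP l. ennreal (\<sigma> ^ ?d m l) * Z l) t \<le> (\<Sum>l. ennreal (\<tau> ^ ?d m l) * epowr (Z l) t)" for m
      proof -
        have "(SUP l. ennreal (\<sigma> ^ ?d m l) * Z l) \<le> epowr (\<Sum>l. ennreal (\<tau> ^ ?d m l) * epowr (Z l) t) (1 / t)"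
        proof (rule SUP_least)
          fix l
          have "epowr (ennreal (\<sigma> ^ ?d m l) * Z l) t = ennreal (\<tau> ^ ?d m l) * epowr (Z l) t"
            using 2 \<sigma> by (simp add: epowr_mult \<tau>p)
          also have "\<dots> \<le> (\<Sum>l. ennreal (\<tau> ^ ?d m l) * epowr (Z l) t)"
            using sum_le_suminf[of "\<lambda>l. ennreal (\<tau> ^ ?d m l) * epowr (Z l) t" "{l}"] by simp
          finally show "ennreal (\<sigma> ^ ?d m l) * Z l \<le> epowr (\<Sum>l. ennreal (\<tau> ^ ?d m l) * epowr (Z l) t) (1 / t)"
            using 2 by (intro epowr_root_le)
        qed
        from epowr_mono[OF this, of t] show ?thesis using 2 by (simp add: epowr_epowr)
      qed
      have "(\<Sum>m. epowr (\<Sum>l. ennreal (\<rho> ^ ?d m l) * Z l) t)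
          \<le> (\<Sum>m. ennreal (?c powr t) * (\<Sum>l. ennreal (\<tau> ^ ?d m l) * epowr (Z l) t))"
      proof (intro suminf_le)
        fix m
        have "epowr (\<Sum>l. ennreal (\<rho> ^ ?d m l) * Z l) t \<le> epowr (ennreal ?c * (SUP l. ennreal (\<sigma> ^ ?d m l) * Z l)) t"
          using 2 by (intro epowr_mono step) auto
        also have "\<dots> \<le> ennreal (?c powr t) * (\<Sum>l. ennreal (\<tau> ^ ?d m l) * epowr (Z l) t)"
          using 2 c by (simp add: epowr_mult mult_left_mono[OF sup])
        finally show "epowr (\<Sum>l. ennreal (\<rho> ^ ?d m l) * Z l) t \<le> ennreal (?c powr t) * (\<Sum>l. ennreal (\<tau> ^ ?d m l) * epowr (Z l) t)" .
      qed auto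
      also have "\<dots> = ennreal (?c powr t) * (\<Sum>l. \<Sum>m. ennreal (\<tau> ^ ?d m l) * epowr (Z l) t)"
        by (simp add: suminf_ennreal_swap[of "\<lambda>m l. ennreal (\<tau> ^ ?d m l) * epowr (Z l) t"])
      also have "\<dots> = ennreal (?c powr t) * (\<Sum>l. (\<Sum>m. ennreal (\<tau> ^ ?d l m)) * epowr (Z l) t)"
        by (simp add: add.commute)
      also have "\<dots> \<le> ennreal (?c powr t) * (\<Sum>l. ennreal (2 / (1 - \<tau>)) * epowr (Z l) t)"
        using \<tau> by (intro mult_left_mono suminf_le mult_right_mono suminf_geometric_distance) auto
      also have "\<dots> = ennreal (?c powr t) * (ennreal (2 / (1 - \<tau>)) * (\<Sum>l. epowr (Z l) t))" by simp
      finally have "lr_norm q (\<lambda>m. \<Sum>l. ennreal (\<rho> ^ ?d m l) * Z l)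
          \<le> epowr (ennreal (?c powr t) * (ennreal (2 / (1 - \<tau>)) * (\<Sum>l. epowr (Z l) t))) (1 / t)"
        unfolding lr_norm_def using 2 by (auto intro!: epowr_mono)
      also have "\<dots> = ennreal (?c * (2 / (1 - \<tau>)) powr (1 / t)) * lr_norm q Z"
      proof -
        have "ennreal (?c * (2 / (1 - \<tau>)) powr (1 / t)) = ennreal ?c * ennreal ((2 / (1 - \<tau>)) powr (1 / t))"
          using c by (intro ennreal_mult) auto
        then show ?thesis
          using 2 c \<tau> by (simp add: epowr_mult powr_powr lr_norm_def mult.assoc)
      qed
      finally show ?thesis .
    qed
    moreover have "?c * (2 / (1 - \<tau>)) powr (1 / t) > 0" using c \<tau> by simp
    ultimately show ?thesis using that by blast
  qed
qed

lemma lr_norm_truncated_const: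
  assumes "0 < q"
  shows "lr_norm q (\<lambda>m. if m < L then v else 0) \<le> ennreal (real L powr recip q + 1) * v"
proof (cases rule: exponent_cases[OF assms])
  case 1
  have "(SUP m. if m < L then v else 0) \<le> 1 * v" by (intro SUP_least) auto
  also have "\<dots> \<le> ennreal (real L powr recip q + 1) * v"
    by (intro mult_right_mono) (auto simp: ennreal_plus[symmetric] simp del: ennreal_plus)
  finally show ?thesis by (simp add: 1 lr_norm_top)
next
  case (2 t)
  have t: "recip q = 1 / t" using 2 by (simp add: recip_def divide_ennreal flip: ennreal_1)
  have "(\<Sum>m. epowr (if m < L then v else 0) t) = (\<Sum>m<L. epowr v t)"
    by (subst suminf_finite[of "{..<L}"]) auto
  then have "lr_norm q (\<lambda>m. if m < L then v else 0) = epowr (ennreal (real L) * epowr v t) (1 / t)"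
    using 2 by (simp add: lr_norm_def ennreal_of_nat_eq_real_of_nat)
  also have "\<dots> = ennreal (real L powr (1 / t)) * v"
    using 2 by (simp add: epowr_mult epowr_epowr)
  also have "\<dots> \<le> ennreal (real L powr recip q + 1) * v"
    unfolding t by (intro mult_right_mono ennreal_leI) auto
  finally show ?thesis .
qed

text \<open>The common form of all discrete estimates below: a kernel that decays geometrically away
  from the diagonal, and finitely many initial indices controlled by a single quantity v. The
  constant K is fixed before the sequences.\<close>

lemma lr_norm_Hardy:
  fixes \<rho> C :: real
  assumes q: "0 < q" and \<rho>: "0 < \<rho>" "\<rho> < 1" and C: "C \<ge> 0"
  obtains K :: real where "K > 0"
    "\<And>X Z v. (\<And>m. m \<ge> L \<Longrightarrow> X m \<le> ennreal C * (\<Sum>l. ennreal (\<rho> ^ ((m - l) + (l - m))) * Z l)) \<Longrightarrow>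
      (\<And>m. m < L \<Longrightarrow> X m \<le> ennreal C * v) \<Longrightarrow> lr_norm q X \<le> ennreal K * (lr_norm q Z + v)"
proof -
  obtain K1 where K1: "K1 > 0" "\<And>a c. lr_norm q (\<lambda>j. a j + c j) \<le> ennreal K1 * (lr_norm q a + lr_norm q c)"
    by (rule lr_norm_add[OF q]) (rule that)
  obtain K2 where K2: "K2 > 0" "\<And>Z. lr_norm q (\<lambda>m. \<Sum>l. ennreal (\<rho> ^ ((m - l) + (l - m))) * Z l) \<le> ennreal K2 * lr_norm q Z"
    by (rule lr_norm_geometric[OF q \<rho>]) (rule that)
  let ?M = "max K2 (real L powr recip q + 1)"
  have "lr_norm q X \<le> ennreal (C * K1 * ?M + 1) * (lr_norm q Z + v)"
    if X: "\<And>m. m \<ge> L \<Longrightarrow> X m \<le> ennreal C * (\<Sum>l. ennreal (\<rho> ^ ((m - l) + (l - m))) * Z l)"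
      "\<And>m. m < L \<Longrightarrow> X m \<le> ennreal C * v" for X Z v
  proof -
    let ?G = "\<lambda>m. \<Sum>l. ennreal (\<rho> ^ ((m - l) + (l - m))) * Z l" and ?V = "\<lambda>m. if m < L then v else 0"
    have "X m \<le> ennreal C * (?G m + ?V m)" for m
    proof (cases "m < L")
      case True
      have "ennreal C * v \<le> ennreal C * (?G m + v)" by (intro mult_left_mono) auto
      then show ?thesis using True X(2)[OF True] order_trans by auto
    next
      case False
      then show ?thesis using X(1)[of m] by simp
    qed
    then have "lr_norm q X \<le> lr_norm q (\<lambda>m. ennreal C * (?G m + ?V m))"
      by (rule lr_norm_mono[OF _ q])
    also have "\<dots> = ennreal C * lr_norm q (\<lambda>m. ?G m + ?V m)" by (rule lr_norm_cmult[OF q])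
    also have "\<dots> \<le> ennreal C * (ennreal K1 * (ennreal ?M * lr_norm q Z + ennreal ?M * v))"
    proof (intro mult_left_mono order_trans[OF K1(2)] add_mono)
      show "lr_norm q ?G \<le> ennreal ?M * lr_norm q Z"
        by (rule order_trans[OF K2(2)]) (auto intro!: mult_right_mono ennreal_leI)
      show "lr_norm q ?V \<le> ennreal ?M * v"
        by (rule order_trans[OF lr_norm_truncated_const[OF q]]) (auto intro!: mult_right_mono ennreal_leI simp del: ennreal_plus)
    qed auto
    also have "\<dots> = ennreal (C * K1 * ?M) * (lr_norm q Z + v)"
      using C K1(1) K2(1) by (simp add: ennreal_mult distrib_left mult.assoc less_imp_le le_max_iff_disj)
    also have "\<dots> \<le> ennreal (C * K1 * ?M + 1) * (lr_norm q Z + v)"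
      by (intro mult_right_mono ennreal_leI) auto
    finally show ?thesis .
  qed
  moreover have "C * K1 * ?M + 1 > 0"
    using C K1(1) K2(1) by (intro add_nonneg_pos mult_nonneg_nonneg) (auto simp: less_imp_le le_max_iff_disj)
  ultimately show ?thesis using that by blast
qed

section \<open>Reciprocal exponents and dyadic blocks of indices\<close>

lemma recip_top [simp]: "recip top = 0"
  by (simp add: recip_def)

lemma recip_ennreal: "0 < t \<Longrightarrow> recip (ennreal t) = 1 / t"
  by (simp add: recip_def divide_ennreal flip: ennreal_1)

lemma recip_2 [simp]: "recip 2 = 1 / 2"
  using recip_ennreal[of 2] by simp

lemma recip_strict_antimono:
  assumes "0 < q" "q < r"
  shows "recip r < recip q"
proof -
  obtain t where t: "q = ennreal t" "t > 0" using assms by (cases q) auto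
  show ?thesis
  proof (cases r)
    case (real u)
    with assms t have "t < u" by (simp add: ennreal_less_iff)
    with real t show ?thesis by (simp add: recip_ennreal frac_less2)
  qed (use t in \<open>simp add: recip_ennreal\<close>)
qed

text \<open>On these blocks of indices the logarithmic weight \<open>(1 + j)\<^sup>b\<close> is essentially constant;
  the corresponding blocks of frequencies \<open>\<lambda>\<^sub>j\<close> are doubly exponential.\<close>

definition dyadic :: "nat \<Rightarrow> nat set" where
  "dyadic m = {2 ^ m..<2 ^ Suc m}"

definition on :: "nat set \<Rightarrow> (nat \<Rightarrow> ennreal) \<Rightarrow> nat \<Rightarrow> ennreal" where
  "on A y j = (if j \<in> A then y j else 0)"

lemma on_in: "j \<in> A \<Longrightarrow> on A y j = y j"
  by (simp add: on_def)

lemma on_out: "j \<notin> A \<Longrightarrow> on A y j = 0"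
  by (simp add: on_def)

lemma dyadic_unique: "j \<in> dyadic m \<Longrightarrow> j \<in> dyadic n \<Longrightarrow> m = n"
proof -
  have "\<not> m < n" if "j \<in> dyadic m" "j \<in> dyadic n" for m n
  proof
    assume "m < n"
    then have "(2::nat) ^ Suc m \<le> 2 ^ n" by (intro power_increasing) auto
    with that show False by (auto simp: dyadic_def)
  qed
  then show "j \<in> dyadic m \<Longrightarrow> j \<in> dyadic n \<Longrightarrow> m = n" by (meson linorder_neqE_nat)
qed

lemma dyadic_exists: "1 \<le> j \<Longrightarrow> \<exists>m. j \<in> dyadic m"
  using ex_power_ivl1[of 2 j] by (auto simp: dyadic_def)

lemma card_dyadic [simp]: "card (dyadic m) = 2 ^ m"
  by (simp add: dyadic_def)

lemma finite_dyadic [simp]: "finite (dyadic m)"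
  by (simp add: dyadic_def)

lemma lr_norm_zero [simp]: "0 < q \<Longrightarrow> lr_norm q (\<lambda>j. 0) = 0"
  using lr_norm_cmult[of q 0 "\<lambda>j. 0"] by simp

text \<open>The index 0 lies in no dyadic block, hence the condition at 0 here and in the statements
  built on this one; coefficient sequences of lacunary functions vanish below 3.\<close>

lemma suminf_dyadic:
  fixes f :: "nat \<Rightarrow> ennreal"
  assumes "f 0 = 0"
  shows "(\<Sum>j. f j) = (\<Sum>m. \<Sum>j. on (dyadic m) f j)"
proof -
  have "f j = (\<Sum>m. on (dyadic m) f j)" for j
  proof (cases "j = 0")
    case True
    have "(\<lambda>m. on (dyadic m) f j) = (\<lambda>m. 0)" using True by (auto simp: on_def dyadic_def)
    then show ?thesis using True assms by simp
  next
    case False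
    then obtain m where m: "j \<in> dyadic m" using dyadic_exists[of j] by auto
    then have "(\<Sum>m. on (dyadic m) f j) = (\<Sum>m\<in>{m}. on (dyadic m) f j)"
      by (intro suminf_finite) (auto simp: on_def dest: dyadic_unique)
    then show ?thesis using m by (simp add: on_def)
  qed
  then have "(\<Sum>j. f j) = (\<Sum>j. \<Sum>m. on (dyadic m) f j)" by simp
  then show ?thesis by (simp only: suminf_ennreal_swap[of "\<lambda>j m. on (dyadic m) f j"])
qed

lemma lr_norm_dyadic:
  assumes q: "0 < q" and y: "y 0 = 0"
  shows "lr_norm q y = lr_norm q (\<lambda>m. lr_norm q (on (dyadic m) y))"
proof (cases rule: exponent_cases[OF q])
  case 1
  have "y j \<le> (SUP m. SUP j. on (dyadic m) y j)" for j
  proof (cases "j = 0")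
    case False
    then obtain m where "j \<in> dyadic m" using dyadic_exists[of j] by auto
    then have "y j \<le> on (dyadic m) y j" by (simp add: on_def)
    also have "\<dots> \<le> (SUP m. SUP j. on (dyadic m) y j)"
      by (meson SUP_upper UNIV_I order_trans)
    finally show ?thesis .
  qed (simp add: y)
  moreover have "on (dyadic m) y j \<le> (SUP j. y j)" for m j
    by (auto simp: on_def intro: SUP_upper)
  ultimately show ?thesis
    unfolding 1 lr_norm_top by (intro antisym SUP_least)
next
  case (2 t)
  have "(\<Sum>j. epowr (y j) t) = (\<Sum>m. \<Sum>j. on (dyadic m) (\<lambda>j. epowr (y j) t) j)"
    by (rule suminf_dyadic) (simp add: y)
  also have "\<dots> = (\<Sum>m. epowr (lr_norm q (on (dyadic m) y)) t)"
  proof (rule suminf_cong)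
    fix m
    have "on (dyadic m) (\<lambda>j. epowr (y j) t) j = epowr (on (dyadic m) y j) t" for j
      by (simp add: on_def)
    then show "(\<Sum>j. on (dyadic m) (\<lambda>j. epowr (y j) t) j) = epowr (lr_norm q (on (dyadic m) y)) t"
      using 2 by (simp add: lr_norm_def epowr_epowr)
  qed
  finally show ?thesis
    using 2 by (simp add: lr_norm_def)
qed

lemma lr_norm_tail_dyadic:
  assumes q: "0 < q" and y: "y 0 = 0"
  shows "lr_norm q (on {2 ^ m..} y) = lr_norm q (on {m..} (\<lambda>i. lr_norm q (on (dyadic i) y)))"
proof -
  have "lr_norm q (on (dyadic i) (on {2 ^ m..} y)) = on {m..} (\<lambda>i. lr_norm q (on (dyadic i) y)) i" for i
  proof (cases "i < m")
    case True
    then have "(2::nat) ^ Suc i \<le> 2 ^ m" by (intro power_increasing) auto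
    then have "on (dyadic i) (on {2 ^ m..} y) = (\<lambda>j. 0)" by (auto simp: on_def dyadic_def)
    then show ?thesis using True q by (simp add: on_def)
  next
    case False
    then have "(2::nat) ^ m \<le> 2 ^ i" by (intro power_increasing) auto
    then have "dyadic i \<subseteq> {2 ^ m..}" by (auto simp: dyadic_def simp del: power_increasing_iff)
    then have "on (dyadic i) (on {2 ^ m..} y) = on (dyadic i) y" by (auto simp: on_def fun_eq_iff)
    then show ?thesis using False by (simp add: on_def)
  qed
  then show ?thesis
    using lr_norm_dyadic[OF q, of "on {2 ^ m..} y"] y by (simp add: on_def[of "{2 ^ m..}" _ 0])
qed

lemma lr_norm_const_on:
  assumes q: "0 < q" and A: "finite A" "A \<noteq> {}"
  shows "lr_norm q (on A (\<lambda>j. c)) = ennreal (real (card A) powr recip q) * c"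
proof (cases rule: exponent_cases[OF q])
  case 1
  have "(SUP j. on A (\<lambda>j. c) j) = c"
  proof (rule antisym)
    show "(SUP j. on A (\<lambda>j. c) j) \<le> c" by (intro SUP_least) (simp add: on_def)
    obtain j where "j \<in> A" using A by auto
    then have "c = on A (\<lambda>j. c) j" by (simp add: on_def)
    also have "\<dots> \<le> (SUP j. on A (\<lambda>j. c) j)" by (rule SUP_upper) simp
    finally show "c \<le> (SUP j. on A (\<lambda>j. c) j)" .
  qed
  moreover have "card A > 0" using A by (simp add: card_gt_0_iff)
  ultimately show ?thesis by (simp add: 1 lr_norm_top)
next
  case (2 t)
  have "(\<Sum>j. epowr (on A (\<lambda>j. c) j) t) = (\<Sum>j\<in>A. epowr (on A (\<lambda>j. c) j) t)"
    using A by (intro suminf_finite) (auto simp: on_def)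
  also have "\<dots> = ennreal (real (card A)) * epowr c t"
    by (simp add: on_def ennreal_of_nat_eq_real_of_nat)
  finally show ?thesis
    using 2 by (simp add: lr_norm_def epowr_mult epowr_epowr recip_ennreal)
qed

text \<open>Hoelder's inequality on counting measure with exponent s / r against the constant 1.
  Only the ratio has to exceed 1, so exponents below 1 are covered.\<close>

lemma lr_norm_Hoelder_finite:
  assumes r: "0 < r" "r \<le> s" and A: "finite A" "A \<noteq> {}"
  shows "lr_norm r (on A y) \<le> ennreal (real (card A) powr (recip r - recip s)) * lr_norm s (on A y)"
proof -
  have s: "0 < s" using r by simp
  have cA: "card A > 0" using A by (simp add: card_gt_0_iff)
  show ?thesis
  proof (cases "s = top")
    case True
    have "on A y j \<le> on A (\<lambda>_. lr_norm s (on A y)) j" for j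
      using lr_norm_ge[OF s, of "on A y" j] by (cases "j \<in> A") (simp_all add: on_in on_out)
    then have "lr_norm r (on A y) \<le> lr_norm r (on A (\<lambda>_. lr_norm s (on A y)))"
      by (rule lr_norm_mono[OF _ r(1)])
    then show ?thesis using lr_norm_const_on[OF r(1) A, of "lr_norm s (on A y)"] True by simp
  next
    case False
    then obtain \<sigma> where \<sigma>: "s = ennreal \<sigma>" "\<sigma> > 0" using s by (cases s) auto
    have "r < top" using le_less_trans[OF r(2), of top] \<sigma> by auto
    then obtain \<tau> where \<tau>: "r = ennreal \<tau>" "\<tau> > 0" using r(1) by (cases r) auto
    have "\<tau> \<le> \<sigma>" using r \<tau> \<sigma> by simp
    show ?thesis
    proof (cases "\<tau> = \<sigma>")
      case True
      then show ?thesis using cA \<tau> \<sigma> by simp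
    next
      case False
      with \<open>\<tau> \<le> \<sigma>\<close> have "\<tau> < \<sigma>" by simp
      have sum: "(\<Sum>j. epowr (on A y j) u) = (\<Sum>j\<in>A. epowr (y j) u)" for u
      proof -
        have "(\<Sum>j. epowr (on A y j) u) = (\<Sum>j\<in>A. epowr (on A y j) u)"
          using A by (intro suminf_finite) (auto simp: on_def)
        then show ?thesis by (simp add: on_def)
      qed
      let ?p = "\<sigma> / \<tau>" and ?p' = "\<sigma> / (\<sigma> - \<tau>)"
      have "(\<Sum>j\<in>A. epowr (y j) \<tau>) = (\<integral>\<^sup>+j. epowr (y j) \<tau> * 1 \<partial>count_space A)"
        using A by (simp add: nn_integral_count_space_finite)
      also have "\<dots> \<le> epowr (\<integral>\<^sup>+j. epowr (epowr (y j) \<tau>) ?p \<partial>count_space A) (1 / ?p)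
          * epowr (\<integral>\<^sup>+j. epowr 1 ?p' \<partial>count_space A) (1 / ?p')"
        using \<open>\<tau> < \<sigma>\<close> \<tau> \<sigma> by (intro nn_integral_Hoelder) (auto simp: field_simps)
      also have "\<dots> = epowr (\<Sum>j\<in>A. epowr (y j) \<sigma>) (\<tau> / \<sigma>) * ennreal (real (card A) powr (1 - \<tau> / \<sigma>))"
        using A \<tau> \<sigma> by (simp add: nn_integral_count_space_finite epowr_epowr ennreal_of_nat_eq_real_of_nat diff_divide_distrib)
      finally have "epowr (\<Sum>j\<in>A. epowr (y j) \<tau>) (1 / \<tau>)
          \<le> epowr (epowr (\<Sum>j\<in>A. epowr (y j) \<sigma>) (\<tau> / \<sigma>) * ennreal (real (card A) powr (1 - \<tau> / \<sigma>))) (1 / \<tau>)"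
        using \<tau> by (intro epowr_mono) auto
      also have "\<dots> = epowr (\<Sum>j\<in>A. epowr (y j) \<sigma>) (1 / \<sigma>) * ennreal (real (card A) powr (1 / \<tau> - 1 / \<sigma>))"
      proof -
        have "(1 - \<tau> / \<sigma>) / \<tau> = 1 / \<tau> - 1 / \<sigma>" using \<tau> \<sigma> by (simp add: field_simps)
        then show ?thesis using \<tau> \<sigma> by (simp add: epowr_mult epowr_epowr powr_powr)
      qed
      finally show ?thesis
        using \<tau> \<sigma> by (simp add: lr_norm_ennreal sum recip_ennreal mult.commute)
    qed
  qed
qed

section \<open>Square sums over blocks and tails, compared with weighted sequence norms\<close>

definition l2_block :: "(nat \<Rightarrow> ennreal) \<Rightarrow> nat \<Rightarrow> ennreal" where
  "l2_block y m = lr_norm 2 (on (dyadic m) y)"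

definition l2_tail :: "(nat \<Rightarrow> ennreal) \<Rightarrow> nat \<Rightarrow> ennreal" where
  "l2_tail y m = lr_norm 2 (on {2 ^ m..} y)"

definition w2 :: "real \<Rightarrow> nat \<Rightarrow> ennreal" where
  "w2 \<beta> m = ennreal (2 powr (real m * \<beta>))"

lemma w2_add: "w2 (\<beta> + \<gamma>) m = w2 \<beta> m * w2 \<gamma> m"
  by (simp add: w2_def distrib_left powr_add ennreal_mult)

lemma l2_block_le_tail: "l2_block y m \<le> l2_tail y m"
  unfolding l2_block_def l2_tail_def
  by (intro lr_norm_mono) (auto simp: on_def dyadic_def)

text \<open>The square sum over blocks is replaced by the plain sum. This loses nothing in the end,
  because the weights grow geometrically when Hardy's inequality is applied.\<close>

lemma l2_tail_le_sum:
  assumes "y 0 = 0"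
  shows "l2_tail y m \<le> (\<Sum>i. on {m..} (l2_block y) i)"
proof -
  have "l2_tail y m = lr_norm 2 (on {m..} (l2_block y))"
    unfolding l2_tail_def l2_block_def by (rule lr_norm_tail_dyadic) (simp_all add: assms)
  also have "\<dots> \<le> lr_norm 1 (on {m..} (l2_block y))"
    by (rule lr_norm_embed) auto
  also have "\<dots> = (\<Sum>i. on {m..} (l2_block y) i)"
    using lr_norm_ennreal[of 1] by simp
  finally show ?thesis .
qed

text \<open>For i at least m the weight at m equals the weight at i times
  \<open>\<rho> ^ (i - m)\<close>, with \<open>\<rho> = 2 powr (- \<beta>)\<close>; positivity of
  \<open>\<beta>\<close> makes this a decaying kernel.\<close>

lemma l2_tail_Hardy:
  assumes q: "0 < q" and \<beta>: "0 < \<beta>"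
  obtains K :: real where "K > 0"
    "\<And>y. y 0 = 0 \<Longrightarrow> lr_norm q (\<lambda>m. w2 \<beta> m * l2_tail y m) \<le> ennreal K * lr_norm q (\<lambda>m. w2 \<beta> m * l2_block y m)"
proof -
  define \<rho> where "\<rho> = 2 powr (- \<beta>)"
  have \<rho>: "0 < \<rho>" "\<rho> < 1" using \<beta> by (auto simp: \<rho>_def powr_less_one)
  obtain K where K: "K > 0"
    "\<And>X Z v. (\<And>m. m \<ge> 0 \<Longrightarrow> X m \<le> ennreal 1 * (\<Sum>l. ennreal (\<rho> ^ ((m - l) + (l - m))) * Z l)) \<Longrightarrow>
      (\<And>m. m < 0 \<Longrightarrow> X m \<le> ennreal 1 * v) \<Longrightarrow> lr_norm q X \<le> ennreal K * (lr_norm q Z + v)"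
    by (rule lr_norm_Hardy[OF q \<rho>, of 1 0]) (auto intro: that)
  have "lr_norm q (\<lambda>m. w2 \<beta> m * l2_tail y m) \<le> ennreal K * (lr_norm q (\<lambda>m. w2 \<beta> m * l2_block y m) + 0)"
    if y: "y 0 = 0" for y
  proof (rule K(2))
    fix m :: nat
    have "w2 \<beta> m * l2_tail y m \<le> w2 \<beta> m * (\<Sum>i. on {m..} (l2_block y) i)"
      by (intro mult_left_mono l2_tail_le_sum y) auto
    also have "\<dots> = (\<Sum>i. w2 \<beta> m * on {m..} (l2_block y) i)" by simp
    also have "\<dots> \<le> (\<Sum>i. ennreal (\<rho> ^ ((m - i) + (i - m))) * (w2 \<beta> i * l2_block y i))"
    proof (intro suminf_le)
      fix i
      show "w2 \<beta> m * on {m..} (l2_block y) i \<le> ennreal (\<rho> ^ ((m - i) + (i - m))) * (w2 \<beta> i * l2_block y i)"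
      proof (cases "m \<le> i")
        case True
        have "\<rho> ^ (i - m) * 2 powr (real i * \<beta>) = 2 powr (real m * \<beta>)"
          using True by (simp add: \<rho>_def powr_realpow[symmetric] powr_powr powr_add[symmetric] of_nat_diff algebra_simps)
        then have "w2 \<beta> m = ennreal (\<rho> ^ (i - m)) * w2 \<beta> i"
          using \<rho> by (simp add: w2_def flip: ennreal_mult)
        then show ?thesis using True by (simp add: on_def mult.assoc)
      qed (simp add: on_def)
    qed auto
    finally show "w2 \<beta> m * l2_tail y m \<le> ennreal 1 * (\<Sum>l. ennreal (\<rho> ^ ((m - l) + (l - m))) * (w2 \<beta> l * l2_block y l))"
      by simp
  qed simp
  with K(1) show ?thesis by (intro that[of K]) auto
qed

definition wlr :: "ennreal \<Rightarrow> real \<Rightarrow> (nat \<Rightarrow> ennreal) \<Rightarrow> ennreal" where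
  "wlr r \<gamma> y = lr_norm r (\<lambda>j. ennreal ((1 + real j) powr \<gamma>) * y j)"

lemma dyadic_weight:
  assumes "j \<in> dyadic m"
  shows "(1 + real j) powr \<gamma> \<le> 2 powr \<bar>\<gamma>\<bar> * 2 powr (real m * \<gamma>)"
    and "2 powr (real m * \<gamma>) \<le> 2 powr \<bar>\<gamma>\<bar> * (1 + real j) powr \<gamma>"
proof -
  have "real (2 ^ m) \<le> real j" "real (j + 1) \<le> real (2 ^ Suc m)"
    using assms unfolding of_nat_le_iff by (auto simp: dyadic_def)
  then have "2 ^ m \<le> real j" "1 + real j \<le> 2 ^ m * 2" by simp_all
  then have j: "2 powr real m \<le> 1 + real j" "1 + real j \<le> 2 powr (real m + 1)"
    unfolding powr_add by (simp_all add: powr_realpow del: of_nat_power_le_of_nat_cancel_iff numeral_power_le_of_nat_cancel_iff)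
  have m: "2 powr real m \<le> 2 powr (real m + 1)" by simp
  show "(1 + real j) powr \<gamma> \<le> 2 powr \<bar>\<gamma>\<bar> * 2 powr (real m * \<gamma>)"
  proof (cases "\<gamma> \<ge> 0")
    case True
    then have "(1 + real j) powr \<gamma> \<le> (2 powr (real m + 1)) powr \<gamma>"
      using j by (intro powr_mono2) auto
    then show ?thesis using True by (simp add: powr_powr powr_add[symmetric] algebra_simps)
  next
    case False
    then have "(1 + real j) powr \<gamma> \<le> (2 powr real m) powr \<gamma>"
      using j by (intro powr_mono2') auto
    also have "\<dots> \<le> 2 powr \<bar>\<gamma>\<bar> * 2 powr (real m * \<gamma>)"
      by (simp add: powr_powr ge_one_powr_ge_zero)
    finally show ?thesis .
  qed
  show "2 powr (real m * \<gamma>) \<le> 2 powr \<bar>\<gamma>\<bar> * (1 + real j) powr \<gamma>"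
  proof (cases "\<gamma> \<ge> 0")
    case True
    then have "(2 powr real m) powr \<gamma> \<le> (1 + real j) powr \<gamma>"
      using j by (intro powr_mono2) auto
    also have "\<dots> \<le> 2 powr \<bar>\<gamma>\<bar> * (1 + real j) powr \<gamma>"
      using ge_one_powr_ge_zero[of 2 "\<bar>\<gamma>\<bar>"] by (simp add: mult_le_cancel_right1)
    finally show ?thesis by (simp add: powr_powr)
  next
    case False
    then have "(2 powr (real m + 1)) powr \<gamma> \<le> (1 + real j) powr \<gamma>"
      using j by (intro powr_mono2') auto
    then have "2 powr \<bar>\<gamma>\<bar> * (2 powr (real m + 1)) powr \<gamma> \<le> 2 powr \<bar>\<gamma>\<bar> * (1 + real j) powr \<gamma>"
      by (intro mult_left_mono) auto
    moreover have "2 powr \<bar>\<gamma>\<bar> * (2 powr (real m + 1)) powr \<gamma> = 2 powr (real m * \<gamma>)"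
      using False by (simp add: powr_powr powr_add[symmetric] algebra_simps)
    ultimately show ?thesis by simp
  qed
qed

lemma wlr_dyadic:
  assumes r: "0 < r" and y: "y 0 = 0"
  shows "wlr r \<gamma> y \<le> ennreal (2 powr \<bar>\<gamma>\<bar>) * lr_norm r (\<lambda>m. w2 \<gamma> m * lr_norm r (on (dyadic m) y))"
    and "lr_norm r (\<lambda>m. w2 \<gamma> m * lr_norm r (on (dyadic m) y)) \<le> ennreal (2 powr \<bar>\<gamma>\<bar>) * wlr r \<gamma> y"
proof -
  let ?y = "\<lambda>j. ennreal ((1 + real j) powr \<gamma>) * y j"
  have eq: "wlr r \<gamma> y = lr_norm r (\<lambda>m. lr_norm r (on (dyadic m) ?y))"
    unfolding wlr_def using lr_norm_dyadic[OF r, of ?y] y by simp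
  have "lr_norm r (on (dyadic m) ?y) \<le> ennreal (2 powr \<bar>\<gamma>\<bar>) * (w2 \<gamma> m * lr_norm r (on (dyadic m) y))" for m
  proof -
    have "lr_norm r (on (dyadic m) ?y) \<le> lr_norm r (\<lambda>j. (ennreal (2 powr \<bar>\<gamma>\<bar>) * w2 \<gamma> m) * on (dyadic m) y j)"
      using r by (intro lr_norm_mono)
        (auto simp: on_def w2_def ennreal_mult[symmetric] intro!: mult_right_mono ennreal_leI dyadic_weight)
    then show ?thesis by (simp add: lr_norm_cmult[OF r] mult.assoc)
  qed
  then have "wlr r \<gamma> y \<le> lr_norm r (\<lambda>m. ennreal (2 powr \<bar>\<gamma>\<bar>) * (w2 \<gamma> m * lr_norm r (on (dyadic m) y)))"
    unfolding eq by (rule lr_norm_mono[OF _ r])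
  then show "wlr r \<gamma> y \<le> ennreal (2 powr \<bar>\<gamma>\<bar>) * lr_norm r (\<lambda>m. w2 \<gamma> m * lr_norm r (on (dyadic m) y))"
    by (simp add: lr_norm_cmult[OF r])
  have "w2 \<gamma> m * lr_norm r (on (dyadic m) y) \<le> ennreal (2 powr \<bar>\<gamma>\<bar>) * lr_norm r (on (dyadic m) ?y)" for m
  proof -
    have "w2 \<gamma> m * y j \<le> ennreal (2 powr \<bar>\<gamma>\<bar>) * (ennreal ((1 + real j) powr \<gamma>) * y j)" if "j \<in> dyadic m" for j
    proof -
      have "w2 \<gamma> m * y j \<le> ennreal (2 powr \<bar>\<gamma>\<bar> * (1 + real j) powr \<gamma>) * y j"
        unfolding w2_def using that by (intro mult_right_mono ennreal_leI dyadic_weight) auto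
      then show ?thesis by (simp add: ennreal_mult mult.assoc)
    qed
    then have "lr_norm r (\<lambda>j. w2 \<gamma> m * on (dyadic m) y j) \<le> lr_norm r (\<lambda>j. ennreal (2 powr \<bar>\<gamma>\<bar>) * on (dyadic m) ?y j)"
      using r by (intro lr_norm_mono) (auto simp: on_def)
    then show ?thesis by (simp add: lr_norm_cmult[OF r])
  qed
  then have "lr_norm r (\<lambda>m. w2 \<gamma> m * lr_norm r (on (dyadic m) y)) \<le> lr_norm r (\<lambda>m. ennreal (2 powr \<bar>\<gamma>\<bar>) * lr_norm r (on (dyadic m) ?y))"
    by (rule lr_norm_mono[OF _ r])
  then show "lr_norm r (\<lambda>m. w2 \<gamma> m * lr_norm r (on (dyadic m) y)) \<le> ennreal (2 powr \<bar>\<gamma>\<bar>) * wlr r \<gamma> y"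
    by (simp add: lr_norm_cmult[OF r] eq)
qed

lemma dyadic_card_powr: "ennreal (real (card (dyadic m)) powr a) = w2 a m"
  by (simp add: w2_def powr_powr flip: powr_realpow)

lemma dyadic_nonempty [simp]: "dyadic m \<noteq> {}"
  by (simp add: dyadic_def)

text \<open>A block has 2^m indices, so passing from exponent 2 to \<open>max r 2\<close> costs 2 to
  the power m times \<open>1/2 - recip (max r 2)\<close>, and this is exactly the shift of the
  weight exponent. Passing on to r inside a block, and from q to r across blocks, is free.\<close>

lemma tail_le_wlr:
  assumes r: "0 < r" "r \<le> q" and \<beta>: "0 < \<beta>"
  obtains K :: real where "K > 0"
    "\<And>y. y 0 = 0 \<Longrightarrow> lr_norm q (\<lambda>m. w2 \<beta> m * l2_tail y m) \<le> ennreal K * wlr r (\<beta> + 1/2 - recip (max r 2)) y"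
proof -
  have q: "0 < q" using r by simp
  let ?\<gamma> = "\<beta> + 1/2 - recip (max r 2)"
  obtain K where K: "K > 0"
    "\<And>y. y 0 = 0 \<Longrightarrow> lr_norm q (\<lambda>m. w2 \<beta> m * l2_tail y m) \<le> ennreal K * lr_norm q (\<lambda>m. w2 \<beta> m * l2_block y m)"
    by (rule l2_tail_Hardy[OF q \<beta>]) (rule that)
  have "lr_norm q (\<lambda>m. w2 \<beta> m * l2_tail y m) \<le> ennreal (K * 2 powr \<bar>?\<gamma>\<bar>) * wlr r ?\<gamma> y" if y: "y 0 = 0" for y
  proof -
    have block: "w2 \<beta> m * l2_block y m \<le> w2 ?\<gamma> m * lr_norm r (on (dyadic m) y)" for m
    proof -
      have "l2_block y m \<le> w2 (1/2 - recip (max r 2)) m * lr_norm (max r 2) (on (dyadic m) y)"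
        using lr_norm_Hoelder_finite[of 2 "max r 2" "dyadic m" y]
        unfolding l2_block_def dyadic_card_powr by simp
      also have "\<dots> \<le> w2 (1/2 - recip (max r 2)) m * lr_norm r (on (dyadic m) y)"
        using r by (intro mult_left_mono lr_norm_embed) auto
      finally have "w2 \<beta> m * l2_block y m \<le> w2 \<beta> m * (w2 (1/2 - recip (max r 2)) m * lr_norm r (on (dyadic m) y))"
        by (intro mult_left_mono) auto
      then show ?thesis
        using w2_add[of \<beta> "1/2 - recip (max r 2)" m] by (simp add: mult.assoc add_diff_eq)
    qed
    have "lr_norm q (\<lambda>m. w2 \<beta> m * l2_tail y m) \<le> ennreal K * lr_norm q (\<lambda>m. w2 \<beta> m * l2_block y m)"
      by (rule K(2)) (rule y)
    also have "\<dots> \<le> ennreal K * lr_norm r (\<lambda>m. w2 \<beta> m * l2_block y m)"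
      by (intro mult_left_mono lr_norm_embed r) auto
    also have "\<dots> \<le> ennreal K * lr_norm r (\<lambda>m. w2 ?\<gamma> m * lr_norm r (on (dyadic m) y))"
      by (intro mult_left_mono lr_norm_mono block r) auto
    also have "\<dots> \<le> ennreal K * (ennreal (2 powr \<bar>?\<gamma>\<bar>) * wlr r ?\<gamma> y)"
      by (intro mult_left_mono wlr_dyadic r y) auto
    also have "\<dots> = ennreal (K * 2 powr \<bar>?\<gamma>\<bar>) * wlr r ?\<gamma> y"
      using K(1) by (simp add: ennreal_mult mult.assoc)
    finally show ?thesis .
  qed
  then show ?thesis using K(1) by (intro that[of "K * 2 powr \<bar>?\<gamma>\<bar>"]) auto
qed

text \<open>The same count with \<open>min r 2\<close>: going down from r is free, and returning to
  exponent 2 costs 2 to the power m times \<open>recip (min r 2) - 1/2\<close>, which restores the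
  exponent \<open>\<beta>\<close>. A block is part of its tail, so the tail can be put in
  directly.\<close>

lemma wlr_le_tail:
  assumes q: "0 < q" "q \<le> r"
  obtains K :: real where "K > 0"
    "\<And>y. y 0 = 0 \<Longrightarrow> wlr r (\<beta> + 1/2 - recip (min r 2)) y \<le> ennreal K * lr_norm q (\<lambda>m. w2 \<beta> m * l2_tail y m)"
proof -
  have r: "0 < r" using q by simp
  let ?\<gamma> = "\<beta> + 1/2 - recip (min r 2)"
  have "wlr r ?\<gamma> y \<le> ennreal (2 powr \<bar>?\<gamma>\<bar>) * lr_norm q (\<lambda>m. w2 \<beta> m * l2_tail y m)" if y: "y 0 = 0" for y
  proof -
    have block: "w2 ?\<gamma> m * lr_norm r (on (dyadic m) y) \<le> w2 \<beta> m * l2_tail y m" for m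
    proof -
      have "lr_norm r (on (dyadic m) y) \<le> lr_norm (min r 2) (on (dyadic m) y)"
        using r by (intro lr_norm_embed) auto
      also have "\<dots> \<le> w2 (recip (min r 2) - 1/2) m * l2_block y m"
        using lr_norm_Hoelder_finite[of "min r 2" 2 "dyadic m" y] r
        unfolding l2_block_def dyadic_card_powr by simp
      also have "\<dots> \<le> w2 (recip (min r 2) - 1/2) m * l2_tail y m"
        by (intro mult_left_mono l2_block_le_tail) auto
      finally have "w2 ?\<gamma> m * lr_norm r (on (dyadic m) y) \<le> w2 ?\<gamma> m * (w2 (recip (min r 2) - 1/2) m * l2_tail y m)"
        by (intro mult_left_mono) auto
      then show ?thesis
        using w2_add[of ?\<gamma> "recip (min r 2) - 1/2" m] by (simp add: mult.assoc)
    qed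
    have "wlr r ?\<gamma> y \<le> ennreal (2 powr \<bar>?\<gamma>\<bar>) * lr_norm r (\<lambda>m. w2 ?\<gamma> m * lr_norm r (on (dyadic m) y))"
      by (intro wlr_dyadic r y)
    also have "\<dots> \<le> ennreal (2 powr \<bar>?\<gamma>\<bar>) * lr_norm r (\<lambda>m. w2 \<beta> m * l2_tail y m)"
      by (intro mult_left_mono lr_norm_mono block r) auto
    also have "\<dots> \<le> ennreal (2 powr \<bar>?\<gamma>\<bar>) * lr_norm q (\<lambda>m. w2 \<beta> m * l2_tail y m)"
      by (intro mult_left_mono lr_norm_embed q) auto
    finally show ?thesis .
  qed
  then show ?thesis by (intro that[of "2 powr \<bar>?\<gamma>\<bar>"]) auto
qed

text \<open>Extremal sequences: each block of the support is either full, with equal entries, or a single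
  entry, according to which end of \<open>\<ell>\<^sub>r\<close> versus \<open>\<ell>\<^sub>2\<close> is sharp.\<close>

lemma test_sequence:
  fixes \<mu> \<beta> :: real and N :: nat
  assumes r: "0 < r" and \<mu>: "\<mu> = 0 \<or> \<mu> = 1/2 - recip r" and N: "N \<ge> 1"
  obtains c :: "nat \<Rightarrow> real" where "\<And>j. c j \<ge> 0" "\<And>j. j < 3 \<Longrightarrow> c j = 0" "\<And>j. j \<ge> 2 ^ (N + 2) \<Longrightarrow> c j = 0"
    "\<And>q. 0 < q \<Longrightarrow> lr_norm q (\<lambda>m. w2 \<beta> m * l2_block (\<lambda>j. ennreal (c j)) m) = ennreal (real N powr recip q)"
    "lr_norm r (\<lambda>m. w2 (\<beta> + \<mu>) m * lr_norm r (on (dyadic m) (\<lambda>j. ennreal (c j)))) = ennreal (real N powr recip r)"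
proof -
  define A where "A m = (if \<mu> = 0 then {2 ^ m} else dyadic m)" for m :: nat
  \<comment> \<open>Exponent of the square norm of a block: 0 for a single entry, 1/2 for 2^m equal
    entries. Entries 2 to the power -m (\<beta> + \<nu>) then make every weighted block norm equal
    to 1.\<close>
  define \<nu> :: real where "\<nu> = (if \<mu> = 0 then 0 else 1/2)"
  have A: "finite (A m)" "A m \<noteq> {}" "A m \<subseteq> dyadic m" for m
    by (auto simp: A_def dyadic_def)
  \<comment> \<open>Starting with block 2 keeps the support at indices 4 and above, inside the
    admissible range of lacunary coefficients.\<close>
  define S where "S = {2..<N + 2}"
  have S: "finite S" "S \<noteq> {}" "card S = N" using N by (auto simp: S_def)
  define c where "c j = (if \<exists>m\<in>S. j \<in> A m then 2 powr (- real (THE m. j \<in> A m) * (\<beta> + \<nu>)) else 0)" for j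
  have the: "(THE m. j \<in> A m) = m" if "j \<in> A m" for j m
    using that A(3) dyadic_unique by (intro the_equality) blast+
  have block: "on (dyadic m) (\<lambda>j. ennreal (c j)) = on (A m) (\<lambda>j. if m \<in> S then ennreal (2 powr (- real m * (\<beta> + \<nu>))) else 0)" for m
  proof
    fix j
    show "on (dyadic m) (\<lambda>j. ennreal (c j)) j = on (A m) (\<lambda>j. if m \<in> S then ennreal (2 powr (- real m * (\<beta> + \<nu>))) else 0) j"
    proof (cases "j \<in> A m")
      case True
      then have "j \<in> dyadic m" using A by auto
      moreover have "(\<exists>n\<in>S. j \<in> A n) \<longleftrightarrow> m \<in> S" using True the by metis
      ultimately show ?thesis using True the[OF True] by (simp add: on_def c_def)
    next
      case False
      have "\<not> (\<exists>n\<in>S. j \<in> A n)" if "j \<in> dyadic m"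
        using that False A(3) dyadic_unique by blast
      then show ?thesis using False by (simp add: on_def c_def)
    qed
  qed
  \<comment> \<open>One computation for both claims: s = 2 with weight exponent \<beta>, and s = r
    with \<beta> + \<mu>. The assumption on \<kappa> says that weight, block norm and entry
    cancel.\<close>
  have norm: "w2 \<kappa> m * lr_norm s (on (dyadic m) (\<lambda>j. ennreal (c j))) = on S (\<lambda>_. 1) m"
    if s: "0 < s" and \<kappa>: "\<kappa> + (if \<mu> = 0 then 0 else recip s) = \<beta> + \<nu>" for s \<kappa> m
  proof (cases "m \<in> S")
    case True
    have "real (card (A m)) powr recip s = 2 powr (real m * (if \<mu> = 0 then 0 else recip s))"
      by (simp add: A_def powr_powr flip: powr_realpow)
    then have "w2 \<kappa> m * lr_norm s (on (dyadic m) (\<lambda>j. ennreal (c j)))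
       = ennreal (2 powr (real m * \<kappa>) * 2 powr (real m * (if \<mu> = 0 then 0 else recip s)) * 2 powr (- real m * (\<beta> + \<nu>)))"
      using True A by (simp add: block lr_norm_const_on[OF s] w2_def ennreal_mult mult.assoc)
    also have "2 powr (real m * \<kappa>) * 2 powr (real m * (if \<mu> = 0 then 0 else recip s)) * 2 powr (- real m * (\<beta> + \<nu>)) = 1"
    proof -
      have "real m * \<kappa> + real m * (if \<mu> = 0 then 0 else recip s) + (- real m * (\<beta> + \<nu>)) = 0"
        unfolding \<kappa>[symmetric] by (simp add: algebra_simps)
      then show ?thesis by (simp only: powr_add[symmetric]) simp
    qed
    finally show ?thesis using True by (simp add: on_in)
  next
    case False
    have "on (dyadic m) (\<lambda>j. ennreal (c j)) = (\<lambda>j. 0)"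
      unfolding block using False by (simp add: on_def fun_eq_iff)
    then show ?thesis using False s by (simp add: on_out)
  qed
  show ?thesis
  proof (rule that[of c])
    show "c j \<ge> 0" for j by (simp add: c_def)
    show "c j = 0" if "j < 3" for j
    proof -
      have "j \<notin> A m" if "m \<in> S" for m
      proof
        assume "j \<in> A m"
        then have "2 ^ m \<le> j" using A(3)[of m] by (auto simp: dyadic_def)
        moreover have "(2::nat) ^ 2 \<le> 2 ^ m" using that by (intro power_increasing) (auto simp: S_def)
        ultimately show False using \<open>j < 3\<close> by simp
      qed
      then show ?thesis by (auto simp: c_def)
    qed
    show "c j = 0" if "j \<ge> 2 ^ (N + 2)" for j
    proof -
      have "j \<notin> A m" if "m \<in> S" for m
      proof
        assume "j \<in> A m"
        then have "j < 2 ^ Suc m" using A(3)[of m] by (auto simp: dyadic_def)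
        moreover have "(2::nat) ^ Suc m \<le> 2 ^ (N + 2)" using that by (intro power_increasing) (auto simp: S_def)
        ultimately show False using \<open>j \<ge> 2 ^ (N + 2)\<close> by simp
      qed
      then show ?thesis by (auto simp: c_def)
    qed
    show "lr_norm q (\<lambda>m. w2 \<beta> m * l2_block (\<lambda>j. ennreal (c j)) m) = ennreal (real N powr recip q)" if "0 < q" for q
      unfolding l2_block_def using norm[of 2 \<beta>] lr_norm_const_on[OF that S(1,2), of 1] S(3)
      by (simp add: \<nu>_def)
    show "lr_norm r (\<lambda>m. w2 (\<beta> + \<mu>) m * lr_norm r (on (dyadic m) (\<lambda>j. ennreal (c j)))) = ennreal (real N powr recip r)"
      using norm[of r "\<beta> + \<mu>"] lr_norm_const_on[OF r S(1,2), of 1] S(3) \<mu> r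
      by (auto simp: \<nu>_def split: if_splits)
  qed
qed

section \<open>Distributions and the functions representing them\<close>

text \<open>Since h vanishes outside a ball, Weierstrass approximation passes from polynomials to
  continuous functions; truncated multiples of the distance function pass on to closed sets, and
  these generate the Borel sets. Polynomials are the right test class because their products with
  one Schwartz cut-off are Schwartz functions.\<close>

lemma AE_zero_of_polynomials:
  fixes h :: "'a::euclidean_space \<Rightarrow> complex"
  assumes h: "integrable lborel h" and R: "\<And>x. norm x > R \<Longrightarrow> h x = 0"
    and poly: "\<And>P. real_polynomial_function P \<Longrightarrow> (LINT x|lborel. of_real (P x) * h x) = 0"
  shows "AE x in lborel. h x = 0"
proof -
  have [measurable]: "h \<in> borel_measurable borel" using h by (auto dest: borel_measurable_integrable)
  have int: "integrable lborel (\<lambda>x. of_real (F x) * h x)"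
    if F: "continuous_on UNIV F" for F :: "'a \<Rightarrow> real"
  proof -
    have [measurable]: "F \<in> borel_measurable borel" using F by (rule borel_measurable_continuous_onI)
    have "compact (F ` cball 0 R)" using F continuous_on_subset by (intro compact_continuous_image) auto
    then obtain K where K: "\<And>x. norm x \<le> R \<Longrightarrow> \<bar>F x\<bar> \<le> K"
      using compact_imp_bounded[of "F ` cball 0 R"] unfolding bounded_iff
      by (metis image_eqI mem_cball_0 real_norm_def)
    show ?thesis
    proof (rule Bochner_Integration.integrable_bound)
      show "integrable lborel (\<lambda>x. of_real K * h x)" using h by simp
      have "\<bar>F x\<bar> * cmod (h x) \<le> \<bar>K\<bar> * cmod (h x)" for x
        using K[of x] R[of x] by (cases "norm x \<le> R") (auto intro!: mult_right_mono)
      then show "AE x in lborel. norm (of_real (F x) * h x) \<le> norm (of_real K * h x)"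
        by (auto simp: norm_mult)
    qed simp
  qed
  have cont: "(LINT x|lborel. of_real (F x) * h x) = 0" if F: "continuous_on UNIV F" for F :: "'a \<Rightarrow> real"
  proof -
    have "cmod (LINT x|lborel. of_real (F x) * h x) \<le> e * (LINT x|lborel. cmod (h x))" if "e > 0" for e
    proof -
      obtain P where P: "real_polynomial_function P" "\<And>x. x \<in> cball 0 R \<Longrightarrow> \<bar>F x - P x\<bar> < e"
        using Stone_Weierstrass_real_polynomial_function[OF compact_cball continuous_on_subset[OF F] \<open>e > 0\<close>]
        by blast
      have cP: "continuous_on UNIV P" using P(1) by (simp add: continuous_on_polymonial_function real_polynomial_function_eq)
      have "(LINT x|lborel. of_real (F x) * h x) = (LINT x|lborel. of_real (F x) * h x) - (LINT x|lborel. of_real (P x) * h x)"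
        by (simp add: poly[OF P(1)])
      also have "\<dots> = (LINT x|lborel. of_real (F x) * h x - of_real (P x) * h x)"
        by (intro Bochner_Integration.integral_diff[symmetric] int F cP)
      also have "cmod \<dots> \<le> (LINT x|lborel. e * cmod (h x))"
      proof (rule order_trans[OF integral_norm_bound Bochner_Integration.integral_mono])
        show "integrable lborel (\<lambda>x. cmod (of_real (F x) * h x - of_real (P x) * h x))"
          by (intro integrable_norm Bochner_Integration.integrable_diff int F cP)
        show "integrable lborel (\<lambda>x. e * cmod (h x))" using h by simp
        fix x
        have "cmod (of_real (F x) * h x - of_real (P x) * h x) = \<bar>F x - P x\<bar> * cmod (h x)"
          by (simp add: norm_mult flip: left_diff_distrib of_real_diff)
        also have "\<dots> \<le> e * cmod (h x)"
        proof (cases "norm x \<le> R")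
          case True
          then show ?thesis using P(2)[of x] by (intro mult_right_mono) auto
        next
          case False
          then show ?thesis using R[of x] by simp
        qed
        finally show "cmod (of_real (F x) * h x - of_real (P x) * h x) \<le> e * cmod (h x)" .
      qed
      finally show ?thesis by simp
    qed
    then have le: "cmod (LINT x|lborel. of_real (F x) * h x) \<le> e * (LINT x|lborel. cmod (h x))" if "e > 0" for e
      using that by blast
    have "cmod (LINT x|lborel. of_real (F x) * h x) \<le> 0"
    proof (rule field_le_epsilon)
      fix e :: real assume "e > 0"
      define N where "N = (LINT x|lborel. cmod (h x))"
      have N: "N \<ge> 0" unfolding N_def by (rule Bochner_Integration.integral_nonneg) simp
      have "cmod (LINT x|lborel. of_real (F x) * h x) \<le> e / (N + 1) * N"
        unfolding N_def using \<open>e > 0\<close> N[unfolded N_def] by (intro le divide_pos_pos add_nonneg_pos) auto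
      also have "\<dots> \<le> e" using \<open>e > 0\<close> N by (simp add: field_simps)
      finally show "cmod (LINT x|lborel. of_real (F x) * h x) \<le> 0 + e" by simp
    qed
    then show ?thesis by simp
  qed
  have closed: "set_lebesgue_integral lborel A h = 0" if A: "closed A" for A
  proof (cases "A = {}")
    case True
    then show ?thesis by (simp add: set_lebesgue_integral_def)
  next
    case False
    let ?F = "\<lambda>n x. max 0 (1 - real n * infdist x A)"
    have [measurable]: "?F n \<in> borel_measurable borel" for n
      by (intro borel_measurable_continuous_onI continuous_intros)
    have "(\<lambda>n. LINT x|lborel. of_real (?F n x) * h x) \<longlonglongrightarrow> (LINT x|lborel. indicat_real A x *\<^sub>R h x)"
    proof (rule integral_dominated_convergence)
      show "integrable lborel (\<lambda>x. cmod (h x))" using h by simp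
      show "AE x in lborel. norm (of_real (?F n x) * h x) \<le> cmod (h x)" for n
        by (auto simp: norm_mult infdist_nonneg intro!: mult_left_le_one_le)
      show "AE x in lborel. (\<lambda>n. of_real (?F n x) * h x) \<longlonglongrightarrow> indicat_real A x *\<^sub>R h x"
      proof (intro AE_I2)
        fix x
        have "(\<lambda>n. ?F n x) \<longlonglongrightarrow> indicat_real A x"
        proof (cases "x \<in> A")
          case False
          then have d: "infdist x A > 0"
            using infdist_pos_not_in_closed[OF A \<open>A \<noteq> {}\<close>] by blast
          have "eventually (\<lambda>n. ?F n x = 0) sequentially"
            using eventually_ge_at_top[of "nat \<lceil>1 / infdist x A\<rceil>"]
          proof eventually_elim
            case (elim n)
            then have "1 / infdist x A \<le> real n" by linarith
            then show ?case using d by (simp add: field_simps)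
          qed
          then show ?thesis using False by (simp add: tendsto_eventually)
        qed simp
        then show "(\<lambda>n. of_real (?F n x) * h x) \<longlonglongrightarrow> indicat_real A x *\<^sub>R h x"
          by (auto simp: scaleR_conv_of_real intro!: tendsto_intros)
      qed
      show "(\<lambda>x. indicat_real A x *\<^sub>R h x) \<in> borel_measurable lborel" using borel_closed[OF A] by simp
    qed simp
    moreover have "(LINT x|lborel. of_real (?F n x) * h x) = 0" for n
      by (intro cont continuous_intros)
    ultimately show ?thesis by (simp add: set_lebesgue_integral_def LIMSEQ_const_iff)
  qed
  have "set_lebesgue_integral lborel A h = 0" if A: "A \<in> sets lborel" for A
  proof -
    have sigma: "A \<in> sigma_sets UNIV (Collect closed)"
      using A by (simp add: borel_eq_closed)
    then show ?thesis
    proof (induction rule: sigma_sets_induct_disjoint[of "Collect closed" UNIV, consumes 0, case_names Int sub sigma basic empty compl union])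
      case Int show ?case by (auto simp: Int_stable_def)
    next
      case (basic A) then show ?case using closed by simp
    next
      case empty show ?case by (simp add: set_lebesgue_integral_def)
    next
      case (compl A)
      then have [measurable]: "A \<in> sets borel" by (simp add: borel_eq_closed)
      have "set_lebesgue_integral lborel (UNIV - A) h = set_lebesgue_integral lborel UNIV h - set_lebesgue_integral lborel A h"
      proof -
        have ii: "integrable lborel (\<lambda>x. indicat_real B x *\<^sub>R h x)" if "B \<in> sets borel" for B
          using that h by (intro integrable_mult_indicator) auto
        have "(LINT x|lborel. indicat_real UNIV x *\<^sub>R h x) - (LINT x|lborel. indicat_real A x *\<^sub>R h x)
            = (LINT x|lborel. indicat_real UNIV x *\<^sub>R h x - indicat_real A x *\<^sub>R h x)"
          by (intro Bochner_Integration.integral_diff[symmetric] ii) auto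
        also have "\<dots> = (LINT x|lborel. indicat_real (UNIV - A) x *\<^sub>R h x)"
          by (intro Bochner_Integration.integral_cong) (auto simp: indicator_def)
        finally show ?thesis unfolding set_lebesgue_integral_def by (rule sym)
      qed
      then show ?case using compl closed[of UNIV] by simp
    next
      case (union A)
      then have [measurable]: "A i \<in> sets borel" for i by (auto simp: borel_eq_closed)
      have "set_lebesgue_integral lborel (\<Union>i. A i) h = (\<Sum>i. set_lebesgue_integral lborel (A i) h)"
        using union(1) h
        by (intro lebesgue_integral_countable_add)
          (auto simp: disjoint_family_on_def set_integrable_def intro!: integrable_mult_indicator)
      moreover have "set_lebesgue_integral lborel (A i) h = 0" for i
        using union(2) by (intro union(3)) auto
      ultimately show ?case by simp
    qed (use sigma in auto)
  qed
  then show ?thesis by (intro sigma_finite_measure.density_zero[OF sigma_finite_lborel] h) auto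
qed

lemma schwartz_polynomial_mult:
  fixes f :: "real^'d::finite \<Rightarrow> complex"
  assumes "real_polynomial_function P" "f \<in> schwartz"
  shows "(\<lambda>x. of_real (P x) * f x) \<in> schwartz"
  using assms
proof (induction arbitrary: f)
  case (linear L)
  have "(\<lambda>x. of_real (L x) * f x) = (\<lambda>x. \<Sum>i\<in>UNIV. of_real (L (axis i 1)) * (of_real (x $ i) * f x))"
  proof
    fix x
    have "L x = L (\<Sum>i\<in>UNIV. (x $ i) *\<^sub>R axis i 1)"
      using basis_expansion[of x] by (simp add: scalar_mult_eq_scaleR)
    also have "\<dots> = (\<Sum>i\<in>UNIV. x $ i * L (axis i 1))"
      using bounded_linear.linear[OF linear(1)] by (simp add: linear_sum linear_scale)
    finally show "of_real (L x) * f x = (\<Sum>i\<in>UNIV. of_real (L (axis i 1)) * (of_real (x $ i) * f x))"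
      by (simp add: sum_distrib_left sum_distrib_right ac_simps)
  qed
  then show ?case
    by (simp only:) (intro schwartz_sum schwartz_cmult schwartz_coord_mult linear)
next
  case (const c)
  then show ?case by (rule schwartz_cmult)
next
  case (add g h)
  then show ?case by (simp add: distrib_right schwartz_add)
next
  case (mult g h)
  then show ?case by (simp add: mult.assoc)
qed

text \<open>The difference of the two functions, cut off by a dilate of \<rho>, is compactly
  supported and annihilates every polynomial. The cut-offs equal 1 on growing balls that exhaust the
  space. The bump \<phi>0 of the resolution is the \<rho> used later.\<close>

lemma represents_unique:
  fixes \<rho> g h :: "real^'d::finite \<Rightarrow> complex"
  assumes \<rho>: "\<rho> \<in> schwartz" "\<And>x. norm x \<le> 1 \<Longrightarrow> \<rho> x = 1" "\<And>x. norm x > 2 \<Longrightarrow> \<rho> x = 0"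
    and g: "represents g u" and h: "represents h u"
  shows "AE x in lborel. g x = h x"
proof -
  have [measurable]: "g \<in> borel_measurable borel" "h \<in> borel_measurable borel"
    using g h by (auto simp: represents_def)
  have "AE x in lborel. (g x - h x) * \<rho> ((1 / real (Suc n)) *\<^sub>R x) = 0" for n
  proof (rule AE_zero_of_polynomials)
    let ?\<rho> = "\<lambda>x. \<rho> ((1 / real (Suc n)) *\<^sub>R x)"
    have S: "?\<rho> \<in> schwartz" by (intro schwartz_dilate \<rho>) simp
    have int: "integrable lborel (\<lambda>x. g x * f x)" "integrable lborel (\<lambda>x. h x * f x)"
      "(LINT x|lborel. g x * f x) = (LINT x|lborel. h x * f x)" if "f \<in> schwartz" for f
      using that g h by (auto simp: represents_def)
    show "integrable lborel (\<lambda>x. (g x - h x) * ?\<rho> x)"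
      using int(1,2)[OF S] by (simp add: left_diff_distrib)
    show "(g x - h x) * ?\<rho> x = 0" if "norm x > 2 * real (Suc n)" for x
    proof -
      have "norm ((1 / real (Suc n)) *\<^sub>R x) > 2" using that by (simp add: field_simps)
      then show ?thesis by (simp only: \<rho>(3)) simp
    qed
    fix P :: "real^'d \<Rightarrow> real" assume P: "real_polynomial_function P"
    let ?f = "\<lambda>x. of_real (P x) * ?\<rho> x"
    have f: "?f \<in> schwartz" by (rule schwartz_polynomial_mult[OF P S])
    have "(LINT x|lborel. of_real (P x) * ((g x - h x) * ?\<rho> x)) = (LINT x|lborel. g x * ?f x - h x * ?f x)"
      by (simp add: algebra_simps)
    also have "\<dots> = 0"
      by (subst Bochner_Integration.integral_diff[OF int(1,2)[OF f]]) (simp only: int(3)[OF f] diff_self)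
    finally show "(LINT x|lborel. of_real (P x) * ((g x - h x) * ?\<rho> x)) = 0" .
  qed
  then have "AE x in lborel. \<forall>n. (g x - h x) * \<rho> ((1 / real (Suc n)) *\<^sub>R x) = 0"
    by (simp only: AE_all_countable) simp
  then show ?thesis
  proof eventually_elim
    case (elim x)
    obtain n where "norm x \<le> real n" using real_arch_simple by blast
    then have "norm ((1 / real (Suc n)) *\<^sub>R x) \<le> 1" by (simp add: field_simps)
    then have "\<rho> ((1 / real (Suc n)) *\<^sub>R x) = 1" by (rule \<rho>(2))
    with elim[rule_format, of n] show ?case by (simp only: mult_1_right right_minus_eq)
  qed
qed

lemma represents_fun_of:
  assumes "represents g u"
  shows "represents (fun_of u) u"
  using assms unfolding fun_of_def by (rule someI[of "\<lambda>g. represents g u"])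

lemma schwartz_norm_bound:
  fixes f :: "real^'d::finite \<Rightarrow> complex"
  assumes f: "f \<in> schwartz"
  shows "(1 + norm x) ^ N * cmod (f x) \<le> schwartz_norm N f"
proof -
  let ?S = "{is :: 'd list. length is \<le> N}"
  have fin: "finite ?S" using finite_lists_length_le[of "UNIV :: 'd set" N] by simp
  have "\<exists>C. \<forall>x. (1 + norm x) ^ N * cmod (iter_partial is f x) \<le> C" for "is"
  proof -
    have "iter_partial is f \<in> schwartz"
      by (induction "is") (auto simp: iter_partial_def f schwartz_partial)
    then show ?thesis using schwartz_decay by metis
  qed
  then obtain C where C: "\<And>is x. (1 + norm x) ^ N * cmod (iter_partial is f x) \<le> C is" by metis
  \<comment> \<open>A real supremum carries information only if bounded. Finitely many lists of
    directions have length at most N, so a maximum of single bounds suffices.\<close>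
  have bdd: "bdd_above ((\<lambda>(is, x). (1 + norm x) ^ N * cmod (iter_partial is f x)) ` (?S \<times> UNIV))"
  proof (rule bdd_aboveI2)
    fix z assume z: "z \<in> ?S \<times> (UNIV :: (real^'d) set)"
    have "(case z of (is, x) \<Rightarrow> (1 + norm x) ^ N * cmod (iter_partial is f x)) \<le> C (fst z)"
      using C by (simp add: case_prod_beta)
    also have "\<dots> \<le> Max (C ` ?S)" using z fin by (intro Max_ge) auto
    finally show "(case z of (is, x) \<Rightarrow> (1 + norm x) ^ N * cmod (iter_partial is f x)) \<le> Max (C ` ?S)" .
  qed
  have "(case ([], x) of (is, x) \<Rightarrow> (1 + norm x) ^ N * cmod (iter_partial is f x)) \<le> schwartz_norm N f"
    unfolding schwartz_norm_def by (intro cSUP_upper bdd) simp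
  then show ?thesis by (simp add: iter_partial_def)
qed

lemma tempered_of_bounded:
  fixes g :: "real^'d::finite \<Rightarrow> complex"
  assumes [measurable]: "g \<in> borel_measurable borel" and K: "\<And>x. cmod (g x) \<le> K"
  shows "(\<lambda>f. LINT x|lborel. g x * f x) \<in> tempered"
proof -
  have int: "integrable lborel (\<lambda>x. g x * f x)" if f: "f \<in> schwartz" for f
  proof (rule Bochner_Integration.integrable_bound)
    show "integrable lborel (\<lambda>x. of_real K * f x)" using schwartz_integrable[OF f] by simp
    have "K \<ge> 0" using norm_ge_zero order_trans K by blast
    then show "AE x in lborel. norm (g x * f x) \<le> norm (of_real K * f x)"
      using K by (auto simp: norm_mult intro!: mult_right_mono)
  qed (use schwartz_measurable[OF f] in simp)
  have "K \<ge> 0" using norm_ge_zero order_trans K by blast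
  let ?N = "CARD('d) + 2"
  let ?I = "LINT x|lborel. 1 / (1 + norm (x::real^'d)) ^ ?N"
  have bound: "cmod (LINT x|lborel. g x * f x) \<le> (K * ?I) * schwartz_norm ?N f" if f: "f \<in> schwartz" for f
  proof -
    have "cmod (LINT x|lborel. g x * f x) \<le> (LINT x|lborel. K * schwartz_norm ?N f * (1 / (1 + norm (x::real^'d)) ^ ?N))"
    proof (rule order_trans[OF integral_norm_bound Bochner_Integration.integral_mono])
      show "integrable lborel (\<lambda>x. cmod (g x * f x))" by (intro integrable_norm int f)
      show "integrable lborel (\<lambda>x. K * schwartz_norm ?N f * (1 / (1 + norm (x::real^'d)) ^ ?N))"
        using integrable_decay[where 'a="real^'d"] by (intro integrable_mult_right) simp
      fix x :: "real^'d"
      have "(1 + norm x) ^ ?N > 0" by (simp add: add_pos_nonneg)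
      then have "cmod (f x) \<le> schwartz_norm ?N f * (1 / (1 + norm x) ^ ?N)"
        using schwartz_norm_bound[OF f, of x ?N] by (simp add: field_simps)
      then have "cmod (g x) * cmod (f x) \<le> K * (schwartz_norm ?N f * (1 / (1 + norm x) ^ ?N))"
        using K \<open>K \<ge> 0\<close> by (intro mult_mono) auto
      then show "cmod (g x * f x) \<le> K * schwartz_norm ?N f * (1 / (1 + norm x) ^ ?N)"
        by (simp only: norm_mult mult.assoc)
    qed
    also have "\<dots> = K * schwartz_norm ?N f * ?I" by (rule integral_mult_right_zero)
    finally show ?thesis by (simp add: ac_simps)
  qed
  have "(LINT x|lborel. g x * (f x + h x)) = (LINT x|lborel. g x * f x) + (LINT x|lborel. g x * h x)"
    if "f \<in> schwartz" "h \<in> schwartz" for f h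
    using int[OF that(1)] int[OF that(2)] by (simp add: distrib_left)
  moreover have "(LINT x|lborel. g x * (c * f x)) = c * (LINT x|lborel. g x * f x)" for f c
    by (subst integral_mult_right_zero[symmetric]) (simp add: ac_simps)
  ultimately show ?thesis using bound unfolding tempered_def by blast
qed

section \<open>Lacunary trigonometric sums against band-limited weights\<close>

text \<open>From \<open>y / s \<le> exp (y / s)\<close>, raised to the power s. It turns exponential
  integrals into moments, and later lets a double exponential absorb powers.\<close>

lemma powr_le_exp:
  fixes y s :: real
  assumes s: "0 < s" and y: "0 \<le> y"
  shows "y powr s \<le> s powr s * exp y"
proof -
  have "y / s \<le> exp (y / s)" using exp_ge_add_one_self[of "y / s"] by linarith
  then have "(y / s) powr s \<le> exp (y / s) powr s" using s y by (intro powr_mono2) auto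
  then show ?thesis using s y by (simp add: powr_divide exp_powr_real field_simps)
qed

lemma cosh_le_exp_square:
  fixes a :: real
  assumes "0 \<le> a" "a \<le> 1"
  shows "cosh a \<le> exp (a\<^sup>2)"
proof -
  have "exp (- a) \<le> 1 - a + a\<^sup>2"
  proof -
    have "exp (- a) \<le> 1 / (1 + a)"
      using exp_ge_add_one_self[of a] assms by (simp add: exp_minus field_simps)
    also have "\<dots> \<le> 1 - a + a\<^sup>2"
      using assms by (simp add: field_simps power2_eq_square power3_eq_cube)
    finally show ?thesis .
  qed
  then have "cosh a \<le> 1 + a\<^sup>2"
    using exp_bound[of a] assms by (simp add: cosh_field_def)
  also have "\<dots> \<le> exp (a\<^sup>2)" by (rule exp_ge_add_one_self)
  finally show ?thesis .
qed

lemma exp_le_cosh_sinh: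
  fixes a y :: real
  assumes a: "0 < a" and y: "\<bar>y\<bar> \<le> a"
  shows "exp y \<le> cosh a + sinh a / a * y"
proof -
  let ?t = "(1 + y / a) / 2"
  have t: "0 \<le> ?t" "?t \<le> 1" using assms by (auto simp: field_simps abs_le_iff)
  have "exp ((1 - ?t) *\<^sub>R (- a) + ?t *\<^sub>R a) \<le> (1 - ?t) * exp (- a) + ?t * exp a"
    by (rule convex_onD[OF exp_convex t]) auto
  moreover have "(1 - ?t) *\<^sub>R (- a) + ?t *\<^sub>R a = y" using a by (simp add: field_simps)
  moreover have "(1 - ?t) * exp (- a) + ?t * exp a = cosh a + sinh a / a * y"
    using a by (simp add: cosh_field_def sinh_field_def field_simps)
  ultimately show ?thesis by simp
qed

locale lacunary_setting =
  fixes \<psi> \<phi>0 :: "real^'d::finite \<Rightarrow> complex" and i1 :: 'd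
  assumes psi: "\<psi> \<in> schwartz" and psi_nonzero: "\<psi> \<noteq> (\<lambda>x. 0)"
    and psi_supp: "supp (fourier \<psi>) \<subseteq> {\<xi>. norm \<xi> \<le> 2}"
    and phi0: "\<phi>0 \<in> schwartz" and phi0_supp: "supp \<phi>0 \<subseteq> {x. norm x \<le> 2}"
    and phi0_one: "\<And>x. norm x \<le> 1 \<Longrightarrow> \<phi>0 x = 1"
begin

definition freq :: "real \<Rightarrow> real^'d" where
  "freq \<mu> = \<mu> *\<^sub>R axis i1 1"

lemma inner_freq [simp]: "x \<bullet> freq \<mu> = \<mu> * (x $ i1)"
  by (simp add: freq_def inner_axis)

lemma norm_freq [simp]: "norm (freq \<mu>) = \<bar>\<mu>\<bar>"
  by (simp add: freq_def norm_axis_1)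

abbreviation osc :: "real \<Rightarrow> real^'d \<Rightarrow> complex" where
  "osc \<mu> x \<equiv> cis (\<mu> * (x $ i1))"

lemma osc_schwartz: "f \<in> schwartz \<Longrightarrow> (\<lambda>x. osc \<mu> x * f x) \<in> schwartz"
  using schwartz_cis_mult[of f "freq \<mu>"] by simp

lemma fourier_osc: "fourier (\<lambda>x. osc \<mu> x * f x) \<xi> = fourier f (\<xi> - freq \<mu>)"
  using fourier_modulate[of "freq \<mu>" f \<xi>] by simp

text \<open>The support condition by itself gives zero only beyond norm 2; continuity adds the
  sphere. The value on the sphere is what \<open>piece_small\<close> depends on.\<close>

lemma phi0_zero: "norm x \<ge> 2 \<Longrightarrow> \<phi>0 x = 0"
proof -
  have out: "\<phi>0 x = 0" if "norm x > 2" for x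
    using that phi0_supp closure_subset[of "{x. \<phi>0 x \<noteq> 0}"] by (auto simp: supp_def)
  assume x: "norm x \<ge> 2"
  have "(\<lambda>n. (1 + inverse (real (Suc n))) *\<^sub>R x) \<longlonglongrightarrow> (1 + 0) *\<^sub>R x"
    by (intro tendsto_intros LIMSEQ_inverse_real_of_nat)
  then have lim: "(\<lambda>n. \<phi>0 ((1 + inverse (real (Suc n))) *\<^sub>R x)) \<longlonglongrightarrow> \<phi>0 x"
    using schwartz_continuous[OF phi0, of UNIV]
    by (intro isCont_tendsto_compose[of _ \<phi>0]) (auto simp: continuous_on_eq_continuous_at)
  have "\<phi>0 ((1 + inverse (real (Suc n))) *\<^sub>R x) = 0" for n
  proof (rule out)
    have "inverse (real (Suc n)) * norm x > 0" using x by (intro mult_pos_pos) auto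
    then have "2 < (1 + inverse (real (Suc n))) * norm x" using x by (simp add: distrib_right)
    then show "2 < norm ((1 + inverse (real (Suc n))) *\<^sub>R x)" by simp
  qed
  with lim show ?thesis by (simp add: LIMSEQ_const_iff)
qed

lemma fun_of_AE:
  fixes g :: "real^'d \<Rightarrow> complex"
  assumes "represents g u"
  shows "AE x in lborel. fun_of u x = g x" "fun_of u \<in> borel_measurable borel"
proof -
  show "AE x in lborel. fun_of u x = g x"
    by (rule represents_unique[of \<phi>0])
      (use phi0 phi0_one phi0_zero represents_fun_of[OF assms] assms in auto)
  show "fun_of u \<in> borel_measurable borel"
    using represents_fun_of[OF assms] by (simp add: represents_def)
qed

definition \<kappa> :: complex where
  "\<kappa> = (SOME \<kappa>. \<kappa> \<noteq> 0 \<and> (\<forall>f\<in>schwartz. \<forall>x. inv_fourier (fourier f) (x :: real^'d) = \<kappa> * f x))"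

lemma kappa: "\<kappa> \<noteq> 0" "f \<in> schwartz \<Longrightarrow> inv_fourier (fourier f) (x :: real^'d) = \<kappa> * f x"
proof -
  have "\<phi>0 0 = 1" by (rule phi0_one) simp
  have "\<exists>\<kappa>. \<kappa> \<noteq> 0 \<and> (\<forall>f\<in>schwartz. \<forall>x. inv_fourier (fourier f) (x :: real^'d) = \<kappa> * f x)"
  proof (rule fourier_inversion[OF phi0 \<open>\<phi>0 0 = 1\<close>])
    fix k assume "k \<noteq> 0" and k: "\<And>f x. f \<in> schwartz \<Longrightarrow> inv_fourier (fourier f) (x :: real^'d) = k * f x"
    then show ?thesis by (intro exI[of _ k]) simp
  qed
  from someI_ex[OF this]
  have *: "\<kappa> \<noteq> 0 \<and> (\<forall>f\<in>schwartz. \<forall>x. inv_fourier (fourier f) (x :: real^'d) = \<kappa> * f x)"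
    unfolding \<kappa>_def .
  show "\<kappa> \<noteq> 0" using * by (rule conjunct1)
  show "f \<in> schwartz \<Longrightarrow> inv_fourier (fourier f) (x :: real^'d) = \<kappa> * f x"
    by (rule *[THEN conjunct2, rule_format])
qed

text \<open>The weights against which lacunary sums are integrated. Besides \<psi> itself these
  include its translates and the differences of a translate and \<psi>, which appear when a
  difference operator falls on the product.\<close>

definition band :: "(real^'d \<Rightarrow> complex) set" where
  "band = {f \<in> schwartz. \<forall>\<xi>. norm \<xi> > 2 \<longrightarrow> fourier f \<xi> = 0}"

lemma band_schwartz: "f \<in> band \<Longrightarrow> f \<in> schwartz"
  by (simp add: band_def)

lemma psi_band: "\<psi> \<in> band"
  using psi psi_supp closure_subset[of "{x. fourier \<psi> x \<noteq> 0}"] by (auto simp: supp_def band_def)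

lemma shift_band: "f \<in> band \<Longrightarrow> (\<lambda>x. f (x + h)) \<in> band"
  by (auto simp: band_def schwartz_shift fourier_shift schwartz_measurable)

lemma diff_band: "f \<in> band \<Longrightarrow> g \<in> band \<Longrightarrow> (\<lambda>x. f x - g x) \<in> band"
  using fourier_lincomb[of f g 1 "-1"] by (auto simp: band_def schwartz_diff schwartz_integrable)

text \<open>After modulation the two spectra lie in balls of radius 2 with centres more than 4
  apart, so the product of the transforms vanishes pointwise and Parseval's identity
  applies.\<close>

lemma band_orthogonal:
  assumes f: "f \<in> band" and g: "g \<in> band" and \<nu>: "\<bar>\<nu>\<bar> > 4"
  shows "(LINT x|lborel. osc \<nu> x * (f x * cnj (g x))) = 0"
proof -
  have 0: "fourier (\<lambda>x. osc \<nu> x * f x) \<xi> * cnj (fourier g \<xi>) = 0" for \<xi>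
  proof (cases "norm \<xi> > 2")
    case False
    have "\<bar>\<nu>\<bar> \<le> norm \<xi> + norm (\<xi> - freq \<nu>)"
      using norm_triangle_ineq4[of \<xi> "\<xi> - freq \<nu>"] by simp
    with False \<nu> have "norm (\<xi> - freq \<nu>) > 2" by simp
    then show ?thesis using f by (simp add: fourier_osc band_def)
  qed (use g in \<open>simp add: band_def\<close>)
  have "\<kappa> * (LINT x|lborel. (osc \<nu> x * f x) * cnj (g x)) = 0"
    using parseval[of "\<lambda>x. osc \<nu> x * f x" g \<kappa>] kappa f g osc_schwartz band_schwartz 0 by simp
  then show ?thesis using kappa by (simp add: mult.assoc)
qed

text \<open>A Riesz product with free constant terms \<open>\<alpha> j\<close> in place of 1; they
  become values of cosh, the constant terms of chords of the exponential.\<close>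

definition riesz :: "nat \<Rightarrow> (nat \<Rightarrow> real) \<Rightarrow> (nat \<Rightarrow> complex) \<Rightarrow> real^'d \<Rightarrow> real" where
  "riesz n \<alpha> c x = (\<Prod>j\<in>{3..<n}. \<alpha> j + Re (c j * osc (lac_freq j) x))"

lemma riesz_measurable [measurable]: "riesz n \<alpha> c \<in> borel_measurable borel"
  unfolding riesz_def by measurable

lemma riesz_bound: "\<bar>riesz n \<alpha> c x\<bar> \<le> (\<Prod>j\<in>{3..<n}. \<bar>\<alpha> j\<bar> + cmod (c j))"
  unfolding riesz_def abs_prod
proof (intro prod_mono conjI)
  fix j
  have "\<bar>Re (c j * osc (lac_freq j) x)\<bar> \<le> cmod (c j)"
    using abs_Re_le_cmod[of "c j * osc (lac_freq j) x"] by (simp only: norm_mult norm_cis mult_1_right)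
  then show "\<bar>\<alpha> j + Re (c j * osc (lac_freq j) x)\<bar> \<le> \<bar>\<alpha> j\<bar> + cmod (c j)" by linarith
qed simp

lemma riesz_mult_integrable:
  assumes q: "integrable lborel q"
  shows "integrable lborel (\<lambda>x. osc \<nu> x * (of_real (riesz n \<alpha> c x) * q x))"
proof (rule Bochner_Integration.integrable_bound)
  have [measurable]: "q \<in> borel_measurable borel" using q by (auto dest: borel_measurable_integrable)
  let ?K = "\<Prod>j\<in>{3..<n}. \<bar>\<alpha> j\<bar> + cmod (c j)"
  show "integrable lborel (\<lambda>x. of_real ?K * q x)" using q by simp
  show "(\<lambda>x. osc \<nu> x * (of_real (riesz n \<alpha> c x) * q x)) \<in> borel_measurable lborel" by simp
  have "norm (osc \<nu> x * (of_real (riesz n \<alpha> c x) * q x)) \<le> norm (of_real ?K * q x)" for x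
  proof -
    have "\<bar>riesz n \<alpha> c x\<bar> * cmod (q x) \<le> \<bar>?K\<bar> * cmod (q x)"
      using riesz_bound[of n \<alpha> c x] by (intro mult_right_mono) auto
    then show ?thesis by (simp only: norm_mult norm_cis norm_of_real mult_1_left)
  qed
  then show "AE x in lborel. norm (osc \<nu> x * (of_real (riesz n \<alpha> c x) * q x)) \<le> norm (of_real ?K * q x)"
    by blast
qed

text \<open>The frequencies of the Riesz product over \<open>j < n\<close> have modulus at most \<open>2 ^ n - 2 * n - 2\<close>,
  the sum of the \<open>\<lambda>\<^sub>j\<close>, which stays more than \<open>4\<close> below \<open>\<lambda>\<^sub>n\<close>.\<close>

lemma riesz_integral:
  assumes \<theta>: "\<theta> \<in> band" and n: "3 \<le> n"
  shows "\<nu> = 0 \<or> \<bar>\<nu>\<bar> > 4 + (2 ^ n - 2 * real n - 2) \<Longrightarrow>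
    (LINT x|lborel. osc \<nu> x * (of_real (riesz n \<alpha> c x) * (\<theta> x * cnj (\<theta> x))))
      = (if \<nu> = 0 then of_real (\<Prod>j\<in>{3..<n}. \<alpha> j) * (LINT x|lborel. \<theta> x * cnj (\<theta> x)) else 0)"
  using n
proof (induction n arbitrary: \<nu> rule: dec_induct)
  case base
  then show ?case
    using band_orthogonal[OF \<theta> \<theta>, of \<nu>] by (auto simp: riesz_def)
next
  case (step n)
  note [measurable] = schwartz_measurable[OF band_schwartz[OF \<theta>]]
  let ?q = "\<lambda>x. \<theta> x * cnj (\<theta> x)"
  let ?I = "\<lambda>\<nu>. LINT x|lborel. osc \<nu> x * (of_real (riesz n \<alpha> c x) * ?q x)"
  have q: "integrable lborel ?q"
    using \<theta> by (intro schwartz_mult_integrable schwartz_cnj band_schwartz)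
  have int: "integrable lborel (\<lambda>x. osc \<nu> x * (of_real (riesz n \<alpha> c x) * ?q x))" for \<nu>
    by (rule riesz_mult_integrable[OF q])
  let ?l = "lac_freq n"
  have l: "?l = 2 ^ n - 2" by (simp add: lac_freq_def)
  \<comment> \<open>Expanding the last factor shifts the frequency by 0 or by plus or minus
    \<open>?l\<close>; this is why the induction keeps \<nu> general.\<close>
  have pt: "osc \<nu> x * (of_real (riesz (Suc n) \<alpha> c x) * ?q x)
      = of_real (\<alpha> n) * (osc \<nu> x * (of_real (riesz n \<alpha> c x) * ?q x))
      + (c n / 2) * (osc (\<nu> + ?l) x * (of_real (riesz n \<alpha> c x) * ?q x))
      + (cnj (c n) / 2) * (osc (\<nu> - ?l) x * (of_real (riesz n \<alpha> c x) * ?q x))" for x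
  proof -
    have r: "riesz (Suc n) \<alpha> c x = riesz n \<alpha> c x * (\<alpha> n + Re (c n * osc ?l x))"
      using step by (simp add: riesz_def prod.atLeastLessThan_Suc)
    have re: "complex_of_real (Re (c n * osc ?l x)) = (c n * osc ?l x + cnj (c n) * osc (- ?l) x) / 2"
      using complex_add_cnj[of "c n * osc ?l x"] by (simp add: cis_cnj)
    have "osc (\<nu> + ?l) x = osc \<nu> x * osc ?l x" "osc (\<nu> - ?l) x = osc \<nu> x * osc (- ?l) x"
      by (simp_all add: cis_mult algebra_simps)
    then show ?thesis unfolding r of_real_mult of_real_add re by (simp add: algebra_simps add_divide_distrib)
  qed
  have eq: "(LINT x|lborel. osc \<nu> x * (of_real (riesz (Suc n) \<alpha> c x) * ?q x))
      = of_real (\<alpha> n) * ?I \<nu> + (c n / 2) * ?I (\<nu> + ?l) + (cnj (c n) / 2) * ?I (\<nu> - ?l)"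
    unfolding pt using int by simp
  have pow: "2 ^ Suc n = 2 * (2::real) ^ n" by simp
  have n3: "real n \<ge> 3" using step by simp
  have "2 ^ n \<ge> 2 * real n + 2"
  proof -
    have "2 * n + 2 \<le> 2 ^ n" using step(1) by (induction n rule: dec_induct) auto
    then have "real (2 * n + 2) \<le> real (2 ^ n)" by (simp only: of_nat_le_iff)
    then show ?thesis by simp
  qed
  \<comment> \<open>Subtracting \<open>?l\<close> from the bound for \<open>Suc n\<close> gives
    exactly the bound for n, so shifted frequencies stay admissible. For \<nu> = 0 the inequality
    amounts to 2 n > 4.\<close>
  then have "\<bar>\<nu> + ?l\<bar> > 4 + (2 ^ n - 2 * real n - 2)" "\<bar>\<nu> - ?l\<bar> > 4 + (2 ^ n - 2 * real n - 2)"
    "\<nu> = 0 \<or> \<bar>\<nu>\<bar> > 4 + (2 ^ n - 2 * real n - 2)"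
    using step.prems n3 unfolding l pow by (auto simp: abs_if split: if_splits)
  moreover have "\<nu> + ?l \<noteq> 0" "\<nu> - ?l \<noteq> 0"
    using calculation \<open>2 ^ n \<ge> 2 * real n + 2\<close> by auto
  ultimately have "?I (\<nu> + ?l) = 0" "?I (\<nu> - ?l) = 0"
    "?I \<nu> = (if \<nu> = 0 then of_real (\<Prod>j\<in>{3..<n}. \<alpha> j) * (LINT x|lborel. ?q x) else 0)"
    using step.IH[of "\<nu> + ?l"] step.IH[of "\<nu> - ?l"] step.IH[of \<nu>] by auto
  then show ?case
    unfolding eq using step(1) by (simp add: prod.atLeastLessThan_Suc)
qed

definition lac_sum :: "nat \<Rightarrow> (nat \<Rightarrow> complex) \<Rightarrow> real^'d \<Rightarrow> complex" where
  "lac_sum n c x = (\<Sum>j\<in>{3..<n}. c j * osc (lac_freq j) x)"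

lemma lac_sum_measurable [measurable]: "lac_sum n c \<in> borel_measurable borel"
  unfolding lac_sum_def by measurable

lemma lac_sum_cmult: "lac_sum n (\<lambda>j. a * c j) x = a * lac_sum n c x"
  by (simp add: lac_sum_def sum_distrib_left mult.assoc)

text \<open>The exponential of a lacunary sum is dominated by a Riesz product, because \<open>exp y\<close> lies below
  its chord on \<open>[-a, a]\<close>; this replaces the combinatorics of moments.\<close>

lemma exp_lac_sum_integral:
  assumes \<theta>: "\<theta> \<in> band" and c: "\<And>j. cmod (c j) \<le> 1"
  shows "(\<integral>\<^sup>+x. ennreal (cmod (\<theta> x) ^ 2 * exp (Re (lac_sum n c x))) \<partial>lborel)
    \<le> ennreal (exp (\<Sum>j\<in>{3..<n}. (cmod (c j))\<^sup>2) * (LINT x|lborel. (cmod (\<theta> x))\<^sup>2))"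
proof -
  note [measurable] = schwartz_measurable[OF band_schwartz[OF \<theta>]]
  \<comment> \<open>\<open>riesz_integral\<close> starts at 3; for smaller n the index set is empty
    before and after the change.\<close>
  define N where "N = max n 3"
  have N: "{3..<n} = {3..<N}" "3 \<le> N" by (auto simp: N_def)
  \<comment> \<open>Constant term of the chord of exp on the interval of radius
    \<open>cmod (c j)\<close>; the next line scales the coefficient by the slope. For
    \<open>c j = 0\<close> the quotient is 0 by convention and the factor is 1.\<close>
  define \<alpha> where "\<alpha> j = cosh (cmod (c j))" for j
  define d where "d j = of_real (sinh (cmod (c j)) / cmod (c j)) * c j" for j
  have factor: "exp (Re (c j * osc (lac_freq j) x)) \<le> \<alpha> j + Re (d j * osc (lac_freq j) x)" for j x
  proof (cases "c j = 0")
    case False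
    have "\<bar>Re (c j * osc (lac_freq j) x)\<bar> \<le> cmod (c j)"
      using abs_Re_le_cmod[of "c j * osc (lac_freq j) x"] by (simp only: norm_mult norm_cis mult_1_right)
    then have "exp (Re (c j * osc (lac_freq j) x)) \<le> cosh (cmod (c j)) + sinh (cmod (c j)) / cmod (c j) * Re (c j * osc (lac_freq j) x)"
      using False by (intro exp_le_cosh_sinh) auto
    also have "\<dots> = \<alpha> j + Re (d j * osc (lac_freq j) x)"
      unfolding \<alpha>_def d_def by (simp only: mult.assoc scaleR_conv_of_real[symmetric]) simp
    finally show ?thesis .
  qed (simp add: \<alpha>_def d_def)
  have exp_le: "exp (Re (lac_sum n c x)) \<le> riesz N \<alpha> d x" for x
    unfolding lac_sum_def riesz_def N Re_sum exp_sum[OF finite_atLeastLessThan]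
    by (intro prod_mono conjI factor) simp
  let ?q = "\<lambda>x. \<theta> x * cnj (\<theta> x)"
  have q: "integrable lborel ?q"
    using \<theta> by (intro schwartz_mult_integrable schwartz_cnj band_schwartz)
  have qr: "?q x = of_real ((cmod (\<theta> x))\<^sup>2)" for x by (simp only: complex_norm_square)
  have int: "integrable lborel (\<lambda>x. riesz N \<alpha> d x * (cmod (\<theta> x))\<^sup>2)"
  proof -
    have "integrable lborel (\<lambda>x. Re (osc 0 x * (of_real (riesz N \<alpha> d x) * ?q x)))"
      by (intro integrable_Re riesz_mult_integrable q)
    then show ?thesis unfolding qr by simp
  qed
  have "(LINT x|lborel. riesz N \<alpha> d x * (cmod (\<theta> x))\<^sup>2) = (\<Prod>j\<in>{3..<N}. \<alpha> j) * (LINT x|lborel. (cmod (\<theta> x))\<^sup>2)"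
  proof -
    have "complex_of_real (LINT x|lborel. riesz N \<alpha> d x * (cmod (\<theta> x))\<^sup>2) = (LINT x|lborel. osc 0 x * (of_real (riesz N \<alpha> d x) * ?q x))"
      unfolding qr by (simp add: integral_complex_of_real[symmetric] del: integral_complex_of_real)
    also have "\<dots> = of_real (\<Prod>j\<in>{3..<N}. \<alpha> j) * (LINT x|lborel. ?q x)"
      using riesz_integral[OF \<theta> N(2), of 0 \<alpha> d] by simp
    also have "\<dots> = complex_of_real ((\<Prod>j\<in>{3..<N}. \<alpha> j) * (LINT x|lborel. (cmod (\<theta> x))\<^sup>2))"
      unfolding qr by (simp only: of_real_mult integral_complex_of_real)
    finally show ?thesis by (simp only: of_real_eq_iff)
  qed
  also have "\<dots> \<le> exp (\<Sum>j\<in>{3..<n}. (cmod (c j))\<^sup>2) * (LINT x|lborel. (cmod (\<theta> x))\<^sup>2)"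
  proof (intro mult_right_mono Bochner_Integration.integral_nonneg)
    show "(\<Prod>j\<in>{3..<N}. \<alpha> j) \<le> exp (\<Sum>j\<in>{3..<n}. (cmod (c j))\<^sup>2)"
      unfolding N exp_sum[OF finite_atLeastLessThan] \<alpha>_def
      using c by (intro prod_mono conjI cosh_le_exp_square) (auto intro: less_imp_le)
  qed simp
  finally have le: "(LINT x|lborel. riesz N \<alpha> d x * (cmod (\<theta> x))\<^sup>2) \<le> exp (\<Sum>j\<in>{3..<n}. (cmod (c j))\<^sup>2) * (LINT x|lborel. (cmod (\<theta> x))\<^sup>2)" .
  have "(\<integral>\<^sup>+x. ennreal (cmod (\<theta> x) ^ 2 * exp (Re (lac_sum n c x))) \<partial>lborel)
      \<le> (\<integral>\<^sup>+x. ennreal (riesz N \<alpha> d x * (cmod (\<theta> x))\<^sup>2) \<partial>lborel)"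
    unfolding mult.commute[of "cmod _ ^ 2"]
    by (intro nn_integral_mono ennreal_leI mult_right_mono exp_le) simp
  also have "\<dots> = ennreal (LINT x|lborel. riesz N \<alpha> d x * (cmod (\<theta> x))\<^sup>2)"
  proof (intro nn_integral_eq_integral int AE_I2 mult_nonneg_nonneg)
    fix x
    show "0 \<le> riesz N \<alpha> d x" using exp_le[of x] exp_ge_zero order_trans by blast
  qed simp
  also have "\<dots> \<le> ennreal (exp (\<Sum>j\<in>{3..<n}. (cmod (c j))\<^sup>2) * (LINT x|lborel. (cmod (\<theta> x))\<^sup>2))"
    using le by (rule ennreal_leI)
  finally show ?thesis .
qed

text \<open>Once the square sum is normalised to 1, the modulus of the sum is at most twice the
  larger of |Re| and |Im|, and the exponential of the latter is dominated by the exponentials of the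
  real part in the four directions 1, -1, i, -i. Each of these integrals costs \<open>exp 1\<close>,
  which gives \<open>4 * exp 1\<close>.\<close>

lemma lac_sum_moment:
  assumes \<theta>: "\<theta> \<in> band" and s: "0 < s"
  shows "(\<integral>\<^sup>+x. ennreal (cmod (\<theta> x) ^ 2 * cmod (lac_sum n c x) powr s) \<partial>lborel)
    \<le> ennreal (4 * exp 1 * (2 * s) powr s * sqrt (\<Sum>j\<in>{3..<n}. (cmod (c j))\<^sup>2) powr s * (LINT x|lborel. (cmod (\<theta> x))\<^sup>2))"
    (is "_ \<le> ennreal (_ * _ * ?\<sigma> powr s * ?E)")
proof (cases "?\<sigma> = 0")
  case True
  then have "\<And>j. j \<in> {3..<n} \<Longrightarrow> c j = 0" by (simp add: sum_nonneg_eq_0_iff)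
  then have "lac_sum n c x = 0" for x by (simp add: lac_sum_def)
  then show ?thesis by simp
next
  case False
  note [measurable] = schwartz_measurable[OF band_schwartz[OF \<theta>]]
  have \<sigma>: "?\<sigma> > 0" using False sum_nonneg[of "{3..<n}" "\<lambda>j. (cmod (c j))\<^sup>2"] by simp
  \<comment> \<open>Set to zero outside the window because the exponential estimate wants every
    coefficient bounded by 1, while those outside are arbitrary.\<close>
  define c' where "c' j = (if j \<in> {3..<n} then c j / of_real ?\<sigma> else 0)" for j
  have E: "?E \<ge> 0" by (rule Bochner_Integration.integral_nonneg) simp
  have sum1: "(\<Sum>j\<in>{3..<n}. (cmod (c' j))\<^sup>2) = 1"
  proof -
    have "(\<Sum>j\<in>{3..<n}. (cmod (c' j))\<^sup>2) = (\<Sum>j\<in>{3..<n}. (cmod (c j))\<^sup>2) / ?\<sigma>\<^sup>2"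
      using \<sigma> by (simp add: c'_def norm_divide power_divide sum_divide_distrib[symmetric] sum_nonneg)
    then show ?thesis using \<sigma> by (simp add: sum_nonneg)
  qed
  have c'1: "cmod (a * c' j) \<le> 1" if "cmod a = 1" for a j
  proof (cases "j \<in> {3..<n}")
    case True
    have "(cmod (c' j))\<^sup>2 \<le> (\<Sum>j\<in>{3..<n}. (cmod (c' j))\<^sup>2)"
      using True by (intro member_le_sum) auto
    then show ?thesis using that unfolding sum1 by (simp add: norm_mult power_le_one_iff abs_square_le_1)
  next
    case False
    then have "c' j = 0" by (simp only: c'_def if_False)
    then show ?thesis by simp
  qed
  let ?W = "lac_sum n c'"
  have W: "lac_sum n c x = of_real ?\<sigma> * ?W x" for x
    unfolding lac_sum_def sum_distrib_left
    using \<sigma> by (intro sum.cong) (auto simp: c'_def)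
  have part: "(\<integral>\<^sup>+x. ennreal (cmod (\<theta> x) ^ 2 * exp (Re (a * ?W x))) \<partial>lborel) \<le> ennreal (exp 1 * ?E)" if "cmod a = 1" for a
    using exp_lac_sum_integral[OF \<theta>, of "\<lambda>j. a * c' j" n, OF c'1[OF that]] sum1 that
    unfolding lac_sum_cmult by (simp only: norm_mult mult_1_left)
  have pt: "cmod (lac_sum n c x) powr s \<le> ?\<sigma> powr s * (2 * s) powr s *
      (exp (Re (1 * ?W x)) + exp (Re (- 1 * ?W x)) + exp (Re (\<i> * ?W x)) + exp (Re (- \<i> * ?W x)))" for x
  proof -
    let ?y = "max \<bar>Re (?W x)\<bar> \<bar>Im (?W x)\<bar>"
    have "cmod (?W x) \<le> 2 * ?y" using cmod_le[of "?W x"] by linarith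
    then have "cmod (?W x) powr s \<le> (2 * ?y) powr s" using s by (intro powr_mono2) auto
    also have "\<dots> = 2 powr s * ?y powr s" by (simp add: powr_mult)
    also have "\<dots> \<le> 2 powr s * (s powr s * exp ?y)" using s by (intro mult_left_mono powr_le_exp) auto
    also have "\<dots> = (2 * s) powr s * exp ?y" using s by (simp add: powr_mult)
    also have "exp ?y \<le> exp (Re (1 * ?W x)) + exp (Re (- 1 * ?W x)) + exp (Re (\<i> * ?W x)) + exp (Re (- \<i> * ?W x))"
      by (auto simp: max_def abs_if add_nonneg_nonneg intro: add_increasing add_increasing2)
    finally show ?thesis
      using \<sigma> unfolding W by (simp add: norm_mult powr_mult mult.assoc mult_left_mono)
  qed
  let ?K = "?\<sigma> powr s * (2 * s) powr s"
  have "(\<integral>\<^sup>+x. ennreal (cmod (\<theta> x) ^ 2 * cmod (lac_sum n c x) powr s) \<partial>lborel)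
      \<le> (\<integral>\<^sup>+x. ennreal ?K * (ennreal (cmod (\<theta> x) ^ 2 * exp (Re (1 * ?W x))) + ennreal (cmod (\<theta> x) ^ 2 * exp (Re (- 1 * ?W x)))
        + ennreal (cmod (\<theta> x) ^ 2 * exp (Re (\<i> * ?W x))) + ennreal (cmod (\<theta> x) ^ 2 * exp (Re (- \<i> * ?W x)))) \<partial>lborel)"
  proof (rule nn_integral_mono)
    fix x
    have "cmod (\<theta> x) ^ 2 * cmod (lac_sum n c x) powr s \<le> cmod (\<theta> x) ^ 2 * (?K *
      (exp (Re (1 * ?W x)) + exp (Re (- 1 * ?W x)) + exp (Re (\<i> * ?W x)) + exp (Re (- \<i> * ?W x))))"
      by (intro mult_left_mono pt) simp
    also have "\<dots> = ?K * (cmod (\<theta> x) ^ 2 * exp (Re (1 * ?W x)) + cmod (\<theta> x) ^ 2 * exp (Re (- 1 * ?W x))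
        + cmod (\<theta> x) ^ 2 * exp (Re (\<i> * ?W x)) + cmod (\<theta> x) ^ 2 * exp (Re (- \<i> * ?W x)))"
      by (simp add: algebra_simps)
    finally show "ennreal (cmod (\<theta> x) ^ 2 * cmod (lac_sum n c x) powr s) \<le> ennreal ?K * (ennreal (cmod (\<theta> x) ^ 2 * exp (Re (1 * ?W x))) + ennreal (cmod (\<theta> x) ^ 2 * exp (Re (- 1 * ?W x)))
        + ennreal (cmod (\<theta> x) ^ 2 * exp (Re (\<i> * ?W x))) + ennreal (cmod (\<theta> x) ^ 2 * exp (Re (- \<i> * ?W x))))"
      by (simp add: ennreal_mult[symmetric] ennreal_plus[symmetric] ennreal_leI del: ennreal_plus)
  qed
  also have "\<dots> \<le> ennreal ?K * (ennreal (exp 1 * ?E) + ennreal (exp 1 * ?E) + ennreal (exp 1 * ?E) + ennreal (exp 1 * ?E))"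
  proof -
    have [measurable]: "(\<lambda>x. ennreal (cmod (\<theta> x) ^ 2 * exp (Re (a * ?W x)))) \<in> borel_measurable lborel" for a
      by simp
    show ?thesis
      apply (subst nn_integral_cmult, measurable)
      apply (subst nn_integral_add, measurable)+
      apply (intro mult_left_mono add_mono part)
          apply simp_all
      done
  qed
  also have "\<dots> = ennreal (4 * exp 1 * (2 * s) powr s * ?\<sigma> powr s * ?E)"
    using E by (simp add: ennreal_mult[symmetric] ennreal_plus[symmetric] del: ennreal_plus)
  finally show ?thesis .
qed

text \<open>The upper half of Zygmund's inequality. The integrand is split as |\<theta>| |W|^p times
  |\<theta>|^(p - 1) and treated by Cauchy-Schwarz, so that the moment bound with weight
  |\<theta>|^2 applies. The weight enters only through its decay constant D, and linearly: a weight
  that is small with the step of a difference gives a small norm.\<close>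

lemma Lp_norm_lac_sum:
  fixes p :: real
  assumes p: "1 < p"
  obtains M :: nat and C :: real where "C > 0"
    "\<And>\<theta> D n c. \<theta> \<in> band \<Longrightarrow> D \<ge> 0 \<Longrightarrow> (\<And>x. cmod (\<theta> x) \<le> D / (1 + norm x) ^ M) \<Longrightarrow>
      Lp_norm p (\<lambda>x. ennreal (cmod (\<theta> x * lac_sum n c x))) \<le> ennreal (C * D * sqrt (\<Sum>j\<in>{3..<n}. (cmod (c j))\<^sup>2))"
proof -
  define d where "d = CARD('d) + 2"
  \<comment> \<open>Decay order d makes |\<theta>|^2 integrable; the second entry makes
    |\<theta>|^(2 p - 2) integrable too, which takes many powers when p is close to 1.\<close>
  define M where "M = max d (nat \<lceil>real d / (2 * p - 2)\<rceil>)"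
  define I where "I = (LINT x|lborel. 1 / (1 + norm (x::real^'d)) ^ d)"
  have intd: "integrable lborel (\<lambda>x. 1 / (1 + norm (x::real^'d)) ^ d)"
    using integrable_decay[where 'a="real^'d"] by (simp add: d_def)
  have I: "I \<ge> 0" unfolding I_def by (rule Bochner_Integration.integral_nonneg) simp
  define A where "A = 4 * exp 1 * (2 * (2 * p)) powr (2 * p)"
  define C where "C = (A * I * I) powr (1 / (2 * p)) + 1"
  have A: "A > 0" using p by (simp add: A_def)
  have M1: "1 / (1 + norm x) ^ (2 * M) \<le> 1 / (1 + norm x) ^ d" for x :: "real^'d"
    by (intro divide_left_mono power_increasing mult_pos_pos zero_less_power) (auto simp: M_def add_pos_nonneg)
  have M2: "(1 / (1 + norm x) ^ M) powr (2 * p - 2) \<le> 1 / (1 + norm x) ^ d" for x :: "real^'d"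
  proof -
    have pos: "1 + norm x > 0" by (simp add: add_pos_nonneg)
    have "real d / (2 * p - 2) \<le> real M" unfolding M_def by linarith
    then have "real d \<le> real M * (2 * p - 2)" using p by (simp add: field_simps)
    then have "(1 + norm x) powr real d \<le> (1 + norm x) powr (real M * (2 * p - 2))"
      by (intro powr_mono) auto
    also have "\<dots> = ((1 + norm x) ^ M) powr (2 * p - 2)"
      using pos by (simp add: powr_powr flip: powr_realpow)
    finally have "1 / ((1 + norm x) ^ M) powr (2 * p - 2) \<le> 1 / (1 + norm x) ^ d"
      using pos by (intro divide_left_mono) (auto simp: powr_realpow)
    then show ?thesis using pos by (simp add: powr_divide)
  qed
  have "Lp_norm p (\<lambda>x. ennreal (cmod (\<theta> x * lac_sum n c x))) \<le> ennreal (C * D * sqrt (\<Sum>j\<in>{3..<n}. (cmod (c j))\<^sup>2))"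
    if \<theta>: "\<theta> \<in> band" and D: "D \<ge> 0" and bound: "\<And>x. cmod (\<theta> x) \<le> D / (1 + norm x) ^ M" for \<theta> D n c
  proof -
    note [measurable] = schwartz_measurable[OF band_schwartz[OF \<theta>]]
    let ?W = "lac_sum n c" and ?\<sigma> = "sqrt (\<Sum>j\<in>{3..<n}. (cmod (c j))\<^sup>2)"
    have \<sigma>: "?\<sigma> \<ge> 0" by (simp add: sum_nonneg)
    have E: "(LINT x|lborel. (cmod (\<theta> x))\<^sup>2) \<le> D\<^sup>2 * I"
    proof -
      have "(LINT x|lborel. (cmod (\<theta> x))\<^sup>2) \<le> (LINT x|lborel. D\<^sup>2 * (1 / (1 + norm (x::real^'d)) ^ d))"
      proof (rule Bochner_Integration.integral_mono)
        show "integrable lborel (\<lambda>x. (cmod (\<theta> x))\<^sup>2)"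
          using integrable_norm[OF schwartz_mult_integrable[OF band_schwartz[OF \<theta>] band_schwartz[OF \<theta>]]]
          by (simp add: norm_mult power2_eq_square)
        show "integrable lborel (\<lambda>x. D\<^sup>2 * (1 / (1 + norm (x::real^'d)) ^ d))" using intd by (rule integrable_mult_right)
        fix x
        have "(cmod (\<theta> x))\<^sup>2 \<le> (D / (1 + norm x) ^ M)\<^sup>2" by (intro power_mono bound) simp
        also have "\<dots> = D\<^sup>2 * (1 / (1 + norm x) ^ (2 * M))" by (simp add: power_divide power_mult[symmetric] mult.commute)
        also have "\<dots> \<le> D\<^sup>2 * (1 / (1 + norm x) ^ d)" by (intro mult_left_mono M1) simp
        finally show "(cmod (\<theta> x))\<^sup>2 \<le> D\<^sup>2 * (1 / (1 + norm x) ^ d)" .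
      qed
      then show ?thesis by (simp only: I_def integral_mult_right_zero)
    qed
    have first: "(\<integral>\<^sup>+x. epowr (ennreal (cmod (\<theta> x) * cmod (?W x) powr p)) 2 \<partial>lborel) \<le> ennreal (A * ?\<sigma> powr (2 * p) * (D\<^sup>2 * I))"
    proof -
      have "(\<integral>\<^sup>+x. epowr (ennreal (cmod (\<theta> x) * cmod (?W x) powr p)) 2 \<partial>lborel)
          = (\<integral>\<^sup>+x. ennreal (cmod (\<theta> x) ^ 2 * cmod (?W x) powr (2 * p)) \<partial>lborel)"
        by (simp add: powr_mult powr_powr mult.commute powr_numeral)
      also have "\<dots> \<le> ennreal (A * ?\<sigma> powr (2 * p) * (LINT x|lborel. (cmod (\<theta> x))\<^sup>2))"
        unfolding A_def using lac_sum_moment[OF \<theta>, of "2 * p" n c] p by simp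
      also have "\<dots> \<le> ennreal (A * ?\<sigma> powr (2 * p) * (D\<^sup>2 * I))"
        using A by (intro ennreal_leI mult_left_mono E) auto
      finally show ?thesis .
    qed
    have second: "(\<integral>\<^sup>+x. epowr (ennreal (cmod (\<theta> x) powr (p - 1))) 2 \<partial>lborel) \<le> ennreal (D powr (2 * p - 2) * I)"
    proof -
      have "(\<integral>\<^sup>+x. epowr (ennreal (cmod (\<theta> x) powr (p - 1))) 2 \<partial>lborel)
          \<le> (\<integral>\<^sup>+x. ennreal (D powr (2 * p - 2) * (1 / (1 + norm (x::real^'d)) ^ d)) \<partial>lborel)"
      proof (rule nn_integral_mono)
        fix x
        have "cmod (\<theta> x) powr (2 * p - 2) \<le> (D * (1 / (1 + norm x) ^ M)) powr (2 * p - 2)"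
          using p bound[of x] by (intro powr_mono2) auto
        also have "\<dots> = D powr (2 * p - 2) * (1 / (1 + norm x) ^ M) powr (2 * p - 2)" by (rule powr_mult)
        also have "\<dots> \<le> D powr (2 * p - 2) * (1 / (1 + norm x) ^ d)" by (intro mult_left_mono M2) simp
        finally have "cmod (\<theta> x) powr (2 * p - 2) \<le> D powr (2 * p - 2) * (1 / (1 + norm x) ^ d)" .
        moreover have "(p - 1) * 2 = 2 * p - 2" by simp
        ultimately show "epowr (ennreal (cmod (\<theta> x) powr (p - 1))) 2 \<le> ennreal (D powr (2 * p - 2) * (1 / (1 + norm x) ^ d))"
          by (simp only: epowr_ennreal powr_ge_zero powr_powr ennreal_leI)
      qed
      also have "\<dots> = ennreal (LINT x|lborel. D powr (2 * p - 2) * (1 / (1 + norm (x::real^'d)) ^ d))"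
        using intd by (intro nn_integral_eq_integral integrable_mult_right) auto
      finally show ?thesis by (simp only: integral_mult_right_zero I_def)
    qed
    have "(\<integral>\<^sup>+x. epowr (ennreal (cmod (\<theta> x * ?W x))) p \<partial>lborel)
        = (\<integral>\<^sup>+x. ennreal (cmod (\<theta> x) * cmod (?W x) powr p) * ennreal (cmod (\<theta> x) powr (p - 1)) \<partial>lborel)"
    proof (rule nn_integral_cong)
      fix x
      have "cmod (\<theta> x) powr p = cmod (\<theta> x) * cmod (\<theta> x) powr (p - 1)"
        using powr_add[of "cmod (\<theta> x)" 1 "p - 1"] by simp
      then show "epowr (ennreal (cmod (\<theta> x * ?W x))) p = ennreal (cmod (\<theta> x) * cmod (?W x) powr p) * ennreal (cmod (\<theta> x) powr (p - 1))"
        by (simp add: norm_mult powr_mult ennreal_mult[symmetric] ac_simps)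
    qed
    also have "\<dots> \<le> epowr (\<integral>\<^sup>+x. epowr (ennreal (cmod (\<theta> x) * cmod (?W x) powr p)) 2 \<partial>lborel) (1 / 2)
        * epowr (\<integral>\<^sup>+x. epowr (ennreal (cmod (\<theta> x) powr (p - 1))) 2 \<partial>lborel) (1 / 2)"
      by (rule nn_integral_Hoelder) auto
    also have "\<dots> \<le> epowr (ennreal (A * ?\<sigma> powr (2 * p) * (D\<^sup>2 * I))) (1 / 2) * epowr (ennreal (D powr (2 * p - 2) * I)) (1 / 2)"
      by (intro mult_mono epowr_mono first second) auto
    also have "\<dots> = epowr (ennreal (A * ?\<sigma> powr (2 * p) * (D\<^sup>2 * I) * (D powr (2 * p - 2) * I))) (1 / 2)"
      using A I by (subst epowr_mult[symmetric]) (auto simp: ennreal_mult)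
    also have "A * ?\<sigma> powr (2 * p) * (D\<^sup>2 * I) * (D powr (2 * p - 2) * I) = (A * I * I) * (D * ?\<sigma>) powr (2 * p)"
    proof -
      have "D\<^sup>2 * D powr (2 * p - 2) = D powr (2 * p)"
        using powr_add[of D 2 "2 * p - 2"] D by (simp add: powr_numeral)
      then show ?thesis by (simp add: powr_mult ac_simps)
    qed
    finally have "Lp_norm p (\<lambda>x. ennreal (cmod (\<theta> x * ?W x))) \<le> epowr (epowr (ennreal ((A * I * I) * (D * ?\<sigma>) powr (2 * p))) (1 / 2)) (1 / p)"
      unfolding Lp_norm_def using p by (intro epowr_mono) auto
    also have "\<dots> = epowr (ennreal ((A * I * I) * (D * ?\<sigma>) powr (2 * p))) (1 / (2 * p))"
      by (simp add: epowr_epowr)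
    also have "\<dots> = ennreal ((A * I * I) powr (1 / (2 * p)) * (D * ?\<sigma>))"
      using A I D \<sigma> p by (simp add: powr_mult powr_powr)
    also have "\<dots> \<le> ennreal (C * D * ?\<sigma>)"
      using D \<sigma> unfolding C_def by (intro ennreal_leI) (simp add: distrib_right mult.assoc)
    finally show ?thesis .
  qed
  moreover have "C > 0" by (simp add: C_def add_nonneg_pos)
  ultimately show ?thesis by (rule that[rotated])
qed

end

section \<open>The Triebel-Lizorkin quasi-norm of lacunary functions\<close>

lemma inv_fourier_diff:
  assumes "f \<in> schwartz" "g \<in> schwartz"
  shows "inv_fourier (\<lambda>x. f x - g x) \<xi> = inv_fourier f \<xi> - inv_fourier g \<xi>"
  using fourier_lincomb[of f g 1 "-1" "- \<xi>"] assms
  by (simp add: inv_fourier_eq schwartz_integrable)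

text \<open>Of the M + d powers of decay of the kernel, M pay for moving the weight from x + s z
  back to x, which is possible because s is at most 1, and d make the remaining integral
  finite.\<close>

lemma inv_fourier_dilate_decay:
  fixes \<rho> :: "real^'d::finite \<Rightarrow> complex"
  assumes \<rho>: "\<rho> \<in> schwartz"
  obtains D where "D > 0"
    "\<And>s g A x. 0 < s \<Longrightarrow> s \<le> 1 \<Longrightarrow> g \<in> schwartz \<Longrightarrow> (\<And>x. cmod (g x) \<le> A / (1 + norm x) ^ M) \<Longrightarrow>
      cmod (inv_fourier (\<lambda>\<xi>. \<rho> (s *\<^sub>R \<xi>) * fourier g \<xi>) x) \<le> D * A / (1 + norm x) ^ M"
proof -
  let ?d = "CARD('d) + 2" and ?c = "fourier_const TYPE('d)"
  obtain B where B: "B > 0" "\<And>z. cmod (fourier \<rho> z) \<le> B / (1 + norm z) ^ (M + ?d)"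
    by (rule schwartz_decay'[OF schwartz_fourier[OF \<rho>], of "M + ?d"]) (rule that)
  define I where "I = (LINT z|lborel. 1 / (1 + norm (z::real^'d)) ^ ?d)"
  have I: "I \<ge> 0" unfolding I_def by (rule Bochner_Integration.integral_nonneg) simp
  have "cmod (inv_fourier (\<lambda>\<xi>. \<rho> (s *\<^sub>R \<xi>) * fourier g \<xi>) x) \<le> (cmod ?c * B * I + 1) * A / (1 + norm x) ^ M"
    if s: "0 < s" "s \<le> 1" and g: "g \<in> schwartz" and A: "\<And>x. cmod (g x) \<le> A / (1 + norm x) ^ M" for s g A x
  proof -
    have A0: "A \<ge> 0" using A[of 0] order_trans[OF norm_ge_zero A[of 0]] by simp
    have pos: "1 + norm z > 0" for z :: "real^'d" by (simp add: add_pos_nonneg)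
    have pt: "cmod (fourier \<rho> z * g (x + s *\<^sub>R z)) \<le> A * B / (1 + norm x) ^ M * (1 / (1 + norm z) ^ ?d)" for z
    proof -
      have "1 + norm x \<le> (1 + norm (x + s *\<^sub>R z)) * (1 + norm (s *\<^sub>R z))" by (rule one_plus_norm_affine)
      also have "\<dots> \<le> (1 + norm (x + s *\<^sub>R z)) * (1 + norm z)"
        using s by (intro mult_left_mono) (auto intro: mult_left_le_one_le)
      finally have "(1 + norm x) ^ M \<le> ((1 + norm (x + s *\<^sub>R z)) * (1 + norm z)) ^ M"
        by (intro power_mono) auto
      then have le: "1 / ((1 + norm (x + s *\<^sub>R z)) ^ M * (1 + norm z) ^ M) \<le> 1 / (1 + norm x) ^ M"
        using pos by (intro divide_left_mono) (auto simp: power_mult_distrib)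
      have "cmod (fourier \<rho> z * g (x + s *\<^sub>R z)) \<le> B / (1 + norm z) ^ (M + ?d) * (A / (1 + norm (x + s *\<^sub>R z)) ^ M)"
        unfolding norm_mult using B(1) pos by (intro mult_mono B(2) A) (auto intro!: divide_nonneg_pos)
      also have "\<dots> = A * B * (1 / (1 + norm z) ^ ?d) * (1 / ((1 + norm (x + s *\<^sub>R z)) ^ M * (1 + norm z) ^ M))"
        by (simp add: power_add ac_simps)
      also have "\<dots> \<le> A * B * (1 / (1 + norm z) ^ ?d) * (1 / (1 + norm x) ^ M)"
        using A0 B(1) pos by (intro mult_left_mono le) auto
      finally show ?thesis by (simp add: ac_simps)
    qed
    have "cmod (LINT z|lborel. fourier \<rho> z * g (x + s *\<^sub>R z)) \<le> (LINT z|lborel. A * B / (1 + norm x) ^ M * (1 / (1 + norm (z::real^'d)) ^ ?d))"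
    proof (rule order_trans[OF integral_norm_bound Bochner_Integration.integral_mono])
      show int: "integrable lborel (\<lambda>z. A * B / (1 + norm x) ^ M * (1 / (1 + norm (z::real^'d)) ^ ?d))"
        using integrable_decay[where 'a="real^'d"] by (intro integrable_mult_right) simp
      have "(\<lambda>z. g (x + s *\<^sub>R z)) \<in> schwartz" using s g by (intro schwartz_affine) auto
      then show "integrable lborel (\<lambda>z. cmod (fourier \<rho> z * g (x + s *\<^sub>R z)))"
        by (intro integrable_norm schwartz_mult_integrable schwartz_fourier \<rho>)
    qed (rule pt)
    then have le: "cmod (LINT z|lborel. fourier \<rho> z * g (x + s *\<^sub>R z)) \<le> A * B / (1 + norm x) ^ M * I"
      by (simp only: I_def integral_mult_right_zero)
    have "cmod (inv_fourier (\<lambda>\<xi>. \<rho> (s *\<^sub>R \<xi>) * fourier g \<xi>) x) \<le> cmod ?c * (A * B / (1 + norm x) ^ M * I)"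
      unfolding inv_fourier_dilate_mult[OF g \<rho> s(1)] norm_mult by (intro mult_left_mono le) simp
    also have "\<dots> = (cmod ?c * B * I) * (A / (1 + norm x) ^ M)" by simp
    also have "\<dots> \<le> (cmod ?c * B * I + 1) * (A / (1 + norm x) ^ M)"
      using A0 pos by (intro mult_right_mono) auto
    finally show ?thesis by simp
  qed
  moreover have "cmod ?c * B * I + 1 > 0" using B(1) I by (intro add_nonneg_pos mult_nonneg_nonneg) auto
  ultimately show ?thesis by (rule that[rotated])
qed

section \<open>Littlewood-Paley blocks of lacunary functions\<close>

context lacunary_setting
begin

text \<open>The expansion of W tested against \<psi> f, indexed by frequency from 0 with zeros below
  3. The estimates below speak of pairs b, u in this relation, which spares the index shift and the
  auxiliary distribution W.\<close>

definition coeffs :: "(nat \<Rightarrow> complex) \<Rightarrow> 'd distr \<Rightarrow> bool" where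
  "coeffs b u \<longleftrightarrow> (\<forall>j<3. b j = 0) \<and>
    (\<forall>f\<in>schwartz. (\<lambda>n. b n * (LINT x|lborel. osc (lac_freq n) x * \<psi> x * f x)) sums u f)"

lemma lacunary_coeffs:
  assumes "u \<in> lacunary \<psi> i1"
  obtains b where "coeffs b u"
proof -
  obtain b W where W: "lacunary_expansion i1 b W" and u: "\<And>f. f \<in> schwartz \<Longrightarrow> u f = distr_mult \<psi> W f"
    using assms by (auto simp: lacunary_def)
  define b' where "b' j = (if j < 3 then 0 else b j)" for j
  have "(\<lambda>n. b' n * (LINT x|lborel. osc (lac_freq n) x * \<psi> x * f x)) sums u f" if f: "f \<in> schwartz" for f
  proof -
    have "(\<lambda>n. b (n + 3) * (LINT x|lborel. cis (lac_freq (n + 3) * (x $ i1)) * (\<psi> x * f x))) sums W (\<lambda>x. \<psi> x * f x)"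
      by (rule W[unfolded lacunary_expansion_def, THEN conjunct2, rule_format, OF schwartz_mult[OF psi f]])
    then have "(\<lambda>n. b' (n + 3) * (LINT x|lborel. osc (lac_freq (n + 3)) x * \<psi> x * f x)) sums u f"
      using u[OF f] by (simp add: b'_def distr_mult_def mult.assoc)
    then show ?thesis
      by (subst sums_iff_shift'[of _ 3, symmetric]) (simp add: b'_def lessThan_nat_numeral)
  qed
  then have "coeffs b' u" by (simp add: coeffs_def b'_def)
  then show ?thesis by (rule that)
qed

abbreviation wave :: "nat \<Rightarrow> real^'d \<Rightarrow> complex" where
  "wave n x \<equiv> osc (lac_freq n) x * \<psi> x"

lemma wave_schwartz: "wave n \<in> schwartz"
  by (rule osc_schwartz[OF psi])

lemma fourier_wave: "fourier (wave n) \<xi> = fourier \<psi> (\<xi> - freq (lac_freq n))"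
  by (rule fourier_osc)

text \<open>The centre is \<lambda>_n = 2^n - 2 and the radius 2, so the outer edge is exactly 2^n,
  where the bump dilated by 2^n is still 1.\<close>

lemma fourier_wave_support:
  assumes "fourier (wave n) \<xi> \<noteq> 0" "n \<ge> 3"
  shows "2 ^ n - 4 \<le> norm \<xi>" "norm \<xi> \<le> 2 ^ n"
proof -
  have l: "lac_freq n \<ge> 0" unfolding lac_freq_def using one_le_power[of "2::real" n] power_increasing[of 1 n "2::real"] assms(2) by simp
  have "norm (\<xi> - freq (lac_freq n)) \<le> 2"
    using assms psi_band unfolding fourier_wave band_def by force
  then have "\<bar>norm \<xi> - \<bar>lac_freq n\<bar>\<bar> \<le> 2"
    using norm_triangle_ineq3[of \<xi> "freq (lac_freq n)"] by simp
  then show "2 ^ n - 4 \<le> norm \<xi>" "norm \<xi> \<le> 2 ^ n"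
    using l unfolding lac_freq_def by linarith+
qed

lemma fourier_wave_disjoint:
  assumes "n \<ge> 3" "m \<ge> 3" "n \<noteq> m"
  shows "fourier (wave n) \<xi> * cnj (fourier (wave m) \<xi>) = 0"
proof (rule ccontr)
  assume "fourier (wave n) \<xi> * cnj (fourier (wave m) \<xi>) \<noteq> 0"
  then have nz: "fourier (wave n) \<xi> \<noteq> 0" "fourier (wave m) \<xi> \<noteq> 0" by auto
  then have "norm (\<xi> - freq (lac_freq n)) \<le> 2" "norm (\<xi> - freq (lac_freq m)) \<le> 2"
    using psi_band unfolding fourier_wave band_def by force+
  then have "norm (freq (lac_freq n) - freq (lac_freq m)) \<le> 4"
    using norm_triangle_ineq4[of "\<xi> - freq (lac_freq m)" "\<xi> - freq (lac_freq n)"] by simp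
  moreover have "freq (lac_freq n) - freq (lac_freq m) = freq (lac_freq n - lac_freq m)"
    by (simp add: freq_def scaleR_diff_left)
  ultimately have d: "\<bar>lac_freq n - lac_freq m\<bar> \<le> 4" by (simp only: norm_freq)
  have "lac_freq i + 8 \<le> lac_freq j" if "i < j" "3 \<le> i" for i j
  proof -
    have "(2::real) ^ 3 \<le> 2 ^ i" "(2::real) ^ Suc i \<le> 2 ^ j" using that by (intro power_increasing; simp)+
    then show ?thesis by (simp add: lac_freq_def)
  qed
  then have "lac_freq n + 8 \<le> lac_freq m \<or> lac_freq m + 8 \<le> lac_freq n"
    using assms by (meson linorder_neqE_nat)
  with d show False by linarith
qed

abbreviation res :: "nat \<Rightarrow> real^'d \<Rightarrow> complex" where
  "res \<equiv> resolution \<phi>0"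

lemma res_schwartz: "res l \<in> schwartz"
proof (cases "l = 0")
  case True
  then show ?thesis using phi0 by (simp add: resolution_def[abs_def])
next
  case False
  then have "res l = (\<lambda>x. \<phi>0 ((1/2) ^ l *\<^sub>R x) - \<phi>0 ((1/2) ^ (l - 1) *\<^sub>R x))"
    by (simp add: resolution_def[abs_def])
  then show ?thesis by (simp only:) (intro schwartz_diff schwartz_dilate phi0; simp)
qed

text \<open>On the spectrum of the wave, both dilated bumps in \<open>res l\<close> equal 1 and
  cancel if n < l, and both vanish if n is at least l + 2; for l = 0 the single bump
  vanishes.\<close>

lemma res_wave_zero:
  assumes n: "n \<ge> 3" and l: "n \<noteq> l" "n \<noteq> Suc l"
  shows "res l \<xi> * fourier (wave n) \<xi> = 0"
proof (cases "fourier (wave n) \<xi> = 0")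
  case False
  note supp = fourier_wave_support[OF False n]
  show ?thesis
  proof (cases "n < l")
    case True
    then have "(2::real) ^ n \<le> 2 ^ (l - 1)" by (intro power_increasing) auto
    with supp have "norm \<xi> \<le> 2 ^ (l - 1)" by linarith
    then have 1: "norm ((1/2) ^ (l - 1) *\<^sub>R \<xi>) \<le> 1" by (simp add: power_one_over field_simps)
    have "(1/2::real) ^ l \<le> (1/2) ^ (l - 1)" by (intro power_decreasing) auto
    then have "norm ((1/2) ^ l *\<^sub>R \<xi>) \<le> norm ((1/2) ^ (l - 1) *\<^sub>R \<xi>)" by (simp add: mult_right_mono)
    with 1 have 2: "norm ((1/2) ^ l *\<^sub>R \<xi>) \<le> 1" by linarith
    show ?thesis using True phi0_one[OF 1] phi0_one[OF 2] by (simp add: resolution_def)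
  next
    case False
    then have nl: "l + 2 \<le> n" using l by simp
    then have "(2::real) ^ (l + 1) \<le> 2 ^ (n - 1)" "(2::real) ^ 2 \<le> 2 ^ (n - 1)" using n by (intro power_increasing; simp)+
    moreover have "(2::real) ^ n = 2 * 2 ^ (n - 1)" using n by (cases n) auto
    ultimately have "2 * 2 ^ l \<le> norm \<xi>" using supp by simp
    then have 1: "norm ((1/2) ^ l *\<^sub>R \<xi>) \<ge> 2" by (simp add: power_one_over field_simps)
    have "(1/2::real) ^ l \<le> (1/2) ^ (l - 1)" by (intro power_decreasing) auto
    then have "norm ((1/2) ^ l *\<^sub>R \<xi>) \<le> norm ((1/2) ^ (l - 1) *\<^sub>R \<xi>)" by (simp add: mult_right_mono)
    with 1 have 2: "norm ((1/2) ^ (l - 1) *\<^sub>R \<xi>) \<ge> 2" by linarith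
    show ?thesis using phi0_zero[OF 1] phi0_zero[OF 2] by (cases "l = 0") (simp_all add: resolution_def)
  qed
qed simp

lemma phi0_wave_low:
  assumes n: "n \<ge> 3" and nz: "fourier (wave n) \<xi> \<noteq> 0"
  shows "\<phi>0 ((1/2) ^ (n - 2) *\<^sub>R \<xi>) = 0"
proof (rule phi0_zero)
  have "(2::real) ^ 1 \<le> 2 ^ (n - 2)" using n by (intro power_increasing) auto
  moreover have "(2::real) ^ n = 4 * 2 ^ (n - 2)"
  proof -
    have "n = 2 + (n - 2)" using n by simp
    then have "(2::real) ^ n = 2 ^ (2 + (n - 2))" by (rule arg_cong)
    then show ?thesis by (simp only: power_add) simp
  qed
  ultimately have "2 * 2 ^ (n - 2) \<le> norm \<xi>" using fourier_wave_support[OF nz n] by simp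
  then show "2 \<le> norm ((1/2) ^ (n - 2) *\<^sub>R \<xi>)" by (simp add: power_one_over field_simps)
qed

lemma res_wave_sum:
  assumes n: "n \<ge> 3"
  shows "(res (n - 1) \<xi> + res n \<xi>) * fourier (wave n) \<xi> = fourier (wave n) \<xi>"
proof (cases "fourier (wave n) \<xi> = 0")
  case False
  have 1: "norm ((1/2) ^ n *\<^sub>R \<xi>) \<le> 1"
    using fourier_wave_support[OF False n] by (simp add: power_one_over field_simps)
  have "n - 1 - 1 = n - 2" by simp
  then have "res (n - 1) \<xi> + res n \<xi> = \<phi>0 ((1/2) ^ n *\<^sub>R \<xi>) - \<phi>0 ((1/2) ^ (n - 2) *\<^sub>R \<xi>)"
    using n unfolding resolution_def by simp
  then show ?thesis using phi0_one[OF 1] phi0_wave_low[OF n False] by simp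
qed simp

definition piece :: "nat \<Rightarrow> nat \<Rightarrow> real^'d \<Rightarrow> complex" where
  "piece l n = inv_fourier (\<lambda>\<xi>. res l \<xi> * fourier (wave n) \<xi>)"

lemma piece_schwartz: "piece l n \<in> schwartz"
  unfolding piece_def by (intro schwartz_inv_fourier schwartz_mult res_schwartz schwartz_fourier wave_schwartz)

lemma piece_pairing:
  assumes f: "f \<in> schwartz"
  shows "(LINT x|lborel. piece l n x * f x) = (LINT \<xi>|lborel. res l \<xi> * fourier (wave n) \<xi> * inv_fourier f \<xi>)"
  unfolding piece_def
  by (intro inv_fourier_swap schwartz_integrable schwartz_mult res_schwartz schwartz_fourier wave_schwartz f)

lemma piece_zero:
  assumes "n \<ge> 3" "n \<noteq> l" "n \<noteq> Suc l"
  shows "piece l n x = 0"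
  unfolding piece_def res_wave_zero[OF assms] by (simp add: inv_fourier_def)

lemma piece_sum:
  assumes n: "n \<ge> 3"
  shows "piece (n - 1) n x + piece n n x = \<kappa> * wave n x"
proof -
  have S: "(\<lambda>\<xi>. res l \<xi> * fourier (wave n) \<xi>) \<in> schwartz" for l
    by (intro schwartz_mult res_schwartz schwartz_fourier wave_schwartz)
  have "fourier (wave n) = (\<lambda>\<xi>. 1 * (res (n - 1) \<xi> * fourier (wave n) \<xi>) + 1 * (res n \<xi> * fourier (wave n) \<xi>))"
    using res_wave_sum[OF n] by (simp add: distrib_right)
  then have "inv_fourier (fourier (wave n)) x = piece (n - 1) n x + piece n n x"
    unfolding piece_def inv_fourier_eq
    using fourier_lincomb[OF schwartz_integrable[OF S] schwartz_integrable[OF S], of 1 "n - 1" 1 n "- x"] by simp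
  then show ?thesis using kappa(2)[OF wave_schwartz, of n x] by simp
qed

definition block :: "(nat \<Rightarrow> complex) \<Rightarrow> nat \<Rightarrow> real^'d \<Rightarrow> complex" where
  "block b l x = b l * piece l l x + b (Suc l) * piece l (Suc l) x"

lemma block_schwartz: "block b l \<in> schwartz"
  unfolding block_def[abs_def] by (intro schwartz_lincomb piece_schwartz)

lemma block_pairing:
  assumes "f \<in> schwartz"
  shows "(LINT x|lborel. block b l x * f x) = b l * (LINT x|lborel. piece l l x * f x) + b (Suc l) * (LINT x|lborel. piece l (Suc l) x * f x)"
proof -
  have int: "integrable lborel (\<lambda>x. piece l n x * f x)" for n
    by (intro schwartz_mult_integrable piece_schwartz assms)
  have "(LINT x|lborel. block b l x * f x) = (LINT x|lborel. b l * (piece l l x * f x) + b (Suc l) * (piece l (Suc l) x * f x))"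
    by (simp add: block_def algebra_simps)
  also have "\<dots> = b l * (LINT x|lborel. piece l l x * f x) + b (Suc l) * (LINT x|lborel. piece l (Suc l) x * f x)"
    using int by simp
  finally show ?thesis .
qed

text \<open>All multipliers move to the test function, where every wave except those with index l
  and \<open>Suc l\<close> is annihilated; the infinite expansion turns into a finite sum.\<close>

lemma represents_block:
  assumes b: "coeffs b u"
  shows "represents (block b l) (distr_inv_fourier (distr_mult (res l) (distr_fourier u)))"
  unfolding represents_def
proof (intro conjI ballI)
  show "block b l \<in> borel_measurable lborel" using schwartz_measurable[OF block_schwartz] by simp
  fix f :: "real^'d \<Rightarrow> complex" assume f: "f \<in> schwartz"
  show "integrable lborel (\<lambda>x. block b l x * f x)" by (intro schwartz_mult_integrable block_schwartz f)
  let ?h = "\<lambda>x. res l x * inv_fourier f x"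
  have h: "?h \<in> schwartz" by (intro schwartz_mult res_schwartz schwartz_inv_fourier f)
  have pairing: "(LINT x|lborel. wave n x * fourier ?h x) = (LINT x|lborel. piece l n x * f x)" for n
  proof -
    have "(LINT x|lborel. wave n x * fourier ?h x) = (LINT x|lborel. fourier (wave n) x * ?h x)"
      by (intro fourier_swap[symmetric] schwartz_integrable wave_schwartz h)
    then show ?thesis unfolding piece_pairing[OF f] by (simp add: ac_simps)
  qed
  have "(\<lambda>n. b n * (LINT x|lborel. piece l n x * f x)) sums u (fourier ?h)"
    using b schwartz_fourier[OF h] unfolding coeffs_def pairing[symmetric] by (simp add: mult.assoc)
  moreover have "(\<lambda>n. b n * (LINT x|lborel. piece l n x * f x)) sums (\<Sum>n\<in>{l, Suc l}. b n * (LINT x|lborel. piece l n x * f x))"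
  proof (rule sums_finite)
    fix n assume "n \<notin> {l, Suc l}"
    then show "b n * (LINT x|lborel. piece l n x * f x) = 0"
      using b piece_zero[of n l] by (cases "n < 3") (auto simp: coeffs_def)
  qed simp
  ultimately have "u (fourier ?h) = (\<Sum>n\<in>{l, Suc l}. b n * (LINT x|lborel. piece l n x * f x))"
    by (rule sums_unique2)
  then show "distr_inv_fourier (distr_mult (res l) (distr_fourier u)) f = (LINT x|lborel. block b l x * f x)"
    unfolding block_pairing[OF f] by (simp add: distr_inv_fourier_def distr_mult_def distr_fourier_def)
qed

lemma lp_block_AE:
  assumes "coeffs b u"
  shows "AE x in lborel. \<forall>l. lp_block \<phi>0 l u x = block b l x"
  unfolding AE_all_countable lp_block_def by (intro allI fun_of_AE represents_block assms)

lemma F_norm_eq: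
  assumes "coeffs b u"
  shows "F_norm \<phi>0 0 \<gamma> p r u = Lp_norm p (\<lambda>x. lr_norm r (\<lambda>j. ennreal ((1 + real j) powr \<gamma> * cmod (block b j x))))"
  unfolding F_norm_def
  by (rule Lp_norm_cong_AE) (use lp_block_AE[OF assms] in \<open>auto elim!: eventually_mono\<close>)

text \<open>Uniform in both indices, since all waves have the modulus of \<psi> and a block is made
  of at most two multipliers with dilation factor at most 1.\<close>

lemma piece_decay:
  obtains D where "D > 0" "\<And>l n x. cmod (piece l n x) \<le> D / (1 + norm x) ^ M"
proof -
  obtain A where A: "A > 0" "\<And>x. cmod (\<psi> x) \<le> A / (1 + norm x) ^ M"
    by (rule schwartz_decay'[OF psi, of M]) (rule that)
  obtain D where D: "D > 0"
    "\<And>s g A x. 0 < s \<Longrightarrow> s \<le> 1 \<Longrightarrow> g \<in> schwartz \<Longrightarrow> (\<And>x. cmod (g x) \<le> A / (1 + norm x) ^ M) \<Longrightarrow>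
      cmod (inv_fourier (\<lambda>\<xi>. \<phi>0 (s *\<^sub>R \<xi>) * fourier g \<xi>) x) \<le> D * A / (1 + norm x) ^ M"
    using inv_fourier_dilate_decay[OF phi0, of M] by blast
  have dec: "cmod (inv_fourier (\<lambda>\<xi>. \<phi>0 ((1/2) ^ l *\<^sub>R \<xi>) * fourier (wave n) \<xi>) x) \<le> D * A / (1 + norm x) ^ M" for l n x
    using A(2) by (intro D(2) wave_schwartz) (auto simp: norm_mult power_le_one)
  have pos: "0 \<le> D * A / (1 + norm x) ^ M" for x :: "real^'d"
    using A(1) D(1) by simp
  have two: "2 * D * A / (1 + norm x) ^ M = D * A / (1 + norm x) ^ M + D * A / (1 + norm x) ^ M" for x :: "real^'d"
    unfolding mult_2 distrib_right add_divide_distrib ..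
  have "cmod (piece l n x) \<le> 2 * D * A / (1 + norm x) ^ M" for l n x
  proof (cases "l = 0")
    case True
    then have "cmod (piece l n x) \<le> D * A / (1 + norm x) ^ M"
      using dec[of 0 n x] by (simp add: piece_def resolution_def[abs_def])
    also have "\<dots> \<le> D * A / (1 + norm x) ^ M + D * A / (1 + norm x) ^ M" using pos[of x] by linarith
    finally show ?thesis unfolding two .
  next
    case False
    have S: "(\<lambda>\<xi>. \<phi>0 ((1/2) ^ l *\<^sub>R \<xi>) * fourier (wave n) \<xi>) \<in> schwartz" for l
      by (intro schwartz_mult schwartz_dilate phi0 schwartz_fourier wave_schwartz) simp
    have "piece l n x = inv_fourier (\<lambda>\<xi>. \<phi>0 ((1/2) ^ l *\<^sub>R \<xi>) * fourier (wave n) \<xi>) x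
        - inv_fourier (\<lambda>\<xi>. \<phi>0 ((1/2) ^ (l - 1) *\<^sub>R \<xi>) * fourier (wave n) \<xi>) x"
      unfolding inv_fourier_diff[OF S S, symmetric] piece_def
      using False by (simp add: resolution_def[abs_def] left_diff_distrib)
    then have "cmod (piece l n x) \<le> D * A / (1 + norm x) ^ M + D * A / (1 + norm x) ^ M"
      using norm_triangle_ineq4 dec[of l n x] dec[of "l - 1" n x] by (smt (verit))
    then show ?thesis unfolding two .
  qed
  moreover have "2 * D * A > 0" using A(1) D(1) by simp
  ultimately show ?thesis by (rule that[rotated])
qed

lemma weight_step: "(1 + real j) powr \<gamma> \<le> 2 powr \<bar>\<gamma>\<bar> * (1 + real (Suc j)) powr \<gamma>"
  and weight_step': "(1 + real (Suc j)) powr \<gamma> \<le> 2 powr \<bar>\<gamma>\<bar> * (1 + real j) powr \<gamma>"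
proof -
  have one: "1 \<le> 2 powr \<bar>\<gamma>\<bar>" by (rule ge_one_powr_ge_zero) auto
  show "(1 + real j) powr \<gamma> \<le> 2 powr \<bar>\<gamma>\<bar> * (1 + real (Suc j)) powr \<gamma>"
  proof (cases "\<gamma> \<ge> 0")
    case True
    then have "(1 + real j) powr \<gamma> \<le> 1 * (1 + real (Suc j)) powr \<gamma>" by (simp add: powr_mono2)
    also have "\<dots> \<le> 2 powr \<bar>\<gamma>\<bar> * (1 + real (Suc j)) powr \<gamma>" using one by (intro mult_right_mono) auto
    finally show ?thesis .
  next
    case False
    then have "(2 * (1 + real j)) powr \<gamma> \<le> (1 + real (Suc j)) powr \<gamma>" by (intro powr_mono2') auto
    then have "2 powr \<bar>\<gamma>\<bar> * (2 powr \<gamma> * (1 + real j) powr \<gamma>) \<le> 2 powr \<bar>\<gamma>\<bar> * (1 + real (Suc j)) powr \<gamma>"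
      unfolding powr_mult by (intro mult_left_mono) auto
    moreover have "2 powr \<bar>\<gamma>\<bar> * 2 powr \<gamma> = 1" using False by (simp flip: powr_add)
    ultimately show ?thesis by (simp flip: mult.assoc)
  qed
  show "(1 + real (Suc j)) powr \<gamma> \<le> 2 powr \<bar>\<gamma>\<bar> * (1 + real j) powr \<gamma>"
  proof (cases "\<gamma> \<ge> 0")
    case True
    then have "(1 + real (Suc j)) powr \<gamma> \<le> (2 * (1 + real j)) powr \<gamma>" by (intro powr_mono2) auto
    then show ?thesis using True unfolding powr_mult by simp
  next
    case False
    then have "(1 + real (Suc j)) powr \<gamma> \<le> 1 * (1 + real j) powr \<gamma>" by (simp add: powr_mono2')
    also have "\<dots> \<le> 2 powr \<bar>\<gamma>\<bar> * (1 + real j) powr \<gamma>" using one by (intro mult_right_mono) auto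
    finally show ?thesis .
  qed
qed

abbreviation mods :: "(nat \<Rightarrow> complex) \<Rightarrow> nat \<Rightarrow> ennreal" where
  "mods b j \<equiv> ennreal (cmod (b j))"

lemma Lp_norm_decay_finite:
  assumes "1 \<le> p"
  shows "Lp_norm p (\<lambda>x::real^'d. ennreal (1 / (1 + norm x) ^ (CARD('d) + 2))) < top"
proof -
  have "(\<integral>\<^sup>+x. epowr (ennreal (1 / (1 + norm (x::real^'d)) ^ (CARD('d) + 2))) p \<partial>lborel)
      \<le> (\<integral>\<^sup>+x. ennreal (1 / (1 + norm (x::real^'d)) ^ (CARD('d) + 2)) \<partial>lborel)"
  proof (rule nn_integral_mono)
    fix x :: "real^'d"
    let ?a = "1 / (1 + norm x) ^ (CARD('d) + 2)"
    have "(1 + norm x) ^ (CARD('d) + 2) \<ge> 1" by (rule one_le_power) simp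
    then have "0 < ?a" "?a \<le> 1" by (auto simp: divide_le_eq add_pos_nonneg)
    then have "?a powr p \<le> ?a powr 1" using assms by (intro powr_mono') auto
    then show "epowr (ennreal ?a) p \<le> ennreal ?a" using \<open>0 < ?a\<close> by (simp add: ennreal_leI)
  qed
  also have "\<dots> = ennreal (LINT x|lborel. 1 / (1 + norm (x::real^'d)) ^ (CARD('d) + 2))"
    using integrable_decay[where 'a="real^'d"] by (intro nn_integral_eq_integral) auto
  also have "\<dots> < top" by simp
  finally show ?thesis by (simp only: Lp_norm_def epowr_less_top_iff)
qed

text \<open>Every piece has the same decaying profile in x, so the sequence norm is taken pointwise
  and the profile is left for the L_p norm. The two neighbouring coefficients in a block are merged
  by a geometric kernel.\<close>

lemma F_norm_le_wlr:
  assumes p: "1 < p" and r: "0 < r"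
  obtains K :: real where "K > 0" "\<And>b u. coeffs b u \<Longrightarrow> F_norm \<phi>0 0 \<gamma> p r u \<le> ennreal K * wlr r \<gamma> (mods b)"
proof -
  let ?d = "CARD('d) + 2"
  obtain D where D: "D > 0" "\<And>l n x. cmod (piece l n x) \<le> D / (1 + norm x) ^ ?d"
    by (rule piece_decay[of ?d]) (rule that)
  \<comment> \<open>The power compares the weights at j and \<open>Suc j\<close>; the factor 2
    offsets the kernel value 1/2 at distance one.\<close>
  define C where "C = 2 * 2 powr \<bar>\<gamma>\<bar>"
  have C: "C \<ge> 2" unfolding C_def using ge_one_powr_ge_zero[of 2 "\<bar>\<gamma>\<bar>"] by simp
  obtain K where K: "K > 0"
    "\<And>X Z v. (\<And>m. m \<ge> 0 \<Longrightarrow> X m \<le> ennreal C * (\<Sum>l. ennreal ((1/2) ^ ((m - l) + (l - m))) * Z l)) \<Longrightarrow>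
      (\<And>m. m < 0 \<Longrightarrow> X m \<le> ennreal C * v) \<Longrightarrow> lr_norm r X \<le> ennreal K * (lr_norm r Z + v)"
    using lr_norm_Hardy[OF r, of "1/2" C 0] C by auto
  define L where "L = enn2real (Lp_norm p (\<lambda>x::real^'d. ennreal (1 / (1 + norm x) ^ ?d)))"
  have L: "Lp_norm p (\<lambda>x::real^'d. ennreal (1 / (1 + norm x) ^ ?d)) = ennreal L"
    using Lp_norm_decay_finite[of p] p unfolding L_def by (intro ennreal_enn2real[symmetric]) simp
  have L0: "L \<ge> 0" by (simp add: L_def)
  have "F_norm \<phi>0 0 \<gamma> p r u \<le> ennreal (D * K * L + 1) * wlr r \<gamma> (mods b)" if b: "coeffs b u" for b u
  proof -
    let ?X = "\<lambda>j. ennreal ((1 + real j) powr \<gamma> * (cmod (b j) + cmod (b (Suc j))))"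
    let ?Z = "\<lambda>j. ennreal ((1 + real j) powr \<gamma>) * mods b j"
    have "lr_norm r ?X \<le> ennreal K * (lr_norm r ?Z + 0)"
    proof (rule K(2))
      fix j :: nat
      let ?k = "\<lambda>l. ennreal ((1/2) ^ ((j - l) + (l - j)))"
      have "(1 + real j) powr \<gamma> * (cmod (b j) + cmod (b (Suc j)))
          \<le> C * ((1 + real j) powr \<gamma> * cmod (b j)) + C * (1/2 * ((1 + real (Suc j)) powr \<gamma> * cmod (b (Suc j))))"
      proof -
        have "(1 + real j) powr \<gamma> * cmod (b j) \<le> C * ((1 + real j) powr \<gamma> * cmod (b j))"
          using mult_right_mono[of 1 C "(1 + real j) powr \<gamma> * cmod (b j)"] C by simp
        moreover have "(1 + real j) powr \<gamma> * cmod (b (Suc j)) \<le> C * (1/2 * ((1 + real (Suc j)) powr \<gamma> * cmod (b (Suc j))))"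
          using mult_right_mono[OF weight_step[of j \<gamma>], of "cmod (b (Suc j))"] by (simp add: C_def)
        ultimately show ?thesis unfolding distrib_left by (rule add_mono)
      qed
      then have "?X j \<le> ennreal (C * ((1 + real j) powr \<gamma> * cmod (b j)) + C * (1/2 * ((1 + real (Suc j)) powr \<gamma> * cmod (b (Suc j)))))"
        by (rule ennreal_leI)
      also have "\<dots> = ennreal C * (ennreal 1 * ?Z j + ennreal (1/2) * ?Z (Suc j))"
      proof -
        have "ennreal (C * z1 + C * (1/2 * z2)) = ennreal C * (ennreal 1 * ennreal z1 + ennreal (1/2) * ennreal z2)"
          if z: "0 \<le> z1" "0 \<le> z2" for z1 z2
        proof -
          have "0 \<le> C" "0 \<le> (1/2::real)" "0 \<le> 1/2 * z2" "0 \<le> C * z1" "0 \<le> C * (1/2 * z2)"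
            using C z by auto
          with z show ?thesis
            by (simp only: ennreal_plus ennreal_mult distrib_left ennreal_1 mult_1_left)
        qed
        from this[of "(1 + real j) powr \<gamma> * cmod (b j)" "(1 + real (Suc j)) powr \<gamma> * cmod (b (Suc j))"]
        show ?thesis by (simp only: ennreal_mult norm_ge_zero powr_ge_zero mult_nonneg_nonneg)
      qed
      also have "\<dots> = ennreal C * (\<Sum>l\<in>{j, Suc j}. ?k l * ?Z l)"
        by simp
      also have "\<dots> \<le> ennreal C * (\<Sum>l. ?k l * ?Z l)"
        by (intro mult_left_mono sum_le_suminf) auto
      finally show "?X j \<le> ennreal C * (\<Sum>l. ?k l * ?Z l)" .
    qed simp
    then have X: "lr_norm r ?X \<le> ennreal K * wlr r \<gamma> (mods b)" by (simp add: wlr_def)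
    have pt: "lr_norm r (\<lambda>j. ennreal ((1 + real j) powr \<gamma> * cmod (block b j x)))
        \<le> (ennreal D * (ennreal K * wlr r \<gamma> (mods b))) * ennreal (1 / (1 + norm x) ^ ?d)" for x
    proof -
      have "lr_norm r (\<lambda>j. ennreal ((1 + real j) powr \<gamma> * cmod (block b j x))) \<le> lr_norm r (\<lambda>j. ennreal (D / (1 + norm x) ^ ?d) * ?X j)"
      proof (rule lr_norm_mono[OF _ r])
        fix j
        have "cmod (block b j x) \<le> cmod (b j) * (D / (1 + norm x) ^ ?d) + cmod (b (Suc j)) * (D / (1 + norm x) ^ ?d)"
          unfolding block_def by (intro norm_triangle_mono) (auto simp only: norm_mult intro!: mult_left_mono D(2) norm_ge_zero)
        then have "(1 + real j) powr \<gamma> * cmod (block b j x) \<le> (1 + real j) powr \<gamma> * (cmod (b j) * (D / (1 + norm x) ^ ?d) + cmod (b (Suc j)) * (D / (1 + norm x) ^ ?d))"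
          by (intro mult_left_mono) auto
        also have "\<dots> = D / (1 + norm x) ^ ?d * ((1 + real j) powr \<gamma> * (cmod (b j) + cmod (b (Suc j))))"
          by (simp only: distrib_left mult.commute mult.left_commute)
        finally show "ennreal ((1 + real j) powr \<gamma> * cmod (block b j x)) \<le> ennreal (D / (1 + norm x) ^ ?d) * ?X j"
          using D(1) by (subst ennreal_mult[symmetric]) (auto intro: ennreal_leI)
      qed
      also have "\<dots> = ennreal (D / (1 + norm x) ^ ?d) * lr_norm r ?X" by (rule lr_norm_cmult[OF r])
      also have "\<dots> \<le> ennreal (D / (1 + norm x) ^ ?d) * (ennreal K * wlr r \<gamma> (mods b))" by (intro mult_left_mono X) simp
      also have "ennreal (D / (1 + norm x) ^ ?d) = ennreal D * ennreal (1 / (1 + norm x) ^ ?d)"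
        using D(1) by (subst ennreal_mult[symmetric]) auto
      finally show ?thesis by (simp only: ac_simps)
    qed
    have "F_norm \<phi>0 0 \<gamma> p r u \<le> Lp_norm p (\<lambda>x::real^'d. (ennreal D * (ennreal K * wlr r \<gamma> (mods b))) * ennreal (1 / (1 + norm x) ^ ?d))"
      unfolding F_norm_eq[OF b] using p by (intro Lp_norm_mono pt) simp
    also have "\<dots> = (ennreal D * (ennreal K * wlr r \<gamma> (mods b))) * ennreal L"
      using p by (subst Lp_norm_cmult) (simp_all only: L, simp_all)
    also have "\<dots> = ennreal (D * K * L) * wlr r \<gamma> (mods b)"
      using D(1) K(1) L0 by (simp add: ennreal_mult ac_simps)
    also have "\<dots> \<le> ennreal (D * K * L + 1) * wlr r \<gamma> (mods b)"
      by (intro mult_right_mono ennreal_leI) auto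
    finally show ?thesis .
  qed
  moreover have "D * K * L + 1 > 0" using D(1) K(1) L0 by (intro add_nonneg_pos mult_nonneg_nonneg) auto
  ultimately show ?thesis by (intro that[of "D * K * L + 1"])
qed

section \<open>Recovering the coefficients from the blocks\<close>

lemma psi_norm_pos: "0 < (LINT x|lborel. (cmod (\<psi> x))\<^sup>2)" (is "0 < ?E")
proof -
  have "?E \<ge> 0" by (rule Bochner_Integration.integral_nonneg) simp
  moreover have "?E \<noteq> 0"
  proof
    assume "?E = 0"
    then have "complex_of_real ?E = 0" by simp
    then have "(LINT x|lborel. \<psi> x * cnj (\<psi> x)) = 0"
      by (simp only: integral_complex_of_real[symmetric] complex_norm_square)
    then have "\<psi> x = 0" for x by (rule schwartz_zero_of_L2[OF psi])
    then show False using psi_nonzero by blast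
  qed
  ultimately show ?thesis by (metis order_le_less)
qed

lemma wave_pairing:
  assumes "n \<ge> 3" "m \<ge> 3"
  shows "(LINT x|lborel. wave n x * cnj (wave m x)) = (if n = m then of_real (LINT x|lborel. (cmod (\<psi> x))\<^sup>2) else 0)"
proof (cases "n = m")
  case True
  have "wave n x * cnj (wave n x) = of_real ((cmod (\<psi> x))\<^sup>2)" for x
    unfolding complex_norm_square[symmetric] by (simp add: norm_mult)
  then show ?thesis using True by (simp only: integral_complex_of_real simp_thms if_True)
next
  case False
  then have "\<kappa> * (LINT x|lborel. wave n x * cnj (wave m x)) = 0"
    using parseval[OF wave_schwartz wave_schwartz kappa(2)[OF wave_schwartz], of n m]
      fourier_wave_disjoint[OF assms False] by simp
  then show ?thesis using False kappa(1) by simp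
qed

text \<open>The two pieces of wave j add up to \<kappa> times the wave, and the other wave in each
  block is orthogonal to wave j because the spectra are disjoint.\<close>

lemma block_coefficient:
  assumes j: "j \<ge> 3" and b: "\<And>j. j < 3 \<Longrightarrow> b j = 0"
  shows "(LINT x|lborel. block b (j - 1) x * cnj (wave j x)) + (LINT x|lborel. block b j x * cnj (wave j x))
    = b j * (\<kappa> * of_real (LINT x|lborel. (cmod (\<psi> x))\<^sup>2))"
proof -
  let ?w = "\<lambda>x. cnj (wave j x)"
  have w: "?w \<in> schwartz" by (rule schwartz_cnj[OF wave_schwartz])
  have other: "b n * (LINT x|lborel. piece l n x * ?w x) = 0" if "n \<noteq> j" for n l
  proof (cases "n < 3")
    case False
    then have "fourier (wave n) \<xi> * cnj (fourier (wave j) \<xi>) = 0" for \<xi>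
      using that j by (intro fourier_wave_disjoint) auto
    then have 0: "res l \<xi> * fourier (wave n) \<xi> * inv_fourier ?w \<xi> = 0" for \<xi>
      unfolding inv_fourier_cnj by (simp only: mult.assoc mult_zero_right)
    show ?thesis unfolding piece_pairing[OF w] 0 by simp
  qed (simp add: b)
  have int: "integrable lborel (\<lambda>x. piece l j x * ?w x)" for l
    by (intro schwartz_mult_integrable piece_schwartz w)
  have "(LINT x|lborel. block b (j - 1) x * ?w x) + (LINT x|lborel. block b j x * ?w x)
      = b j * (LINT x|lborel. piece (j - 1) j x * ?w x) + b j * (LINT x|lborel. piece j j x * ?w x)"
  proof -
    have jj: "j - 1 \<noteq> j" "Suc j \<noteq> j" "Suc (j - 1) = j" using j by auto
    show ?thesis unfolding block_pairing[OF w] other[OF jj(1)] other[OF jj(2)] jj(3) by simp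
  qed
  also have "\<dots> = b j * (LINT x|lborel. piece (j - 1) j x * ?w x + piece j j x * ?w x)"
    using int by (simp add: distrib_left)
  also have "(LINT x|lborel. piece (j - 1) j x * ?w x + piece j j x * ?w x) = (LINT x|lborel. \<kappa> * (wave j x * ?w x))"
    by (simp only: distrib_right[symmetric] piece_sum[OF j] mult.assoc)
  also have "\<dots> = \<kappa> * of_real (LINT x|lborel. (cmod (\<psi> x))\<^sup>2)"
    unfolding integral_mult_right_zero wave_pairing[OF j j] by simp
  finally show ?thesis .
qed

lemma schwartz_Lp_finite:
  assumes f: "f \<in> schwartz" and p: "1 \<le> p"
  shows "Lp_norm p (\<lambda>x::real^'d. ennreal (cmod (f x))) < top"
proof -
  let ?d = "CARD('d) + 2"
  obtain C where C: "C > 0" "\<And>x. cmod (f x) \<le> C / (1 + norm x) ^ ?d"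
    by (rule schwartz_decay'[OF f, of ?d]) (rule that)
  have "Lp_norm p (\<lambda>x. ennreal (cmod (f x))) \<le> Lp_norm p (\<lambda>x::real^'d. ennreal C * ennreal (1 / (1 + norm x) ^ ?d))"
    using C p by (intro Lp_norm_mono) (auto simp: ennreal_mult[symmetric] intro!: ennreal_leI simp del: power_Suc)
  also have "\<dots> = ennreal C * Lp_norm p (\<lambda>x::real^'d. ennreal (1 / (1 + norm x) ^ ?d))"
    using p by (intro Lp_norm_cmult) auto
  also have "\<dots> < top" using Lp_norm_decay_finite[OF p] by (simp add: ennreal_mult_less_top)
  finally show ?thesis .
qed

text \<open>Hoelder's inequality against one wave, for the two blocks that contain it. The bound is
  for single entries only, but it gives the iteration in \<open>wlr_le_F_norm\<close> its start:
  control of the low indices and of the remainder.\<close>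

lemma coefficient_le_F_norm:
  assumes p: "1 < p" and r: "0 < r"
  obtains K :: real where "K > 0"
    "\<And>b u j. coeffs b u \<Longrightarrow> ennreal ((1 + real j) powr \<gamma>) * mods b j \<le> ennreal K * F_norm \<phi>0 0 \<gamma> p r u"
proof -
  define p' where "p' = p / (p - 1)"
  have p': "1 < p'" "1 / p + 1 / p' = 1" using p by (auto simp: p'_def field_simps)
  define E where "E = cmod \<kappa> * (LINT x|lborel. (cmod (\<psi> x))\<^sup>2)"
  have E: "E > 0" using kappa(1) psi_norm_pos by (simp add: E_def)
  have fin: "Lp_norm p' (\<lambda>x. ennreal (cmod (\<psi> x))) < top"
    using p' by (intro schwartz_Lp_finite psi) simp
  define N where "N = enn2real (Lp_norm p' (\<lambda>x. ennreal (cmod (\<psi> x))))"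
  have N: "Lp_norm p' (\<lambda>x. ennreal (cmod (\<psi> x))) = ennreal N" "N \<ge> 0"
    using fin unfolding N_def by auto
  define K where "K = (2 powr \<bar>\<gamma>\<bar> + 1) * N / E + 1"
  have "ennreal ((1 + real j) powr \<gamma>) * mods b j \<le> ennreal K * F_norm \<phi>0 0 \<gamma> p r u" if b: "coeffs b u" for b u j
  proof (cases "j < 3")
    case True
    then show ?thesis using b by (simp add: coeffs_def)
  next
    case False
    then have j: "j \<ge> 3" by simp
    let ?F = "F_norm \<phi>0 0 \<gamma> p r u" and ?w = "\<lambda>j. (1 + real j) powr \<gamma>"
    let ?G = "\<lambda>l. Lp_norm p (\<lambda>x. ennreal (cmod (block b l x)))"
    have G: "ennreal (?w l) * ?G l \<le> ?F" for l
    proof -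
      have "ennreal (?w l) * ?G l = Lp_norm p (\<lambda>x. ennreal (?w l) * ennreal (cmod (block b l x)))"
        using p schwartz_measurable[OF block_schwartz[of b l]] by (intro Lp_norm_cmult[symmetric]) auto
      also have "\<dots> \<le> ?F"
        unfolding F_norm_eq[OF b]
      proof (intro Lp_norm_mono)
        fix x
        have "ennreal (?w l) * ennreal (cmod (block b l x)) = (\<lambda>j. ennreal (?w j * cmod (block b j x))) l"
          by (simp add: ennreal_mult)
        also have "\<dots> \<le> lr_norm r (\<lambda>j. ennreal (?w j * cmod (block b j x)))" by (rule lr_norm_ge[OF r])
        finally show "ennreal (?w l) * ennreal (cmod (block b l x)) \<le> lr_norm r (\<lambda>j. ennreal (?w j * cmod (block b j x)))" .
      qed (use p in simp)
      finally show ?thesis .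
    qed
    have pair: "ennreal (cmod (LINT x|lborel. block b l x * cnj (wave j x))) \<le> ?G l * ennreal N" for l
    proof -
      have "ennreal (cmod (LINT x|lborel. block b l x * cnj (wave j x))) \<le> ?G l * Lp_norm p' (\<lambda>x. ennreal (cmod (cnj (wave j x))))"
        using schwartz_measurable[OF block_schwartz[of b l]] schwartz_measurable[OF schwartz_cnj[OF wave_schwartz[of j]]]
        by (intro Lp_norm_Hoelder_pairing p p')
      also have "Lp_norm p' (\<lambda>x. ennreal (cmod (cnj (wave j x)))) = ennreal N"
        unfolding N(1)[symmetric] by (simp add: norm_mult)
      finally show ?thesis .
    qed
    have "E * cmod (b j) = cmod ((LINT x|lborel. block b (j - 1) x * cnj (wave j x)) + (LINT x|lborel. block b j x * cnj (wave j x)))"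
      using b psi_norm_pos by (subst block_coefficient[OF j]) (auto simp: coeffs_def E_def norm_mult)
    also have "\<dots> \<le> cmod (LINT x|lborel. block b (j - 1) x * cnj (wave j x)) + cmod (LINT x|lborel. block b j x * cnj (wave j x))"
      by (rule norm_triangle_ineq)
    finally have "ennreal (E * cmod (b j)) \<le> ennreal (cmod (LINT x|lborel. block b (j - 1) x * cnj (wave j x))) + ennreal (cmod (LINT x|lborel. block b j x * cnj (wave j x)))"
      by (simp flip: ennreal_plus add: ennreal_leI)
    also have "\<dots> \<le> ?G (j - 1) * ennreal N + ?G j * ennreal N" by (intro add_mono pair)
    finally have "ennreal (?w j) * ennreal (E * cmod (b j)) \<le> ennreal (?w j) * (?G (j - 1) * ennreal N + ?G j * ennreal N)"
      by (intro mult_left_mono) auto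
    also have "\<dots> = ennreal N * (ennreal (?w j) * ?G (j - 1)) + ennreal N * (ennreal (?w j) * ?G j)"
      by (simp add: distrib_left ac_simps)
    also have "\<dots> \<le> ennreal N * (ennreal (2 powr \<bar>\<gamma>\<bar>) * ?F) + ennreal N * ?F"
    proof (intro add_mono mult_left_mono G)
      have "?w j \<le> 2 powr \<bar>\<gamma>\<bar> * ?w (j - 1)"
        using weight_step'[of "j - 1" \<gamma>] j by simp
      then have "ennreal (?w j) * ?G (j - 1) \<le> ennreal (2 powr \<bar>\<gamma>\<bar> * ?w (j - 1)) * ?G (j - 1)"
        by (intro mult_right_mono ennreal_leI) auto
      also have "\<dots> = ennreal (2 powr \<bar>\<gamma>\<bar>) * (ennreal (?w (j - 1)) * ?G (j - 1))"
        by (simp only: ennreal_mult powr_ge_zero mult.assoc)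
      also have "\<dots> \<le> ennreal (2 powr \<bar>\<gamma>\<bar>) * ?F" by (intro mult_left_mono G) auto
      finally show "ennreal (?w j) * ?G (j - 1) \<le> ennreal (2 powr \<bar>\<gamma>\<bar>) * ?F" .
    qed auto
    also have "\<dots> = ennreal ((2 powr \<bar>\<gamma>\<bar> + 1) * N) * ?F"
      using N(2) by (simp add: ennreal_mult ennreal_plus distrib_right distrib_left ac_simps)
    finally have "ennreal (1 / E) * (ennreal (?w j) * ennreal (E * cmod (b j))) \<le> ennreal (1 / E) * (ennreal ((2 powr \<bar>\<gamma>\<bar> + 1) * N) * ?F)"
      by (intro mult_left_mono) auto
    also have "ennreal (1 / E) * (ennreal (?w j) * ennreal (E * cmod (b j))) = ennreal (?w j) * mods b j"
      using E by (simp flip: ennreal_mult)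
    also have "ennreal (1 / E) * (ennreal ((2 powr \<bar>\<gamma>\<bar> + 1) * N) * ?F) = ennreal ((2 powr \<bar>\<gamma>\<bar> + 1) * N / E) * ?F"
      using E N(2) by (simp add: ennreal_mult[symmetric] mult.assoc[symmetric])
    also have "\<dots> \<le> ennreal K * ?F" by (intro mult_right_mono ennreal_leI) (auto simp: K_def)
    finally show ?thesis .
  qed
  moreover have "K > 0" using E N(2) by (auto simp: K_def intro!: add_nonneg_pos divide_nonneg_pos mult_nonneg_nonneg)
  ultimately show ?thesis by (intro that[of K])
qed

text \<open>Recentred at \<lambda>_n, the spectrum of the wave is the fixed spectrum of \<psi>, and
  its points scaled by 2^(n - 1) tend to the point 2 on the distinguished axis, where \<phi>0
  vanishes; the other bump of the block is 0 there for every n. Dominated convergence then makes the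
  integral of the transform, hence the piece uniformly in x, tend to 0.\<close>

lemma piece_small:
  obtains \<delta> :: "nat \<Rightarrow> real" where "\<delta> \<longlonglongrightarrow> 0" "\<And>n x. n \<ge> 3 \<Longrightarrow> cmod (piece (n - 1) n x) \<le> \<delta> n"
proof -
  let ?c = "fourier_const TYPE('d)"
  define \<delta> where "\<delta> n = cmod ?c * (LINT \<xi>|lborel. cmod (res (n - 1) (\<xi> + freq (lac_freq n))) * cmod (fourier \<psi> \<xi>))" for n
  note [measurable] = schwartz_measurable[OF schwartz_fourier[OF psi]] schwartz_measurable[OF res_schwartz]
  have bound: "cmod (piece (n - 1) n x) \<le> \<delta> n" for n x
  proof -
    have S: "(\<lambda>\<xi>. res (n - 1) \<xi> * fourier (wave n) \<xi>) \<in> schwartz"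
      by (intro schwartz_mult res_schwartz schwartz_fourier wave_schwartz)
    have "cmod (piece (n - 1) n x) \<le> cmod ?c * (LINT \<xi>|lborel. cmod (res (n - 1) \<xi> * fourier (wave n) \<xi>))"
      unfolding piece_def inv_fourier_eq by (rule fourier_bound[OF schwartz_integrable[OF S]])
    also have "(LINT \<xi>|lborel. cmod (res (n - 1) \<xi> * fourier (wave n) \<xi>))
        = (LINT \<xi>|lborel. cmod (res (n - 1) (\<xi> + freq (lac_freq n)) * fourier (wave n) (\<xi> + freq (lac_freq n))))"
      using schwartz_measurable[OF S] by (intro integral_shift[symmetric]) simp
    finally show ?thesis by (simp only: \<delta>_def fourier_wave add_diff_cancel_right' norm_mult)
  qed
  obtain B where B: "B > 0" "\<And>x. cmod (\<phi>0 x) \<le> B" by (rule schwartz_bounded[OF phi0]) (rule that)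
  have lim: "\<delta> \<longlonglongrightarrow> cmod ?c * integral\<^sup>L lborel (\<lambda>\<xi>::real^'d. 0::real)"
    unfolding \<delta>_def
  proof (intro tendsto_mult tendsto_const integral_dominated_convergence)
    have res: "cmod (res l \<xi>) \<le> B + B" for l \<xi>
      using B(1) B(2)[of \<xi>] norm_triangle_le_diff[OF add_mono[OF B(2) B(2)]] by (auto simp: resolution_def)
    show "integrable lborel (\<lambda>\<xi>. (B + B) * cmod (fourier \<psi> \<xi>))"
      by (intro integrable_mult_right integrable_norm schwartz_integrable schwartz_fourier psi)
    show "AE \<xi> in lborel. norm (cmod (res (n - 1) (\<xi> + freq (lac_freq n))) * cmod (fourier \<psi> \<xi>)) \<le> (B + B) * cmod (fourier \<psi> \<xi>)" for n
      using res by (auto intro!: mult_right_mono)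
    show "AE \<xi> in lborel. (\<lambda>n. cmod (res (n - 1) (\<xi> + freq (lac_freq n))) * cmod (fourier \<psi> \<xi>)) \<longlonglongrightarrow> 0"
    proof (intro AE_I2)
      fix \<xi>
      show "(\<lambda>n. cmod (res (n - 1) (\<xi> + freq (lac_freq n))) * cmod (fourier \<psi> \<xi>)) \<longlonglongrightarrow> 0"
      proof (cases "fourier \<psi> \<xi> = 0")
        case False
        have arg: "(1/2) ^ (n - 1) *\<^sub>R (\<xi> + freq (lac_freq n)) = (1/2) ^ (n - 1) *\<^sub>R (\<xi> - freq 2) + freq 2"
          and low: "\<phi>0 ((1/2) ^ (n - 2) *\<^sub>R (\<xi> + freq (lac_freq n))) = 0" if n: "n \<ge> 3" for n
        proof -
          have "(1/2::real) ^ (n - 1) * 2 ^ n = 2" using n by (cases n) (auto simp: power_one_over)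
          moreover have "freq (lac_freq n) = 2 ^ n *\<^sub>R axis i1 1 - freq 2"
            by (simp add: freq_def lac_freq_def scaleR_diff_left)
          ultimately show "(1/2) ^ (n - 1) *\<^sub>R (\<xi> + freq (lac_freq n)) = (1/2) ^ (n - 1) *\<^sub>R (\<xi> - freq 2) + freq 2"
            by (simp add: scaleR_add_right scaleR_diff_right freq_def)
          show "\<phi>0 ((1/2) ^ (n - 2) *\<^sub>R (\<xi> + freq (lac_freq n))) = 0"
            using False by (intro phi0_wave_low n) (simp add: fourier_wave)
        qed
        have ev: "eventually (\<lambda>n. res (n - 1) (\<xi> + freq (lac_freq n)) = \<phi>0 ((1/2) ^ (n - 1) *\<^sub>R (\<xi> - freq 2) + freq 2)) sequentially"
          using eventually_ge_at_top[of 3]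
        proof eventually_elim
          case (elim n)
          have "n - 1 - 1 = n - 2" "n - 1 \<noteq> 0" using elim by auto
          then show ?case unfolding resolution_def using arg[OF elim] low[OF elim] by simp
        qed
        have "(\<lambda>n. (1/2::real) ^ (n - 1)) \<longlonglongrightarrow> 0"
          by (subst filterlim_sequentially_Suc[symmetric]) (simp add: LIMSEQ_power_zero)
        then have "(\<lambda>n. (1/2) ^ (n - 1) *\<^sub>R (\<xi> - freq 2) + freq 2) \<longlonglongrightarrow> 0 *\<^sub>R (\<xi> - freq 2) + freq 2"
          by (intro tendsto_intros)
        then have "(\<lambda>n. (1/2) ^ (n - 1) *\<^sub>R (\<xi> - freq 2) + freq 2) \<longlonglongrightarrow> freq 2" by simp
        then have "(\<lambda>n. \<phi>0 ((1/2) ^ (n - 1) *\<^sub>R (\<xi> - freq 2) + freq 2)) \<longlonglongrightarrow> \<phi>0 (freq 2)"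
          using schwartz_continuous[OF phi0, of UNIV]
          by (intro isCont_tendsto_compose[of _ \<phi>0]) (auto simp: continuous_on_eq_continuous_at)
        moreover have "\<phi>0 (freq 2) = 0" by (rule phi0_zero) simp
        ultimately have "(\<lambda>n. res (n - 1) (\<xi> + freq (lac_freq n))) \<longlonglongrightarrow> 0"
          using tendsto_cong[OF ev] by simp
        then show ?thesis by (intro tendsto_mult_left_zero tendsto_norm_zero)
      qed simp
    qed
  qed simp_all
  show ?thesis by (rule that[OF _ bound]) (use lim in simp)
qed

text \<open>On a small ball where \<psi> stays away from 0, and for large n, the block n determines
  b_n up to a small multiple of b_n and b_(n + 1). The first is absorbed, the second is replaced by
  the same relation at n + 1, and so on. This holds at every point of the ball, so integrating over
  it yields the quasi-norm. The finitely many low indices are handled by the bound on single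
  coefficients.\<close>

lemma wlr_le_F_norm:
  assumes p: "1 < p" and r: "0 < r"
  obtains K :: real where "K > 0" "\<And>b u. coeffs b u \<Longrightarrow> wlr r \<gamma> (mods b) \<le> ennreal K * F_norm \<phi>0 0 \<gamma> p r u"
proof -
  let ?w = "\<lambda>j. (1 + real j) powr \<gamma>"
  obtain K1 where K1: "K1 > 0"
    "\<And>b u j. coeffs b u \<Longrightarrow> ennreal (?w j) * mods b j \<le> ennreal K1 * F_norm \<phi>0 0 \<gamma> p r u"
    by (rule coefficient_le_F_norm[OF p r, of \<gamma>]) (rule that)
  obtain \<delta> where \<delta>: "\<delta> \<longlonglongrightarrow> 0" "\<And>n x. n \<ge> 3 \<Longrightarrow> cmod (piece (n - 1) n x) \<le> \<delta> n"
    by (rule piece_small) (rule that)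
  obtain x0 where "\<psi> x0 \<noteq> 0" using psi_nonzero by blast
  define c where "c = cmod \<kappa> * (cmod (\<psi> x0) / 2)"
  have c: "c > 0" using kappa(1) \<open>\<psi> x0 \<noteq> 0\<close> by (simp add: c_def)
  have "isCont (\<lambda>x. cmod (\<psi> x)) x0"
    using schwartz_continuous[OF psi, of UNIV] by (intro continuous_norm) (auto simp: continuous_on_eq_continuous_at)
  then obtain R where R: "R > 0" "\<And>x. dist x x0 < R \<Longrightarrow> dist (cmod (\<psi> x)) (cmod (\<psi> x0)) < cmod (\<psi> x0) / 2"
    unfolding continuous_at_eps_delta using \<open>\<psi> x0 \<noteq> 0\<close> by (metis half_gt_zero zero_less_norm_iff)
  define U where "U = ball x0 R"
  have U: "cmod (\<psi> x) \<ge> cmod (\<psi> x0) / 2" if "x \<in> U" for x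
    using R(2)[of x] that by (simp add: U_def dist_commute dist_real_def abs_if split: if_splits)
  \<comment> \<open>Small enough that the term in b_n is absorbed and the next coefficient, after
    the change of weight, enters with factor exactly 1/2.\<close>
  define e where "e = c / (4 * 2 powr \<bar>\<gamma>\<bar>)"
  have e: "0 < e" "e \<le> c / 4" "4 * (2 powr \<bar>\<gamma>\<bar> * e) = c"
    using c ge_one_powr_ge_zero[of 2 "\<bar>\<gamma>\<bar>"] by (auto simp: e_def divide_le_eq mult_le_cancel_left1)
  obtain L0 where L0: "\<And>n. n \<ge> L0 \<Longrightarrow> \<bar>\<delta> n\<bar> < e"
    using LIMSEQ_D[OF \<delta>(1) e(1)] by auto
  define L where "L = max L0 3"
  have L: "3 \<le> n" "cmod (piece (n - 1) n x) \<le> e" "cmod (piece n (Suc n) x) \<le> e" if "n \<ge> L" for n x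
    using that L0[of n] L0[of "Suc n"] \<delta>(2)[of n x] \<delta>(2)[of "Suc n" x] by (auto simp: L_def)
  define C where "C = max (2 / c) K1"
  have C: "C \<ge> 0" "2 / c \<le> C" "K1 \<le> C" using K1 by (auto simp: C_def)
  obtain K where K: "K > 0"
    "\<And>X Z v. (\<And>m. m \<ge> L \<Longrightarrow> X m \<le> ennreal C * (\<Sum>l. ennreal ((1/2) ^ ((m - l) + (l - m))) * Z l)) \<Longrightarrow>
      (\<And>m. m < L \<Longrightarrow> X m \<le> ennreal C * v) \<Longrightarrow> lr_norm r X \<le> ennreal K * (lr_norm r Z + v)"
    using lr_norm_Hardy[OF r, of "1/2" C L] C by auto
  define V where "V = measure lborel U"
  have V: "emeasure lborel U = ennreal V" "V > 0"
    using R(1) emeasure_lborel_ball_finite[of x0 R] by (auto simp: V_def U_def emeasure_eq_ennreal_measure less_top)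
  define K' where "K' = max (2 * K) (2 * K / V powr (1 / p))"
  have K': "K' > 0" using K(1) by (simp add: K'_def)
  have fin_case: "wlr r \<gamma> (mods b) \<le> ennreal K' * F_norm \<phi>0 0 \<gamma> p r u"
    if b: "coeffs b u" and fin: "F_norm \<phi>0 0 \<gamma> p r u \<noteq> top" for b u
  proof -
    let ?F = "F_norm \<phi>0 0 \<gamma> p r u" and ?V = "wlr r \<gamma> (mods b)"
    let ?A = "\<lambda>x. lr_norm r (\<lambda>j. ennreal (?w j * cmod (block b j x)))"
    have step: "?w n * cmod (b n) \<le> 2 / c * (?w n * cmod (block b n x)) + 1/2 * (?w (Suc n) * cmod (b (Suc n)))"
      if x: "x \<in> U" and n: "n \<ge> L" for x n
    proof -
      have "block b n x = b n * (\<kappa> * wave n x) - b n * piece (n - 1) n x + b (Suc n) * piece n (Suc n) x"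
        unfolding block_def piece_sum[OF L(1)[OF n], symmetric] by (simp add: algebra_simps)
      then have "b n * (\<kappa> * wave n x) = block b n x + b n * piece (n - 1) n x - b (Suc n) * piece n (Suc n) x"
        by simp
      then have "cmod (b n * (\<kappa> * wave n x)) \<le> cmod (block b n x) + cmod (b n * piece (n - 1) n x) + cmod (b (Suc n) * piece n (Suc n) x)"
        by (metis norm_triangle_le_diff norm_triangle_ineq add_right_mono order_refl)
      also have "\<dots> \<le> cmod (block b n x) + cmod (b n) * e + cmod (b (Suc n)) * e"
        unfolding norm_mult by (intro add_mono mult_left_mono L n order_refl norm_ge_zero)
      finally have 1: "cmod (b n * (\<kappa> * wave n x)) \<le> cmod (block b n x) + cmod (b n) * e + cmod (b (Suc n)) * e" .
      have "cmod (b n) * c \<le> cmod (b n) * (cmod \<kappa> * cmod (\<psi> x))"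
        unfolding c_def by (intro mult_left_mono U[OF x]) auto
      also have "\<dots> = cmod (b n * (\<kappa> * wave n x))" by (simp add: norm_mult)
      finally have "cmod (b n) * c \<le> cmod (block b n x) + cmod (b n) * e + cmod (b (Suc n)) * e" using 1 by linarith
      moreover have "cmod (b n) * e \<le> cmod (b n) * (c / 4)" by (intro mult_left_mono e) simp
      moreover have "0 \<le> cmod (b n) * c" using c by simp
      ultimately have "cmod (b n) * (c / 2) \<le> cmod (block b n x) + cmod (b (Suc n)) * e"
        unfolding times_divide_eq_right by linarith
      then have "?w n * (cmod (b n) * (c / 2)) \<le> ?w n * (cmod (block b n x) + cmod (b (Suc n)) * e)"
        by (intro mult_left_mono) auto
      also have "\<dots> = ?w n * cmod (block b n x) + (?w n * e) * cmod (b (Suc n))" by (simp add: algebra_simps)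
      also have "\<dots> \<le> ?w n * cmod (block b n x) + (c / 4 * ?w (Suc n)) * cmod (b (Suc n))"
      proof (intro add_left_mono mult_right_mono)
        have "?w n * e \<le> 2 powr \<bar>\<gamma>\<bar> * ?w (Suc n) * e"
          using e(1) by (intro mult_right_mono weight_step) auto
        also have "\<dots> = c / 4 * ?w (Suc n)" by (simp add: e(3)[symmetric])
        finally show "?w n * e \<le> c / 4 * ?w (Suc n)" .
      qed simp
      finally have "2 / c * (?w n * (cmod (b n) * (c / 2))) \<le> 2 / c * (?w n * cmod (block b n x) + (c / 4 * ?w (Suc n)) * cmod (b (Suc n)))"
        using c by (intro mult_left_mono) auto
      then show ?thesis using c by (simp add: distrib_left ac_simps)
    qed
    \<comment> \<open>Only the direction of growing index occurs, so unrolling m times leaves a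
      one-sided geometric sum and a remainder with factor 2^(-m).\<close>
    have iter: "?w n * cmod (b n) \<le> 2 / c * (\<Sum>l\<in>{n..<n + m}. (1/2) ^ (l - n) * (?w l * cmod (block b l x))) + (1/2) ^ m * (?w (n + m) * cmod (b (n + m)))"
      if x: "x \<in> U" and n: "n \<ge> L" for x n m
    proof (induction m)
      case (Suc m)
      have "(1/2) ^ m * (?w (n + m) * cmod (b (n + m)))
          \<le> (1/2) ^ m * (2 / c * (?w (n + m) * cmod (block b (n + m) x)) + 1/2 * (?w (Suc (n + m)) * cmod (b (Suc (n + m)))))"
        using n by (intro mult_left_mono step x) auto
      with Suc show ?case by (simp add: distrib_left mult.assoc)
    qed simp
    have main: "?V \<le> ennreal K * (?A x + ?F)" if x: "x \<in> U" for x
      unfolding wlr_def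
    proof (rule K(2))
      fix n assume "n < L"
      show "ennreal (?w n) * mods b n \<le> ennreal C * ?F"
        by (rule order_trans[OF K1(2)[OF b]]) (intro mult_right_mono ennreal_leI C, simp)
    next
      fix n assume n: "L \<le> n"
      let ?Z = "\<lambda>l. ennreal (?w l * cmod (block b l x))"
      let ?S = "\<Sum>l. ennreal ((1/2) ^ ((n - l) + (l - n))) * ?Z l"
      have le: "ennreal (?w n) * mods b n \<le> ennreal C * ?S + ennreal ((1/2) ^ m) * (ennreal K1 * ?F)" for m
      proof -
        have "ennreal (?w n) * mods b n = ennreal (?w n * cmod (b n))" by (simp add: ennreal_mult)
        also have "\<dots> \<le> ennreal (2 / c * (\<Sum>l\<in>{n..<n + m}. (1/2) ^ (l - n) * (?w l * cmod (block b l x))) + (1/2) ^ m * (?w (n + m) * cmod (b (n + m))))"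
          by (intro ennreal_leI iter x n)
        also have "\<dots> = ennreal (2 / c) * (\<Sum>l\<in>{n..<n + m}. ennreal ((1/2) ^ (l - n)) * ?Z l) + ennreal ((1/2) ^ m) * (ennreal (?w (n + m)) * mods b (n + m))"
        proof -
          have "0 \<le> (1/2::real) ^ k" for k by simp
          moreover have "0 \<le> 2 / c" using c by simp
          moreover have "0 \<le> ?w k * cmod z" for k z by simp
          ultimately show ?thesis
            by (simp only: ennreal_plus ennreal_mult sum_nonneg mult_nonneg_nonneg sum_ennreal[symmetric] powr_ge_zero norm_ge_zero)
        qed
        also have "\<dots> \<le> ennreal C * ?S + ennreal ((1/2) ^ m) * (ennreal K1 * ?F)"
        proof (rule add_mono)
          have "(\<Sum>l\<in>{n..<n + m}. ennreal ((1/2) ^ (l - n)) * ?Z l) = (\<Sum>l\<in>{n..<n + m}. ennreal ((1/2) ^ ((n - l) + (l - n))) * ?Z l)"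
            by (rule sum.cong) auto
          also have "\<dots> \<le> ?S" by (rule sum_le_suminf) auto
          finally have "(\<Sum>l\<in>{n..<n + m}. ennreal ((1/2) ^ (l - n)) * ?Z l) \<le> ?S" .
          then show "ennreal (2 / c) * (\<Sum>l\<in>{n..<n + m}. ennreal ((1/2) ^ (l - n)) * ?Z l) \<le> ennreal C * ?S"
            by (intro mult_mono ennreal_leI C) auto
          show "ennreal ((1/2) ^ m) * (ennreal (?w (n + m)) * mods b (n + m)) \<le> ennreal ((1/2) ^ m) * (ennreal K1 * ?F)"
            by (intro mult_left_mono K1(2)[OF b]) simp
        qed
        finally show ?thesis .
      qed
      \<comment> \<open>The quasi-norm is finite here, so the remainder, at most 2^(-m) times a
        fixed multiple of it, tends to 0.\<close>
      show "ennreal (?w n) * mods b n \<le> ennreal C * ?S"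
      proof -
        obtain f where f: "?F = ennreal f" "f \<ge> 0" using fin by (cases ?F) auto
        have "(\<lambda>m. ennreal ((1/2) ^ m * (K1 * f))) \<longlonglongrightarrow> ennreal (0 * (K1 * f))"
          by (intro tendsto_ennrealI tendsto_mult tendsto_const LIMSEQ_power_zero) simp
        then have "(\<lambda>m. ennreal C * ?S + ennreal ((1/2) ^ m * (K1 * f))) \<longlonglongrightarrow> ennreal C * ?S + 0"
          by (intro tendsto_add tendsto_const) simp
        moreover have "ennreal (?w n) * mods b n \<le> ennreal C * ?S + ennreal ((1/2) ^ m * (K1 * f))" for m
          using le[of m] f K1(1) by (simp add: ennreal_mult)
        ultimately show ?thesis using LIMSEQ_le_const by fastforce
      qed
    qed
    show ?thesis
    proof (cases "?V \<le> ennreal (2 * K) * ?F")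
      case True
      then have "?V \<le> ennreal (2 * K) * ?F" .
      also have "\<dots> \<le> ennreal K' * ?F" by (intro mult_right_mono ennreal_leI) (auto simp: K'_def)
      finally show ?thesis .
    next
      case False
      \<comment> \<open>The quasi-norm term cannot be the larger one at any point of the ball, since
        that would be the case already settled. A bound by the pointwise term alone can be raised to
        the power p and integrated.\<close>
      have A: "?V \<le> ennreal (2 * K) * ?A x" if x: "x \<in> U" for x
      proof (cases "?A x \<le> ?F")
        case True
        have "?V \<le> ennreal K * (?A x + ?F)" by (rule main[OF x])
        also have "\<dots> \<le> ennreal K * (?F + ?F)" using True by (intro mult_left_mono add_right_mono) auto
        also have "\<dots> = ennreal (2 * K) * ?F" using K(1) by (simp add: mult_2[symmetric] ennreal_mult ac_simps)
        finally show ?thesis using False by simp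
      next
        case False
        have "?V \<le> ennreal K * (?A x + ?F)" by (rule main[OF x])
        also have "\<dots> \<le> ennreal K * (?A x + ?A x)" using False by (intro mult_left_mono add_left_mono) auto
        also have "\<dots> = ennreal (2 * K) * ?A x" using K(1) by (simp add: mult_2[symmetric] ennreal_mult ac_simps)
        finally show ?thesis .
      qed
      let ?k = "ennreal (1 / (2 * K))"
      have A': "?k * ?V \<le> ?A x" if x: "x \<in> U" for x
      proof -
        have "?k * ?V \<le> ?k * (ennreal (2 * K) * ?A x)" by (intro mult_left_mono A x) simp
        also have "\<dots> = ?A x" using K(1) by (simp add: mult.assoc[symmetric] ennreal_mult[symmetric])
        finally show ?thesis .
      qed
      have "epowr (?k * ?V) p * ennreal V = (\<integral>\<^sup>+x. epowr (?k * ?V) p * indicator U x \<partial>lborel)"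
        unfolding V(1)[symmetric] by (rule nn_integral_cmult_indicator[symmetric]) (simp add: U_def)
      also have "\<dots> \<le> (\<integral>\<^sup>+x. epowr (?A x) p \<partial>lborel)"
        using p by (intro nn_integral_mono) (auto simp: indicator_def intro!: epowr_mono A')
      also have "\<dots> = epowr ?F p" using p unfolding F_norm_eq[OF b] by (subst epowr_Lp_norm) auto
      finally have "epowr (epowr (?k * ?V) p * ennreal V) (1 / p) \<le> ?F"
        using p by (intro epowr_root_ge) auto
      then have le: "?k * ?V * ennreal (V powr (1 / p)) \<le> ?F"
        using p V(2) by (simp add: epowr_mult epowr_epowr)
      have "?V = ennreal (2 * K / V powr (1 / p)) * (?k * ?V * ennreal (V powr (1 / p)))"
      proof -
        have "2 * K / V powr (1 / p) * (1 / (2 * K) * V powr (1 / p)) = 1" using K(1) V(2) by simp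
        then have one: "ennreal (2 * K / V powr (1 / p)) * (?k * ennreal (V powr (1 / p))) = 1"
          using K(1) by (subst ennreal_mult[symmetric]) (auto simp: ennreal_mult[symmetric])
        have "ennreal (2 * K / V powr (1 / p)) * (?k * ?V * ennreal (V powr (1 / p)))
            = ennreal (2 * K / V powr (1 / p)) * (?k * ennreal (V powr (1 / p))) * ?V"
          by (simp only: ac_simps)
        then show ?thesis unfolding one by simp
      qed
      also have "\<dots> \<le> ennreal (2 * K / V powr (1 / p)) * ?F" by (intro mult_left_mono le) simp
      also have "\<dots> \<le> ennreal K' * ?F" by (intro mult_right_mono ennreal_leI) (auto simp: K'_def)
      finally show ?thesis .
    qed
  qed
  have "wlr r \<gamma> (mods b) \<le> ennreal K' * F_norm \<phi>0 0 \<gamma> p r u" if b: "coeffs b u" for b u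
    using fin_case[OF b] K' by (cases "F_norm \<phi>0 0 \<gamma> p r u = top") (auto simp: ennreal_mult_top)
  with K' show ?thesis by (intro that[of K'])
qed

end

section \<open>The Besov quasi-norm of lacunary functions\<close>

lemma diff_op_measurable:
  fixes f :: "real^'d::finite \<Rightarrow> complex"
  assumes [measurable]: "f \<in> borel_measurable borel"
  shows "(diff_op y ^^ k) f \<in> borel_measurable borel"
  by (induction k) (auto simp: diff_op_def[abs_def])

lemma diff_op_cnj: "(diff_op y ^^ k) (\<lambda>x. cnj (f x)) = (\<lambda>x. cnj ((diff_op y ^^ k) f x))"
  by (induction k) (auto simp: diff_op_def fun_eq_iff)

lemma diff_op_AE_tendsto:
  fixes f :: "nat \<Rightarrow> real^'d::finite \<Rightarrow> complex"
  assumes "AE x in lborel. (\<lambda>n. f n x) \<longlonglongrightarrow> g x"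
  shows "AE x in lborel. (\<lambda>n. (diff_op y ^^ k) (f n) x) \<longlonglongrightarrow> (diff_op y ^^ k) g x"
proof (induction k)
  case (Suc k)
  from AE_shift[OF Suc, of y] Suc show ?case
    by eventually_elim (auto simp: diff_op_def intro: tendsto_diff)
qed (use assms in simp)

lemma schwartz_diff_op:
  fixes f :: "real^'d::finite \<Rightarrow> complex"
  shows "f \<in> schwartz \<Longrightarrow> (diff_op y ^^ k) f \<in> schwartz"
  by (induction k) (auto simp: diff_op_def[abs_def] intro: schwartz_diff schwartz_shift)

lemma fourier_diff_op:
  fixes f :: "real^'d::finite \<Rightarrow> complex"
  assumes "f \<in> schwartz"
  shows "fourier ((diff_op y ^^ k) f) \<xi> = (cis (y \<bullet> \<xi>) - 1) ^ k * fourier f \<xi>"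
proof (induction k)
  case (Suc k)
  let ?g = "(diff_op y ^^ k) f"
  have g: "?g \<in> schwartz" using assms by (rule schwartz_diff_op)
  have "(diff_op y ^^ Suc k) f = (\<lambda>x. 1 * ?g (x + y) + (- 1) * ?g x)"
    by (simp add: diff_op_def fun_eq_iff)
  then have "fourier ((diff_op y ^^ Suc k) f) \<xi> = fourier (\<lambda>x. 1 * ?g (x + y) + (- 1) * ?g x) \<xi>" by (simp only:)
  also have "\<dots> = 1 * fourier (\<lambda>x. ?g (x + y)) \<xi> + (- 1) * fourier ?g \<xi>"
    by (intro fourier_lincomb schwartz_integrable schwartz_shift g)
  also have "\<dots> = (cis (y \<bullet> \<xi>) - 1) * fourier ?g \<xi>"
    by (simp add: fourier_shift[OF schwartz_measurable[OF g]] algebra_simps)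
  finally show ?case using Suc by simp
qed simp

text \<open>The adjoint of a difference with step y is the difference with step -y. Integrability is
  proved along with the identity because g is known to be integrable only against Schwartz
  functions.\<close>

lemma diff_op_pairing:
  fixes g :: "real^'d::finite \<Rightarrow> complex"
  assumes [measurable]: "g \<in> borel_measurable borel"
    and int: "\<And>w. w \<in> schwartz \<Longrightarrow> integrable lborel (\<lambda>x. g x * w x)"
    and w: "w \<in> schwartz"
  shows "integrable lborel (\<lambda>x. (diff_op y ^^ k) g x * w x) \<and>
    (LINT x|lborel. (diff_op y ^^ k) g x * w x) = (LINT x|lborel. g x * (diff_op (- y) ^^ k) w x)"
  using w
proof (induction k arbitrary: w)
  case (Suc k)
  let ?G = "(diff_op y ^^ k) g"
  have [measurable]: "?G \<in> borel_measurable borel" by (rule diff_op_measurable) simp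
  note [measurable] = schwartz_measurable[OF Suc.prems]
  have s: "(\<lambda>x. w (x + - y)) \<in> schwartz" by (rule schwartz_shift[OF Suc.prems])
  have i1: "integrable lborel (\<lambda>x. ?G x * w x)" using Suc by blast
  have i2: "integrable lborel (\<lambda>x. ?G x * w (x + - y))" using Suc.IH[OF s] by blast
  have i3: "integrable lborel (\<lambda>x. ?G (x + y) * w x)"
    using integrable_shift[OF i2, of y] by simp
  have eq: "(diff_op y ^^ Suc k) g x * w x = ?G (x + y) * w x - ?G x * w x" for x
    by (simp add: diff_op_def left_diff_distrib)
  have "(LINT x|lborel. (diff_op y ^^ Suc k) g x * w x) = (LINT x|lborel. ?G (x + y) * w x) - (LINT x|lborel. ?G x * w x)"
    unfolding eq using i3 i1 by (rule Bochner_Integration.integral_diff)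
  also have "(LINT x|lborel. ?G (x + y) * w x) = (LINT x|lborel. ?G x * w (x + - y))"
    using integral_shift[of "\<lambda>x. ?G x * w (x + - y)" y] by simp
  also have "\<dots> - (LINT x|lborel. ?G x * w x) = (LINT x|lborel. ?G x * diff_op (- y) w x)"
  proof -
    have dw: "diff_op (- y) w x = w (x + - y) - w x" for x
      by (simp only: diff_op_def)
    show ?thesis
      unfolding dw right_diff_distrib by (rule Bochner_Integration.integral_diff[OF i2 i1, symmetric])
  qed
  also have "\<dots> = (LINT x|lborel. g x * (diff_op (- y) ^^ k) (diff_op (- y) w) x)"
    using Suc.IH[of "diff_op (- y) w"] schwartz_diff_op[OF Suc.prems, of 1 "- y"] by simp
  also have "(diff_op (- y) ^^ k) (diff_op (- y) w) = (diff_op (- y) ^^ Suc k) w"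
    by (simp add: funpow_swap1)
  finally show ?case
    unfolding eq using i3 i1 by simp
qed (use int in simp)

lemma Lp_norm_diff_op:
  fixes p :: real
  assumes p: "0 < p"
  obtains K :: real where "K > 0"
    "\<And>f y. f \<in> borel_measurable borel \<Longrightarrow> Lp_norm p (\<lambda>x. ennreal (cmod ((diff_op y ^^ k) f x)))
      \<le> ennreal K * Lp_norm p (\<lambda>x. ennreal (cmod ((f :: real^'d::finite \<Rightarrow> complex) x)))"
proof -
  define c where "c = 2 * 4 powr (1 + 1 / p)"
  have c: "c > 0" by (simp add: c_def)
  have step: "Lp_norm p (\<lambda>x. ennreal (cmod (diff_op y f x))) \<le> ennreal c * Lp_norm p (\<lambda>x. ennreal (cmod (f x)))"
    if [measurable]: "f \<in> borel_measurable borel" for f :: "real^'d \<Rightarrow> complex" and y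
  proof -
    have "Lp_norm p (\<lambda>x. ennreal (cmod (diff_op y f x))) \<le> Lp_norm p (\<lambda>x. ennreal (cmod (f (x + y))) + ennreal (cmod (f x)))"
      using p by (intro Lp_norm_mono)
        (auto simp: diff_op_def ennreal_plus[symmetric] simp del: ennreal_plus intro!: ennreal_leI norm_triangle_ineq4)
    also have "\<dots> \<le> ennreal (4 powr (1 + 1 / p)) * (Lp_norm p (\<lambda>x. ennreal (cmod (f (x + y)))) + Lp_norm p (\<lambda>x. ennreal (cmod (f x))))"
      using p by (intro Lp_norm_add) auto
    also have "Lp_norm p (\<lambda>x. ennreal (cmod (f (x + y)))) = Lp_norm p (\<lambda>x. ennreal (cmod (f x)))"
      by (rule Lp_norm_shift[of "\<lambda>x. ennreal (cmod (f x))"]) simp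
    also have "ennreal (4 powr (1 + 1 / p)) * (Lp_norm p (\<lambda>x. ennreal (cmod (f x))) + Lp_norm p (\<lambda>x. ennreal (cmod (f x))))
        = ennreal c * Lp_norm p (\<lambda>x. ennreal (cmod (f x)))"
      by (simp add: c_def mult_2[symmetric] ennreal_mult ac_simps)
    finally show ?thesis .
  qed
  have "Lp_norm p (\<lambda>x. ennreal (cmod ((diff_op y ^^ k) f x))) \<le> ennreal (c ^ k) * Lp_norm p (\<lambda>x. ennreal (cmod (f x)))"
    if [measurable]: "f \<in> borel_measurable borel" for f :: "real^'d \<Rightarrow> complex" and y
  proof (induction k)
    case (Suc k)
    have "Lp_norm p (\<lambda>x. ennreal (cmod ((diff_op y ^^ Suc k) f x))) \<le> ennreal c * Lp_norm p (\<lambda>x. ennreal (cmod ((diff_op y ^^ k) f x)))"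
      using step[OF diff_op_measurable[OF that]] by simp
    also have "\<dots> \<le> ennreal c * (ennreal (c ^ k) * Lp_norm p (\<lambda>x. ennreal (cmod (f x))))"
      by (intro mult_left_mono Suc) simp
    also have "\<dots> = ennreal (c ^ Suc k) * Lp_norm p (\<lambda>x. ennreal (cmod (f x)))"
      using c by (simp add: ennreal_mult mult.assoc)
    finally show ?case .
  qed simp
  with c show ?thesis by (intro that[of "c ^ k"]) auto
qed

text \<open>Averaging over the step keeps only the constant term \<open>(-1)\<^sup>k\<close> of the symbol of the difference
  at high frequencies, so that no step has to be chosen for all frequencies at once.\<close>

lemma cis_diff_power_average:
  assumes \<mu>: "\<mu> > 0" and t: "t > 0"
  shows "cmod ((LINT s|lborel. indicat_real {0..t} s *\<^sub>R (cis (s * \<mu>) - 1) ^ k) - (-1) ^ k * of_real t) \<le> 2 ^ Suc k / \<mu>"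
proof -
  let ?I = "\<lambda>l. LINT s|lborel. indicat_real {0..t} s *\<^sub>R cis (s * (real l * \<mu>))"
  have int: "integrable lborel (\<lambda>s. indicat_real {0..t} s *\<^sub>R cis (s * a))" for a
    by (rule borel_integrable_compact) (auto intro!: continuous_intros)
  have I0: "?I 0 = of_real t"
    using t by (simp add: scaleR_conv_of_real)
  have I: "cmod (?I l) \<le> 2 / \<mu>" if "l \<ge> 1" for l
  proof -
    define a where "a = real l * \<mu>"
    have a: "a \<ge> \<mu>" "a > 0" using that \<mu> by (auto simp: a_def)
    have d: "((\<lambda>s. cis (s * a) / (\<i> * of_real a)) has_vector_derivative cis (s * a)) (at s within {0..t})" for s
    proof -
      have "((\<lambda>s. cis (s * a)) has_vector_derivative (\<i> * of_real a * cis (s * a))) (at s)"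
        using has_derivative_cis_inner[of a s]
        by (simp add: has_vector_derivative_def scaleR_conv_of_real ac_simps)
      then have "((\<lambda>s. (1 / (\<i> * of_real a)) * cis (s * a)) has_vector_derivative (1 / (\<i> * of_real a)) * (\<i> * of_real a * cis (s * a))) (at s within {0..t})"
        by (rule has_vector_derivative_mult_right[OF has_vector_derivative_at_within])
      then show ?thesis using a by simp
    qed
    have "?I l = cis (t * a) / (\<i> * of_real a) - cis (0 * a) / (\<i> * of_real a)"
      unfolding a_def[symmetric] using t by (intro integral_FTC_Icc d) (auto intro!: continuous_intros)
    also have "cmod \<dots> \<le> cmod (cis (t * a) / (\<i> * of_real a)) + cmod (cis (0 * a) / (\<i> * of_real a))"
      by (rule norm_triangle_ineq4)
    also have "\<dots> = 2 / a" using a by (simp add: norm_divide norm_mult)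
    also have "\<dots> \<le> 2 / \<mu>" using a \<mu> by (intro divide_left_mono) auto
    finally show ?thesis .
  qed
  have pow: "indicat_real {0..t} s *\<^sub>R (cis (s * \<mu>) - 1) ^ k
      = (\<Sum>l\<le>k. (of_nat (k choose l) * (-1) ^ (k - l)) * (indicat_real {0..t} s *\<^sub>R cis (s * (real l * \<mu>))))" for s
  proof -
    have "(cis (s * \<mu>) + (-1)) ^ k = (\<Sum>l\<le>k. of_nat (k choose l) * cis (s * \<mu>) ^ l * (-1) ^ (k - l))"
      by (rule binomial_ring)
    moreover have "cis (s * (real l * \<mu>)) = cis (s * \<mu>) ^ l" for l
      by (simp add: Complex.DeMoivre ac_simps)
    ultimately show ?thesis
      by (simp add: scaleR_conv_of_real sum_distrib_left ac_simps)
  qed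
  have "(LINT s|lborel. indicat_real {0..t} s *\<^sub>R (cis (s * \<mu>) - 1) ^ k) = (\<Sum>l\<le>k. (of_nat (k choose l) * (-1) ^ (k - l)) * ?I l)"
  proof -
    have "integrable lborel (\<lambda>s. (of_nat (k choose l) * (-1) ^ (k - l)) * (indicat_real {0..t} s *\<^sub>R cis (s * (real l * \<mu>))))" for l
      using int by (rule integrable_mult_right)
    then show ?thesis unfolding pow by (simp only: Bochner_Integration.integral_sum integral_mult_right_zero)
  qed
  also have "\<dots> = (-1) ^ k * of_real t + (\<Sum>l\<in>{1..k}. (of_nat (k choose l) * (-1) ^ (k - l)) * ?I l)"
  proof -
    have split: "{..k} = insert 0 {1..k}" by auto
    show ?thesis unfolding split by (subst sum.insert) (simp_all only: I0 finite_atLeastAtMost, simp_all)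
  qed
  finally have "cmod ((LINT s|lborel. indicat_real {0..t} s *\<^sub>R (cis (s * \<mu>) - 1) ^ k) - (-1) ^ k * of_real t)
      = cmod (\<Sum>l\<in>{1..k}. (of_nat (k choose l) * (-1) ^ (k - l)) * ?I l)" by simp
  also have "\<dots> \<le> (\<Sum>l\<in>{1..k}. real (k choose l) * (2 / \<mu>))"
  proof (rule sum_norm_le)
    fix l assume "l \<in> {1..k}"
    then have "real (k choose l) * cmod (?I l) \<le> real (k choose l) * (2 / \<mu>)"
      by (intro mult_left_mono I) auto
    then show "cmod ((of_nat (k choose l) * (-1) ^ (k - l)) * ?I l) \<le> real (k choose l) * (2 / \<mu>)"
      by (simp only: norm_mult norm_power norm_of_nat norm_minus_cancel norm_one power_one mult_1_right)
  qed
  also have "\<dots> \<le> (\<Sum>l\<le>k. real (k choose l) * (2 / \<mu>))"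
    using \<mu> by (intro sum_mono2) auto
  also have "\<dots> = 2 ^ k * (2 / \<mu>)"
  proof -
    have "(\<Sum>l\<le>k. real (k choose l)) = real (\<Sum>l\<le>k. k choose l)" by simp
    also have "\<dots> = 2 ^ k" unfolding choose_row_sum by simp
    finally show ?thesis by (simp only: sum_distrib_right[symmetric])
  qed
  finally show ?thesis by (simp add: mult.commute)
qed

section \<open>Partial sums, their spectra and averaged differences\<close>

context lacunary_setting
begin

definition partial :: "nat \<Rightarrow> (nat \<Rightarrow> complex) \<Rightarrow> real^'d \<Rightarrow> complex" where
  "partial n c x = \<psi> x * lac_sum n c x"

lemma partial_eq: "partial n c = (\<lambda>x. \<Sum>j\<in>{3..<n}. c j * wave j x)"
  by (simp add: partial_def lac_sum_def sum_distrib_left ac_simps fun_eq_iff)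

lemma partial_schwartz: "partial n c \<in> schwartz"
  unfolding partial_eq by (intro schwartz_sum schwartz_cmult wave_schwartz)

lemma fourier_partial: "fourier (partial n c) \<xi> = (\<Sum>j\<in>{3..<n}. c j * fourier (wave j) \<xi>)"
proof -
  have "fourier (\<lambda>x. \<Sum>j\<in>J. c j * wave j x) \<xi> = (\<Sum>j\<in>J. c j * fourier (wave j) \<xi>)" if "finite J" for J
    using that
  proof (induction J)
    case (insert j J)
    have S: "(\<lambda>x. \<Sum>j\<in>J. c j * wave j x) \<in> schwartz" by (intro schwartz_sum schwartz_cmult wave_schwartz)
    show ?case
      using insert fourier_lincomb[OF schwartz_integrable[OF wave_schwartz] schwartz_integrable[OF S], of "c j" j 1 \<xi>]
      by simp
  qed (simp add: fourier_def)
  then show ?thesis unfolding partial_eq by simp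
qed

definition energy :: real where
  "energy = (LINT x|lborel. (cmod (\<psi> x))\<^sup>2)"

lemma energy_pos: "energy > 0"
  unfolding energy_def by (rule psi_norm_pos)

definition spec :: "nat \<Rightarrow> real^'d \<Rightarrow> real" where
  "spec j \<xi> = (cmod (fourier (wave j) \<xi>))\<^sup>2"

lemma spec_integrable: "integrable lborel (spec j)"
  using integrable_norm[OF schwartz_mult_integrable[OF schwartz_fourier[OF wave_schwartz] schwartz_fourier[OF wave_schwartz], of j j]]
  by (simp add: spec_def[abs_def] norm_mult power2_eq_square)

lemma spec_integral:
  assumes "j \<ge> 3"
  shows "complex_of_real (LINT \<xi>|lborel. spec j \<xi>) = \<kappa> * of_real energy"
proof -
  have "complex_of_real (LINT \<xi>|lborel. spec j \<xi>) = (LINT \<xi>|lborel. fourier (wave j) \<xi> * cnj (fourier (wave j) \<xi>))"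
    unfolding spec_def by (simp only: integral_complex_of_real[symmetric] complex_norm_square)
  also have "\<dots> = \<kappa> * (LINT x|lborel. wave j x * cnj (wave j x))"
    by (intro parseval wave_schwartz kappa)
  finally show ?thesis using wave_pairing[OF assms assms] by (simp add: energy_def)
qed

text \<open>Differences act as multipliers and the spectra of the waves are disjoint, so only
  diagonal terms survive. The step -y on the test function corresponds to step y on the function
  represented by u.\<close>

lemma coeffs_partial_pairing:
  assumes b: "coeffs b u"
  shows "u ((diff_op (- y) ^^ k) (\<lambda>x. cnj (partial n c x)))
    = (\<Sum>j\<in>{3..<n}. b j * cnj (c j) * ((LINT \<xi>|lborel. (cis (y \<bullet> \<xi>) - 1) ^ k * of_real (spec j \<xi>)) / \<kappa>))"
proof -
  let ?w = "\<lambda>x. cnj ((diff_op (- y) ^^ k) (partial n c) x)"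
  let ?I = "\<lambda>j. LINT \<xi>|lborel. (cis (y \<bullet> \<xi>) - 1) ^ k * of_real (spec j \<xi>)"
  have D: "(diff_op (- y) ^^ k) (partial n c) \<in> schwartz" by (intro schwartz_diff_op partial_schwartz)
  have w: "?w \<in> schwartz" by (intro schwartz_cnj D)
  have pair: "(LINT x|lborel. wave i x * ?w x) = (if i \<in> {3..<n} then cnj (c i) * ?I i / \<kappa> else 0)" if i: "i \<ge> 3" for i
  proof -
    have pt: "fourier (wave i) \<xi> * cnj (fourier ((diff_op (- y) ^^ k) (partial n c)) \<xi>)
        = (if i \<in> {3..<n} then cnj (c i) * ((cis (y \<bullet> \<xi>) - 1) ^ k * of_real (spec i \<xi>)) else 0)" for \<xi>
    proof -
      have "fourier (wave i) \<xi> * cnj (fourier ((diff_op (- y) ^^ k) (partial n c)) \<xi>)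
          = (cis (y \<bullet> \<xi>) - 1) ^ k * (\<Sum>j\<in>{3..<n}. cnj (c j) * (fourier (wave i) \<xi> * cnj (fourier (wave j) \<xi>)))"
        by (simp add: fourier_diff_op[OF partial_schwartz] fourier_partial sum_distrib_left cis_cnj ac_simps)
      also have "(\<Sum>j\<in>{3..<n}. cnj (c j) * (fourier (wave i) \<xi> * cnj (fourier (wave j) \<xi>)))
          = (\<Sum>j\<in>{3..<n}. if j = i then cnj (c i) * of_real (spec i \<xi>) else 0)"
      proof (rule sum.cong)
        fix j assume j: "j \<in> {3..<n}"
        show "cnj (c j) * (fourier (wave i) \<xi> * cnj (fourier (wave j) \<xi>)) = (if j = i then cnj (c i) * of_real (spec i \<xi>) else 0)"
        proof (cases "j = i")
          case True
          then show ?thesis unfolding spec_def complex_norm_square by simp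
        next
          case False
          then show ?thesis using fourier_wave_disjoint[of i j \<xi>] i j by simp
        qed
      qed simp
      finally show ?thesis by (simp add: sum.delta)
    qed
    have "\<kappa> * (LINT x|lborel. wave i x * ?w x) = (LINT \<xi>|lborel. fourier (wave i) \<xi> * cnj (fourier ((diff_op (- y) ^^ k) (partial n c)) \<xi>))"
      by (intro parseval[symmetric] wave_schwartz D kappa)
    also have "\<dots> = (if i \<in> {3..<n} then cnj (c i) * ?I i else 0)"
      unfolding pt by (cases "i \<in> {3..<n}") (simp_all del: atLeastLessThan_iff)
    finally show ?thesis using kappa(1) by (auto simp: field_simps)
  qed
  have "(\<lambda>i. b i * (LINT x|lborel. wave i x * ?w x)) sums u ?w"
    using b w unfolding coeffs_def by (simp add: mult.assoc)
  moreover have "(\<lambda>i. b i * (LINT x|lborel. wave i x * ?w x)) sums (\<Sum>i\<in>{3..<n}. b i * (LINT x|lborel. wave i x * ?w x))"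
  proof (rule sums_finite)
    fix i assume "i \<notin> {3..<n}"
    then show "b i * (LINT x|lborel. wave i x * ?w x) = 0"
      using b pair[of i] by (cases "i < 3") (auto simp: coeffs_def)
  qed simp
  ultimately have "u ?w = (\<Sum>i\<in>{3..<n}. b i * (LINT x|lborel. wave i x * ?w x))"
    by (rule sums_unique2)
  also have "\<dots> = (\<Sum>j\<in>{3..<n}. b j * cnj (c j) * (?I j / \<kappa>))"
    by (intro sum.cong) (auto simp: pair)
  finally show ?thesis unfolding diff_op_cnj .
qed

lemma Lp_norm_partial:
  assumes p: "1 < p"
  obtains C :: real where "C > 0"
    "\<And>n c. Lp_norm p (\<lambda>x. ennreal (cmod (partial n c x))) \<le> ennreal (C * sqrt (\<Sum>j\<in>{3..<n}. (cmod (c j))\<^sup>2))"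
proof -
  obtain C M where C: "C > 0"
    "\<And>\<theta> D n c. \<theta> \<in> band \<Longrightarrow> D \<ge> 0 \<Longrightarrow> (\<And>x. cmod (\<theta> x) \<le> D / (1 + norm x) ^ M) \<Longrightarrow>
      Lp_norm p (\<lambda>x. ennreal (cmod (\<theta> x * lac_sum n c x))) \<le> ennreal (C * D * sqrt (\<Sum>j\<in>{3..<n}. (cmod (c j))\<^sup>2))"
    by (rule Lp_norm_lac_sum[OF p]) (rule that, assumption, blast)
  obtain D where D: "D > 0" "\<And>x. cmod (\<psi> x) \<le> D / (1 + norm x) ^ M"
    by (rule schwartz_decay'[OF psi, of M]) (rule that)
  show ?thesis
    using C(1) D(1) C(2)[OF psi_band _ D(2)] by (intro that[of "C * D"]) (auto simp: partial_def)
qed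

text \<open>Fubini moves the average over the step inside the spectral integral, where
  \<open>cis_diff_power_average\<close> applies at the frequency \<xi>_1; on the spectrum of the
  wave this is at least \<lambda>_j - 2.\<close>

lemma average_pairing:
  assumes j: "j \<ge> 3" and t: "t > 0"
  shows "integrable lborel (\<lambda>s. indicat_real {0..t} s *\<^sub>R (LINT \<xi>|lborel. (cis (freq s \<bullet> \<xi>) - 1) ^ k * of_real (spec j \<xi>)))"
    and "cmod ((LINT s|lborel. indicat_real {0..t} s *\<^sub>R (LINT \<xi>|lborel. (cis (freq s \<bullet> \<xi>) - 1) ^ k * of_real (spec j \<xi>)))
      - (-1) ^ k * of_real t * (\<kappa> * of_real energy)) \<le> 2 ^ Suc k / (lac_freq j - 2) * (cmod \<kappa> * energy)"
proof -
  have [measurable]: "spec j \<in> borel_measurable borel"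
    using borel_measurable_integrable[OF spec_integrable[of j]] by simp
  have [measurable]: "(\<lambda>\<xi>::real^'d. \<xi> $ i1) \<in> borel_measurable borel"
    by (intro borel_measurable_continuous_onI continuous_intros)
  have fr: "freq s \<bullet> \<xi> = s * (\<xi> $ i1)" for s \<xi> by (simp add: inner_commute)
  let ?F = "\<lambda>s \<xi>. (indicat_real {0..t} s *\<^sub>R (cis (s * (\<xi> $ i1)) - 1) ^ k) * of_real (spec j \<xi>)"
  have sp: "0 \<le> spec j \<xi>" for \<xi> by (simp add: spec_def)
  have l: "lac_freq j > 2"
  proof -
    have "(2::real) ^ 3 \<le> 2 ^ j" using j by (intro power_increasing) auto
    then show ?thesis by (simp add: lac_freq_def)
  qed
  have bd: "cmod (?F s \<xi>) \<le> indicat_real {0..t} s * 2 ^ k * spec j \<xi>" for s \<xi>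
  proof -
    have "cmod (cis (s * (\<xi> $ i1)) - 1) \<le> 2" using norm_triangle_ineq4[of "cis (s * (\<xi> $ i1))" 1] by simp
    then have "cmod (cis (s * (\<xi> $ i1)) - 1) ^ k \<le> 2 ^ k" by (intro power_mono) auto
    then show ?thesis using sp[of \<xi>] by (auto simp: norm_mult norm_power indicator_def intro!: mult_right_mono)
  qed
  have "integrable (lborel \<Otimes>\<^sub>M lborel) (case_prod ?F)"
  proof (rule Bochner_Integration.integrable_bound)
    have i1: "integrable lborel (\<lambda>s. indicat_real {0..t} s * 2 ^ k)" using t by simp
    show "integrable (lborel \<Otimes>\<^sub>M lborel) (\<lambda>(s, \<xi>). indicat_real {0..t} s * 2 ^ k * spec j \<xi>)"
    proof (rule lborel_pair.Fubini_integrable)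
      have "integrable lborel (\<lambda>s. (indicat_real {0..t} s * 2 ^ k) * (LINT \<xi>|lborel. spec j \<xi>))"
        by (intro integrable_mult_left i1)
      then show "integrable lborel (\<lambda>s. LINT \<xi>|lborel. norm (case (s, \<xi>) of (s, \<xi>) \<Rightarrow> indicat_real {0..t} s * 2 ^ k * spec j \<xi>))"
        using sp by (simp add: abs_mult)
      show "AE s in lborel. integrable lborel (\<lambda>\<xi>. case (s, \<xi>) of (s, \<xi>) \<Rightarrow> indicat_real {0..t} s * 2 ^ k * spec j \<xi>)"
        using spec_integrable[of j] by simp
    qed measurable
    show "AE z in lborel \<Otimes>\<^sub>M lborel. norm (case z of (s, \<xi>) \<Rightarrow> ?F s \<xi>) \<le> norm (case z of (s, \<xi>) \<Rightarrow> indicat_real {0..t} s * 2 ^ k * spec j \<xi>)"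
      using bd sp by (auto simp: abs_mult)
  qed measurable
  note fub = lborel_pair.Fubini_integral[OF this] lborel_pair.integrable_fst'[OF this]
  have inner: "(LINT \<xi>|lborel. ?F s \<xi>) = indicat_real {0..t} s *\<^sub>R (LINT \<xi>|lborel. (cis (freq s \<bullet> \<xi>) - 1) ^ k * of_real (spec j \<xi>))" for s
    unfolding fr by (subst integral_scaleR_right[symmetric]) simp
  show "integrable lborel (\<lambda>s. indicat_real {0..t} s *\<^sub>R (LINT \<xi>|lborel. (cis (freq s \<bullet> \<xi>) - 1) ^ k * of_real (spec j \<xi>)))"
    using fub(2) unfolding case_prod_conv inner .
  let ?J = "\<lambda>\<xi>. LINT s|lborel. indicat_real {0..t} s *\<^sub>R (cis (s * (\<xi> $ i1)) - 1) ^ k"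
  have outer: "(LINT s|lborel. ?F s \<xi>) = ?J \<xi> * of_real (spec j \<xi>)" for \<xi>
    by (rule integral_mult_left_zero)
  have eq: "(LINT s|lborel. indicat_real {0..t} s *\<^sub>R (LINT \<xi>|lborel. (cis (freq s \<bullet> \<xi>) - 1) ^ k * of_real (spec j \<xi>)))
      = (LINT \<xi>|lborel. ?J \<xi> * of_real (spec j \<xi>))"
    using fub(1) unfolding inner outer by simp
  have i2: "integrable lborel (\<lambda>\<xi>. ?J \<xi> * of_real (spec j \<xi>))"
    using lborel_pair.integrable_snd[OF \<open>integrable (lborel \<Otimes>\<^sub>M lborel) (case_prod ?F)\<close>] unfolding outer .
  have i3: "integrable lborel (\<lambda>\<xi>. ((-1) ^ k * of_real t) * complex_of_real (spec j \<xi>))"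
    using spec_integrable[of j] by (intro integrable_mult_right integrable_of_real)
  have "(LINT \<xi>|lborel. ?J \<xi> * of_real (spec j \<xi>)) - (-1) ^ k * of_real t * (\<kappa> * of_real energy)
      = (LINT \<xi>|lborel. ?J \<xi> * of_real (spec j \<xi>)) - (LINT \<xi>|lborel. ((-1) ^ k * of_real t) * complex_of_real (spec j \<xi>))"
    unfolding spec_integral[OF j, symmetric] by simp
  also have "\<dots> = (LINT \<xi>|lborel. ?J \<xi> * of_real (spec j \<xi>) - ((-1) ^ k * of_real t) * complex_of_real (spec j \<xi>))"
    using i2 i3 by (rule Bochner_Integration.integral_diff[symmetric])
  also have "cmod \<dots> \<le> (LINT \<xi>|lborel. 2 ^ Suc k / (lac_freq j - 2) * spec j \<xi>)"
  proof (rule order_trans[OF integral_norm_bound Bochner_Integration.integral_mono])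
    show "integrable lborel (\<lambda>\<xi>. cmod (?J \<xi> * of_real (spec j \<xi>) - ((-1) ^ k * of_real t) * complex_of_real (spec j \<xi>)))"
      using i2 i3 by (intro integrable_norm Bochner_Integration.integrable_diff)
    show "integrable lborel (\<lambda>\<xi>. 2 ^ Suc k / (lac_freq j - 2) * spec j \<xi>)"
      by (intro integrable_mult_right spec_integrable)
    fix \<xi>
    show "cmod (?J \<xi> * of_real (spec j \<xi>) - ((-1) ^ k * of_real t) * complex_of_real (spec j \<xi>)) \<le> 2 ^ Suc k / (lac_freq j - 2) * spec j \<xi>"
    proof (cases "fourier (wave j) \<xi> = 0")
      case False
      then have "norm (\<xi> - freq (lac_freq j)) \<le> 2"
        using psi_band unfolding fourier_wave band_def by force
      then have "\<bar>(\<xi> - freq (lac_freq j)) $ i1\<bar> \<le> 2"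
        using component_le_norm_cart order_trans by blast
      then have x1: "\<xi> $ i1 \<ge> lac_freq j - 2" by (simp add: freq_def axis_def)
      have "cmod (?J \<xi> * of_real (spec j \<xi>) - ((-1) ^ k * of_real t) * complex_of_real (spec j \<xi>))
          = cmod (?J \<xi> - (-1) ^ k * of_real t) * spec j \<xi>"
        using sp[of \<xi>] by (simp add: left_diff_distrib[symmetric] norm_mult del: of_real_mult)
      also have "\<dots> \<le> 2 ^ Suc k / (\<xi> $ i1) * spec j \<xi>"
        using x1 l t sp by (intro mult_right_mono cis_diff_power_average) auto
      also have "\<dots> \<le> 2 ^ Suc k / (lac_freq j - 2) * spec j \<xi>"
        using x1 l sp by (intro mult_right_mono divide_left_mono) auto
      finally show ?thesis .
    qed (simp add: spec_def)
  qed
  also have "\<dots> = 2 ^ Suc k / (lac_freq j - 2) * (LINT \<xi>|lborel. spec j \<xi>)" by (rule integral_mult_right_zero)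
  also have "(LINT \<xi>|lborel. spec j \<xi>) = cmod \<kappa> * energy"
  proof -
    have "(LINT \<xi>|lborel. spec j \<xi>) = cmod (complex_of_real (LINT \<xi>|lborel. spec j \<xi>))"
      using sp by (simp add: Bochner_Integration.integral_nonneg)
    also have "\<dots> = cmod \<kappa> * energy" unfolding spec_integral[OF j] using energy_pos by (simp add: norm_mult)
    finally show ?thesis .
  qed
  finally show "cmod ((LINT s|lborel. indicat_real {0..t} s *\<^sub>R (LINT \<xi>|lborel. (cis (freq s \<bullet> \<xi>) - 1) ^ k * of_real (spec j \<xi>)))
      - (-1) ^ k * of_real t * (\<kappa> * of_real energy)) \<le> 2 ^ Suc k / (lac_freq j - 2) * (cmod \<kappa> * energy)"
    unfolding eq .
qed

end

section \<open>Modulus of smoothness against tails of the coefficients\<close>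

lemma sqrt_le_of_square_bound:
  fixes S w C e :: real
  assumes "0 \<le> S" "0 < e" "0 \<le> w" "0 \<le> C" "e * S \<le> w * (C * sqrt S)"
  shows "sqrt S \<le> C / e * w"
proof (cases "S = 0")
  case True
  then show ?thesis using assms by simp
next
  case False
  then have S: "sqrt S > 0" using assms by simp
  have "(e * sqrt S) * sqrt S = e * S" using assms(1) by simp
  also have "\<dots> \<le> (w * C) * sqrt S" using assms(5) by (simp add: mult.assoc)
  finally have "e * sqrt S \<le> w * C" using S by (rule mult_right_le_imp_le)
  then show ?thesis using assms(2) by (simp add: field_simps)
qed

text \<open>The reciprocal of the first frequency of the block \<open>dyadic m\<close>, up to a constant factor.\<close>

definition dbl :: "nat \<Rightarrow> real" where
  "dbl m = 2 powr (- (2 ^ m))"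

lemma dbl_bounds: "0 < dbl m" "dbl m \<le> 1"
  using powr_mono[of "- (2 ^ m)" 0 2] by (auto simp: dbl_def)

context lacunary_setting
begin

text \<open>The function is paired with a partial sum of its own expansion. The pairing produces the
  square sum, while the norm of the partial sum in the dual exponent costs only its root, so one
  root cancels. For the modulus the pairing is averaged over steps up to t; the condition with
  \<open>2 ^ (k + 2)\<close> keeps the averaging error at no more than half of the main
  term.\<close>

lemma coeffs_le_Lp_norm:
  assumes p: "1 < p"
  obtains K :: real where "K > 0"
    "\<And>b u g N. coeffs b u \<Longrightarrow> represents g u \<Longrightarrow>
      ennreal (sqrt (\<Sum>j\<in>{3..<N}. (cmod (b j))\<^sup>2)) \<le> ennreal K * Lp_norm p (\<lambda>x. ennreal (cmod (g x)))"
    "\<And>b u g N n t. coeffs b u \<Longrightarrow> represents g u \<Longrightarrow> 3 \<le> n \<Longrightarrow> 0 < t \<Longrightarrow> 2 ^ (k + 2) \<le> t * (lac_freq n - 2) \<Longrightarrow>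
      ennreal (sqrt (\<Sum>j\<in>{n..<N}. (cmod (b j))\<^sup>2)) \<le> ennreal K * modulus k p g t"
proof -
  define p' where "p' = p / (p - 1)"
  have p': "1 < p'" "1 / p + 1 / p' = 1" using p by (auto simp: p'_def field_simps)
  obtain C where C: "C > 0"
    "\<And>n c. Lp_norm p' (\<lambda>x. ennreal (cmod (partial n c x))) \<le> ennreal (C * sqrt (\<Sum>j\<in>{3..<n}. (cmod (c j))\<^sup>2))"
    by (rule Lp_norm_partial[OF p'(1)]) (rule that)
  \<comment> \<open>The 2 makes up for the half of the main term given away in the averaged
    estimate.\<close>
  define K where "K = 2 * C / energy"
  have K: "K > 0" using C(1) energy_pos by (simp add: K_def)
  have pair: "ennreal (cmod (u ((diff_op (- y) ^^ k) (\<lambda>x. cnj (partial N c x)))))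
      \<le> Lp_norm p (\<lambda>x. ennreal (cmod ((diff_op y ^^ k) g x))) * ennreal (C * sqrt (\<Sum>j\<in>{3..<N}. (cmod (c j))\<^sup>2))"
    if g: "represents g u" for g u y k N c
  proof -
    have gm: "g \<in> borel_measurable borel" and gint: "\<And>w. w \<in> schwartz \<Longrightarrow> integrable lborel (\<lambda>x. g x * w x)"
      and gu: "\<And>w. w \<in> schwartz \<Longrightarrow> u w = (LINT x|lborel. g x * w x)"
      using g by (auto simp: represents_def)
    have w: "(\<lambda>x. cnj (partial N c x)) \<in> schwartz" by (intro schwartz_cnj partial_schwartz)
    have "u ((diff_op (- y) ^^ k) (\<lambda>x. cnj (partial N c x))) = (LINT x|lborel. (diff_op y ^^ k) g x * cnj (partial N c x))"
      unfolding gu[OF schwartz_diff_op[OF w]] using diff_op_pairing[OF gm gint w] by simp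
    also have "ennreal (cmod \<dots>) \<le> Lp_norm p (\<lambda>x. ennreal (cmod ((diff_op y ^^ k) g x))) * Lp_norm p' (\<lambda>x. ennreal (cmod (cnj (partial N c x))))"
      by (intro Lp_norm_Hoelder_pairing p p' diff_op_measurable gm schwartz_measurable[OF w])
    also have "\<dots> \<le> Lp_norm p (\<lambda>x. ennreal (cmod ((diff_op y ^^ k) g x))) * ennreal (C * sqrt (\<Sum>j\<in>{3..<N}. (cmod (c j))\<^sup>2))"
      using C(2)[of N c] by (intro mult_left_mono) simp_all
    finally show ?thesis .
  qed
  have spec0: "(LINT \<xi>|lborel. complex_of_real (spec j \<xi>)) / \<kappa> = of_real energy" if "j \<ge> 3" for j
    using spec_integral[OF that] kappa(1) by (simp add: integral_complex_of_real)
  have first: "ennreal (sqrt (\<Sum>j\<in>{3..<N}. (cmod (b j))\<^sup>2)) \<le> ennreal K * Lp_norm p (\<lambda>x. ennreal (cmod (g x)))"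
    if b: "coeffs b u" and g: "represents g u" for b u g N
  proof (cases "Lp_norm p (\<lambda>x. ennreal (cmod (g x))) = top")
    case True
    then show ?thesis using K by (simp add: ennreal_mult_top)
  next
    case False
    then obtain w where w: "Lp_norm p (\<lambda>x. ennreal (cmod (g x))) = ennreal w" "w \<ge> 0"
      by (cases "Lp_norm p (\<lambda>x. ennreal (cmod (g x)))") auto
    let ?S = "\<Sum>j\<in>{3..<N}. (cmod (b j))\<^sup>2"
    have S: "?S \<ge> 0" by (simp add: sum_nonneg)
    have "u (\<lambda>x. cnj (partial N b x)) = (\<Sum>j\<in>{3..<N}. b j * cnj (b j) * of_real energy)"
      unfolding coeffs_partial_pairing[OF b, of 0 0 N b, simplified funpow_0 power_0 mult_1_left]
      by (intro sum.cong refl, drule atLeastLessThan_iff[THEN iffD1, THEN conjunct1])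
        (drule spec0, simp only: times_divide_eq_right[symmetric])
    also have "\<dots> = of_real (energy * ?S)"
      by (simp add: sum_distrib_left complex_norm_square mult.commute del: of_real_power)
    finally have "ennreal (cmod (complex_of_real (energy * ?S))) \<le> ennreal w * ennreal (C * sqrt ?S)"
      using pair[OF g, of 0 0 N b] w by simp
    then have "energy * ?S \<le> w * (C * sqrt ?S)"
      using S C(1) w(2) energy_pos by (simp add: ennreal_mult[symmetric] norm_mult del: of_real_mult)
    then have "sqrt ?S \<le> C / energy * w"
      using S C(1) w(2) energy_pos by (intro sqrt_le_of_square_bound) auto
    also have "\<dots> \<le> K * w" using C(1) w(2) energy_pos by (simp add: K_def divide_right_mono mult_right_mono)
    finally show ?thesis using w K by (simp add: ennreal_mult[symmetric] ennreal_leI)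
  qed
  have second: "ennreal (sqrt (\<Sum>j\<in>{n..<N}. (cmod (b j))\<^sup>2)) \<le> ennreal K * modulus k p g t"
    if b: "coeffs b u" and g: "represents g u" and n: "3 \<le> n" and t: "0 < t" and tn: "2 ^ (k + 2) \<le> t * (lac_freq n - 2)"
    for b u g N n t
  proof (cases "modulus k p g t = top")
    case True
    then show ?thesis using K by (simp add: ennreal_mult_top)
  next
    case False
    then obtain w where w: "modulus k p g t = ennreal w" "w \<ge> 0" by (cases "modulus k p g t") auto
    \<comment> \<open>The test function contains only frequencies from n on, those for which steps
      up to t run through enough oscillations.\<close>
    define c where "c j = (if n \<le> j then b j else 0)" for j
    define S where "S = (\<Sum>j\<in>{3..<N}. (cmod (c j))\<^sup>2)"
    have S: "S \<ge> 0" by (simp add: S_def sum_nonneg)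
    have Seq: "S = (\<Sum>j\<in>{n..<N}. (cmod (b j))\<^sup>2)"
      unfolding S_def using n by (intro sum.mono_neutral_cong_right) (auto simp: c_def)
    define P where "P s = u ((diff_op (- freq s) ^^ k) (\<lambda>x. cnj (partial N c x)))" for s
    let ?I = "\<lambda>j s. LINT \<xi>|lborel. (cis (freq s \<bullet> \<xi>) - 1) ^ k * of_real (spec j \<xi>)"
    let ?A = "\<lambda>j. LINT s|lborel. indicat_real {0..t} s *\<^sub>R ?I j s"
    have bc: "b j * cnj (c j) = of_real ((cmod (c j))\<^sup>2)" for j
      by (simp add: c_def complex_norm_square del: of_real_power)
    have P: "P s = (\<Sum>j\<in>{3..<N}. (of_real ((cmod (c j))\<^sup>2) / \<kappa>) * ?I j s)" for s
      unfolding P_def coeffs_partial_pairing[OF b] bc by simp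
    have Pb: "cmod (P s) \<le> w * (C * sqrt S)" if s: "0 \<le> s" "s \<le> t" for s
    proof -
      have "Lp_norm p (\<lambda>x. ennreal (cmod ((diff_op (freq s) ^^ k) g x))) \<le> modulus k p g t"
        unfolding modulus_def using s by (intro SUP_upper) simp
      then have "Lp_norm p (\<lambda>x. ennreal (cmod ((diff_op (freq s) ^^ k) g x))) * ennreal (C * sqrt S) \<le> ennreal w * ennreal (C * sqrt S)"
        unfolding w by (rule mult_right_mono) simp
      then have "ennreal (cmod (P s)) \<le> ennreal w * ennreal (C * sqrt S)"
        using pair[OF g, of k "freq s" N c] unfolding P_def S_def by (rule order_trans[rotated])
      then show ?thesis using w C(1) S by (simp add: ennreal_mult[symmetric])
    qed
    have int: "integrable lborel (\<lambda>s. indicat_real {0..t} s *\<^sub>R ?I j s)" if "j \<in> {3..<N}" for j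
      using that t by (intro average_pairing(1)) auto
    have Pi: "indicat_real {0..t} s *\<^sub>R P s = (\<Sum>j\<in>{3..<N}. (of_real ((cmod (c j))\<^sup>2) / \<kappa>) * (indicat_real {0..t} s *\<^sub>R ?I j s))" for s
      unfolding P by (simp add: scaleR_sum_right)
    have iP: "integrable lborel (\<lambda>s. indicat_real {0..t} s *\<^sub>R P s)"
      unfolding Pi using int by (intro Bochner_Integration.integrable_sum integrable_mult_right) auto
    have "cmod (LINT s|lborel. indicat_real {0..t} s *\<^sub>R P s) \<le> (LINT s|lborel. indicat_real {0..t} s * (w * (C * sqrt S)))"
    proof (rule order_trans[OF integral_norm_bound Bochner_Integration.integral_mono])
      show "integrable lborel (\<lambda>s. cmod (indicat_real {0..t} s *\<^sub>R P s))" using iP by (rule integrable_norm)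
      show "integrable lborel (\<lambda>s. indicat_real {0..t} s * (w * (C * sqrt S)))" using t by simp
      show "cmod (indicat_real {0..t} s *\<^sub>R P s) \<le> indicat_real {0..t} s * (w * (C * sqrt S))" for s
        using Pb[of s] by (auto simp: indicator_def)
    qed
    then have upper: "cmod (LINT s|lborel. indicat_real {0..t} s *\<^sub>R P s) \<le> t * (w * (C * sqrt S))"
      using t by simp
    have "(LINT s|lborel. indicat_real {0..t} s *\<^sub>R P s) = (\<Sum>j\<in>{3..<N}. (of_real ((cmod (c j))\<^sup>2) / \<kappa>) * ?A j)"
    proof -
      have "integrable lborel (\<lambda>s. (of_real ((cmod (c j))\<^sup>2) / \<kappa>) * (indicat_real {0..t} s *\<^sub>R ?I j s))" if "j \<in> {3..<N}" for j
        using int[OF that] by (rule integrable_mult_right)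
      then show ?thesis unfolding Pi by (simp only: Bochner_Integration.integral_sum integral_mult_right_zero)
    qed
    also have "\<dots> = (\<Sum>j\<in>{3..<N}. (of_real ((cmod (c j))\<^sup>2) / \<kappa>) * (?A j - (-1) ^ k * of_real t * (\<kappa> * of_real energy)))
        + (-1) ^ k * of_real (t * energy * S)"
    proof -
      have "(\<Sum>j\<in>{3..<N}. (of_real ((cmod (c j))\<^sup>2) / \<kappa>) * ((-1) ^ k * of_real t * (\<kappa> * of_real energy))) = (-1) ^ k * of_real (t * energy * S)"
        using kappa(1) unfolding S_def by (simp add: sum_distrib_left ac_simps)
      then show ?thesis by (simp add: right_diff_distrib sum_subtractf)
    qed
    finally have eq: "(LINT s|lborel. indicat_real {0..t} s *\<^sub>R P s)
      = (\<Sum>j\<in>{3..<N}. (of_real ((cmod (c j))\<^sup>2) / \<kappa>) * (?A j - (-1) ^ k * of_real t * (\<kappa> * of_real energy)))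
        + (-1) ^ k * of_real (t * energy * S)" .
    have "cmod (\<Sum>j\<in>{3..<N}. (of_real ((cmod (c j))\<^sup>2) / \<kappa>) * (?A j - (-1) ^ k * of_real t * (\<kappa> * of_real energy)))
        \<le> (\<Sum>j\<in>{3..<N}. (cmod (c j))\<^sup>2 * (t / 2 * energy))"
    proof (rule sum_norm_le)
      fix j assume j: "j \<in> {3..<N}"
      show "cmod ((of_real ((cmod (c j))\<^sup>2) / \<kappa>) * (?A j - (-1) ^ k * of_real t * (\<kappa> * of_real energy))) \<le> (cmod (c j))\<^sup>2 * (t / 2 * energy)"
      proof (cases "n \<le> j")
        case True
        have l: "0 < lac_freq n - 2" "lac_freq n \<le> lac_freq j"
        proof -
          have "(2::real) ^ 3 \<le> 2 ^ n" "(2::real) ^ n \<le> 2 ^ j" using n True by (intro power_increasing; simp)+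
          then show "0 < lac_freq n - 2" "lac_freq n \<le> lac_freq j" by (auto simp: lac_freq_def)
        qed
        have "2 ^ Suc k / (lac_freq j - 2) \<le> 2 ^ Suc k / (lac_freq n - 2)"
          using l by (intro divide_left_mono) auto
        also have "\<dots> \<le> t / 2" using tn l by (simp add: field_simps)
        finally have d: "2 ^ Suc k / (lac_freq j - 2) \<le> t / 2" .
        have "cmod (?A j - (-1) ^ k * of_real t * (\<kappa> * of_real energy)) \<le> 2 ^ Suc k / (lac_freq j - 2) * (cmod \<kappa> * energy)"
          using j t by (intro average_pairing(2)) auto
        also have "\<dots> \<le> t / 2 * (cmod \<kappa> * energy)"
          using energy_pos by (intro mult_right_mono d) auto
        finally have "(cmod (c j))\<^sup>2 / cmod \<kappa> * cmod (?A j - (-1) ^ k * of_real t * (\<kappa> * of_real energy)) \<le> (cmod (c j))\<^sup>2 / cmod \<kappa> * (t / 2 * (cmod \<kappa> * energy))"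
          by (intro mult_left_mono) auto
        also have "\<dots> = (cmod (c j))\<^sup>2 * (t / 2 * energy)" using kappa(1) by simp
        finally show ?thesis by (simp only: norm_mult norm_divide norm_of_real abs_power2)
      qed (simp add: c_def)
    qed
    also have "\<dots> = t * energy * S / 2" by (simp add: S_def sum_distrib_left sum_divide_distrib ac_simps)
    finally have small: "cmod (\<Sum>j\<in>{3..<N}. (of_real ((cmod (c j))\<^sup>2) / \<kappa>) * (?A j - (-1) ^ k * of_real t * (\<kappa> * of_real energy))) \<le> t * energy * S / 2" .
    have "cmod ((-1) ^ k * of_real (t * energy * S)) = t * energy * S"
      using t energy_pos S by (simp add: norm_mult norm_power del: of_real_mult)
    then have "t * energy * S \<le> cmod (LINT s|lborel. indicat_real {0..t} s *\<^sub>R P s) + t * energy * S / 2"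
      using small norm_triangle_ineq2[of "(-1) ^ k * of_real (t * energy * S)"
          "- (\<Sum>j\<in>{3..<N}. (of_real ((cmod (c j))\<^sup>2) / \<kappa>) * (?A j - (-1) ^ k * of_real t * (\<kappa> * of_real energy)))"]
      unfolding eq by (simp only: norm_minus_cancel diff_minus_eq_add add.commute)
    then have "t * (energy / 2 * S) \<le> t * (w * (C * sqrt S))" using upper by (simp add: ac_simps)
    then have "energy / 2 * S \<le> w * (C * sqrt S)" using t by simp
    then have "sqrt S \<le> C / (energy / 2) * w"
      using S C(1) w(2) energy_pos by (intro sqrt_le_of_square_bound) auto
    then have "sqrt S \<le> K * w" by (simp add: K_def ac_simps)
    then show ?thesis unfolding Seq[symmetric] w(1) using K w(2) by (simp add: ennreal_mult[symmetric] ennreal_leI)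
  qed
  show ?thesis by (rule that[OF K first second])
qed

lemma lr_norm_2_on_le:
  assumes "\<And>N. ennreal (sqrt (\<Sum>j\<in>A \<inter> {..<N}. (cmod (b j))\<^sup>2)) \<le> B"
  shows "lr_norm 2 (on A (mods b)) \<le> B"
proof -
  have "(\<Sum>j. epowr (on A (mods b) j) 2) \<le> epowr B 2"
    unfolding suminf_eq_SUP
  proof (rule SUP_least)
    fix N
    let ?S = "\<Sum>j\<in>A \<inter> {..<N}. (cmod (b j))\<^sup>2"
    have "(\<Sum>j<N. epowr (on A (mods b) j) 2) = (\<Sum>j\<in>A \<inter> {..<N}. ennreal ((cmod (b j))\<^sup>2))"
      by (rule sum.mono_neutral_cong_right) (auto simp: on_def powr_numeral)
    also have "\<dots> = ennreal ?S" by (simp add: sum_ennreal)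
    also have "\<dots> = epowr (ennreal (sqrt ?S)) 2" by (simp add: sum_nonneg powr_numeral)
    also have "\<dots> \<le> epowr B 2" by (intro epowr_mono assms) simp
    finally show "(\<Sum>j<N. epowr (on A (mods b) j) 2) \<le> epowr B 2" .
  qed
  then have "epowr (\<Sum>j. epowr (on A (mods b) j) 2) (1 / 2) \<le> B" by (intro epowr_root_ge) auto
  then show ?thesis using lr_norm_ennreal[of 2 "on A (mods b)"] by simp
qed

lemma sqrt_sum_le_lr_norm_2:
  assumes "\<And>j. j \<in> {3..<n} \<Longrightarrow> ennreal (cmod (c j)) \<le> y j"
  shows "ennreal (sqrt (\<Sum>j\<in>{3..<n}. (cmod (c j))\<^sup>2)) \<le> lr_norm 2 y"
proof -
  have "epowr (ennreal (sqrt (\<Sum>j\<in>{3..<n}. (cmod (c j))\<^sup>2))) 2 = (\<Sum>j\<in>{3..<n}. ennreal ((cmod (c j))\<^sup>2))"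
    by (simp add: sum_nonneg powr_numeral sum_ennreal)
  also have "\<dots> \<le> (\<Sum>j\<in>{3..<n}. epowr (y j) 2)"
  proof (rule sum_mono)
    fix j assume "j \<in> {3..<n}"
    from epowr_mono[OF assms[OF this], of 2] show "ennreal ((cmod (c j))\<^sup>2) \<le> epowr (y j) 2"
      by (simp add: powr_numeral)
  qed
  also have "\<dots> \<le> (\<Sum>j. epowr (y j) 2)" by (rule sum_le_suminf) auto
  finally have "ennreal (sqrt (\<Sum>j\<in>{3..<n}. (cmod (c j))\<^sup>2)) \<le> epowr (\<Sum>j. epowr (y j) 2) (1 / 2)"
    by (intro epowr_root_le) auto
  then show ?thesis using lr_norm_ennreal[of 2 y] by simp
qed

text \<open>One difference of the product \<psi> W is the translated weight times the difference of
  W, plus the difference of the weight times W; the other k - 1 differences are merely bounded. In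
  the first term frequencies with j below 2^m gain the factor \<open>dbl m\<close> and the others
  are bounded by 2; in the second the weight itself has size \<open>norm y\<close>.\<close>

lemma Lp_norm_diff_partial:
  assumes p: "1 < p" and k: "k \<ge> 1"
  obtains K :: real where "K > 0"
    "\<And>b n y. b 0 = 0 \<Longrightarrow> Lp_norm p (\<lambda>x. ennreal (cmod ((diff_op y ^^ k) (partial n b) x))) \<le> ennreal K * l2_tail (mods b) 0"
    "\<And>b n y. b 0 = 0 \<Longrightarrow> Lp_norm p (\<lambda>x. ennreal (cmod (partial n b x))) \<le> ennreal K * l2_tail (mods b) 0"
    "\<And>b n y m. b 0 = 0 \<Longrightarrow> norm y \<le> dbl (Suc m) \<Longrightarrow> Lp_norm p (\<lambda>x. ennreal (cmod ((diff_op y ^^ k) (partial n b) x)))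
      \<le> ennreal K * (l2_tail (mods b) m + ennreal (dbl m) * l2_tail (mods b) 0)"
proof -
  obtain C M where C: "C > 0"
    "\<And>\<theta> D n c. \<theta> \<in> band \<Longrightarrow> D \<ge> 0 \<Longrightarrow> (\<And>x. cmod (\<theta> x) \<le> D / (1 + norm x) ^ M) \<Longrightarrow>
      Lp_norm p (\<lambda>x. ennreal (cmod (\<theta> x * lac_sum n c x))) \<le> ennreal (C * D * sqrt (\<Sum>j\<in>{3..<n}. (cmod (c j))\<^sup>2))"
    by (rule Lp_norm_lac_sum[OF p]) (rule that, assumption, blast)
  obtain D where D: "D > 0" "\<And>x. cmod (\<psi> x) \<le> D / (1 + norm x) ^ M"
    by (rule schwartz_decay'[OF psi, of M]) (rule that)
  obtain D2 where D2: "D2 > 0" "\<And>x h. norm h \<le> 1 \<Longrightarrow> cmod (\<psi> (x + h) - \<psi> x) \<le> norm h * (D2 / (1 + norm x) ^ M)"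
    by (rule schwartz_increment[OF psi, of M]) (rule that)
  obtain K1 where K1: "K1 > 0"
    "\<And>f y. f \<in> borel_measurable borel \<Longrightarrow> Lp_norm p (\<lambda>x. ennreal (cmod ((diff_op y ^^ (k - 1)) f x)))
      \<le> ennreal K1 * Lp_norm p (\<lambda>x. ennreal (cmod ((f :: real^'d \<Rightarrow> complex) x)))"
    using Lp_norm_diff_op[of p "k - 1", where 'd='d] p by auto
  obtain K0 where K0: "K0 > 0"
    "\<And>f y. f \<in> borel_measurable borel \<Longrightarrow> Lp_norm p (\<lambda>x. ennreal (cmod ((diff_op y ^^ k) f x)))
      \<le> ennreal K0 * Lp_norm p (\<lambda>x. ennreal (cmod ((f :: real^'d \<Rightarrow> complex) x)))"
    using Lp_norm_diff_op[of p k, where 'd='d] p by auto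
  obtain K2 where K2: "K2 > 0" "\<And>a c. lr_norm 2 (\<lambda>j. a j + c j) \<le> ennreal K2 * (lr_norm 2 a + lr_norm 2 c)"
    using lr_norm_add[of 2] by auto
  have tail0: "l2_tail (mods b) 0 = lr_norm 2 (mods b)" if "b 0 = 0" for b :: "nat \<Rightarrow> complex"
  proof -
    have "on {2 ^ 0..} (mods b) = mods b" using that by (auto simp: on_def fun_eq_iff not_less_eq_eq)
    then show ?thesis by (simp add: l2_tail_def)
  qed
  have part: "Lp_norm p (\<lambda>x. ennreal (cmod (partial n b x))) \<le> ennreal (C * D) * l2_tail (mods b) 0" if b: "b 0 = 0" for b n
  proof -
    have "Lp_norm p (\<lambda>x. ennreal (cmod (partial n b x))) \<le> ennreal (C * D * sqrt (\<Sum>j\<in>{3..<n}. (cmod (b j))\<^sup>2))"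
      unfolding partial_def using D by (intro C psi_band) auto
    also have "\<dots> = ennreal (C * D) * ennreal (sqrt (\<Sum>j\<in>{3..<n}. (cmod (b j))\<^sup>2))"
      using C(1) D(1) by (intro ennreal_mult) (auto simp: sum_nonneg)
    also have "\<dots> \<le> ennreal (C * D) * l2_tail (mods b) 0"
      unfolding tail0[of b, OF b] by (intro mult_left_mono sqrt_sum_le_lr_norm_2) auto
    finally show ?thesis .
  qed
  have pm: "partial n b \<in> borel_measurable borel" for n b by (rule schwartz_measurable[OF partial_schwartz])
  let ?K3 = "4 powr (1 + 1 / p)"
  have refined: "Lp_norm p (\<lambda>x. ennreal (cmod ((diff_op y ^^ k) (partial n b) x)))
      \<le> ennreal (K1 * ?K3 * (C * (D * 2 ^ M) * K2 * 2 + C * D2)) * (l2_tail (mods b) m + ennreal (dbl m) * l2_tail (mods b) 0)"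
    if b: "b 0 = 0" and y: "norm y \<le> dbl (Suc m)" for b n y m
  proof -
    let ?T = "l2_tail (mods b)"
    have y1: "norm y \<le> 1" using y dbl_bounds[of "Suc m"] by linarith
    \<comment> \<open>\<open>dbl (Suc m)\<close> is the square of \<open>dbl m\<close>: one factor
      cancels the largest low frequency, about 2 to the power 2^m, and the other is the
      gain.\<close>
    have yd: "norm y \<le> dbl m * dbl m"
      using y by (simp add: dbl_def powr_add[symmetric])
    have ydm: "norm y \<le> dbl m"
      using yd dbl_bounds[of m] mult_left_le[of "dbl m" "dbl m"] by linarith
    define c where "c j = b j * (osc (lac_freq j) y - 1)" for j
    let ?\<theta> = "\<lambda>x. \<psi> (x + y)" and ?\<eta> = "\<lambda>x. \<psi> (x + y) - \<psi> x"
    have split: "diff_op y (partial n b) x = ?\<theta> x * lac_sum n c x + ?\<eta> x * lac_sum n b x" for x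
    proof -
      have "lac_sum n b (x + y) = lac_sum n c x + lac_sum n b x"
        unfolding lac_sum_def sum.distrib[symmetric]
        by (intro sum.cong) (auto simp: c_def distrib_left cis_mult[symmetric] algebra_simps)
      then show ?thesis by (simp add: diff_op_def partial_def algebra_simps)
    qed
    have \<theta>: "?\<theta> \<in> band" by (rule shift_band[OF psi_band])
    have \<theta>b: "cmod (?\<theta> x) \<le> (D * 2 ^ M) / (1 + norm x) ^ M" for x
    proof -
      have "1 + norm x \<le> (1 + norm (x + y)) * (1 + norm y)" by (rule one_plus_norm_affine)
      also have "\<dots> \<le> (1 + norm (x + y)) * 2" using y1 by (intro mult_left_mono) auto
      finally have "(1 + norm x) ^ M \<le> ((1 + norm (x + y)) * 2) ^ M" by (intro power_mono) auto
      then have "(1 + norm x) ^ M \<le> (1 + norm (x + y)) ^ M * 2 ^ M" by (simp only: power_mult_distrib)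
      moreover have "(1 + norm x) ^ M > 0" "(1 + norm (x + y)) ^ M > 0" by (simp_all add: add_pos_nonneg)
      ultimately have "1 / (1 + norm (x + y)) ^ M \<le> 2 ^ M / (1 + norm x) ^ M"
        by (simp add: divide_le_eq le_divide_eq mult.commute)
      then have "D * (1 / (1 + norm (x + y)) ^ M) \<le> D * (2 ^ M / (1 + norm x) ^ M)"
        using D(1) by (intro mult_left_mono) auto
      then show ?thesis using D(2)[of "x + y"] by simp
    qed
    have \<eta>: "?\<eta> \<in> band" by (rule diff_band[OF \<theta> psi_band])
    have \<eta>b: "cmod (?\<eta> x) \<le> (norm y * D2) / (1 + norm x) ^ M" for x
      using D2(2)[OF y1, of x] by simp
    have A: "Lp_norm p (\<lambda>x. ennreal (cmod (?\<theta> x * lac_sum n c x))) \<le> ennreal (C * (D * 2 ^ M) * K2 * 2) * (?T m + ennreal (dbl m) * ?T 0)"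
    proof -
      have cj: "ennreal (cmod (c j)) \<le> 2 * on {2 ^ m..} (mods b) j + ennreal (dbl m) * mods b j" if j: "j \<in> {3..<n}" for j
      proof (cases "2 ^ m \<le> j")
        case True
        have "cmod (osc (lac_freq j) y - 1) \<le> 2" using norm_triangle_ineq4[of "osc (lac_freq j) y" 1] by simp
        then have "cmod (c j) \<le> cmod (b j) * 2" unfolding c_def norm_mult by (intro mult_left_mono) auto
        then have "ennreal (cmod (c j)) \<le> ennreal (2 * cmod (b j))" by (intro ennreal_leI) simp
        also have "\<dots> = 2 * on {2 ^ m..} (mods b) j" using True by (simp add: on_in ennreal_mult)
        also have "\<dots> \<le> 2 * on {2 ^ m..} (mods b) j + ennreal (dbl m) * mods b j" by simp
        finally show ?thesis .
      next
        case False
        have "cmod (osc (lac_freq j) y - 1) \<le> \<bar>lac_freq j * (y $ i1)\<bar>"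
          using Taylor_exp[of "\<i> * of_real (lac_freq j * (y $ i1))" 0] by (simp add: cis_conv_exp norm_mult)
        also have "\<dots> \<le> lac_freq j * norm y"
        proof -
          have "0 \<le> lac_freq j" using j power_increasing[of 1 j "2::real"] by (simp add: lac_freq_def)
          then show ?thesis using component_le_norm_cart[of y i1] by (simp add: abs_mult mult_left_mono)
        qed
        also have "\<dots> \<le> 2 powr (2 ^ m) * (dbl m * dbl m)"
        proof (intro mult_mono yd)
          have "lac_freq j \<le> 2 ^ j" by (simp add: lac_freq_def)
          also have "\<dots> \<le> 2 ^ (2 ^ m)" using False by (intro power_increasing) auto
          also have "\<dots> = 2 powr (2 ^ m)" by (simp add: powr_realpow[symmetric])
          finally show "lac_freq j \<le> 2 powr (2 ^ m)" .
        qed auto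
        also have "\<dots> = dbl m" by (simp add: dbl_def powr_add[symmetric])
        finally have "cmod (c j) \<le> cmod (b j) * dbl m" unfolding c_def norm_mult by (intro mult_left_mono) auto
        then have "ennreal (cmod (c j)) \<le> ennreal (dbl m * cmod (b j))" by (intro ennreal_leI) (simp add: mult.commute)
        also have "\<dots> = ennreal (dbl m) * mods b j" using dbl_bounds[of m] by (simp add: ennreal_mult)
        also have "\<dots> \<le> 2 * on {2 ^ m..} (mods b) j + ennreal (dbl m) * mods b j" by simp
        finally show ?thesis .
      qed
      have "Lp_norm p (\<lambda>x. ennreal (cmod (?\<theta> x * lac_sum n c x))) \<le> ennreal (C * (D * 2 ^ M) * sqrt (\<Sum>j\<in>{3..<n}. (cmod (c j))\<^sup>2))"
        using D(1) by (intro C(2) \<theta> \<theta>b) auto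
      also have "\<dots> = ennreal (C * (D * 2 ^ M)) * ennreal (sqrt (\<Sum>j\<in>{3..<n}. (cmod (c j))\<^sup>2))"
        using C(1) D(1) by (intro ennreal_mult) (auto simp: sum_nonneg)
      also have "\<dots> \<le> ennreal (C * (D * 2 ^ M)) * (ennreal K2 * (2 * ?T m + ennreal (dbl m) * ?T 0))"
      proof (intro mult_left_mono)
        have "ennreal (sqrt (\<Sum>j\<in>{3..<n}. (cmod (c j))\<^sup>2)) \<le> lr_norm 2 (\<lambda>j. 2 * on {2 ^ m..} (mods b) j + ennreal (dbl m) * mods b j)"
          by (intro sqrt_sum_le_lr_norm_2 cj)
        also have "\<dots> \<le> ennreal K2 * (lr_norm 2 (\<lambda>j. 2 * on {2 ^ m..} (mods b) j) + lr_norm 2 (\<lambda>j. ennreal (dbl m) * mods b j))"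
          by (rule K2(2))
        also have "\<dots> = ennreal K2 * (2 * ?T m + ennreal (dbl m) * ?T 0)"
          unfolding tail0[of b, OF b] by (simp add: lr_norm_cmult l2_tail_def)
        finally show "ennreal (sqrt (\<Sum>j\<in>{3..<n}. (cmod (c j))\<^sup>2)) \<le> ennreal K2 * (2 * ?T m + ennreal (dbl m) * ?T 0)" .
      qed simp
      also have "\<dots> \<le> ennreal (C * (D * 2 ^ M)) * (ennreal K2 * (2 * ?T m + 2 * (ennreal (dbl m) * ?T 0)))"
      proof -
        have "1 * (ennreal (dbl m) * ?T 0) \<le> 2 * (ennreal (dbl m) * ?T 0)" by (rule mult_right_mono) auto
        then show ?thesis by (intro mult_left_mono add_left_mono) auto
      qed
      also have "\<dots> = ennreal (C * (D * 2 ^ M) * K2 * 2) * (?T m + ennreal (dbl m) * ?T 0)"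
        using C(1) D(1) K2(1) by (simp add: ennreal_mult distrib_left ac_simps)
      finally show ?thesis .
    qed
    have B: "Lp_norm p (\<lambda>x. ennreal (cmod (?\<eta> x * lac_sum n b x))) \<le> ennreal (C * D2) * (?T m + ennreal (dbl m) * ?T 0)"
    proof -
      have "Lp_norm p (\<lambda>x. ennreal (cmod (?\<eta> x * lac_sum n b x))) \<le> ennreal (C * (norm y * D2) * sqrt (\<Sum>j\<in>{3..<n}. (cmod (b j))\<^sup>2))"
        using D2(1) by (intro C(2) \<eta> \<eta>b) auto
      also have "\<dots> \<le> ennreal (C * D2 * (dbl m * sqrt (\<Sum>j\<in>{3..<n}. (cmod (b j))\<^sup>2)))"
        using ydm C(1) D2(1) 
        by (intro ennreal_leI) (auto simp: ac_simps intro!: mult_left_mono mult_right_mono sum_nonneg)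
      also have "\<dots> = ennreal (C * D2) * (ennreal (dbl m) * ennreal (sqrt (\<Sum>j\<in>{3..<n}. (cmod (b j))\<^sup>2)))"
        using C(1) D2(1) dbl_bounds[of m] by (simp add: ennreal_mult sum_nonneg)
      also have "\<dots> \<le> ennreal (C * D2) * (ennreal (dbl m) * ?T 0)"
        unfolding tail0[of b, OF b] by (intro mult_left_mono sqrt_sum_le_lr_norm_2) auto
      also have "\<dots> \<le> ennreal (C * D2) * (?T m + ennreal (dbl m) * ?T 0)" by (intro mult_left_mono) auto
      finally show ?thesis .
    qed
    have "(diff_op y ^^ k) (partial n b) = (diff_op y ^^ (k - 1)) (diff_op y (partial n b))"
      using k by (cases k) (simp_all add: funpow_swap1)
    then have "Lp_norm p (\<lambda>x. ennreal (cmod ((diff_op y ^^ k) (partial n b) x)))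
        \<le> ennreal K1 * Lp_norm p (\<lambda>x. ennreal (cmod (diff_op y (partial n b) x)))"
      using K1(2)[OF diff_op_measurable[OF pm, of 1 y], of y] by simp
    also have "Lp_norm p (\<lambda>x. ennreal (cmod (diff_op y (partial n b) x)))
        \<le> Lp_norm p (\<lambda>x. ennreal (cmod (?\<theta> x * lac_sum n c x)) + ennreal (cmod (?\<eta> x * lac_sum n b x)))"
      unfolding split using p
      by (intro Lp_norm_mono) (auto simp: ennreal_plus[symmetric] simp del: ennreal_plus intro!: ennreal_leI norm_triangle_ineq)
    also have "\<dots> \<le> ennreal ?K3 * (Lp_norm p (\<lambda>x. ennreal (cmod (?\<theta> x * lac_sum n c x))) + Lp_norm p (\<lambda>x. ennreal (cmod (?\<eta> x * lac_sum n b x))))"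
    proof (rule Lp_norm_add)
      note [measurable] = schwartz_measurable[OF band_schwartz[OF \<theta>]] schwartz_measurable[OF band_schwartz[OF \<eta>]]
      show "(\<lambda>x. ennreal (cmod (?\<theta> x * lac_sum n c x))) \<in> borel_measurable borel" by measurable
      show "(\<lambda>x. ennreal (cmod (?\<eta> x * lac_sum n b x))) \<in> borel_measurable borel" by measurable
    qed (use p in simp)
    also have "\<dots> \<le> ennreal ?K3 * (ennreal (C * (D * 2 ^ M) * K2 * 2) * (?T m + ennreal (dbl m) * ?T 0) + ennreal (C * D2) * (?T m + ennreal (dbl m) * ?T 0))"
      by (intro mult_left_mono add_mono A B) simp
    finally have "Lp_norm p (\<lambda>x. ennreal (cmod ((diff_op y ^^ k) (partial n b) x)))
      \<le> ennreal K1 * (ennreal ?K3 * (ennreal (C * (D * 2 ^ M) * K2 * 2) * (?T m + ennreal (dbl m) * ?T 0) + ennreal (C * D2) * (?T m + ennreal (dbl m) * ?T 0)))"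
      by (simp add: mult_left_mono)
    also have "\<dots> = ennreal (K1 * ?K3 * (C * (D * 2 ^ M) * K2 * 2 + C * D2)) * (?T m + ennreal (dbl m) * ?T 0)"
      using C(1) D(1) D2(1) K1(1) K2(1) by (simp add: ennreal_mult ennreal_plus distrib_right distrib_left ac_simps)
    finally show ?thesis .
  qed
  define K where "K = max (K1 * ?K3 * (C * (D * 2 ^ M) * K2 * 2 + C * D2)) (max (C * D) (K0 * (C * D)))"
  have K: "K > 0" using C(1) D(1) by (auto simp: K_def less_max_iff_disj)
  show ?thesis
  proof (rule that[OF K])
    fix b :: "nat \<Rightarrow> complex" and n y m assume b: "b 0 = 0"
    show "Lp_norm p (\<lambda>x. ennreal (cmod (partial n b x))) \<le> ennreal K * l2_tail (mods b) 0"
      by (rule order_trans[OF part[of b, OF b]]) (intro mult_right_mono ennreal_leI, auto simp: K_def)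
    have "Lp_norm p (\<lambda>x. ennreal (cmod ((diff_op y ^^ k) (partial n b) x))) \<le> ennreal K0 * (ennreal (C * D) * l2_tail (mods b) 0)"
      by (rule order_trans[OF K0(2)[OF pm]]) (intro mult_left_mono part[of b, OF b], simp)
    also have "\<dots> = ennreal (K0 * (C * D)) * l2_tail (mods b) 0"
      using K0(1) C(1) D(1) by (simp add: ennreal_mult mult.assoc)
    also have "\<dots> \<le> ennreal K * l2_tail (mods b) 0" by (intro mult_right_mono ennreal_leI) (auto simp: K_def)
    finally show "Lp_norm p (\<lambda>x. ennreal (cmod ((diff_op y ^^ k) (partial n b) x))) \<le> ennreal K * l2_tail (mods b) 0" .
    assume y: "norm y \<le> dbl (Suc m)"
    show "Lp_norm p (\<lambda>x. ennreal (cmod ((diff_op y ^^ k) (partial n b) x)))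
      \<le> ennreal K * (l2_tail (mods b) m + ennreal (dbl m) * l2_tail (mods b) 0)"
      by (rule order_trans[OF refined[of b, OF b y]]) (intro mult_right_mono ennreal_leI, auto simp: K_def)
  qed
qed

end

section \<open>Discretisation of the logarithmic integral\<close>

definition log_norm :: "ennreal \<Rightarrow> real \<Rightarrow> (real \<Rightarrow> ennreal) \<Rightarrow> ennreal" where
  "log_norm q b G = (if q = top then (SUP t \<in> {0<..<1}. ennreal ((1 - ln t) powr b) * G t)
      else epowr (\<integral>\<^sup>+t\<in>{0<..<1}. epowr (ennreal ((1 - ln t) powr b) * G t) (enn2real q)
        * ennreal (1 / t) \<partial>lborel) (1 / enn2real q))"

text \<open>On \<open>layer m\<close> both \<open>1 - ln t\<close> and the logarithmic length are of size \<open>2\<^sup>m\<close>.\<close>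

definition layer :: "nat \<Rightarrow> real set" where
  "layer m = {dbl (Suc m)..<(if m = 0 then 1 else dbl m)}"

lemma dbl_antimono: "m \<le> n \<Longrightarrow> dbl n \<le> dbl m"
  unfolding dbl_def by (intro powr_mono) (auto intro: power_increasing)

lemma ln_dbl: "ln (dbl m) = - (2 ^ m) * ln 2"
  by (simp add: dbl_def ln_powr)

lemma layer_subset: "t \<in> layer m \<Longrightarrow> 0 < t \<and> t < 1"
  using dbl_bounds[of m] dbl_bounds[of "Suc m"] by (auto simp: layer_def split: if_splits)

text \<open>Layer 0 reaches up to 1 instead of \<open>dbl 0\<close>, which is 1/2, so the layers
  exhaust the open unit interval; the least admissible index is the right one.\<close>

lemma layer_exists:
  assumes "0 < t" "t < 1"
  obtains m where "t \<in> layer m"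
proof -
  have ex: "\<exists>m. dbl (Suc m) \<le> t"
  proof -
    obtain n where n: "1 / t < real n" using reals_Archimedean2 by blast
    have "real n < 2 ^ n" by (rule of_nat_less_two_power)
    also have "(2::real) ^ n \<le> 2 powr (2 ^ Suc n)"
    proof -
      have "real n \<le> 2 ^ n" by (rule of_nat_less_two_power[THEN less_imp_le])
      also have "(2::real) ^ n \<le> 2 ^ Suc n" by simp
      finally have "(2::real) powr real n \<le> 2 powr (2 ^ Suc n)" by (intro powr_mono) auto
      then show ?thesis by (simp add: powr_realpow)
    qed
    finally have "1 / t \<le> 2 powr (2 ^ Suc n)" using n by linarith
    then have "dbl (Suc n) \<le> t" using assms by (simp add: dbl_def powr_minus field_simps)
    then show ?thesis ..
  qed
  define m where "m = (LEAST m. dbl (Suc m) \<le> t)"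
  have m: "dbl (Suc m) \<le> t" unfolding m_def using ex by (rule LeastI_ex)
  have "t < dbl m" if "m \<noteq> 0"
    using not_less_Least[of "m - 1" "\<lambda>m. dbl (Suc m) \<le> t"] that unfolding m_def[symmetric] by simp
  then have "t \<in> layer m" using m assms by (auto simp: layer_def)
  then show ?thesis by (rule that)
qed

lemma layer_unique:
  assumes "t \<in> layer m" "t \<in> layer n"
  shows "m = n"
proof (rule ccontr)
  have "False" if "t \<in> layer m" "t \<in> layer n" "m < n" for m n
    using that dbl_antimono[of "Suc m" n] by (auto simp: layer_def split: if_splits)
  moreover assume "m \<noteq> n"
  ultimately show False using assms by (metis linorder_neqE_nat)
qed

text \<open>With ln 2 between 2/3 and 1 the quotient z of \<open>1 - ln t\<close> and 2^m lies
  between 1/3 and 3, which explains the constant for either sign of b.\<close>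

lemma layer_weight:
  assumes t: "t \<in> layer m"
  shows "(1 - ln t) powr b \<le> 3 powr \<bar>b\<bar> * 2 powr (real m * b)"
    and "2 powr (real m * b) \<le> 3 powr \<bar>b\<bar> * (1 - ln t) powr b"
proof -
  define z where "z = (1 - ln t) / 2 ^ m"
  have t0: "0 < t" "t < 1" using layer_subset[OF t] by auto
  have l2: "2 / 3 \<le> ln (2::real)" "ln (2::real) \<le> 1" using ln2_ge_two_thirds ln_2_less_1 by auto
  have one: "(1::real) \<le> 2 ^ m" by simp
  have "ln (dbl (Suc m)) \<le> ln t" using t dbl_bounds[of "Suc m"] by (auto simp: layer_def)
  then have "- ln t \<le> 2 ^ Suc m * ln 2" by (simp add: ln_dbl)
  also have "\<dots> \<le> 2 ^ Suc m * 1" by (intro mult_left_mono l2) auto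
  finally have "- ln t \<le> 2 * 2 ^ m" by simp
  with one have up: "1 - ln t \<le> 3 * 2 ^ m" by linarith
  have lo: "2 ^ m \<le> 3 * (1 - ln t)"
  proof (cases "m = 0")
    case True
    moreover have "ln t \<le> 0" using t0 by simp
    ultimately show ?thesis by simp
  next
    case False
    then have "ln t \<le> ln (dbl m)" using t t0 by (auto simp: layer_def)
    then have "2 ^ m * ln 2 \<le> - ln t" by (simp add: ln_dbl)
    moreover have "2 ^ m * (2 / 3) \<le> 2 ^ m * ln (2::real)" by (intro mult_left_mono l2) auto
    ultimately have "2 ^ m * (2 / 3) \<le> - ln t" by (rule order_trans[rotated])
    then have "2 * 2 ^ m \<le> 3 * (- ln t)" by simp
    then have "2 ^ m \<le> 3 * (- ln t)" by (rule order_trans[rotated]) simp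
    also have "\<dots> \<le> 3 * (1 - ln t)" by (intro mult_left_mono) auto
    finally show ?thesis .
  qed
  have z: "1 / 3 \<le> z" "z \<le> 3" using up lo by (auto simp: z_def field_simps)
  have eq: "(1 - ln t) powr b = 2 powr (real m * b) * z powr b"
  proof -
    have "1 - ln t = 2 ^ m * z" by (simp add: z_def)
    moreover have "(2::real) ^ m = 2 powr real m" by (simp add: powr_realpow)
    ultimately show ?thesis using z by (simp add: powr_mult powr_powr)
  qed
  have zb: "z powr b \<le> 3 powr \<bar>b\<bar>" "1 \<le> 3 powr \<bar>b\<bar> * z powr b"
  proof -
    have lz: "\<bar>ln z\<bar> \<le> ln 3"
    proof -
      have "ln (1 / 3) \<le> ln z" "ln z \<le> ln 3" using z by (auto simp only: ln_le_cancel_iff)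
      then show ?thesis by (simp add: ln_div)
    qed
    then have "\<bar>b * ln z\<bar> \<le> \<bar>b\<bar> * ln 3" unfolding abs_mult by (intro mult_left_mono) auto
    then have "b * ln z \<le> \<bar>b\<bar> * ln 3" "0 \<le> \<bar>b\<bar> * ln 3 + b * ln z" by linarith+
    then show "z powr b \<le> 3 powr \<bar>b\<bar>" "1 \<le> 3 powr \<bar>b\<bar> * z powr b"
      using z by (auto simp: powr_def exp_add[symmetric])
  qed
  show "(1 - ln t) powr b \<le> 3 powr \<bar>b\<bar> * 2 powr (real m * b)"
    unfolding eq using zb(1) by (simp add: mult.commute)
  have "2 powr (real m * b) * 1 \<le> 2 powr (real m * b) * (3 powr \<bar>b\<bar> * z powr b)"
    by (intro mult_left_mono zb) auto
  then show "2 powr (real m * b) \<le> 3 powr \<bar>b\<bar> * (1 - ln t) powr b"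
    unfolding eq by (simp add: ac_simps)
qed

lemma layer_integral:
  shows "(\<integral>\<^sup>+t. indicator (layer m) t * ennreal (1 / t) \<partial>lborel) \<le> ennreal (2 * 2 ^ m)"
    and "ennreal (2 ^ m / 2) \<le> (\<integral>\<^sup>+t. indicator (layer m) t * ennreal (1 / t) \<partial>lborel)"
proof -
  define e where "e = (if m = 0 then 1 else dbl m)"
  have e: "0 < e" "dbl (Suc m) \<le> e"
    using dbl_bounds[of m] dbl_bounds[of "Suc m"] dbl_antimono[of m "Suc m"] by (auto simp: e_def)
  have d: "0 < dbl (Suc m)" by (rule dbl_bounds)
  have l2: "2 / 3 \<le> ln (2::real)" "ln (2::real) \<le> 1" using ln2_ge_two_thirds ln_2_less_1 by auto
  have layer: "layer m = {dbl (Suc m)..<e}" by (simp add: layer_def e_def)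
  have "(\<integral>\<^sup>+t. indicator (layer m) t * ennreal (1 / t) \<partial>lborel)
      = (\<integral>\<^sup>+t. ennreal (1 / t) * indicator {dbl (Suc m)..e} t \<partial>lborel)"
    using AE_lborel_singleton[of e]
    by (intro nn_integral_cong_AE, eventually_elim) (auto simp: layer indicator_def)
  also have "\<dots> = ennreal (ln e - ln (dbl (Suc m)))"
    using d e by (intro nn_integral_FTC_Icc) (auto intro!: derivative_eq_intros)
  also have "ln e - ln (dbl (Suc m)) = (if m = 0 then 2 else 2 ^ m) * ln 2"
    by (simp add: e_def ln_dbl)
  finally have eq: "(\<integral>\<^sup>+t. indicator (layer m) t * ennreal (1 / t) \<partial>lborel) = ennreal ((if m = 0 then 2 else 2 ^ m) * ln 2)" .
  have "2 ^ m * (2 / 3) \<le> 2 ^ m * ln (2::real)" "2 ^ m * ln (2::real) \<le> 2 ^ m * 1" by (intro mult_left_mono l2; simp)+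
  then have "(if m = 0 then 2 else 2 ^ m) * ln 2 \<le> (2 * 2 ^ m :: real)" "(2 ^ m / 2 :: real) \<le> (if m = 0 then 2 else 2 ^ m) * ln 2"
    using l2 by (auto split: if_splits)
  then show "(\<integral>\<^sup>+t. indicator (layer m) t * ennreal (1 / t) \<partial>lborel) \<le> ennreal (2 * 2 ^ m)"
    "ennreal (2 ^ m / 2) \<le> (\<integral>\<^sup>+t. indicator (layer m) t * ennreal (1 / t) \<partial>lborel)"
    unfolding eq by (auto intro: ennreal_leI)
qed

lemma layer_measurable [measurable]: "layer m \<in> sets borel"
  by (simp add: layer_def)

lemma nn_integral_layers:
  "(\<integral>\<^sup>+t. (\<Sum>m. indicator (layer m) t * (a m * ennreal (1 / t))) \<partial>lborel)
    = (\<Sum>m. a m * (\<integral>\<^sup>+t. indicator (layer m) t * ennreal (1 / t) \<partial>lborel))"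
proof -
  have "(\<integral>\<^sup>+t. (\<Sum>m. indicator (layer m) t * (a m * ennreal (1 / t))) \<partial>lborel)
      = (\<Sum>m. \<integral>\<^sup>+t. indicator (layer m) t * (a m * ennreal (1 / t)) \<partial>lborel)"
    by (intro nn_integral_suminf) measurable
  also have "\<dots> = (\<Sum>m. \<integral>\<^sup>+t. a m * (indicator (layer m) t * ennreal (1 / t)) \<partial>lborel)"
    by (simp only: ac_simps)
  also have "\<dots> = (\<Sum>m. a m * (\<integral>\<^sup>+t. indicator (layer m) t * ennreal (1 / t) \<partial>lborel))"
    by (subst nn_integral_cmult) (auto intro: measurable)
  finally show ?thesis .
qed

lemma suminf_layers:
  assumes "t \<in> layer m"
  shows "(\<Sum>n. indicator (layer n) t * (a n :: ennreal)) = a m"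
proof -
  have "(\<Sum>n. indicator (layer n) t * a n) = (\<Sum>n\<in>{m}. indicator (layer n) t * a n)"
    using layer_unique[OF assms] by (intro suminf_finite) (auto simp: indicator_def)
  then show ?thesis using assms by simp
qed

text \<open>A layer has logarithmic length of order 2^m, which under the root of order q contributes
  the extra weight exponent \<open>recip q\<close>. G is an arbitrary function: it is compared with
  a function constant on layers, and that one is integrated.\<close>

lemma log_norm_le:
  assumes q: "0 < q"
  obtains K :: real where "K > 0"
    "\<And>G \<Omega>. (\<And>m t. t \<in> layer m \<Longrightarrow> G t \<le> \<Omega> m) \<Longrightarrow>
      log_norm q b G \<le> ennreal K * lr_norm q (\<lambda>m. w2 (b + recip q) m * \<Omega> m)"
  using q
proof (cases rule: exponent_cases)
  case 1
  show ?thesis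
  proof (rule that[of "3 powr \<bar>b\<bar>"])
    fix G \<Omega> assume G: "\<And>m t. t \<in> layer m \<Longrightarrow> G t \<le> (\<Omega> m :: ennreal)"
    show "log_norm q b G \<le> ennreal (3 powr \<bar>b\<bar>) * lr_norm q (\<lambda>m. w2 (b + recip q) m * \<Omega> m)"
      unfolding log_norm_def if_P[OF 1]
    proof (rule SUP_least)
      fix t :: real assume "t \<in> {0<..<1}"
      then obtain m where m: "t \<in> layer m" using layer_exists[of t] by auto
      have "ennreal ((1 - ln t) powr b) * G t \<le> ennreal (3 powr \<bar>b\<bar> * 2 powr (real m * b)) * \<Omega> m"
        by (intro mult_mono ennreal_leI layer_weight G m) auto
      also have "\<dots> = ennreal (3 powr \<bar>b\<bar>) * (w2 (b + recip q) m * \<Omega> m)"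
        by (simp add: 1 w2_def ennreal_mult mult.assoc)
      also have "\<dots> \<le> ennreal (3 powr \<bar>b\<bar>) * lr_norm q (\<lambda>m. w2 (b + recip q) m * \<Omega> m)"
        by (intro mult_left_mono lr_norm_ge q) simp
      finally show "ennreal ((1 - ln t) powr b) * G t \<le> ennreal (3 powr \<bar>b\<bar>) * lr_norm q (\<lambda>m. w2 (b + recip q) m * \<Omega> m)" .
    qed
  qed simp
next
  case (2 s)
  let ?c = "3 powr \<bar>b\<bar>"
  show ?thesis
  proof (rule that[of "?c * 2 powr (1 / s)"])
    fix G \<Omega> assume G: "\<And>m t. t \<in> layer m \<Longrightarrow> G t \<le> (\<Omega> m :: ennreal)"
    let ?a = "\<lambda>m. epowr (ennreal ?c * (w2 b m * \<Omega> m)) s"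
    have "(\<integral>\<^sup>+t\<in>{0<..<1}. epowr (ennreal ((1 - ln t) powr b) * G t) s * ennreal (1 / t) \<partial>lborel)
        \<le> (\<integral>\<^sup>+t. (\<Sum>m. indicator (layer m) t * (?a m * ennreal (1 / t))) \<partial>lborel)"
    proof (rule nn_integral_mono)
      fix t :: real
      show "epowr (ennreal ((1 - ln t) powr b) * G t) s * ennreal (1 / t) * indicator {0<..<1} t
        \<le> (\<Sum>m. indicator (layer m) t * (?a m * ennreal (1 / t)))"
      proof (cases "t \<in> {0<..<1}")
        case True
        then obtain m where m: "t \<in> layer m" using layer_exists[of t] by auto
        have "ennreal ((1 - ln t) powr b) * G t \<le> ennreal (?c * 2 powr (real m * b)) * \<Omega> m"
          by (intro mult_mono ennreal_leI layer_weight G m) auto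
        also have "\<dots> = ennreal ?c * (w2 b m * \<Omega> m)" by (simp add: w2_def ennreal_mult mult.assoc)
        finally show ?thesis
          unfolding suminf_layers[OF m] using True 2 by (auto intro!: mult_right_mono epowr_mono)
      qed simp
    qed
    also have "\<dots> \<le> (\<Sum>m. ?a m * ennreal (2 * 2 ^ m))"
      unfolding nn_integral_layers by (intro suminf_le mult_left_mono layer_integral) auto
    also have "\<dots> = (\<Sum>m. epowr (ennreal (?c * 2 powr (1 / s)) * (w2 (b + recip q) m * \<Omega> m)) s)"
    proof (rule suminf_cong)
      fix m
      have "ennreal (2 * 2 ^ m) = epowr (ennreal (2 powr (1 / s)) * w2 (recip q) m) s"
        using 2 by (simp add: w2_def powr_mult powr_powr recip_ennreal ennreal_mult[symmetric] powr_realpow)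
      then show "?a m * ennreal (2 * 2 ^ m) = epowr (ennreal (?c * 2 powr (1 / s)) * (w2 (b + recip q) m * \<Omega> m)) s"
        using 2 by (simp add: epowr_mult[symmetric] w2_add ennreal_mult ac_simps del: epowr_ennreal)
    qed
    finally have "log_norm q b G \<le> lr_norm q (\<lambda>m. ennreal (?c * 2 powr (1 / s)) * (w2 (b + recip q) m * \<Omega> m))"
      using 2 by (auto simp: log_norm_def lr_norm_def intro!: epowr_mono)
    then show "log_norm q b G \<le> ennreal (?c * 2 powr (1 / s)) * lr_norm q (\<lambda>m. w2 (b + recip q) m * \<Omega> m)"
      by (simp only: lr_norm_cmult[OF q])
  qed simp
qed

lemma log_norm_ge:
  assumes q: "0 < q"
  obtains K :: real where "K > 0"
    "\<And>G \<Omega>. (\<And>m t. t \<in> layer m \<Longrightarrow> \<Omega> m \<le> G t) \<Longrightarrow>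
      lr_norm q (\<lambda>m. w2 (b + recip q) m * \<Omega> m) \<le> ennreal K * log_norm q b G"
  using q
proof (cases rule: exponent_cases)
  case 1
  show ?thesis
  proof (rule that[of "3 powr \<bar>b\<bar>"])
    fix G \<Omega> assume G: "\<And>m t. t \<in> layer m \<Longrightarrow> \<Omega> m \<le> (G t :: ennreal)"
    have "w2 b m * \<Omega> m \<le> ennreal (3 powr \<bar>b\<bar>) * log_norm top b G" for m
    proof -
      have t: "dbl (Suc m) \<in> layer m"
        using powr_less_mono[of "-2" 0 2] by (auto simp: layer_def dbl_def)
      have "w2 b m * \<Omega> m \<le> ennreal (3 powr \<bar>b\<bar> * (1 - ln (dbl (Suc m))) powr b) * G (dbl (Suc m))"
        unfolding w2_def by (intro mult_mono ennreal_leI layer_weight G t) auto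
      also have "\<dots> = ennreal (3 powr \<bar>b\<bar>) * (ennreal ((1 - ln (dbl (Suc m))) powr b) * G (dbl (Suc m)))"
        by (simp add: ennreal_mult mult.assoc)
      also have "\<dots> \<le> ennreal (3 powr \<bar>b\<bar>) * log_norm top b G"
        unfolding log_norm_def if_P[OF refl] using layer_subset[OF t] by (intro mult_left_mono SUP_upper) auto
      finally show ?thesis .
    qed
    then show "lr_norm q (\<lambda>m. w2 (b + recip q) m * \<Omega> m) \<le> ennreal (3 powr \<bar>b\<bar>) * log_norm q b G"
      unfolding 1 lr_norm_top by (auto intro: SUP_least)
  qed simp
next
  case (2 s)
  let ?c = "3 powr (- \<bar>b\<bar>)"
  show ?thesis
  proof (rule that[of "3 powr \<bar>b\<bar> * 2 powr (1 / s)"])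
    fix G \<Omega> assume G: "\<And>m t. t \<in> layer m \<Longrightarrow> \<Omega> m \<le> (G t :: ennreal)"
    let ?a = "\<lambda>m. epowr (ennreal ?c * (w2 b m * \<Omega> m)) s"
    have "(\<Sum>m. epowr (ennreal (?c * 2 powr (- 1 / s)) * (w2 (b + recip q) m * \<Omega> m)) s) = (\<Sum>m. ?a m * ennreal (2 ^ m / 2))"
    proof (rule suminf_cong)
      fix m
      have "ennreal (2 ^ m / 2) = epowr (ennreal (2 powr (- 1 / s)) * w2 (recip q) m) s"
        using 2 by (simp add: w2_def powr_mult powr_powr recip_ennreal ennreal_mult[symmetric] powr_realpow powr_minus_divide powr_divide)
      then show "epowr (ennreal (?c * 2 powr (- 1 / s)) * (w2 (b + recip q) m * \<Omega> m)) s = ?a m * ennreal (2 ^ m / 2)"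
        using 2 by (simp add: epowr_mult[symmetric] w2_add ennreal_mult ac_simps del: epowr_ennreal)
    qed
    also have "\<dots> \<le> (\<integral>\<^sup>+t. (\<Sum>m. indicator (layer m) t * (?a m * ennreal (1 / t))) \<partial>lborel)"
      unfolding nn_integral_layers by (intro suminf_le mult_left_mono layer_integral) auto
    also have "\<dots> \<le> (\<integral>\<^sup>+t\<in>{0<..<1}. epowr (ennreal ((1 - ln t) powr b) * G t) s * ennreal (1 / t) \<partial>lborel)"
    proof (rule nn_integral_mono)
      fix t :: real
      show "(\<Sum>m. indicator (layer m) t * (?a m * ennreal (1 / t)))
        \<le> epowr (ennreal ((1 - ln t) powr b) * G t) s * ennreal (1 / t) * indicator {0<..<1} t"
      proof (cases "t \<in> {0<..<1}")
        case True
        then obtain m where m: "t \<in> layer m" using layer_exists[of t] by auto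
        have "ennreal ?c * (w2 b m * \<Omega> m) \<le> ennreal ?c * (ennreal (3 powr \<bar>b\<bar> * (1 - ln t) powr b) * G t)"
          unfolding w2_def by (intro mult_left_mono mult_mono ennreal_leI layer_weight G m) auto
        also have "\<dots> = ennreal (?c * (3 powr \<bar>b\<bar> * (1 - ln t) powr b)) * G t"
          by (simp add: ennreal_mult mult.assoc)
        also have "?c * (3 powr \<bar>b\<bar> * (1 - ln t) powr b) = (1 - ln t) powr b"
          by (simp add: powr_minus)
        finally show ?thesis
          unfolding suminf_layers[OF m] using True 2 by (auto intro!: mult_right_mono epowr_mono)
      next
        case False
        then have "t \<notin> layer m" for m using layer_subset[of t m] by auto
        then show ?thesis by simp
      qed
    qed
    finally have "lr_norm q (\<lambda>m. ennreal (?c * 2 powr (- 1 / s)) * (w2 (b + recip q) m * \<Omega> m)) \<le> log_norm q b G"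
      using 2 by (auto simp: log_norm_def lr_norm_def intro!: epowr_mono)
    then have "ennreal (?c * 2 powr (- 1 / s)) * lr_norm q (\<lambda>m. w2 (b + recip q) m * \<Omega> m) \<le> log_norm q b G"
      by (simp only: lr_norm_cmult[OF q])
    then have "ennreal (3 powr \<bar>b\<bar> * 2 powr (1 / s)) * (ennreal (?c * 2 powr (- 1 / s)) * lr_norm q (\<lambda>m. w2 (b + recip q) m * \<Omega> m))
        \<le> ennreal (3 powr \<bar>b\<bar> * 2 powr (1 / s)) * log_norm q b G"
      by (rule mult_left_mono) simp
    moreover have "ennreal (3 powr \<bar>b\<bar> * 2 powr (1 / s)) * ennreal (?c * 2 powr (- 1 / s)) = 1"
      by (simp add: ennreal_mult[symmetric] powr_minus field_simps powr_minus_divide)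
    ultimately show "lr_norm q (\<lambda>m. w2 (b + recip q) m * \<Omega> m) \<le> ennreal (3 powr \<bar>b\<bar> * 2 powr (1 / s)) * log_norm q b G"
      by (simp add: mult.assoc[symmetric] del: ennreal_mult')
  qed simp
qed

text \<open>Powers of 2^n are exponential in n and \<open>dbl n\<close> decays doubly exponentially,
  so the full square norm multiplied by \<open>dbl\<close> becomes a harmless term in the weighted
  estimate.\<close>

lemma dbl_absorbs_powr:
  assumes a: "0 < a"
  obtains C :: real where "C > 0" "\<And>n. 2 powr (real n * a) * dbl n \<le> C"
proof (rule that[of "(a / ln 2) powr a"])
  show "(a / ln 2) powr a > 0" using a by simp
  fix n
  have "(2 ^ n * ln 2) powr a \<le> a powr a * exp (2 ^ n * ln 2)" by (intro powr_le_exp a) simp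
  moreover have "(2 ^ n * ln 2) powr a = 2 powr (real n * a) * ln 2 powr a"
    by (simp add: powr_mult powr_powr flip: powr_realpow)
  moreover have "exp (2 ^ n * ln 2) = inverse (dbl n)"
    by (simp add: dbl_def powr_def exp_minus)
  ultimately have "2 powr (real n * a) * ln 2 powr a \<le> a powr a * inverse (dbl n)" by simp
  then have "2 powr (real n * a) * ln 2 powr a * dbl n \<le> a powr a" using dbl_bounds(1)[of n] by (simp add: field_simps)
  then show "2 powr (real n * a) * dbl n \<le> (a / ln 2) powr a" using a by (simp add: powr_divide field_simps)
qed

section \<open>Representing the distribution by an almost everywhere limit of partial sums\<close>

lemma dominated_increments_converge:
  fixes X :: "nat \<Rightarrow> complex"
  assumes "(\<Sum>i. ennreal (4 ^ i * (cmod (X (Suc i) - X i))\<^sup>2)) \<noteq> top"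
  shows "convergent X"
proof -
  have "summable (\<lambda>i. 4 ^ i * (cmod (X (Suc i) - X i))\<^sup>2)"
    using assms by (intro summable_suminf_not_top) auto
  then have "Bseq (\<lambda>i. 4 ^ i * (cmod (X (Suc i) - X i))\<^sup>2)"
    by (intro convergent_imp_Bseq convergentI[OF summable_LIMSEQ_zero])
  then obtain M where M: "M > 0" "\<And>i. norm (4 ^ i * (cmod (X (Suc i) - X i))\<^sup>2) \<le> M"
    by (auto simp: Bseq_def)
  \<comment> \<open>The weight 4^i turns boundedness of the terms into geometric decay of the
    increments, hence absolute convergence.\<close>
  have "cmod (X (Suc i) - X i) \<le> sqrt M * (1 / 2) ^ i" for i
  proof (rule power2_le_imp_le)
    have "(2::real) ^ i * 2 ^ i = 4 ^ i" by (simp flip: power_mult_distrib)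
    then have eq: "(sqrt M * (1 / 2) ^ i)\<^sup>2 = M / 4 ^ i"
      using M(1) by (simp add: power2_eq_square power_divide)
    show "(cmod (X (Suc i) - X i))\<^sup>2 \<le> (sqrt M * (1 / 2) ^ i)\<^sup>2"
      unfolding eq using M(2)[of i] by (simp add: field_simps)
    show "0 \<le> sqrt M * (1 / 2) ^ i" using M(1) by simp
  qed
  then have "summable (\<lambda>i. X (Suc i) - X i)"
    by (rule summable_comparison_test'[of "\<lambda>i. sqrt M * (1 / 2) ^ i" 0, rotated]) (simp add: summable_mult summable_geometric)
  then have "convergent (\<lambda>n. \<Sum>i<n. X (Suc i) - X i)"
    using summable_iff_convergent by blast
  then have "convergent (\<lambda>n. X 0 + (X n - X 0))"
    unfolding sum_lessThan_telescope by (intro convergent_add convergent_const)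
  then show ?thesis by simp
qed

text \<open>The rate (1/8)^i is chosen against the weight 4^i in
  \<open>dominated_increments_converge\<close>: the product (1/2)^i is still summable.\<close>

lemma rapid_subsequence:
  fixes s :: "nat \<Rightarrow> real"
  assumes "summable s"
  obtains \<nu> :: "nat \<Rightarrow> nat" where "mono \<nu>" "\<And>i. i \<le> \<nu> i"
    "\<And>i m n. \<nu> i \<le> m \<Longrightarrow> (\<Sum>j\<in>{m..<n}. s j) \<le> (1 / 8) ^ i"
proof -
  have "\<exists>N. \<forall>m\<ge>N. \<forall>n. norm (\<Sum>j\<in>{m..<n}. s j) < (1 / 8) ^ i" for i
    using assms unfolding summable_Cauchy by (metis zero_less_power divide_pos_pos zero_less_one zero_less_numeral)
  then obtain N where N: "\<And>i m n. N i \<le> m \<Longrightarrow> norm (\<Sum>j\<in>{m..<n}. s j) < (1 / 8) ^ i" by metis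
  show ?thesis
  proof (rule that[of "\<lambda>i. (\<Sum>l\<le>i. N l) + i"])
    show "mono (\<lambda>i. (\<Sum>l\<le>i. N l) + i)" by (intro monoI add_mono sum_mono2) auto
    fix i m n assume "(\<Sum>l\<le>i. N l) + i \<le> m"
    moreover have "N i \<le> (\<Sum>l\<le>i. N l)" by (rule member_le_sum) auto
    ultimately have "N i \<le> m" by linarith
    from N[OF this, of n] show "(\<Sum>j\<in>{m..<n}. s j) \<le> (1 / 8) ^ i" by simp
  qed simp
qed

context lacunary_setting
begin

lemma partial_diff:
  assumes "m \<le> n"
  shows "partial n b x - partial m b x = partial n (\<lambda>j. if m \<le> j then b j else 0) x"
proof -
  have "lac_sum n b x - lac_sum m b x = lac_sum n (\<lambda>j. if m \<le> j then b j else 0) x"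
  proof -
    have "lac_sum n b x = lac_sum m b x + lac_sum n (\<lambda>j. if m \<le> j then b j else 0) x"
    proof -
      have "lac_sum n (\<lambda>j. if j < m then b j else 0) x = lac_sum m b x"
        unfolding lac_sum_def using assms by (intro sum.mono_neutral_cong_right) auto
      moreover have "lac_sum n b x = lac_sum n (\<lambda>j. if j < m then b j else 0) x + lac_sum n (\<lambda>j. if m \<le> j then b j else 0) x"
        unfolding lac_sum_def sum.distrib[symmetric] by (intro sum.cong) auto
      ultimately show ?thesis by simp
    qed
    then show ?thesis by simp
  qed
  then show ?thesis by (simp add: partial_def right_diff_distrib[symmetric])
qed

lemma partial_pairing_sum:
  assumes b: "coeffs b u" and f: "f \<in> schwartz"
  shows "(LINT x|lborel. partial n b x * f x) = (\<Sum>j<n. b j * (LINT x|lborel. osc (lac_freq j) x * \<psi> x * f x))"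
proof -
  have "(LINT x|lborel. partial n b x * f x) = (LINT x|lborel. (\<Sum>j\<in>{3..<n}. b j * (wave j x * f x)))"
    by (simp add: partial_eq sum_distrib_right mult.assoc)
  also have "\<dots> = (\<Sum>j\<in>{3..<n}. LINT x|lborel. b j * (wave j x * f x))"
    by (intro Bochner_Integration.integral_sum integrable_mult_right schwartz_mult_integrable wave_schwartz f)
  also have "\<dots> = (\<Sum>j\<in>{3..<n}. b j * (LINT x|lborel. osc (lac_freq j) x * \<psi> x * f x))"
    by simp
  also have "\<dots> = (\<Sum>j<n. b j * (LINT x|lborel. osc (lac_freq j) x * \<psi> x * f x))"
    using b by (intro sum.mono_neutral_left) (auto simp: coeffs_def)
  finally show ?thesis .
qed

text \<open>A Riesz-Fischer argument, carried out in L_2 whatever p is; bounds in L_p are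
  transferred afterwards. The limit represents u because pairing the partial sums with f gives the
  partial sums of the expansion tested on f.\<close>

lemma represented_of_square_summable:
  assumes b: "coeffs b u" and s: "summable (\<lambda>j. (cmod (b j))\<^sup>2)"
  obtains \<nu> :: "nat \<Rightarrow> nat" and g where "represents g u"
    "AE x in lborel. (\<lambda>i. partial (\<nu> i) b x) \<longlonglongrightarrow> g x"
proof -
  obtain \<nu> where \<nu>: "mono \<nu>" "\<And>i. i \<le> \<nu> i"
    "\<And>i m n. \<nu> i \<le> m \<Longrightarrow> (\<Sum>j\<in>{m..<n}. (cmod (b j))\<^sup>2) \<le> (1 / 8) ^ i"
    by (rule rapid_subsequence[OF s]) (rule that, assumption, blast, blast)
  obtain C where C: "C > 0"
    "\<And>n c. Lp_norm 2 (\<lambda>x. ennreal (cmod (partial n c x))) \<le> ennreal (C * sqrt (\<Sum>j\<in>{3..<n}. (cmod (c j))\<^sup>2))"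
    using Lp_norm_partial[of 2] by auto
  define P where "P i = partial (\<nu> i) b" for i
  have Ps: "P i \<in> schwartz" for i unfolding P_def by (rule partial_schwartz)
  have [measurable]: "P i \<in> borel_measurable borel" for i by (rule schwartz_measurable[OF Ps])
  have step: "Lp_norm 2 (\<lambda>x. ennreal (cmod (P n x - P m x))) \<le> ennreal (C * sqrt ((1 / 8) ^ m))" if "m \<le> n" for m n
  proof -
    let ?c = "\<lambda>j. if \<nu> m \<le> j then b j else 0"
    have "Lp_norm 2 (\<lambda>x. ennreal (cmod (P n x - P m x))) = Lp_norm 2 (\<lambda>x. ennreal (cmod (partial (\<nu> n) ?c x)))"
      unfolding P_def using partial_diff[OF monoD[OF \<nu>(1) that]] by simp
    also have "\<dots> \<le> ennreal (C * sqrt (\<Sum>j\<in>{3..<\<nu> n}. (cmod (?c j))\<^sup>2))" by (rule C(2))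
    also have "\<dots> \<le> ennreal (C * sqrt ((1 / 8) ^ m))"
    proof -
      have "(\<Sum>j\<in>{3..<\<nu> n}. (cmod (?c j))\<^sup>2) = (\<Sum>j\<in>{max 3 (\<nu> m)..<\<nu> n}. (cmod (b j))\<^sup>2)"
        by (rule sum.mono_neutral_cong_right) auto
      also have "\<dots> \<le> (1 / 8) ^ m" by (rule \<nu>(3)) simp
      finally show ?thesis using C(1) by (intro ennreal_leI) (auto intro!: mult_left_mono)
    qed
    finally show ?thesis .
  qed
  have increments: "(\<integral>\<^sup>+x. ennreal ((cmod (P (Suc i) x - P i x))\<^sup>2) \<partial>lborel) \<le> ennreal (C\<^sup>2 * (1 / 8) ^ i)" for i
  proof -
    have "(\<integral>\<^sup>+x. ennreal ((cmod (P (Suc i) x - P i x))\<^sup>2) \<partial>lborel)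
        = epowr (Lp_norm 2 (\<lambda>x. ennreal (cmod (P (Suc i) x - P i x)))) 2"
      by (simp add: epowr_Lp_norm powr_numeral)
    also have "\<dots> \<le> epowr (ennreal (C * sqrt ((1 / 8) ^ i))) 2" by (intro epowr_mono step) auto
    also have "\<dots> = ennreal (C\<^sup>2 * (1 / 8) ^ i)" using C(1) by (simp add: powr_numeral power_mult_distrib)
    finally show ?thesis .
  qed
  have "(\<integral>\<^sup>+x. (\<Sum>i. ennreal (4 ^ i * (cmod (P (Suc i) x - P i x))\<^sup>2)) \<partial>lborel)
      = (\<Sum>i. \<integral>\<^sup>+x. ennreal (4 ^ i * (cmod (P (Suc i) x - P i x))\<^sup>2) \<partial>lborel)"
    by (intro nn_integral_suminf) measurable
  also have "\<dots> \<le> (\<Sum>i. ennreal (C\<^sup>2 * (1 / 2) ^ i))"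
  proof (intro suminf_le)
    fix i
    have "(\<integral>\<^sup>+x. ennreal (4 ^ i * (cmod (P (Suc i) x - P i x))\<^sup>2) \<partial>lborel)
        = ennreal (4 ^ i) * (\<integral>\<^sup>+x. ennreal ((cmod (P (Suc i) x - P i x))\<^sup>2) \<partial>lborel)"
      by (subst nn_integral_cmult[symmetric]) (auto simp: ennreal_mult)
    also have "\<dots> \<le> ennreal (4 ^ i) * ennreal (C\<^sup>2 * (1 / 8) ^ i)" by (intro mult_left_mono increments) auto
    also have "\<dots> = ennreal (C\<^sup>2 * (1 / 2) ^ i)"
    proof -
      have "(4::real) ^ i * (1 / 8) ^ i = (1 / 2) ^ i" by (simp flip: power_mult_distrib)
      then show ?thesis using C(1) by (simp add: ennreal_mult[symmetric] ac_simps)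
    qed
    finally show "(\<integral>\<^sup>+x. ennreal (4 ^ i * (cmod (P (Suc i) x - P i x))\<^sup>2) \<partial>lborel) \<le> ennreal (C\<^sup>2 * (1 / 2) ^ i)" .
  qed auto
  also have "\<dots> = ennreal (\<Sum>i. C\<^sup>2 * (1 / 2) ^ i)"
    by (intro suminf_ennreal2 summable_mult summable_geometric) auto
  finally have "(\<integral>\<^sup>+x. (\<Sum>i. ennreal (4 ^ i * (cmod (P (Suc i) x - P i x))\<^sup>2)) \<partial>lborel) \<noteq> \<infinity>"
    by (auto simp: top_unique)
  then have "AE x in lborel. (\<Sum>i. ennreal (4 ^ i * (cmod (P (Suc i) x - P i x))\<^sup>2)) \<noteq> \<infinity>"
    by (intro nn_integral_PInf_AE) measurable
  then have conv: "AE x in lborel. convergent (\<lambda>i. P i x)"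
    by eventually_elim (rule dominated_increments_converge, simp)
  define g where "g x = lim (\<lambda>i. P i x)" for x
  have gm [measurable]: "g \<in> borel_measurable borel"
    unfolding g_def[abs_def] by (intro borel_measurable_lim_metric) measurable
  have lim: "AE x in lborel. (\<lambda>i. P i x) \<longlonglongrightarrow> g x"
    using conv by eventually_elim (simp add: g_def convergent_LIMSEQ_iff)
  have tail: "Lp_norm 2 (\<lambda>x. ennreal (cmod (g x - P m x))) \<le> ennreal (C * sqrt ((1 / 8) ^ m))" for m
  proof (rule Lp_norm_Fatou[where f="\<lambda>n x. P n x - P m x" and ?n0.0=m])
    show "AE x in lborel. (\<lambda>n. P n x - P m x) \<longlonglongrightarrow> g x - P m x"
      using lim by eventually_elim (intro tendsto_intros)
  qed (auto intro: step)
  have pairing: "integrable lborel (\<lambda>x. (g x - P m x) * f x)"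
    "cmod (LINT x|lborel. (g x - P m x) * f x) \<le> C * sqrt ((1 / 8) ^ m) * enn2real (Lp_norm 2 (\<lambda>x. ennreal (cmod (f x))))"
    if f: "f \<in> schwartz" for f :: "real^'d \<Rightarrow> complex" and m
  proof -
    have [measurable]: "f \<in> borel_measurable borel" by (rule schwartz_measurable[OF f])
    let ?F = "Lp_norm 2 (\<lambda>x. ennreal (cmod (f x)))"
    have F: "?F = ennreal (enn2real ?F)" using schwartz_Lp_finite[OF f, of 2] by (simp add: less_top)
    have "(\<integral>\<^sup>+x. ennreal (cmod (g x - P m x)) * ennreal (cmod (f x)) \<partial>lborel)
        \<le> Lp_norm 2 (\<lambda>x. ennreal (cmod (g x - P m x))) * ?F"
      unfolding Lp_norm_def by (rule nn_integral_Hoelder) auto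
    also have "\<dots> \<le> ennreal (C * sqrt ((1 / 8) ^ m)) * ennreal (enn2real ?F)"
      by (subst F) (intro mult_right_mono tail, simp)
    also have "\<dots> = ennreal (C * sqrt ((1 / 8) ^ m) * enn2real ?F)"
      using C(1) by (intro ennreal_mult[symmetric]) auto
    finally have b: "(\<integral>\<^sup>+x. ennreal (cmod ((g x - P m x) * f x)) \<partial>lborel) \<le> ennreal (C * sqrt ((1 / 8) ^ m) * enn2real ?F)"
      by (simp add: norm_mult ennreal_mult)
    then show i: "integrable lborel (\<lambda>x. (g x - P m x) * f x)"
      by (intro integrableI_bounded) (auto intro: le_less_trans)
    have "ennreal (cmod (LINT x|lborel. (g x - P m x) * f x)) \<le> ennreal (C * sqrt ((1 / 8) ^ m) * enn2real ?F)"
      using integral_norm_bound_ennreal[OF i] b by (rule order_trans)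
    then show "cmod (LINT x|lborel. (g x - P m x) * f x) \<le> C * sqrt ((1 / 8) ^ m) * enn2real ?F"
      using C(1) by (subst (asm) ennreal_le_iff) auto
  qed
  have "represents g u"
    unfolding represents_def
  proof (intro conjI ballI)
    show "g \<in> borel_measurable lborel" by simp
    fix f :: "real^'d \<Rightarrow> complex" assume f: "f \<in> schwartz"
    let ?F = "enn2real (Lp_norm 2 (\<lambda>x. ennreal (cmod (f x))))"
    have iP: "integrable lborel (\<lambda>x. P m x * f x)" for m by (intro schwartz_mult_integrable Ps f)
    have "integrable lborel (\<lambda>x. (g x - P 0 x) * f x + P 0 x * f x)"
      by (intro Bochner_Integration.integrable_add pairing(1) iP f)
    then show ig: "integrable lborel (\<lambda>x. g x * f x)" by (simp add: left_diff_distrib)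
    have "(\<lambda>m. (LINT x|lborel. g x * f x) - (LINT x|lborel. P m x * f x)) \<longlonglongrightarrow> 0"
    proof (rule tendsto_norm_zero_cancel, rule tendsto_sandwich[OF _ _ tendsto_const])
      show "\<forall>\<^sub>F m in sequentially. 0 \<le> cmod ((LINT x|lborel. g x * f x) - (LINT x|lborel. P m x * f x))" by simp
      show "\<forall>\<^sub>F m in sequentially. cmod ((LINT x|lborel. g x * f x) - (LINT x|lborel. P m x * f x)) \<le> C * sqrt ((1 / 8) ^ m) * ?F"
        using pairing(2)[OF f] ig iP by (simp add: left_diff_distrib Bochner_Integration.integral_diff)
      have "(\<lambda>m. C * sqrt ((1 / 8) ^ m) * ?F) \<longlonglongrightarrow> C * sqrt 0 * ?F"
        by (intro tendsto_intros LIMSEQ_power_zero) simp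
      then show "(\<lambda>m. C * sqrt ((1 / 8) ^ m) * ?F) \<longlonglongrightarrow> 0" by simp
    qed
    from tendsto_diff[OF tendsto_const[of "LINT x|lborel. g x * f x"] this]
    have 1: "(\<lambda>m. LINT x|lborel. P m x * f x) \<longlonglongrightarrow> (LINT x|lborel. g x * f x)" by simp
    have "(\<lambda>n. \<Sum>j<n. b j * (LINT x|lborel. osc (lac_freq j) x * \<psi> x * f x)) \<longlonglongrightarrow> u f"
      using b f by (auto simp: coeffs_def sums_def)
    moreover have "filterlim \<nu> at_top sequentially"
      using \<nu>(2) by (intro filterlim_at_top_mono[OF filterlim_ident]) (auto intro: always_eventually)
    ultimately have "(\<lambda>m. \<Sum>j<\<nu> m. b j * (LINT x|lborel. osc (lac_freq j) x * \<psi> x * f x)) \<longlonglongrightarrow> u f"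
      by (rule filterlim_compose)
    then have "(\<lambda>m. LINT x|lborel. P m x * f x) \<longlonglongrightarrow> u f"
      unfolding P_def partial_pairing_sum[OF b f] .
    then show "u f = (LINT x|lborel. g x * f x)" using 1 by (rule LIMSEQ_unique)
  qed
  then show ?thesis using lim unfolding P_def by (rule that)
qed

lemma square_summable_of_l2_tail:
  assumes "b 0 = 0" "l2_tail (mods b) 0 < top"
  shows "summable (\<lambda>j. (cmod (b j))\<^sup>2)"
proof -
  have "on {2 ^ 0..} (mods b) = mods b" using assms(1) by (auto simp: on_def fun_eq_iff not_less_eq_eq)
  then have "lr_norm (ennreal 2) (mods b) < top" using assms(2) by (simp add: l2_tail_def)
  then have "epowr (\<Sum>j. epowr (mods b j) 2) (1 / 2) < top"
    by (simp only: lr_norm_ennreal[OF zero_less_numeral])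
  then have "(\<Sum>j. ennreal ((cmod (b j))\<^sup>2)) \<noteq> top"
    by (simp add: powr_numeral)
  then show ?thesis by (intro summable_suminf_not_top) auto
qed

text \<open>The bounds for partial sums are uniform in their length, and differences respect almost
  everywhere convergence, so Fatou's lemma along the rapid subsequence applies to
  \<open>fun_of u\<close> for each step separately; the supremum over steps comes last.\<close>

lemma lacunary_function_bounds:
  assumes p: "1 < p" and k: "k \<ge> 1"
  obtains K :: real where "K > 0"
    "\<And>b u. coeffs b u \<Longrightarrow> l2_tail (mods b) 0 < top \<Longrightarrow> \<exists>g. represents g u"
    "\<And>b u. coeffs b u \<Longrightarrow> l2_tail (mods b) 0 < top \<Longrightarrow>
      Lp_norm p (\<lambda>x. ennreal (cmod (fun_of u x))) \<le> ennreal K * l2_tail (mods b) 0"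
    "\<And>b u t. coeffs b u \<Longrightarrow> l2_tail (mods b) 0 < top \<Longrightarrow> modulus k p (fun_of u) t \<le> ennreal K * l2_tail (mods b) 0"
    "\<And>b u t m. coeffs b u \<Longrightarrow> l2_tail (mods b) 0 < top \<Longrightarrow> t \<le> dbl (Suc m) \<Longrightarrow>
      modulus k p (fun_of u) t \<le> ennreal K * (l2_tail (mods b) m + ennreal (dbl m) * l2_tail (mods b) 0)"
proof -
  obtain K where K: "K > 0"
    "\<And>b n y. b 0 = 0 \<Longrightarrow> Lp_norm p (\<lambda>x. ennreal (cmod ((diff_op y ^^ k) (partial n b) x))) \<le> ennreal K * l2_tail (mods b) 0"
    "\<And>b n y. b 0 = 0 \<Longrightarrow> Lp_norm p (\<lambda>x. ennreal (cmod (partial n b x))) \<le> ennreal K * l2_tail (mods b) 0"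
    "\<And>b n y m. b 0 = 0 \<Longrightarrow> norm y \<le> dbl (Suc m) \<Longrightarrow> Lp_norm p (\<lambda>x. ennreal (cmod ((diff_op y ^^ k) (partial n b) x)))
      \<le> ennreal K * (l2_tail (mods b) m + ennreal (dbl m) * l2_tail (mods b) 0)"
    by (rule Lp_norm_diff_partial[OF p k]) (rule that, assumption, blast, blast, blast)
  have main: "(\<exists>g. represents g u) \<and> (\<exists>\<nu>. AE x in lborel. (\<lambda>i::nat. partial (\<nu> i) b x) \<longlonglongrightarrow> fun_of u x) \<and> b 0 = 0"
    if b: "coeffs b u" and T: "l2_tail (mods b) 0 < top" for b u
  proof -
    have b0: "b 0 = 0" using b by (simp add: coeffs_def)
    obtain \<nu> :: "nat \<Rightarrow> nat" and g where g: "represents g u" "AE x in lborel. (\<lambda>i. partial (\<nu> i) b x) \<longlonglongrightarrow> g x"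
      by (rule represented_of_square_summable[OF b square_summable_of_l2_tail[of b, OF b0 T]]) (rule that)
    have "AE x in lborel. (\<lambda>i. partial (\<nu> i) b x) \<longlonglongrightarrow> fun_of u x"
      using g(2) fun_of_AE(1)[OF g(1)] by eventually_elim simp
    then show ?thesis using g(1) b0 by blast
  qed
  have bound: "Lp_norm p (\<lambda>x. ennreal (cmod ((diff_op y ^^ l) (fun_of u) x))) \<le> B"
    if b: "coeffs b u" and T: "l2_tail (mods b) 0 < top"
      and B: "\<And>n. Lp_norm p (\<lambda>x. ennreal (cmod ((diff_op y ^^ l) (partial n b) x))) \<le> B" for b u y l B
  proof -
    obtain \<nu> :: "nat \<Rightarrow> nat" where \<nu>: "AE x in lborel. (\<lambda>i. partial (\<nu> i) b x) \<longlonglongrightarrow> fun_of u x"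
      using main[OF b T] by blast
    show ?thesis
      by (rule Lp_norm_Fatou[where f="\<lambda>i. (diff_op y ^^ l) (partial (\<nu> i) b)" and ?n0.0=0])
        (use p B in \<open>auto intro!: diff_op_AE_tendsto[OF \<nu>] diff_op_measurable schwartz_measurable[OF partial_schwartz]\<close>)
  qed
  show ?thesis
  proof (rule that[OF K(1)])
    fix b u t m assume b: "coeffs b u" and T: "l2_tail (mods b) 0 < top"
    note b0 = main[OF b T, THEN conjunct2, THEN conjunct2]
    show "\<exists>g. represents g u" using main[OF b T] by blast
    show "Lp_norm p (\<lambda>x. ennreal (cmod (fun_of u x))) \<le> ennreal K * l2_tail (mods b) 0"
      using bound[OF b T, of 0] K(3)[of b, OF b0] by simp
    show "modulus k p (fun_of u) t \<le> ennreal K * l2_tail (mods b) 0"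
      unfolding modulus_def by (intro SUP_least bound[OF b T] K(2)[of b, OF b0])
    assume t: "t \<le> dbl (Suc m)"
    show "modulus k p (fun_of u) t \<le> ennreal K * (l2_tail (mods b) m + ennreal (dbl m) * l2_tail (mods b) 0)"
      unfolding modulus_def using t by (intro SUP_least bound[OF b T] K(4)[of b, OF b0]) auto
  qed
qed

end

section \<open>The Besov quasi-norm as a weighted norm of tails\<close>

lemma ennreal_term_le_suminf: "f i \<le> (\<Sum>i. f i :: ennreal)"
  using sum_le_suminf[of f "{i}"] by simp

lemma l2_tail_le_first: "l2_tail y m \<le> l2_tail y 0"
proof -
  have "j \<in> {2 ^ m..} \<Longrightarrow> j \<in> {2 ^ 0..}" for j :: nat
    using one_le_power[of "2::nat" m] by (simp only: atLeast_iff power_0) linarith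
  then have "on {2 ^ m..} y j \<le> on {2 ^ 0..} y j" for j
    unfolding on_def by (cases "j \<in> {2 ^ m..}") (simp_all only: if_True if_False zero_le order_refl)
  then show ?thesis unfolding l2_tail_def by (intro lr_norm_mono) auto
qed

lemma B_seminorm_log_norm: "B_seminorm k b p q f = log_norm q b (modulus k p f)"
  by (simp add: B_seminorm_def log_norm_def)

context lacunary_setting
begin

text \<open>On layer m the modulus is bounded by the tail at m - 1 and by \<open>dbl (m - 1)\<close>
  times the full square norm. In the kernel of \<open>lr_norm_Hardy\<close> these are the entries at
  l = m - 1 and at l = 0; layer 0 is the single exceptional index.\<close>

lemma B_norm_le_tail:
  assumes p: "1 < p" and k: "k \<ge> 1" and q: "0 < q" and b: "b > - recip q"
  obtains K :: real where "K > 0"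
    "\<And>c u. coeffs c u \<Longrightarrow> B_norm k b p q u \<le> ennreal K * lr_norm q (\<lambda>m. w2 (b + recip q) m * l2_tail (mods c) m)"
proof -
  define \<beta> where "\<beta> = b + recip q"
  have \<beta>: "\<beta> > 0" using b by (simp add: \<beta>_def)
  obtain K where K: "K > 0"
    "\<And>b u. coeffs b u \<Longrightarrow> l2_tail (mods b) 0 < top \<Longrightarrow> \<exists>g. represents g u"
    "\<And>b u. coeffs b u \<Longrightarrow> l2_tail (mods b) 0 < top \<Longrightarrow>
      Lp_norm p (\<lambda>x. ennreal (cmod (fun_of u x))) \<le> ennreal K * l2_tail (mods b) 0"
    "\<And>b u t. coeffs b u \<Longrightarrow> l2_tail (mods b) 0 < top \<Longrightarrow> modulus k p (fun_of u) t \<le> ennreal K * l2_tail (mods b) 0"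
    "\<And>b u t m. coeffs b u \<Longrightarrow> l2_tail (mods b) 0 < top \<Longrightarrow> t \<le> dbl (Suc m) \<Longrightarrow>
      modulus k p (fun_of u) t \<le> ennreal K * (l2_tail (mods b) m + ennreal (dbl m) * l2_tail (mods b) 0)"
    by (rule lacunary_function_bounds[OF p k]) (rule that, assumption, blast, blast, blast, blast)
  have \<beta>1: "0 < \<beta> + 1" using \<beta> by simp
  \<comment> \<open>The exponent \<open>\<beta> + 1\<close> leaves a spare factor 2^(-n) beside the
    weight, which is the kernel value between m and the index 0 up to a constant.\<close>
  obtain D where D: "D > 0" "\<And>n. 2 powr (real n * (\<beta> + 1)) * dbl n \<le> D"
    by (rule dbl_absorbs_powr[OF \<beta>1]) (rule that)
  obtain L where L: "L > 0"
    "\<And>G \<Omega>. (\<And>m t. t \<in> layer m \<Longrightarrow> G t \<le> \<Omega> m) \<Longrightarrow> log_norm q b G \<le> ennreal L * lr_norm q (\<lambda>m. w2 \<beta> m * \<Omega> m)"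
    unfolding \<beta>_def by (rule log_norm_le[OF q, of b]) (auto intro: that)
  define C where "C = K * (2 powr \<beta> * (2 + 2 * D))"
  have C: "K \<le> C"
  proof -
    have "1 * 1 \<le> 2 powr \<beta> * (2 + 2 * D)" using \<beta> D(1) by (intro mult_mono ge_one_powr_ge_zero) auto
    then have "K * 1 \<le> K * (2 powr \<beta> * (2 + 2 * D))" using K(1) by (intro mult_left_mono) auto
    then show ?thesis by (simp add: C_def)
  qed
  then have C0: "C \<ge> 0" using K(1) by simp
  have half: "(0::real) < 1 / 2" "(1 / 2 :: real) < 1" by simp_all
  obtain H where H: "H > 0"
    "\<And>X Z v. (\<And>m. m \<ge> 1 \<Longrightarrow> X m \<le> ennreal C * (\<Sum>l. ennreal ((1/2) ^ ((m - l) + (l - m))) * Z l)) \<Longrightarrow>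
      (\<And>m. m < 1 \<Longrightarrow> X m \<le> ennreal C * v) \<Longrightarrow> lr_norm q X \<le> ennreal H * (lr_norm q Z + v)"
    by (rule lr_norm_Hardy[OF q half C0, where L=1]) (auto intro: that)
  show ?thesis
  proof (rule that[of "K + L * (H * 2)"])
    show "K + L * (H * 2) > 0" using K(1) L(1) H(1) by (simp add: add_pos_pos)
    fix c u assume c: "coeffs c u"
    let ?T = "l2_tail (mods c)" and ?Z = "\<lambda>m. w2 \<beta> m * l2_tail (mods c) m"
    have Z0: "?Z 0 = ?T 0" by (simp add: w2_def)
    \<comment> \<open>The weight at 0 is 1, so the right-hand side dominates the full square norm;
      if that is infinite there is nothing to prove.\<close>
    have T0: "?T 0 \<le> lr_norm q ?Z" using lr_norm_ge[OF q, of ?Z 0] by (simp only: Z0)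
    show "B_norm k b p q u \<le> ennreal (K + L * (H * 2)) * lr_norm q (\<lambda>m. w2 (b + recip q) m * l2_tail (mods c) m)"
    proof (cases "?T 0 < top")
      case False
      then have "lr_norm q ?Z = top" using T0 by (metis less_top top.extremum_unique)
      moreover have "ennreal (K + L * (H * 2)) \<noteq> 0" using K(1) L(1) H(1) by (simp add: add_pos_pos)
      ultimately show ?thesis by (simp add: ennreal_mult_top \<beta>_def)
    next
      case True
      \<comment> \<open>Points of layer m with m positive lie below \<open>dbl m\<close>, so the
        refined bound is available with m - 1; points of layer 0 come close to 1 and get the plain
        bound.\<close>
      define \<Omega> where "\<Omega> m = (if m = 0 then ennreal K * ?T 0 else ennreal K * (?T (m - 1) + ennreal (dbl (m - 1)) * ?T 0))" for m
      have mod: "modulus k p (fun_of u) t \<le> \<Omega> m" if "t \<in> layer m" for m t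
        using that K(4)[OF c True, of t] K(5)[OF c True, of t "m - 1"]
        by (auto simp: \<Omega>_def layer_def split: if_splits)
      have "lr_norm q (\<lambda>m. w2 \<beta> m * \<Omega> m) \<le> ennreal H * (lr_norm q ?Z + ?T 0)"
      proof (rule H(2))
        fix m :: nat assume "m < 1"
        then have "w2 \<beta> m * \<Omega> m = ennreal K * ?T 0" by (simp add: \<Omega>_def w2_def)
        also have "\<dots> \<le> ennreal C * ?T 0" by (intro mult_right_mono ennreal_leI C) simp
        finally show "w2 \<beta> m * \<Omega> m \<le> ennreal C * ?T 0" .
      next
        fix m :: nat assume "m \<ge> 1"
        then obtain n where m: "m = Suc n" by (cases m) auto
        let ?f = "\<lambda>l. ennreal ((1/2) ^ ((m - l) + (l - m))) * ?Z l"
        have w: "w2 \<beta> m = ennreal (2 powr \<beta>) * w2 \<beta> n"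
          by (simp add: m w2_def ennreal_mult[symmetric] powr_add[symmetric] algebra_simps)
        have "?f n = ennreal (1 / 2) * ?Z n" by (simp only: m diff_Suc_Suc) simp
        then have "ennreal 2 * ?f n = (ennreal 2 * ennreal (1 / 2)) * ?Z n" by (simp only: mult.assoc)
        also have "ennreal 2 * ennreal (1 / 2) = 1" by (simp only: ennreal_mult[symmetric]) simp
        finally have Zn: "?Z n \<le> ennreal 2 * (\<Sum>l. ?f l)"
          using mult_left_mono[OF ennreal_term_le_suminf[of ?f n], of "ennreal 2"] by simp
        have d: "w2 \<beta> n * ennreal (dbl n) \<le> ennreal (2 * D) * ennreal ((1 / 2) ^ m)"
        proof -
          have "2 powr (real n * \<beta>) * dbl n = (2 powr (real n * (\<beta> + 1)) * dbl n) * (1 / 2) ^ n"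
            by (simp add: powr_add distrib_left powr_realpow power_one_over)
          also have "\<dots> \<le> D * (1 / 2) ^ n" by (intro mult_right_mono D) auto
          also have "\<dots> = 2 * D * (1 / 2) ^ m" by (simp add: m)
          finally show ?thesis using dbl_bounds[of n] D(1)
            by (simp add: w2_def ennreal_mult[symmetric] ennreal_leI)
        qed
        have "w2 \<beta> n * (ennreal (dbl n) * ?T 0) = (w2 \<beta> n * ennreal (dbl n)) * ?T 0" by (simp only: mult.assoc)
        also have "\<dots> \<le> (ennreal (2 * D) * ennreal ((1 / 2) ^ m)) * ?T 0" by (intro mult_right_mono d) simp
        also have "\<dots> = ennreal (2 * D) * ?f 0" by (simp add: Z0 mult.assoc)
        also have "\<dots> \<le> ennreal (2 * D) * (\<Sum>l. ?f l)" by (intro mult_left_mono ennreal_term_le_suminf) simp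
        finally have Z00: "w2 \<beta> n * (ennreal (dbl n) * ?T 0) \<le> ennreal (2 * D) * (\<Sum>l. ?f l)" .
        have "w2 \<beta> m * \<Omega> m = ennreal (K * 2 powr \<beta>) * (?Z n + w2 \<beta> n * (ennreal (dbl n) * ?T 0))"
          using K(1) unfolding w by (simp add: \<Omega>_def m ennreal_mult distrib_left ac_simps)
        also have "\<dots> \<le> ennreal (K * 2 powr \<beta>) * (ennreal 2 * (\<Sum>l. ?f l) + ennreal (2 * D) * (\<Sum>l. ?f l))"
          by (intro mult_left_mono add_mono Zn Z00) simp
        also have "\<dots> = (ennreal (K * 2 powr \<beta>) * (ennreal 2 + ennreal (2 * D))) * (\<Sum>l. ?f l)"
          by (simp only: distrib_right mult.assoc)
        also have "ennreal (K * 2 powr \<beta>) * (ennreal 2 + ennreal (2 * D)) = ennreal C"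
        proof -
          have "ennreal 2 + ennreal (2 * D) = ennreal (2 + 2 * D)"
            by (rule ennreal_plus[symmetric]) (use D(1) in auto)
          moreover have "ennreal (K * 2 powr \<beta>) * ennreal (2 + 2 * D) = ennreal (K * 2 powr \<beta> * (2 + 2 * D))"
            by (rule ennreal_mult[symmetric]) (use K(1) D(1) in auto)
          ultimately show ?thesis by (simp only: C_def mult.assoc)
        qed
        finally show "w2 \<beta> m * \<Omega> m \<le> ennreal C * (\<Sum>l. ?f l)" .
      qed
      also have "\<dots> \<le> ennreal H * (lr_norm q ?Z + lr_norm q ?Z)" by (intro mult_left_mono add_left_mono T0) simp
      also have "\<dots> = ennreal (H * 2) * lr_norm q ?Z" using H(1) by (simp add: ennreal_mult mult_2 mult.assoc)
      finally have X: "lr_norm q (\<lambda>m. w2 \<beta> m * \<Omega> m) \<le> ennreal (H * 2) * lr_norm q ?Z" .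
      have "B_seminorm k b p q (fun_of u) \<le> ennreal L * lr_norm q (\<lambda>m. w2 \<beta> m * \<Omega> m)"
        unfolding B_seminorm_log_norm by (rule L(2)[OF mod])
      also have "\<dots> \<le> ennreal L * (ennreal (H * 2) * lr_norm q ?Z)" by (intro mult_left_mono X) simp
      finally have "B_seminorm k b p q (fun_of u) \<le> ennreal (L * (H * 2)) * lr_norm q ?Z"
        using L(1) H(1) by (simp add: ennreal_mult mult.assoc)
      moreover have "Lp_norm p (\<lambda>x. ennreal (cmod (fun_of u x))) \<le> ennreal K * lr_norm q ?Z"
        by (rule order_trans[OF K(3)[OF c True]]) (intro mult_left_mono T0, simp)
      ultimately have "B_norm k b p q u \<le> ennreal K * lr_norm q ?Z + ennreal (L * (H * 2)) * lr_norm q ?Z"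
        using K(2)[OF c True] unfolding B_norm_def by (auto intro: add_mono)
      then show ?thesis using K(1) L(1) H(1) unfolding \<beta>_def by (simp add: distrib_right[symmetric])
    qed
  qed
qed

text \<open>With M = 2^(m + 1), a point of the layer is at least 2^(-M), while the frequency with
  index 2^(m + 2) = 2 M is about 2^(2 M). The product is thus at least 2^(M - 1), which exceeds the
  fixed power once m is at least k + 2. One block of distance alone gives a bounded product, so the
  tail is taken two blocks further.\<close>

lemma double_exponential_gap:
  assumes t: "t \<in> layer m" and m: "k + 2 \<le> m"
  shows "2 ^ (k + 2) \<le> t * (lac_freq (2 ^ (m + 2)) - 2)"
proof -
  define M :: nat where "M = 2 ^ (m + 1)"
  have "m + 1 < M" unfolding M_def by (rule less_exp)
  then have M: "k + 3 \<le> M - 1 + 1" "k + 2 \<le> M - 1" "3 \<le> M" using m by auto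
  have M2: "2 ^ (m + 2) = M + M" by (simp add: M_def)
  have "(2::real) ^ 3 \<le> 2 ^ (M + M)" using M by (intro power_increasing) auto
  then have f: "2 ^ M * 2 ^ M / 2 \<le> lac_freq (2 ^ (m + 2)) - 2" unfolding M2 lac_freq_def by (simp add: power_add)
  have "dbl (Suc m) = 1 / 2 ^ M"
    by (simp add: dbl_def M_def powr_minus_divide powr_realpow[symmetric])
  then have t: "1 / 2 ^ M \<le> t" using t by (auto simp: layer_def)
  have "(2::real) ^ (k + 2) \<le> 2 ^ (M - 1)" using M by (intro power_increasing) auto
  also have "\<dots> = 1 / 2 ^ M * (2 ^ M * 2 ^ M / 2)" using M by (simp add: power_diff)
  also have "\<dots> \<le> t * (lac_freq (2 ^ (m + 2)) - 2)" using layer_subset[OF assms(1)] by (intro mult_mono t f) auto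
  finally show ?thesis .
qed

text \<open>The modulus on layer m controls the tail at m + 2, provided m is at least k + 2. The
  tails below k + 4 are all bounded by the first one, and this is bounded by the L_p norm contained
  in the quasi-norm.\<close>

lemma tail_le_B_norm:
  assumes p: "1 < p" and q: "0 < q" and b: "b > - recip q"
  obtains K :: real where "K > 0"
    "\<And>c u. coeffs c u \<Longrightarrow> lr_norm q (\<lambda>m. w2 (b + recip q) m * l2_tail (mods c) m) \<le> ennreal K * B_norm k b p q u"
proof -
  define \<beta> where "\<beta> = b + recip q"
  have \<beta>: "\<beta> > 0" using b by (simp add: \<beta>_def)
  obtain K where K: "K > 0"
    "\<And>b u g N. coeffs b u \<Longrightarrow> represents g u \<Longrightarrow>
      ennreal (sqrt (\<Sum>j\<in>{3..<N}. (cmod (b j))\<^sup>2)) \<le> ennreal K * Lp_norm p (\<lambda>x. ennreal (cmod (g x)))"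
    "\<And>b u g N n t. coeffs b u \<Longrightarrow> represents g u \<Longrightarrow> 3 \<le> n \<Longrightarrow> 0 < t \<Longrightarrow> 2 ^ (k + 2) \<le> t * (lac_freq n - 2) \<Longrightarrow>
      ennreal (sqrt (\<Sum>j\<in>{n..<N}. (cmod (b j))\<^sup>2)) \<le> ennreal K * modulus k p g t"
    by (rule coeffs_le_Lp_norm[OF p, where k=k]) (rule that, assumption, blast, blast)
  obtain L where L: "L > 0"
    "\<And>G \<Omega>. (\<And>m t. t \<in> layer m \<Longrightarrow> \<Omega> m \<le> G t) \<Longrightarrow> lr_norm q (\<lambda>m. w2 \<beta> m * \<Omega> m) \<le> ennreal L * log_norm q b G"
    unfolding \<beta>_def by (rule log_norm_ge[OF q, of b]) (auto intro: that)
  \<comment> \<open>First summand: the weight changes by \<open>2 powr (2 * \<beta>)\<close> over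
    two blocks, and 4 offsets the kernel value (1/2)^2 at distance two. Second summand: the largest
    weight among the initial indices times the constant of the L_p bound.\<close>
  define C where "C = 2 powr (2 * \<beta>) * 4 + 2 powr (real (k + 4) * \<beta>) * K"
  have C0: "C \<ge> 0" using K(1) by (simp add: C_def)
  have half: "(0::real) < 1 / 2" "(1 / 2 :: real) < 1" by simp_all
  obtain H where H: "H > 0"
    "\<And>X Z v. (\<And>m. m \<ge> k + 4 \<Longrightarrow> X m \<le> ennreal C * (\<Sum>l. ennreal ((1/2) ^ ((m - l) + (l - m))) * Z l)) \<Longrightarrow>
      (\<And>m. m < k + 4 \<Longrightarrow> X m \<le> ennreal C * v) \<Longrightarrow> lr_norm q X \<le> ennreal H * (lr_norm q Z + v)"
    by (rule lr_norm_Hardy[OF q half C0, where L="k + 4"]) (auto intro: that)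
  show ?thesis
  proof (rule that[of "H * (K * L + 1)"])
    show "H * (K * L + 1) > 0" using K(1) L(1) H(1) by (simp add: add_pos_pos)
    fix c u assume c: "coeffs c u"
    let ?T = "l2_tail (mods c)"
    let ?X = "\<lambda>m. w2 \<beta> m * ?T m" and ?B = "B_norm k b p q u"
    define Z where "Z m = w2 \<beta> m * (if k + 2 \<le> m then ?T (m + 2) else 0)" for m
    have "lr_norm q ?X \<le> ennreal (H * (K * L + 1)) * ?B"
    proof (cases "\<exists>g. represents g u")
      case False
      then have "?B = top" by (simp add: B_norm_def)
      moreover have "0 < H * (K * L + 1)" using K(1) L(1) H(1) by (simp add: add_pos_pos)
      then have "ennreal (H * (K * L + 1)) \<noteq> 0" by (simp only: ennreal_eq_0_iff not_le not_False_eq_True)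
      ultimately show ?thesis by (simp only: ennreal_mult_top if_False top_greatest)
    next
      case True
      define g where "g = fun_of u"
      define v where "v = Lp_norm p (\<lambda>x. ennreal (cmod (g x)))"
      have g: "represents g u" using True represents_fun_of unfolding g_def by blast
      have B: "?B = v + B_seminorm k b p q g" using True by (simp add: B_norm_def v_def g_def)
      have T0: "?T 0 \<le> ennreal K * v"
        unfolding l2_tail_def v_def
      proof (rule lr_norm_2_on_le)
        fix N :: nat
        have "(\<Sum>j\<in>{2 ^ 0..} \<inter> {..<N}. (cmod (c j))\<^sup>2) = (\<Sum>j\<in>{3..<N}. (cmod (c j))\<^sup>2)"
          using c by (intro sum.mono_neutral_right) (auto simp: coeffs_def)
        then show "ennreal (sqrt (\<Sum>j\<in>{2 ^ 0..} \<inter> {..<N}. (cmod (c j))\<^sup>2)) \<le> ennreal K * Lp_norm p (\<lambda>x. ennreal (cmod (g x)))"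
          using K(2)[OF c g, of N] by simp
      qed
      have Tm: "?T (m + 2) \<le> ennreal K * modulus k p g t" if "t \<in> layer m" "k + 2 \<le> m" for m t
        unfolding l2_tail_def
      proof (rule lr_norm_2_on_le)
        fix N :: nat
        have "{2 ^ (m + 2)..} \<inter> {..<N} = {2 ^ (m + 2)..<N}" by auto
        moreover have "3 \<le> (2::nat) ^ (m + 2)" by (rule order_trans[OF _ power_increasing[of 2 "m + 2" "2::nat"]]) simp_all
        ultimately show "ennreal (sqrt (\<Sum>j\<in>{2 ^ (m + 2)..} \<inter> {..<N}. (cmod (c j))\<^sup>2)) \<le> ennreal K * modulus k p g t"
          using K(3)[OF c g _ _ double_exponential_gap[OF that], of N] layer_subset[OF that(1)] by simp
      qed
      have K1: "ennreal K * ennreal (1 / K) = 1" using K(1) by (simp only: ennreal_mult[symmetric] less_imp_le zero_le_divide_1_iff) simp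
      define \<Omega> where "\<Omega> m = ennreal (1 / K) * (if k + 2 \<le> m then ?T (m + 2) else 0)" for m
      have "\<Omega> m \<le> modulus k p g t" if "t \<in> layer m" for m t
      proof (cases "k + 2 \<le> m")
        case True
        have "\<Omega> m \<le> ennreal (1 / K) * (ennreal K * modulus k p g t)"
          unfolding \<Omega>_def if_P[OF True] by (intro mult_left_mono Tm that True) simp
        also have "\<dots> = modulus k p g t"
          unfolding mult.assoc[symmetric] mult.commute[of "ennreal (1 / K)"] K1 by simp
        finally show ?thesis .
      qed (simp add: \<Omega>_def)
      then have s: "lr_norm q (\<lambda>m. w2 \<beta> m * \<Omega> m) \<le> ennreal L * B_seminorm k b p q g"
        unfolding B_seminorm_log_norm by (rule L(2))
      have "Z = (\<lambda>m. ennreal K * (w2 \<beta> m * \<Omega> m))"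
      proof
        fix m
        have "ennreal K * (w2 \<beta> m * \<Omega> m) = (ennreal K * ennreal (1 / K)) * Z m"
          by (simp only: \<Omega>_def Z_def ac_simps)
        then show "Z m = ennreal K * (w2 \<beta> m * \<Omega> m)" by (simp only: K1 mult_1_left)
      qed
      then have "lr_norm q Z = ennreal K * lr_norm q (\<lambda>m. w2 \<beta> m * \<Omega> m)" by (simp add: lr_norm_cmult[OF q])
      also have "\<dots> \<le> ennreal K * (ennreal L * B_seminorm k b p q g)" by (intro mult_left_mono s) simp
      also have "\<dots> = ennreal (K * L) * B_seminorm k b p q g" using K(1) L(1) by (simp add: ennreal_mult mult.assoc)
      finally have ZB: "lr_norm q Z \<le> ennreal (K * L) * B_seminorm k b p q g" .
      have "lr_norm q ?X \<le> ennreal H * (lr_norm q Z + v)"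
      proof (rule H(2))
        fix m assume m: "k + 4 \<le> m"
        then obtain n where n: "m = n + 2" "k + 2 \<le> n" by (intro that[of "m - 2"]) auto
        let ?f = "\<lambda>l. ennreal ((1/2) ^ ((m - l) + (l - m))) * Z l"
        have "?f n = ennreal (1 / 4) * Z n" by (simp add: n power2_eq_square)
        then have "ennreal 4 * ?f n = (ennreal 4 * ennreal (1 / 4)) * Z n" by (simp only: mult.assoc)
        also have "ennreal 4 * ennreal (1 / 4) = 1" by (simp only: ennreal_mult[symmetric]) simp
        finally have Zn: "Z n \<le> ennreal 4 * (\<Sum>l. ?f l)"
          using mult_left_mono[OF ennreal_term_le_suminf[of ?f n], of "ennreal 4"] by simp
        have "?X m = ennreal (2 powr (2 * \<beta>)) * Z n"
          using n by (simp add: Z_def w2_def ennreal_mult[symmetric] powr_add[symmetric] mult.assoc[symmetric] algebra_simps)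
        also have "\<dots> \<le> ennreal (2 powr (2 * \<beta>)) * (ennreal 4 * (\<Sum>l. ?f l))" by (intro mult_left_mono Zn) simp
        also have "\<dots> = ennreal (2 powr (2 * \<beta>) * 4) * (\<Sum>l. ?f l)" by (simp only: ennreal_mult powr_ge_zero zero_le_numeral mult.assoc)
        also have "\<dots> \<le> ennreal C * (\<Sum>l. ?f l)" using K(1) by (intro mult_right_mono ennreal_leI) (auto simp: C_def)
        finally show "?X m \<le> ennreal C * (\<Sum>l. ?f l)" .
      next
        fix m assume m: "m < k + 4"
        have "?X m \<le> ennreal (2 powr (real (k + 4) * \<beta>)) * (ennreal K * v)"
          unfolding w2_def
          using m \<beta> by (intro mult_mono ennreal_leI powr_mono order_trans[OF l2_tail_le_first T0]) auto
        also have "\<dots> = ennreal (2 powr (real (k + 4) * \<beta>) * K) * v" using K(1) by (simp add: ennreal_mult mult.assoc)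
        also have "\<dots> \<le> ennreal C * v" by (intro mult_right_mono ennreal_leI) (auto simp: C_def)
        finally show "?X m \<le> ennreal C * v" .
      qed
      also have "\<dots> \<le> ennreal H * (ennreal (K * L + 1) * ?B)"
      proof (intro mult_left_mono)
        have "lr_norm q Z + v \<le> ennreal (K * L) * ?B + 1 * ?B"
        proof (intro add_mono)
          show "lr_norm q Z \<le> ennreal (K * L) * ?B" by (rule order_trans[OF ZB]) (auto simp: B intro: mult_left_mono)
        qed (simp add: B)
        also have "\<dots> = (ennreal (K * L) + ennreal 1) * ?B" by (simp add: distrib_right)
        also have "\<dots> = ennreal (K * L + 1) * ?B" using K(1) L(1) by (subst ennreal_plus) auto
        finally show "lr_norm q Z + v \<le> ennreal (K * L + 1) * ?B" .
      qed simp
      also have "\<dots> = ennreal (H * (K * L + 1)) * ?B" using H(1) K(1) L(1) by (simp add: ennreal_mult mult.assoc)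
      finally show ?thesis .
    qed
    then show "lr_norm q (\<lambda>m. w2 (b + recip q) m * l2_tail (mods c) m) \<le> ennreal (H * (K * L + 1)) * ?B"
      by (simp only: \<beta>_def)
  qed
qed

section \<open>Lacunary functions with finitely many prescribed coefficients\<close>

lemma lacunary_of_finite:
  assumes c3: "\<And>j. j < 3 \<Longrightarrow> c j = 0" and cM: "\<And>j. j \<ge> M \<Longrightarrow> c j = 0"
  obtains u where "u \<in> lacunary \<psi> i1" "coeffs c u"
proof -
  define W :: "'d distr" where "W f = (LINT x|lborel. lac_sum M c x * f x)" for f
  define u where "u = distr_mult \<psi> W"
  have bound: "cmod (lac_sum M c x) \<le> (\<Sum>j\<in>{3..<M}. cmod (c j))" for x
    unfolding lac_sum_def by (intro sum_norm_le) (auto simp: norm_mult)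
  have W: "W \<in> tempered"
    unfolding W_def[abs_def] by (rule tempered_of_bounded[OF lac_sum_measurable bound])
  have Wf: "W f = (\<Sum>j\<in>{3..<M}. c j * (LINT x|lborel. osc (lac_freq j) x * f x))" if f: "f \<in> schwartz" for f
  proof -
    have i: "integrable lborel (\<lambda>x. c j * (osc (lac_freq j) x * f x))" for j
      by (intro integrable_mult_right schwartz_integrable osc_schwartz f)
    have "W f = (LINT x|lborel. (\<Sum>j\<in>{3..<M}. c j * (osc (lac_freq j) x * f x)))"
      by (simp add: W_def lac_sum_def sum_distrib_right mult.assoc)
    also have "\<dots> = (\<Sum>j\<in>{3..<M}. LINT x|lborel. c j * (osc (lac_freq j) x * f x))"
      by (intro Bochner_Integration.integral_sum i)
    finally show ?thesis by simp
  qed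
  obtain D where D: "\<And>x. cmod (\<psi> x) \<le> D" using schwartz_decay'[OF psi, of 0] by auto
  have "u \<in> tempered"
  proof -
    have "u = (\<lambda>f. LINT x|lborel. (lac_sum M c x * \<psi> x) * f x)"
      by (simp add: u_def distr_mult_def[abs_def] W_def[abs_def] mult.assoc)
    moreover have "(\<lambda>f. LINT x|lborel. (lac_sum M c x * \<psi> x) * f x) \<in> tempered"
    proof (rule tempered_of_bounded)
      note [measurable] = schwartz_measurable[OF psi]
      show "(\<lambda>x. lac_sum M c x * \<psi> x) \<in> borel_measurable borel" by measurable
      show "cmod (lac_sum M c x * \<psi> x) \<le> (\<Sum>j\<in>{3..<M}. cmod (c j)) * D" for x
        unfolding norm_mult by (intro mult_mono bound D) (auto simp: sum_nonneg)
    qed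
    ultimately show ?thesis by simp
  qed
  moreover have "lacunary_expansion i1 c W"
    unfolding lacunary_expansion_def
  proof (intro conjI ballI W)
    fix f :: "real^'d \<Rightarrow> complex" assume f: "f \<in> schwartz"
    let ?a = "\<lambda>j. c j * (LINT x|lborel. cis (lac_freq j * (x $ i1)) * f x)"
    have "(\<lambda>n. ?a (n + 3)) sums (\<Sum>n\<in>{0..<M}. ?a (n + 3))"
      by (rule sums_finite) (auto simp: cM)
    also have "(\<Sum>n\<in>{0..<M}. ?a (n + 3)) = sum ?a {0 + 3..<M + 3}" by (rule sum.shift_bounds_nat_ivl[symmetric])
    also have "\<dots> = W f" unfolding Wf[OF f] by (intro sum.mono_neutral_right) (auto simp: cM)
    finally show "(\<lambda>n. ?a (n + 3)) sums W f" .
  qed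
  ultimately have "u \<in> lacunary \<psi> i1" by (auto simp: lacunary_def u_def)
  moreover have "coeffs c u"
    unfolding coeffs_def
  proof (intro conjI ballI allI impI c3)
    fix f :: "real^'d \<Rightarrow> complex" assume f: "f \<in> schwartz"
    let ?a = "\<lambda>j. c j * (LINT x|lborel. osc (lac_freq j) x * \<psi> x * f x)"
    have "?a sums (\<Sum>n\<in>{..<M}. ?a n)" by (rule sums_finite) (auto simp: cM)
    also have "(\<Sum>n\<in>{..<M}. ?a n) = (\<Sum>j\<in>{3..<M}. ?a j)" by (intro sum.mono_neutral_right) (auto simp: c3)
    also have "\<dots> = u f" unfolding u_def distr_mult_def Wf[OF schwartz_mult[OF psi f]] by (simp only: mult.assoc)
    finally show "?a sums u f" .
  qed
  ultimately show ?thesis by (rule that)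
qed

end

section \<open>The embeddings and their sharpness\<close>

lemma powr_growth_le:
  fixes a c C :: real
  assumes "\<And>N::nat. N \<ge> 1 \<Longrightarrow> real N powr a \<le> C * real N powr c"
  shows "a \<le> c"
proof (rule ccontr)
  assume "\<not> a \<le> c"
  then have d: "0 < a - c" by simp
  have bound: "real N powr (a - c) \<le> C" if "N \<ge> 1" for N
    using assms[OF that] that by (simp add: powr_diff field_simps)
  define x where "x = (\<bar>C\<bar> + 1) powr (1 / (a - c))"
  obtain N :: nat where N: "x < real N" using reals_Archimedean2 by blast
  have "0 < x" by (simp add: x_def add_nonneg_pos)
  then have "N \<ge> 1" using N by (cases N) auto
  have "x powr (a - c) < real N powr (a - c)"
    using d N \<open>0 < x\<close> by (intro powr_less_mono2) auto
  moreover have "x powr (a - c) = \<bar>C\<bar> + 1" using d by (simp add: x_def powr_powr)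
  ultimately show False using bound[OF \<open>N \<ge> 1\<close>] by simp
qed

context lacunary_setting
begin

lemma B_norm_le_F_norm:
  assumes p: "1 < p" and k: "k \<ge> 1" and r: "0 < r" "r \<le> q" and b: "b > - recip q"
  obtains C :: real where "C > 0"
    "\<And>u. u \<in> lacunary \<psi> i1 \<Longrightarrow> B_norm k b p q u \<le> ennreal C * F_norm \<phi>0 0 (b + recip q + 1/2 - recip (max r 2)) p r u"
proof -
  let ?\<gamma> = "b + recip q + 1/2 - recip (max r 2)"
  have q: "0 < q" using r by (rule less_le_trans)
  have \<beta>: "0 < b + recip q" using b by simp
  obtain K1 where K1: "K1 > 0" "\<And>c u. coeffs c u \<Longrightarrow> B_norm k b p q u \<le> ennreal K1 * lr_norm q (\<lambda>m. w2 (b + recip q) m * l2_tail (mods c) m)"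
    by (rule B_norm_le_tail[OF p k q b]) (rule that)
  obtain K2 where K2: "K2 > 0" "\<And>y. y 0 = 0 \<Longrightarrow> lr_norm q (\<lambda>m. w2 (b + recip q) m * l2_tail y m) \<le> ennreal K2 * wlr r ?\<gamma> y"
    by (rule tail_le_wlr[OF r \<beta>]) (rule that)
  obtain K3 where K3: "K3 > 0" "\<And>c u. coeffs c u \<Longrightarrow> wlr r ?\<gamma> (mods c) \<le> ennreal K3 * F_norm \<phi>0 0 ?\<gamma> p r u"
    by (rule wlr_le_F_norm[OF p r(1)]) (rule that)
  show ?thesis
  proof (rule that[of "K1 * (K2 * K3)"])
    show "K1 * (K2 * K3) > 0" using K1 K2 K3 by simp
    fix u assume "u \<in> lacunary \<psi> i1"
    then obtain c where c: "coeffs c u" by (rule lacunary_coeffs)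
    then have c0: "mods c 0 = 0" by (simp add: coeffs_def)
    have "B_norm k b p q u \<le> ennreal K1 * (ennreal K2 * (ennreal K3 * F_norm \<phi>0 0 ?\<gamma> p r u))"
      by (rule order_trans[OF K1(2)[OF c] mult_left_mono[OF order_trans[OF K2(2)[of "mods c", OF c0] mult_left_mono[OF K3(2)[OF c]]]]]) simp_all
    then show "B_norm k b p q u \<le> ennreal (K1 * (K2 * K3)) * F_norm \<phi>0 0 ?\<gamma> p r u"
      using K1 K2 K3 by (simp add: ennreal_mult mult.assoc)
  qed
qed

lemma F_norm_le_B_norm:
  assumes p: "1 < p" and q: "0 < q" "q \<le> r" and b: "b > - recip q"
  obtains C :: real where "C > 0"
    "\<And>u. u \<in> lacunary \<psi> i1 \<Longrightarrow> F_norm \<phi>0 0 (b + recip q + 1/2 - recip (min r 2)) p r u \<le> ennreal C * B_norm k b p q u"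
proof -
  let ?\<gamma> = "b + recip q + 1/2 - recip (min r 2)"
  have r: "0 < r" using q by (rule less_le_trans)
  obtain K1 where K1: "K1 > 0" "\<And>c u. coeffs c u \<Longrightarrow> lr_norm q (\<lambda>m. w2 (b + recip q) m * l2_tail (mods c) m) \<le> ennreal K1 * B_norm k b p q u"
    by (rule tail_le_B_norm[OF p q(1) b]) (rule that)
  obtain K2 where K2: "K2 > 0" "\<And>y. y 0 = 0 \<Longrightarrow> wlr r ?\<gamma> y \<le> ennreal K2 * lr_norm q (\<lambda>m. w2 (b + recip q) m * l2_tail y m)"
    by (rule wlr_le_tail[OF q]) (rule that)
  obtain K3 where K3: "K3 > 0" "\<And>c u. coeffs c u \<Longrightarrow> F_norm \<phi>0 0 ?\<gamma> p r u \<le> ennreal K3 * wlr r ?\<gamma> (mods c)"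
    by (rule F_norm_le_wlr[OF p r]) (rule that)
  show ?thesis
  proof (rule that[of "K3 * (K2 * K1)"])
    show "K3 * (K2 * K1) > 0" using K1 K2 K3 by simp
    fix u assume "u \<in> lacunary \<psi> i1"
    then obtain c where c: "coeffs c u" by (rule lacunary_coeffs)
    then have c0: "mods c 0 = 0" by (simp add: coeffs_def)
    have "F_norm \<phi>0 0 ?\<gamma> p r u \<le> ennreal K3 * (ennreal K2 * (ennreal K1 * B_norm k b p q u))"
      by (rule order_trans[OF K3(2)[OF c] mult_left_mono[OF order_trans[OF K2(2)[of "mods c", OF c0] mult_left_mono[OF K1(2)[OF c]]]]]) simp_all
    then show "F_norm \<phi>0 0 ?\<gamma> p r u \<le> ennreal (K3 * (K2 * K1)) * B_norm k b p q u"
      using K1 K2 K3 by (simp add: ennreal_mult mult.assoc)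
  qed
qed

text \<open>The functions behind the necessity of both conditions. Two-sided bounds are recorded
  because each embedding wants an upper bound for its source and a lower bound for its target; K is
  fixed before N. Equal weighted blocks make the tail norm comparable with the block norm by Hardy's
  inequality.\<close>

lemma test_distributions:
  assumes p: "1 < p" and k: "k \<ge> 1" and q: "0 < q" and r: "0 < r" and b: "b > - recip q"
    and \<mu>: "\<mu> = 0 \<or> \<mu> = 1/2 - recip r"
  obtains K :: real where "K > 0"
    "\<And>N. N \<ge> 1 \<Longrightarrow> \<exists>u\<in>lacunary \<psi> i1.
      B_norm k b p q u \<le> ennreal (K * real N powr recip q) \<and>
      ennreal (real N powr recip q) \<le> ennreal K * B_norm k b p q u \<and>
      F_norm \<phi>0 0 (b + recip q + \<mu>) p r u \<le> ennreal (K * real N powr recip r) \<and>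
      ennreal (real N powr recip r) \<le> ennreal K * F_norm \<phi>0 0 (b + recip q + \<mu>) p r u"
proof -
  define \<beta> where "\<beta> = b + recip q"
  have \<beta>: "\<beta> > 0" using b by (simp add: \<beta>_def)
  obtain K1 where K1: "K1 > 0" "\<And>c u. coeffs c u \<Longrightarrow> B_norm k b p q u \<le> ennreal K1 * lr_norm q (\<lambda>m. w2 \<beta> m * l2_tail (mods c) m)"
    by (rule B_norm_le_tail[OF p k q b, folded \<beta>_def]) (rule that)
  obtain K2 where K2: "K2 > 0" "\<And>c u. coeffs c u \<Longrightarrow> lr_norm q (\<lambda>m. w2 \<beta> m * l2_tail (mods c) m) \<le> ennreal K2 * B_norm k b p q u"
    by (rule tail_le_B_norm[OF p q b, folded \<beta>_def]) (rule that)
  obtain K3 where K3: "K3 > 0" "\<And>c u. coeffs c u \<Longrightarrow> F_norm \<phi>0 0 (\<beta> + \<mu>) p r u \<le> ennreal K3 * wlr r (\<beta> + \<mu>) (mods c)"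
    by (rule F_norm_le_wlr[OF p r]) (rule that)
  obtain K4 where K4: "K4 > 0" "\<And>c u. coeffs c u \<Longrightarrow> wlr r (\<beta> + \<mu>) (mods c) \<le> ennreal K4 * F_norm \<phi>0 0 (\<beta> + \<mu>) p r u"
    by (rule wlr_le_F_norm[OF p r]) (rule that)
  obtain K5 where K5: "K5 > 0" "\<And>y. y 0 = 0 \<Longrightarrow> lr_norm q (\<lambda>m. w2 \<beta> m * l2_tail y m) \<le> ennreal K5 * lr_norm q (\<lambda>m. w2 \<beta> m * l2_block y m)"
    by (rule l2_tail_Hardy[OF q \<beta>]) (rule that)
  define D where "D = 2 powr \<bar>\<beta> + \<mu>\<bar>"
  have D: "D > 0" by (simp add: D_def)
  define K where "K = K1 * K5 + K2 + K3 * D + D * K4"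
  have K: "K > 0" "K1 * K5 \<le> K" "K2 \<le> K" "K3 * D \<le> K" "D * K4 \<le> K"
    using K1(1) K2(1) K3(1) K4(1) K5(1) D by (auto simp: K_def add_pos_pos)
  show ?thesis
  proof (rule that[OF K(1)])
    fix N :: nat assume N: "N \<ge> 1"
    obtain a :: "nat \<Rightarrow> real" where a: "\<And>j. a j \<ge> 0" "\<And>j. j < 3 \<Longrightarrow> a j = 0" "\<And>j. j \<ge> 2 ^ (N + 2) \<Longrightarrow> a j = 0"
      "\<And>q. 0 < q \<Longrightarrow> lr_norm q (\<lambda>m. w2 \<beta> m * l2_block (\<lambda>j. ennreal (a j)) m) = ennreal (real N powr recip q)"
      "lr_norm r (\<lambda>m. w2 (\<beta> + \<mu>) m * lr_norm r (on (dyadic m) (\<lambda>j. ennreal (a j)))) = ennreal (real N powr recip r)"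
      by (rule test_sequence[OF r \<mu> N, of \<beta>]) (rule that)
    define c where "c j = complex_of_real (a j)" for j
    have m: "mods c = (\<lambda>j. ennreal (a j))" using a(1) by (simp add: c_def)
    have c0: "mods c 0 = 0" by (simp add: c_def a(2))
    obtain u where u: "u \<in> lacunary \<psi> i1" "coeffs c u"
      by (rule lacunary_of_finite[of c "2 ^ (N + 2)"]) (auto simp: c_def a intro: that)
    have blk: "lr_norm q (\<lambda>m. w2 \<beta> m * l2_block (mods c) m) = ennreal (real N powr recip q)" unfolding m by (rule a(4)[OF q])
    have dy: "lr_norm r (\<lambda>m. w2 (\<beta> + \<mu>) m * lr_norm r (on (dyadic m) (mods c))) = ennreal (real N powr recip r)" unfolding m by (rule a(5))
    have 1: "B_norm k b p q u \<le> ennreal (K * real N powr recip q)"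
    proof -
      have "B_norm k b p q u \<le> ennreal K1 * (ennreal K5 * ennreal (real N powr recip q))"
        unfolding blk[symmetric] by (rule order_trans[OF K1(2)[OF u(2)] mult_left_mono[OF K5(2)[of "mods c", OF c0]]]) simp
      also have "\<dots> = ennreal (K1 * K5 * real N powr recip q)" using K1(1) K5(1) by (simp add: ennreal_mult mult.assoc)
      also have "\<dots> \<le> ennreal (K * real N powr recip q)" by (intro ennreal_leI mult_right_mono K) simp
      finally show ?thesis .
    qed
    have 2: "ennreal (real N powr recip q) \<le> ennreal K * B_norm k b p q u"
    proof -
      have "ennreal (real N powr recip q) \<le> lr_norm q (\<lambda>m. w2 \<beta> m * l2_tail (mods c) m)"
        unfolding blk[symmetric] by (intro lr_norm_mono mult_left_mono l2_block_le_tail q) simp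
      also have "\<dots> \<le> ennreal K2 * B_norm k b p q u" by (rule K2(2)[OF u(2)])
      also have "\<dots> \<le> ennreal K * B_norm k b p q u" by (intro mult_right_mono ennreal_leI K) simp
      finally show ?thesis .
    qed
    have 3: "F_norm \<phi>0 0 (\<beta> + \<mu>) p r u \<le> ennreal (K * real N powr recip r)"
    proof -
      have "F_norm \<phi>0 0 (\<beta> + \<mu>) p r u \<le> ennreal K3 * (ennreal D * ennreal (real N powr recip r))"
        unfolding dy[symmetric] D_def
        by (rule order_trans[OF K3(2)[OF u(2)] mult_left_mono[OF wlr_dyadic(1)[OF r, of "mods c", OF c0]]]) simp
      also have "\<dots> = ennreal (K3 * D * real N powr recip r)" using K3(1) D by (simp add: ennreal_mult mult.assoc)
      also have "\<dots> \<le> ennreal (K * real N powr recip r)" by (intro ennreal_leI mult_right_mono K) simp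
      finally show ?thesis .
    qed
    have 4: "ennreal (real N powr recip r) \<le> ennreal K * F_norm \<phi>0 0 (\<beta> + \<mu>) p r u"
    proof -
      have "ennreal (real N powr recip r) \<le> ennreal D * (ennreal K4 * F_norm \<phi>0 0 (\<beta> + \<mu>) p r u)"
        unfolding dy[symmetric] D_def
        by (rule order_trans[OF wlr_dyadic(2)[OF r, of "mods c", OF c0] mult_left_mono[OF K4(2)[OF u(2)]]]) simp
      also have "\<dots> = ennreal (D * K4) * F_norm \<phi>0 0 (\<beta> + \<mu>) p r u" using K4(1) D by (simp add: ennreal_mult mult.assoc)
      also have "\<dots> \<le> ennreal K * F_norm \<phi>0 0 (\<beta> + \<mu>) p r u" by (intro mult_right_mono ennreal_leI K) simp
      finally show ?thesis .
    qed
    show "\<exists>u\<in>lacunary \<psi> i1.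
      B_norm k b p q u \<le> ennreal (K * real N powr recip q) \<and>
      ennreal (real N powr recip q) \<le> ennreal K * B_norm k b p q u \<and>
      F_norm \<phi>0 0 (b + recip q + \<mu>) p r u \<le> ennreal (K * real N powr recip r) \<and>
      ennreal (real N powr recip r) \<le> ennreal K * F_norm \<phi>0 0 (b + recip q + \<mu>) p r u"
      using 1 2 3 4 u(1) unfolding \<beta>_def by blast
  qed
qed

lemma lacunary_tempered: "u \<in> lacunary \<psi> i1 \<Longrightarrow> u \<in> tempered"
  by (simp add: lacunary_def)

lemma embeds_lacunaryI:
  assumes "0 < C" "\<And>u. u \<in> lacunary \<psi> i1 \<Longrightarrow> nB u \<le> ennreal C * nA u"
  shows "embeds (lacunary \<psi> i1 \<inter> {u \<in> tempered. nA u < top}) nA {u \<in> tempered. nB u < top} nB"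
    and "embeds (lacunary \<psi> i1 \<inter> {u \<in> tempered. nA u < top}) nA (lacunary \<psi> i1 \<inter> {u \<in> tempered. nB u < top}) nB"
proof -
  have "nB u < top" if "u \<in> lacunary \<psi> i1" "nA u < top" for u
    by (rule le_less_trans[OF assms(2)[OF that(1)]]) (use that(2) in \<open>simp add: ennreal_mult_less_top\<close>)
  then show "embeds (lacunary \<psi> i1 \<inter> {u \<in> tempered. nA u < top}) nA {u \<in> tempered. nB u < top} nB"
    "embeds (lacunary \<psi> i1 \<inter> {u \<in> tempered. nA u < top}) nA (lacunary \<psi> i1 \<inter> {u \<in> tempered. nB u < top}) nB"
    using assms unfolding embeds_def by blast+
qed

text \<open>Along the test functions the norm inequality becomes a comparison of two powers of N
  with a constant independent of N, and only the exponents can decide it as N grows.\<close>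

lemma embeds_test:
  assumes E: "embeds (lacunary \<psi> i1 \<inter> {u \<in> tempered. nA u < top}) nA B nB" and K: "0 < K"
    and t: "\<And>N. N \<ge> 1 \<Longrightarrow> \<exists>u\<in>lacunary \<psi> i1. nA u \<le> ennreal (K * real N powr a) \<and> ennreal (real N powr c) \<le> ennreal K * nB u"
  shows "c \<le> a"
proof -
  obtain C :: real where C: "0 < C" "\<And>u. u \<in> lacunary \<psi> i1 \<Longrightarrow> nA u < top \<Longrightarrow> nB u \<le> ennreal C * nA u"
    using E lacunary_tempered unfolding embeds_def by blast
  show ?thesis
  proof (rule powr_growth_le[of c "K * (C * K)"])
    fix N :: nat assume "N \<ge> 1"
    from t[OF this] obtain u where u: "u \<in> lacunary \<psi> i1" "nA u \<le> ennreal (K * real N powr a)"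
      "ennreal (real N powr c) \<le> ennreal K * nB u" by blast
    have "nA u < top" using u(2) by (rule le_less_trans) simp
    note u(3)
    also have "ennreal K * nB u \<le> ennreal K * (ennreal C * ennreal (K * real N powr a))"
      by (intro mult_left_mono order_trans[OF C(2)[OF u(1) \<open>nA u < top\<close>]] u(2)) simp_all
    also have "\<dots> = ennreal (K * (C * K) * real N powr a)" using K C(1) by (simp add: ennreal_mult[symmetric] mult.assoc)
    finally show "real N powr c \<le> K * (C * K) * real N powr a" using K C(1) by (subst (asm) ennreal_le_iff) auto
  qed
qed

end

lemma recip_antimono_iff:
  assumes "0 < q" "0 < r"
  shows "recip q \<le> recip r \<longleftrightarrow> r \<le> q"
  using assms recip_strict_antimono[of q r] recip_strict_antimono[of r q]
  by (metis linorder_le_less_linear not_le order.order_iff_strict)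

theorem theorem5p11:
  fixes \<psi> \<phi>0 :: "real^'d::finite \<Rightarrow> complex"
    and i1 :: 'd
    and k :: nat
    and p b :: real
    and q r :: ennreal
  assumes "\<psi> \<in> schwartz" and "\<psi> \<noteq> (\<lambda>x. 0)" and "supp (fourier \<psi>) \<subseteq> {\<xi>. norm \<xi> \<le> 2}"
    and "\<phi>0 \<in> schwartz" and "supp \<phi>0 \<subseteq> {x. norm x \<le> 2}" and "\<And>x. norm x \<le> 1 \<Longrightarrow> \<phi>0 x = 1"
    and "k \<ge> 1"
    and "1 < p" and "0 < q" and "0 < r" and "b > - recip q"
  shows
    "(embeds
        (lacunary \<psi> i1 \<inter> F_space \<phi>0 0 (b + recip q + 1/2 - recip (max r 2)) p r)
        (F_norm \<phi>0 0 (b + recip q + 1/2 - recip (max r 2)) p r)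
        (B_space k b p q) (B_norm k b p q)
      \<longleftrightarrow> q \<ge> r) \<and>
     (embeds
        (lacunary \<psi> i1 \<inter> B_space k b p q) (B_norm k b p q)
        (F_space \<phi>0 0 (b + recip q + 1/2 - recip (min r 2)) p r)
        (F_norm \<phi>0 0 (b + recip q + 1/2 - recip (min r 2)) p r)
      \<longleftrightarrow> q \<le> r) \<and>
     embeds
        (lacunary \<psi> i1 \<inter> F_space \<phi>0 0 (b + recip (min 2 q)) p q)
        (F_norm \<phi>0 0 (b + recip (min 2 q)) p q)
        (lacunary \<psi> i1 \<inter> B_space k b p q) (B_norm k b p q) \<and>
     embeds
        (lacunary \<psi> i1 \<inter> B_space k b p q) (B_norm k b p q)
        (lacunary \<psi> i1 \<inter> F_space \<phi>0 0 (b + recip (max q 2)) p q)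
        (F_norm \<phi>0 0 (b + recip (max q 2)) p q)"
proof -
  interpret lacunary_setting \<psi> \<phi>0 i1
    using assms(1-6) by unfold_locales
  note p = assms(8) and k = assms(7) and q = assms(9) and r = assms(10) and b = assms(11)
  define \<gamma> where "\<gamma> r = b + recip q + 1/2 - recip (max r 2)" for r
  define \<delta> where "\<delta> r = b + recip q + 1/2 - recip (min r 2)" for r
  have F: "F_space \<phi>0 0 s p r = {u \<in> tempered. F_norm \<phi>0 0 s p r u < top}" for s r by (rule F_space_def)
  have B: "B_space k b p q = {u \<in> tempered. B_norm k b p q u < top}" by (rule B_space_def)
  have upper: "embeds (lacunary \<psi> i1 \<inter> F_space \<phi>0 0 (\<gamma> r) p r) (F_norm \<phi>0 0 (\<gamma> r) p r) (B_space k b p q) (B_norm k b p q)"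
    "embeds (lacunary \<psi> i1 \<inter> F_space \<phi>0 0 (\<gamma> r) p r) (F_norm \<phi>0 0 (\<gamma> r) p r) (lacunary \<psi> i1 \<inter> B_space k b p q) (B_norm k b p q)"
    if rq: "0 < r" "r \<le> q" for r
  proof -
    obtain C where C: "C > 0" "\<And>u. u \<in> lacunary \<psi> i1 \<Longrightarrow> B_norm k b p q u \<le> ennreal C * F_norm \<phi>0 0 (\<gamma> r) p r u"
      by (rule B_norm_le_F_norm[OF p k rq b, folded \<gamma>_def]) (rule that)
    from embeds_lacunaryI[of C "B_norm k b p q" "F_norm \<phi>0 0 (\<gamma> r) p r", OF C]
    show "embeds (lacunary \<psi> i1 \<inter> F_space \<phi>0 0 (\<gamma> r) p r) (F_norm \<phi>0 0 (\<gamma> r) p r) (B_space k b p q) (B_norm k b p q)"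
      "embeds (lacunary \<psi> i1 \<inter> F_space \<phi>0 0 (\<gamma> r) p r) (F_norm \<phi>0 0 (\<gamma> r) p r) (lacunary \<psi> i1 \<inter> B_space k b p q) (B_norm k b p q)"
      unfolding F B by blast+
  qed
  have lower: "embeds (lacunary \<psi> i1 \<inter> B_space k b p q) (B_norm k b p q) (F_space \<phi>0 0 (\<delta> r) p r) (F_norm \<phi>0 0 (\<delta> r) p r)"
    "embeds (lacunary \<psi> i1 \<inter> B_space k b p q) (B_norm k b p q) (lacunary \<psi> i1 \<inter> F_space \<phi>0 0 (\<delta> r) p r) (F_norm \<phi>0 0 (\<delta> r) p r)"
    if qr: "q \<le> r" for r
  proof -
    obtain C where C: "C > 0" "\<And>u. u \<in> lacunary \<psi> i1 \<Longrightarrow> F_norm \<phi>0 0 (\<delta> r) p r u \<le> ennreal C * B_norm k b p q u"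
      by (rule F_norm_le_B_norm[OF p q qr b, folded \<delta>_def]) (rule that)
    from embeds_lacunaryI[of C "F_norm \<phi>0 0 (\<delta> r) p r" "B_norm k b p q", OF C]
    show "embeds (lacunary \<psi> i1 \<inter> B_space k b p q) (B_norm k b p q) (F_space \<phi>0 0 (\<delta> r) p r) (F_norm \<phi>0 0 (\<delta> r) p r)"
      "embeds (lacunary \<psi> i1 \<inter> B_space k b p q) (B_norm k b p q) (lacunary \<psi> i1 \<inter> F_space \<phi>0 0 (\<delta> r) p r) (F_norm \<phi>0 0 (\<delta> r) p r)"
      unfolding F B by blast+
  qed
  have upper_only: "r \<le> q"
    if E: "embeds (lacunary \<psi> i1 \<inter> F_space \<phi>0 0 (\<gamma> r) p r) (F_norm \<phi>0 0 (\<gamma> r) p r) (B_space k b p q) (B_norm k b p q)"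
  proof -
    \<comment> \<open>For r at most 2 this is 0 and the test blocks are single entries; for larger r
      they are full blocks.\<close>
    define \<mu> where "\<mu> = 1/2 - recip (max r 2)"
    have \<mu>: "\<mu> = 0 \<or> \<mu> = 1/2 - recip r" by (auto simp: \<mu>_def max_def)
    have \<gamma>: "\<gamma> r = b + recip q + \<mu>" by (simp add: \<gamma>_def \<mu>_def)
    obtain K where K: "K > 0" "\<And>N. N \<ge> 1 \<Longrightarrow> \<exists>u\<in>lacunary \<psi> i1.
      B_norm k b p q u \<le> ennreal (K * real N powr recip q) \<and>
      ennreal (real N powr recip q) \<le> ennreal K * B_norm k b p q u \<and>
      F_norm \<phi>0 0 (b + recip q + \<mu>) p r u \<le> ennreal (K * real N powr recip r) \<and>
      ennreal (real N powr recip r) \<le> ennreal K * F_norm \<phi>0 0 (b + recip q + \<mu>) p r u"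
      by (rule test_distributions[OF p k q r b \<mu>]) (rule that)
    have "recip q \<le> recip r"
      by (rule embeds_test[OF E[unfolded F \<gamma>] K(1)]) (use K(2) in blast)
    then show ?thesis using recip_antimono_iff[OF q r] by simp
  qed
  have lower_only: "q \<le> r"
    if E: "embeds (lacunary \<psi> i1 \<inter> B_space k b p q) (B_norm k b p q) (F_space \<phi>0 0 (\<delta> r) p r) (F_norm \<phi>0 0 (\<delta> r) p r)"
  proof -
    \<comment> \<open>With the minimum the roles are exchanged: full blocks for r below 2, single
      entries otherwise.\<close>
    define \<mu> where "\<mu> = 1/2 - recip (min r 2)"
    have \<mu>: "\<mu> = 0 \<or> \<mu> = 1/2 - recip r" by (auto simp: \<mu>_def min_def)
    have \<delta>: "\<delta> r = b + recip q + \<mu>" by (simp add: \<delta>_def \<mu>_def)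
    obtain K where K: "K > 0" "\<And>N. N \<ge> 1 \<Longrightarrow> \<exists>u\<in>lacunary \<psi> i1.
      B_norm k b p q u \<le> ennreal (K * real N powr recip q) \<and>
      ennreal (real N powr recip q) \<le> ennreal K * B_norm k b p q u \<and>
      F_norm \<phi>0 0 (b + recip q + \<mu>) p r u \<le> ennreal (K * real N powr recip r) \<and>
      ennreal (real N powr recip r) \<le> ennreal K * F_norm \<phi>0 0 (b + recip q + \<mu>) p r u"
      by (rule test_distributions[OF p k q r b \<mu>]) (rule that)
    have "recip r \<le> recip q"
      by (rule embeds_test[OF E[unfolded B \<delta>] K(1)]) (use K(2) in blast)
    then show ?thesis using recip_antimono_iff[OF r q] by simp
  qed
  \<comment> \<open>The reciprocals of 2 and q add up to those of their minimum and maximum, so the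
    case r = q of the two embeddings has the exponents of the final chain.\<close>
  have diagonal: "\<gamma> q = b + recip (min 2 q)" "\<delta> q = b + recip (max q 2)"
    by (auto simp: \<gamma>_def \<delta>_def max_def min_def)
  show ?thesis
    using upper(1)[OF r] upper_only lower(1)[of r] lower_only upper(2)[OF q order_refl] lower(2)[OF order_refl]
    unfolding diagonal unfolding \<gamma>_def \<delta>_def by blast
qed

end
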